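(* Let $k$ be an algebraically closed field of characteristic $2$, $n\ge 2$, and $G=Sp_{2n}(k)$. The non-trivial spherical semisimple conjugacy classes of $G$ are represented by the following elements (that is, the class of each listed element is spherical, and every non-trivial spherical semisimple class contains a listed element): (a) $a_\lambda=\mathrm{diag}(\lambda I_n,\lambda^{-1}I_n)$ for $\lambda\in k^\ast$, $\lambda\neq 1$; (b) $c_\lambda=\mathrm{diag}(\lambda,I_{n-1},\lambda^{-1},I_{n-1})$ for $\lambda\in k^\ast$, $\lambda\neq 1$.
   Context: A conjugacy class $\mathcal O$ of an algebraic group $G$ is called spherical if a Borel subgroup of $G$, acting by conjugation, has a dense orbit on $\mathcal O$. $Sp_{2n}(k)$ is the group of $2n\times 2n$ matrices preserving the alternating form with matrix $\begin{pmatrix}0&I_n\\-I_n&0\end{pmatrix}$; $I_m$ is the identity matrix of order $m$, and $\mathrm{diag}$ denotes a (block) diagonal matrix. *)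

theory Defs
  imports
    "Jordan_Normal_Form.Determinant"
    "HOL-Algebra.Solvable_Groups"
    "HOL-Algebra.Group_Action"
    "HOL-Analysis.Abstract_Topology"
    "HOL-Computational_Algebra.Polynomial"
begin

section \<open>The Zariski topology on square matrices\<close>

text \<open>Polynomial functions in the entries of an \<open>m \<times> m\<close> matrix.\<close>

inductive_set mat_polyfun :: "nat \<Rightarrow> ('k::comm_ring_1 mat \<Rightarrow> 'k) set" for m where
  const: "(\<lambda>A. c) \<in> mat_polyfun m"
| entry: "\<lbrakk>i < m; j < m\<rbrakk> \<Longrightarrow> (\<lambda>A. A $$ (i, j)) \<in> mat_polyfun m"
| add: "\<lbrakk>f \<in> mat_polyfun m; g \<in> mat_polyfun m\<rbrakk> \<Longrightarrow> (\<lambda>A. f A + g A) \<in> mat_polyfun m"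
| mult: "\<lbrakk>f \<in> mat_polyfun m; g \<in> mat_polyfun m\<rbrakk> \<Longrightarrow> (\<lambda>A. f A * g A) \<in> mat_polyfun m"

definition zariski :: "nat \<Rightarrow> 'k::idom mat topology" where
  "zariski m = topology (\<lambda>U. \<exists>S \<subseteq> mat_polyfun m. U = {A \<in> carrier_mat m m. \<exists>f\<in>S. f A \<noteq> 0})"

lemma istopology_zariski:
  "istopology (\<lambda>U. \<exists>S \<subseteq> mat_polyfun m. U = {A :: 'k::idom mat. A \<in> carrier_mat m m \<and> (\<exists>f\<in>S. f A \<noteq> 0)})"
  (is "istopology ?L")
  unfolding istopology_def
proof (intro conjI allI impI)
  fix U V assume "?L U" "?L V"
  then obtain S T where S: "S \<subseteq> mat_polyfun m" "U = {A. A \<in> carrier_mat m m \<and> (\<exists>f\<in>S. f A \<noteq> 0)}"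
    and T: "T \<subseteq> mat_polyfun m" "V = {A. A \<in> carrier_mat m m \<and> (\<exists>f\<in>T. f A \<noteq> 0)}"
    by blast
  let ?R = "(\<lambda>(f, g) A. f A * g A) ` (S \<times> T)"
  have "?R \<subseteq> mat_polyfun m" using S T by (auto intro: mat_polyfun.mult)
  moreover have "U \<inter> V = {A. A \<in> carrier_mat m m \<and> (\<exists>f\<in>?R. f A \<noteq> 0)}"
    unfolding S T by (auto simp: image_iff)
  ultimately show "?L (U \<inter> V)" by blast
next
  fix K assume "\<forall>U\<in>K. ?L U"
  from bchoice[OF this] obtain S where
      "\<forall>U\<in>K. S U \<subseteq> mat_polyfun m \<and> U = {A. A \<in> carrier_mat m m \<and> (\<exists>f\<in>S U. f A \<noteq> 0)}"
    by blast
  then have S: "\<And>U. U \<in> K \<Longrightarrow> S U \<subseteq> mat_polyfun m"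
      "\<And>U. U \<in> K \<Longrightarrow> U = {A. A \<in> carrier_mat m m \<and> (\<exists>f\<in>S U. f A \<noteq> 0)}"
    by blast+
  have "\<Union>K = {A. A \<in> carrier_mat m m \<and> (\<exists>f\<in>(\<Union>U\<in>K. S U). f A \<noteq> 0)}"
  proof (rule Set.set_eqI)
    fix A
    have "A \<in> \<Union>K \<longleftrightarrow> (\<exists>U\<in>K. A \<in> carrier_mat m m \<and> (\<exists>f\<in>S U. f A \<noteq> 0))"
    proof -
      have "A \<in> U \<longleftrightarrow> A \<in> carrier_mat m m \<and> (\<exists>f\<in>S U. f A \<noteq> 0)" if "U \<in> K" for U
        by (subst S(2)[OF that]) simp
      then show ?thesis by blast
    qed
    then show "A \<in> \<Union>K \<longleftrightarrow> A \<in> {A. A \<in> carrier_mat m m \<and> (\<exists>f\<in>(\<Union>U\<in>K. S U). f A \<noteq> 0)}"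
      by blast
  qed
  moreover have "(\<Union>U\<in>K. S U) \<subseteq> mat_polyfun m" using S(1) by blast
  ultimately show "?L (\<Union>K)" by blast
qed

lemma openin_zariski:
  "openin (zariski m) U \<longleftrightarrow>
    (\<exists>S \<subseteq> mat_polyfun m. U = {A \<in> carrier_mat m m. \<exists>f\<in>S. f A \<noteq> 0})"
  unfolding zariski_def topology_inverse'[OF istopology_zariski] ..

lemma topspace_zariski [simp]: "topspace (zariski m :: 'k::idom mat topology) = carrier_mat m m"
proof
  show "topspace (zariski m :: 'k mat topology) \<subseteq> carrier_mat m m"
    unfolding topspace_def by (auto simp: openin_zariski)
  have "openin (zariski m) (carrier_mat m m :: 'k mat set)"
    unfolding openin_zariski
    by (rule exI[of _ "{\<lambda>A. 1}"]) (auto intro: mat_polyfun.const)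
  then show "carrier_mat m m \<subseteq> topspace (zariski m :: 'k mat topology)"
    by (rule openin_subset)
qed

lemma closedin_zariski:
  "closedin (zariski m) Z \<longleftrightarrow>
    (\<exists>S \<subseteq> mat_polyfun m. Z = {A \<in> carrier_mat m m. \<forall>f\<in>S. f A = 0})"
  (is "?l \<longleftrightarrow> ?r")
proof
  assume ?l
  then have sub: "Z \<subseteq> carrier_mat m m" and op: "openin (zariski m) (carrier_mat m m - Z)"
    by (auto simp: closedin_def)
  from op obtain S where S: "S \<subseteq> mat_polyfun m"
    and eq: "carrier_mat m m - Z = {A \<in> carrier_mat m m. \<exists>f\<in>S. f A \<noteq> 0}"
    unfolding openin_zariski by blast
  have "Z = carrier_mat m m - (carrier_mat m m - Z)" using sub by blast
  also have "\<dots> = {A \<in> carrier_mat m m. \<forall>f\<in>S. f A = 0}" unfolding eq by blast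
  finally show ?r using S by blast
next
  assume ?r
  then obtain S where S: "S \<subseteq> mat_polyfun m" and Z: "Z = {A \<in> carrier_mat m m. \<forall>f\<in>S. f A = 0}"
    by blast
  have "carrier_mat m m - Z = {A \<in> carrier_mat m m. \<exists>f\<in>S. f A \<noteq> 0}" unfolding Z by blast
  with S have "openin (zariski m) (carrier_mat m m - Z)" unfolding openin_zariski by blast
  then show ?l unfolding closedin_def by (auto simp: Z)
qed

section \<open>Borel subgroups and spherical conjugacy classes\<close>

text \<open>
  Below, \<open>G\<close> is a matrix group, that is, a group whose carrier consists of \<open>m \<times> m\<close> matrices;
  all topological notions refer to the Zariski topology.
\<close>

definition closed_connected_solvable :: "nat \<Rightarrow> 'k::idom mat monoid \<Rightarrow> 'k mat set \<Rightarrow> bool" where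
  "closed_connected_solvable m G H \<longleftrightarrow>
     subgroup H G \<and>
     closedin (subtopology (zariski m) (carrier G)) H \<and>
     connectedin (zariski m) H \<and>
     solvable (G\<lparr>carrier := H\<rparr>)"

definition borel_subgroup :: "nat \<Rightarrow> 'k::idom mat monoid \<Rightarrow> 'k mat set \<Rightarrow> bool" where
  "borel_subgroup m G B \<longleftrightarrow>
     closed_connected_solvable m G B \<and>
     (\<forall>H. closed_connected_solvable m G H \<and> B \<subseteq> H \<longrightarrow> H = B)"

definition conj_act :: "('a, 'b) monoid_scheme \<Rightarrow> 'a \<Rightarrow> 'a \<Rightarrow> 'a" where
  "conj_act G g = (\<lambda>x \<in> carrier G. g \<otimes>\<^bsub>G\<^esub> x \<otimes>\<^bsub>G\<^esub> inv\<^bsub>G\<^esub> g)"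

definition conj_class :: "('a, 'b) monoid_scheme \<Rightarrow> 'a \<Rightarrow> 'a set" where
  "conj_class G x = orbit G (conj_act G) x"

definition conj_classes :: "('a, 'b) monoid_scheme \<Rightarrow> 'a set set" where
  "conj_classes G = orbits G (carrier G) (conj_act G)"

definition spherical_class :: "nat \<Rightarrow> 'k::idom mat monoid \<Rightarrow> 'k mat set \<Rightarrow> bool" where
  "spherical_class m G C \<longleftrightarrow>
     (\<exists>B. borel_subgroup m G B \<and>
       (\<exists>x\<in>C. subtopology (zariski m) C closure_of orbit (G\<lparr>carrier := B\<rparr>) (conj_act G) x = C))"

text \<open>
  Over an algebraically closed field, an element of a linear algebraic group
  is semisimple iff it is diagonalizable as a matrix.
\<close>

definition semisimple_mat :: "'k::alg_closed_field mat \<Rightarrow> bool" where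
  "semisimple_mat A \<longleftrightarrow> (\<exists>D. diagonal_mat D \<and> similar_mat A D)"

definition semisimple_class :: "'k::alg_closed_field mat set \<Rightarrow> bool" where
  "semisimple_class C \<longleftrightarrow> (\<forall>x\<in>C. semisimple_mat x)"

section \<open>The symplectic group\<close>

definition symp_form :: "nat \<Rightarrow> 'k::comm_ring_1 mat" where
  "symp_form n = four_block_mat (0\<^sub>m n n) (1\<^sub>m n) (- 1\<^sub>m n) (0\<^sub>m n n)"

definition Sp :: "nat \<Rightarrow> 'k::comm_ring_1 mat monoid" where
  "Sp n = \<lparr>carrier = {g \<in> carrier_mat (2 * n) (2 * n).
                        transpose_mat g * symp_form n * g = symp_form n},
           mult = (*), one = 1\<^sub>m (2 * n)\<rparr>"

definition a_elt :: "nat \<Rightarrow> 'k::field \<Rightarrow> 'k mat" where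
  "a_elt n l = diag_block_mat [l \<cdot>\<^sub>m 1\<^sub>m n, inverse l \<cdot>\<^sub>m 1\<^sub>m n]"

definition c_elt :: "nat \<Rightarrow> 'k::field \<Rightarrow> 'k mat" where
  "c_elt n l = diag_block_mat [l \<cdot>\<^sub>m 1\<^sub>m 1, 1\<^sub>m (n - 1), inverse l \<cdot>\<^sub>m 1\<^sub>m 1, 1\<^sub>m (n - 1)]"

lemma symp_form_carrier [simp]: "symp_form n \<in> carrier_mat (2 * n) (2 * n)"
  unfolding symp_form_def mult_2 by (rule four_block_carrier_mat) auto

lemma symp_form_square: "symp_form n * symp_form n = - (1\<^sub>m (2 * n) :: 'k::comm_ring_1 mat)"
proof -
  have "symp_form n * symp_form n =
      four_block_mat (- 1\<^sub>m n) (0\<^sub>m n n) (0\<^sub>m n n) (- 1\<^sub>m n :: 'k mat)"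
    unfolding symp_form_def
    by (subst mult_four_block_mat[of _ n n _ n _ n _ _ n _ n]) auto
  also have "\<dots> = - 1\<^sub>m (2 * n)"
    by (rule eq_matI) auto
  finally show ?thesis .
qed

lemma group_Sp: "group (Sp n :: 'k::field mat monoid)"
proof (rule groupI)
  let ?m = "2 * n" and ?J = "symp_form n :: 'k mat"
  have J: "?J \<in> carrier_mat ?m ?m" by simp
  fix x :: "'k mat" assume "x \<in> carrier (Sp n)"
  then have x: "x \<in> carrier_mat ?m ?m" and xJ: "transpose_mat x * ?J * x = ?J"
    by (auto simp: Sp_def)
  have xt: "transpose_mat x \<in> carrier_mat ?m ?m" using x by simp
  define h where "h = - (?J * transpose_mat x * ?J)"
  have h: "h \<in> carrier_mat ?m ?m" unfolding h_def using mult_carrier_mat[OF mult_carrier_mat[OF J xt] J] by simp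
  have ht: "transpose_mat h \<in> carrier_mat ?m ?m" using h by simp
  have "h * x = - (?J * transpose_mat x * ?J * x)"
    unfolding h_def using carrier_matD[OF J] xt x by (intro uminus_mult_left_mat) auto
  also have "?J * transpose_mat x * ?J * x = ?J * (transpose_mat x * ?J * x)"
    using J xt x by (simp add: assoc_mult_mat[of _ ?m ?m _ ?m _ ?m] mult_carrier_mat[of _ ?m ?m _ ?m])
  finally have hx: "h * x = 1\<^sub>m ?m" by (simp add: xJ symp_form_square)
  then have xh: "x * h = 1\<^sub>m ?m" using mat_mult_left_right_inverse h x by blast
  have one: "transpose_mat h * transpose_mat x = 1\<^sub>m ?m"
    using transpose_mult[OF x h] xh by simp
  have "transpose_mat h * ?J * h = transpose_mat h * (transpose_mat x * ?J * x) * h"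
    by (simp add: xJ)
  also have "\<dots> = (transpose_mat h * transpose_mat x) * ?J * (x * h)"
    using J xt x h ht by (simp add: assoc_mult_mat[of _ ?m ?m _ ?m _ ?m] mult_carrier_mat[of _ ?m ?m _ ?m])
  also have "\<dots> = ?J" by (simp add: one xh left_mult_one_mat[OF J] right_mult_one_mat[OF J])
  finally have "h \<in> carrier (Sp n)" using h by (simp add: Sp_def)
  with hx show "\<exists>y\<in>carrier (Sp n). y \<otimes>\<^bsub>Sp n\<^esub> x = \<one>\<^bsub>Sp n\<^esub>"
    by (auto simp: Sp_def)
  show "\<one>\<^bsub>Sp n\<^esub> \<otimes>\<^bsub>Sp n\<^esub> x = x" using x by (simp add: Sp_def)
  {
    fix y :: "'k mat" assume "y \<in> carrier (Sp n)"
    then have y: "y \<in> carrier_mat ?m ?m" and yJ: "transpose_mat y * ?J * y = ?J"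
      by (auto simp: Sp_def)
    have yt: "transpose_mat y \<in> carrier_mat ?m ?m" using y by simp
    have "transpose_mat (x * y) * ?J * (x * y) = transpose_mat y * (transpose_mat x * ?J * x) * y"
      using J x y xt yt
      by (simp add: transpose_mult[OF x y] assoc_mult_mat[of _ ?m ?m _ ?m _ ?m] mult_carrier_mat[of _ ?m ?m _ ?m])
    then show "x \<otimes>\<^bsub>Sp n\<^esub> y \<in> carrier (Sp n)"
      using x y by (simp add: Sp_def xJ yJ)
    fix z :: "'k mat" assume "z \<in> carrier (Sp n)"
    then show "x \<otimes>\<^bsub>Sp n\<^esub> y \<otimes>\<^bsub>Sp n\<^esub> z = x \<otimes>\<^bsub>Sp n\<^esub> (y \<otimes>\<^bsub>Sp n\<^esub> z)"
      using x y by (simp add: Sp_def assoc_mult_mat[of _ ?m ?m _ ?m _ ?m] mult_carrier_mat[of _ ?m ?m _ ?m])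
  }
next
  have J: "(symp_form n :: 'k mat) \<in> carrier_mat (2 * n) (2 * n)" by simp
  show "\<one>\<^bsub>Sp n\<^esub> \<in> carrier (Sp n :: 'k mat monoid)"
    by (simp add: Sp_def left_mult_one_mat[OF J] right_mult_one_mat[OF J])
qed

end

theory Submission
  imports Defs "HOL-Analysis.Abstract_Topology_2"
begin

text \<open>
  A Borel subgroup has a dense orbit on an irreducible variety only if semi-invariant functions of
  equal weight are proportional. By the Lie--Kolchin theorem a Borel subgroup stabilizes an isotropic
  flag \<open>\<langle>e\<^sub>0\<rangle> \<subseteq> \<langle>e\<^sub>0, e\<^sub>1\<rangle>\<close>, so that, with \<open>M\<close> the \<open>2 \<times> 2\<close> matrix with entries
  \<open>\<omega>(y e\<^sub>i, e\<^sub>j)\<close>, the functions \<open>\<omega>(y e\<^sub>0, e\<^sub>0)\<close>, \<open>\<omega>(y\<^sup>2 e\<^sub>0, e\<^sub>0)\<close> of \<open>y\<close> have equal weight, and so do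
  \<open>det M\<close> and \<open>(M\<^sub>0\<^sub>1 - M\<^sub>1\<^sub>0)\<^sup>2\<close>. The first pair is not proportional on a class with two different
  pairs \<open>{\<lambda>, 1/\<lambda>}\<close> of eigenvalues other than \<open>1\<close>, the second one on a class in which
  some \<open>\<lambda> \<noteq> 1\<close> has multiplicity at least two and \<open>1\<close> is an eigenvalue as well.

  Conversely, the elements of the class of \<open>a\<^sub>\<lambda>\<close> (or \<open>c\<^sub>\<lambda>\<close>) at which a certain polynomial
  function does not vanish form a single orbit of the standard Borel subgroup: for \<open>a\<^sub>\<lambda>\<close> by
  orthonormalizing the form \<open>\<omega>(y u, v)\<close> along the isotropic flag, for \<open>c\<^sub>\<lambda>\<close> by normalizing the
  two eigenlines. Such a subset is dense because any two points of a class are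
  joined by a polynomial curve, the symplectic group being generated by transvections.
\<close>


section \<open>Rational curves in the Zariski topology\<close>

text \<open>Sphericity only says that some Borel subgroup has a dense orbit, so the classes to be
  excluded face an arbitrary closed connected solvable group. This is the reason for Lie--Kolchin,
  which also yields the maximality of the standard Borel subgroup.

  The second pair of functions measures the failure of \<open>M\<close> to be symmetric:
  \<open>M\<^sub>0\<^sub>1 - M\<^sub>1\<^sub>0\<close> is the value
  \<open>\<omega>((y + inverse y) e\<^sub>0, e\<^sub>1)\<close>. It vanishes on the class of
  \<open>a\<^sub>\<lambda>\<close>, where \<open>y + inverse y\<close> is scalar. On the class of
  \<open>c\<^sub>\<lambda>\<close>, \<open>y - 1\<close> has rank two, and this makes
  \<open>det M\<close> a constant multiple of its square. A class mixing both shapes obeys neither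
  relation.

  Characteristic 2 enters in two ways: \<open>\<lambda> \<noteq> 1\<close> implies
  \<open>\<lambda> \<noteq> 1/\<lambda>\<close>, so that -1 is not a further special eigenvalue; and
  \<open>e\<^sub>i + e\<^sub>l\<close> is orthogonal to \<open>f\<^sub>i + f\<^sub>l\<close>, which
  provides the isotropic plane on which the mixed classes are tested.\<close>

lemma mat_polyfun_sum:
  "(\<And>i. i \<in> I \<Longrightarrow> f i \<in> mat_polyfun m) \<Longrightarrow> (\<lambda>A. \<Sum>i\<in>I. f i A) \<in> mat_polyfun m"
  by (induction I rule: infinite_finite_induct)
     (auto intro: mat_polyfun.const mat_polyfun.add)

lemma mat_polyfun_prod:
  "(\<And>i. i \<in> I \<Longrightarrow> f i \<in> mat_polyfun m) \<Longrightarrow> (\<lambda>A. \<Prod>i\<in>I. f i A) \<in> mat_polyfun m"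
  by (induction I rule: infinite_finite_induct)
     (auto intro: mat_polyfun.const mat_polyfun.mult)

lemma mat_polyfun_diff:
  "f \<in> mat_polyfun m \<Longrightarrow> g \<in> mat_polyfun m \<Longrightarrow> (\<lambda>A. f A - g A) \<in> mat_polyfun m"
  using mat_polyfun.add[OF _ mat_polyfun.mult[OF mat_polyfun.const[of "-1"]], of f m g] by simp

lemma mat_polyfun_det:
  assumes "\<And>i j. i < k \<Longrightarrow> j < k \<Longrightarrow> (\<lambda>A. M A i j) \<in> mat_polyfun m"
  shows "(\<lambda>A. det (mat k k (\<lambda>(i, j). M A i j))) \<in> mat_polyfun m"
proof -
  have "(\<lambda>A. \<Sum>p | p permutes {0..<k}. signof p * (\<Prod>i = 0..<k. M A i (p i))) \<in> mat_polyfun m"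
    by (intro mat_polyfun_sum mat_polyfun.mult mat_polyfun.const mat_polyfun_prod assms)
       (auto simp: permutes_in_image)
  moreover have "det (mat k k (\<lambda>(i, j). M A i j)) =
      (\<Sum>p | p permutes {0..<k}. signof p * (\<Prod>i = 0..<k. M A i (p i)))" for A
    unfolding det_def by (auto simp: permutes_in_image intro!: sum.cong prod.cong)
  ultimately show ?thesis by simp
qed

text \<open>Agreement with polynomials is only asked for on \<open>X\<close>, since inversion is
  polynomial on the symplectic group but not on all matrices.\<close>

lemma mat_polyfun_comp:
  assumes "f \<in> mat_polyfun m"
    and "\<And>i j. i < m \<Longrightarrow> j < m \<Longrightarrow> \<exists>p\<in>mat_polyfun m'. \<forall>A\<in>X. \<phi> A $$ (i, j) = p A"
  shows "\<exists>p\<in>mat_polyfun m'. \<forall>A\<in>X. f (\<phi> A) = p A"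
  using assms(1)
proof induction
  case (const c)
  show ?case using mat_polyfun.const by fastforce
next
  case (entry i j)
  then show ?case using assms(2) by blast
next
  case (add f g)
  then show ?case by (metis (no_types, lifting) mat_polyfun.add)
next
  case (mult f g)
  then show ?case by (metis (no_types, lifting) mat_polyfun.mult)
qed

lemma continuous_map_zariski:
  fixes \<phi> :: "'k::idom mat \<Rightarrow> 'k mat"
  assumes "X \<subseteq> carrier_mat m m" "\<And>A. A \<in> X \<Longrightarrow> \<phi> A \<in> carrier_mat m m"
    and "\<And>i j. i < m \<Longrightarrow> j < m \<Longrightarrow> \<exists>p\<in>mat_polyfun m. \<forall>A\<in>X. \<phi> A $$ (i, j) = p A"
  shows "continuous_map (subtopology (zariski m) X) (zariski m) \<phi>"
  unfolding continuous_map
proof (intro conjI allI impI)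
  show "\<phi> ` topspace (subtopology (zariski m) X) \<subseteq> topspace (zariski m)"
    using assms(1,2) by auto
  fix U :: "'k mat set" assume "openin (zariski m) U"
  then obtain S where S: "S \<subseteq> mat_polyfun m" and U: "U = {A \<in> carrier_mat m m. \<exists>f\<in>S. f A \<noteq> 0}"
    unfolding openin_zariski by blast
  have "\<forall>f\<in>S. \<exists>p. p \<in> mat_polyfun m \<and> (\<forall>A\<in>X. f (\<phi> A) = p A)"
  proof
    fix f assume "f \<in> S"
    then have "f \<in> mat_polyfun m" using S by blast
    from mat_polyfun_comp[OF this assms(3)]
    show "\<exists>p. p \<in> mat_polyfun m \<and> (\<forall>A\<in>X. f (\<phi> A) = p A)" by blast
  qed
  from bchoice[OF this] obtain P where P: "\<And>f. f \<in> S \<Longrightarrow> P f \<in> mat_polyfun m"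
      "\<And>f A. f \<in> S \<Longrightarrow> A \<in> X \<Longrightarrow> f (\<phi> A) = P f A"
    by blast
  have "openin (zariski m) {A \<in> carrier_mat m m. \<exists>f\<in>P ` S. f A \<noteq> 0}"
    unfolding openin_zariski using P(1) by blast
  moreover have "{A \<in> topspace (subtopology (zariski m) X). \<phi> A \<in> U} =
      {A \<in> carrier_mat m m. \<exists>f\<in>P ` S. f A \<noteq> 0} \<inter> X"
    using assms(1,2) P(2) by (auto simp: U)
  ultimately show "openin (subtopology (zariski m) X)
      {A \<in> topspace (subtopology (zariski m) X). \<phi> A \<in> U}"
    unfolding openin_subtopology by blast
qed

text \<open>A finite union of closed sets is closed, so \<open>Z c0\<close> and the union of the
  others separate \<open>K\<close> unless one of them misses it. With closed sets indexed by
  eigenvalues, this turns "finitely many values" into "constant".\<close>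

lemma connectedin_finite_closed_cover:
  assumes K: "connectedin X K" and E: "finite E" "c0 \<in> E"
    and Z: "\<And>c. c \<in> E \<Longrightarrow> closedin X (Z c)" "K \<subseteq> (\<Union>c\<in>E. Z c)"
    and disj: "\<And>c d. c \<in> E \<Longrightarrow> d \<in> E \<Longrightarrow> c \<noteq> d \<Longrightarrow> Z c \<inter> Z d \<inter> K = {}"
    and ne: "Z c0 \<inter> K \<noteq> {}"
  shows "K \<subseteq> Z c0"
proof -
  have "closedin X (\<Union>c\<in>E - {c0}. Z c)"
    using E Z(1) by (intro closedin_Union) auto
  moreover have "K \<subseteq> Z c0 \<union> (\<Union>c\<in>E - {c0}. Z c)" using Z(2) by blast
  moreover have "Z c0 \<inter> (\<Union>c\<in>E - {c0}. Z c) \<inter> K = {}" using disj[OF E(2)] by blast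
  moreover have "closedin X (Z c0)" using Z(1) E by blast
  ultimately have "(\<Union>c\<in>E - {c0}. Z c) \<inter> K = {}"
    using K ne unfolding connectedin_closedin by blast
  then show ?thesis using Z(2) by blast
qed

section \<open>Rational functions of one variable and rational curves\<close>

text \<open>Regular functions off \<open>S\<close>; the values on \<open>S\<close> are arbitrary. A
  non-empty \<open>S\<close> is needed for paths in the torus, whose entries include inverses; the
  curves in the whole group are polynomial and use \<open>S = {}\<close>.\<close>

definition rational_fun :: "'k::field set \<Rightarrow> ('k \<Rightarrow> 'k) set" where
  "rational_fun S = {f. \<exists>a b. \<forall>t. t \<notin> S \<longrightarrow> poly b t \<noteq> 0 \<and> f t = poly a t / poly b t}"

lemma rational_fun_poly: "(\<lambda>t. poly p t) \<in> rational_fun S"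
  unfolding rational_fun_def by (rule CollectI, rule exI[of _ p], rule exI[of _ 1]) simp

lemma rational_fun_const: "(\<lambda>t. c) \<in> rational_fun S"
  using rational_fun_poly[of "[:c:]"] by simp

lemma rational_fun_id: "(\<lambda>t. t) \<in> rational_fun S"
  using rational_fun_poly[of "[:0, 1:]"] by simp

lemma rational_fun_add:
  assumes "f \<in> rational_fun S" "g \<in> rational_fun S"
  shows "(\<lambda>t. f t + g t) \<in> rational_fun S"
proof -
  obtain a b c d where "\<forall>t. t \<notin> S \<longrightarrow> poly b t \<noteq> 0 \<and> f t = poly a t / poly b t"
    "\<forall>t. t \<notin> S \<longrightarrow> poly d t \<noteq> 0 \<and> g t = poly c t / poly d t"
    using assms unfolding rational_fun_def by blast
  then have "\<forall>t. t \<notin> S \<longrightarrow> poly (b * d) t \<noteq> 0 \<and> f t + g t = poly (a * d + c * b) t / poly (b * d) t"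
    by (simp add: field_simps)
  then show ?thesis unfolding rational_fun_def by blast
qed

lemma rational_fun_mult:
  assumes "f \<in> rational_fun S" "g \<in> rational_fun S"
  shows "(\<lambda>t. f t * g t) \<in> rational_fun S"
proof -
  obtain a b c d where "\<forall>t. t \<notin> S \<longrightarrow> poly b t \<noteq> 0 \<and> f t = poly a t / poly b t"
    "\<forall>t. t \<notin> S \<longrightarrow> poly d t \<noteq> 0 \<and> g t = poly c t / poly d t"
    using assms unfolding rational_fun_def by blast
  then have "\<forall>t. t \<notin> S \<longrightarrow> poly (b * d) t \<noteq> 0 \<and> f t * g t = poly (a * c) t / poly (b * d) t"
    by simp
  then show ?thesis unfolding rational_fun_def by blast
qed

lemma rational_fun_inverse:
  assumes "f \<in> rational_fun S" "\<And>t. t \<notin> S \<Longrightarrow> f t \<noteq> 0"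
  shows "(\<lambda>t. inverse (f t)) \<in> rational_fun S"
proof -
  obtain a b where ab: "\<forall>t. t \<notin> S \<longrightarrow> poly b t \<noteq> 0 \<and> f t = poly a t / poly b t"
    using assms unfolding rational_fun_def by blast
  have "\<forall>t. t \<notin> S \<longrightarrow> poly a t \<noteq> 0 \<and> inverse (f t) = poly b t / poly a t"
    using ab assms(2) by (auto simp: field_simps)
  then show ?thesis unfolding rational_fun_def by blast
qed

lemma rational_fun_sum:
  "(\<And>i. i \<in> I \<Longrightarrow> f i \<in> rational_fun S) \<Longrightarrow> (\<lambda>t. \<Sum>i\<in>I. f i t) \<in> rational_fun S"
  by (induction I rule: infinite_finite_induct) (auto intro: rational_fun_const rational_fun_add)

lemma rational_fun_power: "f \<in> rational_fun S \<Longrightarrow> (\<lambda>t. f t ^ k) \<in> rational_fun S"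
  by (induction k) (auto intro: rational_fun_const rational_fun_mult)

lemma rational_fun_finite_zeros:
  assumes "f \<in> rational_fun S" "t0 \<notin> S" "f t0 \<noteq> 0"
  shows "finite {t. t \<notin> S \<and> f t = 0}"
proof -
  obtain a b where ab: "\<forall>t. t \<notin> S \<longrightarrow> poly b t \<noteq> 0 \<and> f t = poly a t / poly b t"
    using assms(1) unfolding rational_fun_def by blast
  then have "poly a t0 \<noteq> 0" using assms(2,3) by auto
  then have "a \<noteq> 0" by auto
  then have "finite {t. poly a t = 0}" by (rule poly_roots_finite)
  then show ?thesis by (rule rev_finite_subset) (use ab in auto)
qed

text \<open>Over a finite field, one plus the product of all \<open>X - a\<close> takes the value 1
  everywhere and has no root.\<close>

lemma infinite_UNIV_alg_closed: "infinite (UNIV :: 'k::alg_closed_field set)"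
proof
  assume fin: "finite (UNIV :: 'k set)"
  define p :: "'k poly" where "p = (\<Prod>a\<in>UNIV. [:- a, 1:])"
  have "degree p = card (UNIV :: 'k set)"
    unfolding p_def by (subst degree_prod_sum_eq) auto
  then have d: "degree p > 0" using fin by (simp add: card_gt_0_iff)
  then have "degree (p + 1) > 0" using degree_add_eq_left[of 1 p] by simp
  then obtain x where "poly (p + 1) x = 0" using alg_closed_imp_poly_has_root by blast
  moreover have "poly p x = 0" unfolding p_def poly_prod using fin by (auto simp: prod_zero_iff)
  ultimately show False by simp
qed

definition rational_curve :: "nat \<Rightarrow> 'k::field set \<Rightarrow> ('k \<Rightarrow> 'k mat) \<Rightarrow> bool" where
  "rational_curve m S \<gamma> \<longleftrightarrow> finite S \<and> (\<forall>i<m. \<forall>j<m. (\<lambda>t. \<gamma> t $$ (i, j)) \<in> rational_fun S)"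

lemma rational_curve_polyfun:
  assumes "rational_curve m S \<gamma>" "f \<in> mat_polyfun m"
  shows "(\<lambda>t. f (\<gamma> t)) \<in> rational_fun S"
  using assms(2) assms(1)
  by induction (auto simp: rational_curve_def
    intro: rational_fun_const rational_fun_add rational_fun_mult)

text \<open>Irreducibility of a curve in elementary form: each function has finitely many zeros off
  \<open>S\<close>, and the field is infinite. Connectedness and density arguments both rest on
  this.\<close>

lemma rational_curve_common_nonzero:
  fixes \<gamma> :: "'k::alg_closed_field \<Rightarrow> 'k mat"
  assumes \<gamma>: "rational_curve m S \<gamma>" and "f \<in> mat_polyfun m" "g \<in> mat_polyfun m"
    and "p \<notin> S" "q \<notin> S" "f (\<gamma> p) \<noteq> 0" "g (\<gamma> q) \<noteq> 0"
  obtains t where "t \<notin> S" "f (\<gamma> t) \<noteq> 0" "g (\<gamma> t) \<noteq> 0"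
proof -
  have "finite {t. t \<notin> S \<and> f (\<gamma> t) = 0}" "finite {t. t \<notin> S \<and> g (\<gamma> t) = 0}"
    using rational_fun_finite_zeros[OF rational_curve_polyfun[OF \<gamma>]] assms(2-) by blast+
  moreover have "finite S" using \<gamma> by (simp add: rational_curve_def)
  ultimately have "finite (S \<union> {t. t \<notin> S \<and> f (\<gamma> t) = 0} \<union> {t. t \<notin> S \<and> g (\<gamma> t) = 0})" by blast
  then obtain t where "t \<notin> S \<union> {t. t \<notin> S \<and> f (\<gamma> t) = 0} \<union> {t. t \<notin> S \<and> g (\<gamma> t) = 0}"
    using ex_new_if_finite[OF infinite_UNIV_alg_closed, of "S \<union> {t. t \<notin> S \<and> f (\<gamma> t) = 0} \<union> {t. t \<notin> S \<and> g (\<gamma> t) = 0}"] by blast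
  then show ?thesis using that by blast
qed

lemma connectedin_rational_curve:
  fixes \<gamma> :: "'k::alg_closed_field \<Rightarrow> 'k mat"
  assumes \<gamma>: "rational_curve m S \<gamma>" and carr: "\<And>t. t \<notin> S \<Longrightarrow> \<gamma> t \<in> carrier_mat m m"
  shows "connectedin (zariski m) (\<gamma> ` (- S))"
proof -
  have False if UV: "openin (zariski m) U" "openin (zariski m) V" "\<gamma> ` (- S) \<subseteq> U \<union> V"
    "U \<inter> V \<inter> \<gamma> ` (- S) = {}" "U \<inter> \<gamma> ` (- S) \<noteq> {}" "V \<inter> \<gamma> ` (- S) \<noteq> {}" for U V
  proof -
    obtain p q where p: "p \<notin> S" "\<gamma> p \<in> U" and q: "q \<notin> S" "\<gamma> q \<in> V"
      using UV(5,6) by blast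
    obtain F where F: "F \<subseteq> mat_polyfun m" and U: "U = {A \<in> carrier_mat m m. \<exists>f\<in>F. f A \<noteq> 0}"
      using \<open>openin (zariski m) U\<close> unfolding openin_zariski by blast
    obtain G where G: "G \<subseteq> mat_polyfun m" and V: "V = {A \<in> carrier_mat m m. \<exists>f\<in>G. f A \<noteq> 0}"
      using \<open>openin (zariski m) V\<close> unfolding openin_zariski by blast
    obtain f g where "f \<in> F" "g \<in> G" "f (\<gamma> p) \<noteq> 0" "g (\<gamma> q) \<noteq> 0" using U V p q by blast
    then obtain t where "t \<notin> S" "f (\<gamma> t) \<noteq> 0" "g (\<gamma> t) \<noteq> 0"
      using rational_curve_common_nonzero[OF \<gamma>, of f g p q] F G p q by blast
    then have "\<gamma> t \<in> U \<inter> V \<inter> \<gamma> ` (- S)" using \<open>f \<in> F\<close> \<open>g \<in> G\<close> carr U V by blast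
    then show False using UV(4) by blast
  qed
  then show ?thesis unfolding connectedin using carr by auto
qed

lemma connected_component_of_rational_curve:
  fixes \<gamma> :: "'k::alg_closed_field \<Rightarrow> 'k mat"
  assumes "rational_curve m S \<gamma>" "X \<subseteq> carrier_mat m m" "\<And>t. t \<notin> S \<Longrightarrow> \<gamma> t \<in> X" "p \<notin> S" "q \<notin> S"
  shows "connected_component_of (subtopology (zariski m) X) (\<gamma> p) (\<gamma> q)"
proof -
  have "connectedin (zariski m) (\<gamma> ` (- S))"
    using assms by (intro connectedin_rational_curve) auto
  then have "connectedin (subtopology (zariski m) X) (\<gamma> ` (- S))"
    using assms(3) by (auto simp: connectedin_subtopology)
  then show ?thesis using assms(4,5) unfolding connected_component_of_def by blast
qed

lemma connectedin_if_connected_component_of: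
  assumes "\<And>x. x \<in> X \<Longrightarrow> connected_component_of (subtopology T X) a x" "X \<subseteq> topspace T"
  shows "connectedin T X"
proof -
  have "connected_space (subtopology T X)"
    unfolding connected_space_iff_connected_component topspace_subtopology_subset[OF assms(2)]
    using assms(1) by (meson connected_component_of_trans connected_component_of_sym)
  then show ?thesis using assms(2) by (simp add: connectedin_def)
qed

section \<open>Subspaces and eigenvectors\<close>

definition vec_subspace :: "nat \<Rightarrow> 'k::field vec set \<Rightarrow> bool" where
  "vec_subspace m W \<longleftrightarrow> W \<subseteq> carrier_vec m \<and> 0\<^sub>v m \<in> W \<and>
     (\<forall>u\<in>W. \<forall>v\<in>W. u + v \<in> W) \<and> (\<forall>c. \<forall>u\<in>W. c \<cdot>\<^sub>v u \<in> W)"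

lemma vec_subspaceD:
  assumes "vec_subspace m W"
  shows "u \<in> W \<Longrightarrow> u \<in> carrier_vec m" "0\<^sub>v m \<in> W" "u \<in> W \<Longrightarrow> v \<in> W \<Longrightarrow> u + v \<in> W"
    "u \<in> W \<Longrightarrow> c \<cdot>\<^sub>v u \<in> W"
  using assms by (auto simp: vec_subspace_def)

lemma vec_subspace_diff:
  assumes W: "vec_subspace m W" and u: "u \<in> W" and v: "v \<in> W" shows "u - v \<in> W"
proof -
  have "u - v = u + (- 1) \<cdot>\<^sub>v v"
    using vec_subspaceD(1)[OF W u] vec_subspaceD(1)[OF W v] by (intro eq_vecI) auto
  then show ?thesis using vec_subspaceD(3)[OF W u vec_subspaceD(4)[OF W v]] by simp
qed

text \<open>Positions of leading entries, as in an echelon form. Their number is the dimension, so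
  that minimal subspaces can be found by counting, without choosing bases.\<close>

definition pivots :: "nat \<Rightarrow> 'k::field vec set \<Rightarrow> nat set" where
  "pivots m W = {i. i < m \<and> (\<exists>w\<in>W. w $ i \<noteq> 0 \<and> (\<forall>j<i. w $ j = 0))}"

text \<open>Gaussian elimination: a vector of \<open>W\<close> with pivot \<open>k\<close> clears
  entry \<open>k\<close> of \<open>w'\<close>, and the difference vanishes one place further. The
  induction runs down from \<open>k = m\<close>, where only the zero vector is left.\<close>

lemma pivots_eqD:
  assumes W: "vec_subspace m W" and W': "vec_subspace m W'" and sub: "W \<subseteq> W'"
    and eq: "pivots m W = pivots m W'"
  shows "W = W'"
proof -
  have *: "w' \<in> W" if "k \<le> m" "w' \<in> W'" "\<forall>j<k. w' $ j = 0" for k w'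
    using that
  proof (induction k arbitrary: w' rule: inc_induct)
    case base
    then have "w' = 0\<^sub>v m" using vec_subspaceD(1)[OF W'] by (intro eq_vecI) auto
    then show ?case using vec_subspaceD(2)[OF W] by simp
  next
    case (step k)
    show ?case
    proof (cases "w' $ k = 0")
      case True
      then show ?thesis using step by (metis less_Suc_eq)
    next
      case False
      then have "k \<in> pivots m W" using step.prems step.hyps eq unfolding pivots_def by blast
      then obtain w where w: "w \<in> W" "w $ k \<noteq> 0" "\<forall>j<k. w $ j = 0" unfolding pivots_def by blast
      define c where "c = w' $ k / w $ k"
      have cw: "c \<cdot>\<^sub>v w \<in> W" using vec_subspaceD(4)[OF W w(1)] .
      have carr: "w \<in> carrier_vec m" "w' \<in> carrier_vec m"
        using vec_subspaceD(1)[OF W w(1)] vec_subspaceD(1)[OF W' step.prems(1)] by auto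
      have "w' - c \<cdot>\<^sub>v w \<in> W'" using vec_subspace_diff[OF W' step.prems(1)] cw sub by blast
      moreover have "\<forall>j<Suc k. (w' - c \<cdot>\<^sub>v w) $ j = 0"
        using carr w step.prems(2) step.hyps by (auto simp: less_Suc_eq c_def)
      ultimately have "w' - c \<cdot>\<^sub>v w \<in> W" by (rule step.IH)
      then have "(w' - c \<cdot>\<^sub>v w) + c \<cdot>\<^sub>v w \<in> W" using vec_subspaceD(3)[OF W] cw by blast
      moreover have "(w' - c \<cdot>\<^sub>v w) + c \<cdot>\<^sub>v w = w'" using carr by (intro eq_vecI) auto
      ultimately show ?thesis by simp
    qed
  qed
  show ?thesis using sub *[of 0] by auto
qed

lemma vec_subspace_minimal:
  assumes fam: "\<And>W. P W \<Longrightarrow> vec_subspace m W" and ne: "P W0"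
  obtains W where "P W" "\<And>W'. P W' \<Longrightarrow> W' \<subseteq> W \<Longrightarrow> W' = W"
proof -
  obtain W where W: "P W" "\<And>W'. P W' \<Longrightarrow> card (pivots m W) \<le> card (pivots m W')"
    using ex_has_least_nat[of P W0 "\<lambda>W. card (pivots m W)"] ne by blast
  show ?thesis
  proof (rule that[OF W(1)])
    fix W' assume W': "P W'" "W' \<subseteq> W"
    have "pivots m W' \<subseteq> pivots m W" using W'(2) unfolding pivots_def by blast
    moreover have "finite (pivots m W)" unfolding pivots_def by simp
    ultimately have "pivots m W' = pivots m W" using W(2)[OF W'(1)] by (simp add: card_seteq)
    then show "W' = W" using pivots_eqD fam W' W(1) by blast
  qed
qed

section \<open>Eigenvectors modulo a subspace\<close>

lemma mult_mat_vec_index: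
  assumes "A \<in> carrier_mat r m" "v \<in> carrier_vec m" "j < r"
  shows "(A *\<^sub>v v) $ j = (\<Sum>q<m. A $$ (j, q) * v $ q)"
  using assms by (simp add: scalar_prod_def lessThan_atLeast0)

text \<open>The linear factor \<open>h - a\<close> applied to \<open>v\<close>. That the result lies
  in \<open>W0\<close> says that \<open>v\<close> is an eigenvector modulo \<open>W0\<close>, which
  avoids quotient spaces.\<close>

abbreviation apply_factor :: "'k::field mat \<Rightarrow> 'k vec \<Rightarrow> 'k \<Rightarrow> 'k vec" where
  "apply_factor h v a \<equiv> h *\<^sub>v v - a \<cdot>\<^sub>v v"

lemma vec_subspace_eigenvectors:
  fixes X :: "'k::field mat set"
  assumes X: "X \<subseteq> carrier_mat m m" and W: "vec_subspace m W" and W0: "vec_subspace m W0"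
  shows "vec_subspace m {v \<in> W. \<forall>h\<in>X. apply_factor h v (x h) \<in> W0}" (is "vec_subspace m ?E")
  unfolding vec_subspace_def
proof (intro conjI ballI allI)
  have hv: "h \<in> carrier_mat m m" "h *\<^sub>v v \<in> carrier_vec m" if "h \<in> X" "v \<in> carrier_vec m" for h v
    using that X by auto
  show "?E \<subseteq> carrier_vec m" using vec_subspaceD(1)[OF W] by blast
  have "apply_factor h (0\<^sub>v m) (x h) = 0\<^sub>v m" if "h \<in> X" for h
    using hv(1)[OF that zero_carrier_vec] by (intro eq_vecI) auto
  then show "0\<^sub>v m \<in> ?E" using vec_subspaceD(2)[OF W] vec_subspaceD(2)[OF W0] by simp
  fix u assume u: "u \<in> ?E"
  then have uc: "u \<in> carrier_vec m" using vec_subspaceD(1)[OF W] by blast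
  show "c \<cdot>\<^sub>v u \<in> ?E" for c
  proof -
    have "c \<cdot>\<^sub>v p - a \<cdot>\<^sub>v (c \<cdot>\<^sub>v u) = c \<cdot>\<^sub>v (p - a \<cdot>\<^sub>v u)" if "p \<in> carrier_vec m" for p a
      using that uc by (intro eq_vecI) (simp_all add: algebra_simps)
    then have "apply_factor h (c \<cdot>\<^sub>v u) (x h) = c \<cdot>\<^sub>v apply_factor h u (x h)" if "h \<in> X" for h
      using hv[OF that uc] by (simp add: mult_mat_vec[OF _ uc])
    then show ?thesis using u vec_subspaceD(4)[OF W] vec_subspaceD(4)[OF W0] by simp
  qed
  fix v assume v: "v \<in> ?E"
  then have vc: "v \<in> carrier_vec m" using vec_subspaceD(1)[OF W] by blast
  have "p + q - a \<cdot>\<^sub>v (u + v) = (p - a \<cdot>\<^sub>v u) + (q - a \<cdot>\<^sub>v v)"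
    if "p \<in> carrier_vec m" "q \<in> carrier_vec m" for p q a
    using that uc vc by (intro eq_vecI) (simp_all add: algebra_simps)
  then have "apply_factor h (u + v) (x h) = apply_factor h u (x h) + apply_factor h v (x h)" if "h \<in> X" for h
    using hv[OF that uc] hv[OF that vc] by (simp add: mult_add_distrib_mat_vec[OF _ uc vc])
  then show "u + v \<in> ?E" using u v vec_subspaceD(3)[OF W] vec_subspaceD(3)[OF W0] by simp
qed

text \<open>Expands a product of factors \<open>h - a\<close> into powers of \<open>h\<close>, so
  that a linear relation between powers can be applied one factor at a time. \<open>N\<close> is any
  bound above the degree.\<close>

lemma apply_factors_sum:
  fixes h :: "'k::field mat"
  assumes h: "h \<in> carrier_mat m m" and v: "v \<in> carrier_vec m" and "length as < N" "j < m"
  shows "(\<Sum>i<N. coeff (\<Prod>a\<leftarrow>as. [:- a, 1:]) i * ((h ^\<^sub>m i) *\<^sub>v v) $ j) =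
    foldl (apply_factor h) v as $ j"
  using v assms(3)
proof (induction as arbitrary: v)
  case Nil
  have "(\<Sum>i<N. coeff (\<Prod>a\<leftarrow>[]. [:- a, 1:]) i * ((h ^\<^sub>m i) *\<^sub>v v) $ j) =
      (\<Sum>i<N. if i = 0 then ((h ^\<^sub>m i) *\<^sub>v v) $ j else 0)"
    by (rule sum.cong) (auto simp: coeff_1)
  then show ?case using Nil h by simp
next
  case (Cons a as)
  obtain M where N: "N = Suc M" using Cons.prems by (cases N) auto
  define q where "q = (\<Prod>a\<leftarrow>as. [:- a, 1:])"
  have deg: "degree q \<le> length as"
    unfolding q_def using degree_prod_list_le[of "map (\<lambda>a. [:- a, 1:]) as"] by (simp add: o_def sum_list_triv)
  have hv: "h *\<^sub>v v \<in> carrier_vec m" using h Cons.prems by auto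
  have pw: "(h ^\<^sub>m Suc i) *\<^sub>v v = (h ^\<^sub>m i) *\<^sub>v (h *\<^sub>v v)" for i
    using h Cons.prems pow_carrier_mat[OF h, of i] by (simp add: assoc_mult_mat_vec[of _ m m])
  have "(\<Sum>i<N. coeff (\<Prod>a\<leftarrow>a # as. [:- a, 1:]) i * ((h ^\<^sub>m i) *\<^sub>v v) $ j) =
      (\<Sum>i<N. coeff (pCons 0 q) i * ((h ^\<^sub>m i) *\<^sub>v v) $ j) - (\<Sum>i<N. a * coeff q i * ((h ^\<^sub>m i) *\<^sub>v v) $ j)"
    unfolding sum_subtractf[symmetric] q_def[symmetric]
    by (rule sum.cong) (auto simp: q_def[symmetric] algebra_simps)
  also have "(\<Sum>i<N. coeff (pCons 0 q) i * ((h ^\<^sub>m i) *\<^sub>v v) $ j) =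
      (\<Sum>i<M. coeff q i * ((h ^\<^sub>m Suc i) *\<^sub>v v) $ j)"
    unfolding N sum.lessThan_Suc_shift by simp
  also have "\<dots> = (\<Sum>i<N. coeff q i * ((h ^\<^sub>m i) *\<^sub>v (h *\<^sub>v v)) $ j)"
    unfolding pw N using deg Cons.prems N by (simp add: coeff_eq_0)
  also have "\<dots> - (\<Sum>i<N. a * coeff q i * ((h ^\<^sub>m i) *\<^sub>v v) $ j) =
      (\<Sum>i<N. coeff q i * ((h ^\<^sub>m i) *\<^sub>v (h *\<^sub>v v - a \<cdot>\<^sub>v v)) $ j)"
    unfolding sum_subtractf[symmetric]
  proof (rule sum.cong)
    fix i
    have hi: "h ^\<^sub>m i \<in> carrier_mat m m" using h by simp
    have "(h ^\<^sub>m i) *\<^sub>v (h *\<^sub>v v - a \<cdot>\<^sub>v v) = (h ^\<^sub>m i) *\<^sub>v (h *\<^sub>v v) - a \<cdot>\<^sub>v ((h ^\<^sub>m i) *\<^sub>v v)"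
      using hi hv Cons.prems by (simp add: mult_minus_distrib_mat_vec mult_mat_vec)
    moreover have "\<dots> $ j = ((h ^\<^sub>m i) *\<^sub>v (h *\<^sub>v v)) $ j - a * ((h ^\<^sub>m i) *\<^sub>v v) $ j"
    proof -
      have "(x - a \<cdot>\<^sub>v y) $ j = x $ j - a * y $ j"
        if "x \<in> carrier_vec m" "y \<in> carrier_vec m" for x y :: "'k vec"
        using that \<open>j < m\<close> by simp
      then show ?thesis using hi hv Cons.prems by (meson mult_mat_vec_carrier)
    qed
    ultimately show "coeff q i * ((h ^\<^sub>m i) *\<^sub>v (h *\<^sub>v v)) $ j - a * coeff q i * ((h ^\<^sub>m i) *\<^sub>v v) $ j =
       coeff q i * ((h ^\<^sub>m i) *\<^sub>v (h *\<^sub>v v - a \<cdot>\<^sub>v v)) $ j"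
      by (simp only: right_diff_distrib) (simp add: mult_ac)
  qed simp
  also have "\<dots> = foldl (apply_factor h) (h *\<^sub>v v - a \<cdot>\<^sub>v v) as $ j"
    unfolding q_def using Cons.prems hv by (intro Cons.IH) auto
  finally show ?case by simp
qed

text \<open>The \<open>m\<^sup>2 + 1\<close> powers of \<open>h\<close> are linearly dependent; factor the resulting polynomial.\<close>

lemma annihilating_factors:
  fixes h :: "'k::alg_closed_field mat"
  assumes h: "h \<in> carrier_mat m m"
  shows "\<exists>as. \<forall>v\<in>carrier_vec m. foldl (apply_factor h) v as = 0\<^sub>v m"
proof -
  define M where "M = m * m"
  \<comment> \<open>Column \<open>i\<close> lists the \<open>m * m\<close> entries of
    \<open>h ^\<^sub>m i\<close>. The extra zero row makes the matrix square and singular, and a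
    kernel vector is a linear relation between the powers.\<close>
  define B where "B = mat (Suc M) (Suc M)
    (\<lambda>(r, i). if r < M then (h ^\<^sub>m i) $$ (r div m, r mod m) else 0)"
  have B: "B \<in> carrier_mat (Suc M) (Suc M)" by (simp add: B_def)
  have "transpose_mat B *\<^sub>v unit_vec (Suc M) M = 0\<^sub>v (Suc M)"
    using B by (intro eq_vecI) (auto simp: B_def)
  moreover have "unit_vec (Suc M) M \<noteq> (0\<^sub>v (Suc M) :: 'k vec)" by simp
  ultimately have "det (transpose_mat B) = 0"
    using det_0_iff_vec_prod_zero[of "transpose_mat B" "Suc M"] B by (metis transpose_carrier_mat unit_vec_carrier)
  then have "det B = 0" using det_transpose[OF B] by simp
  then obtain c where c: "c \<in> carrier_vec (Suc M)" "c \<noteq> 0\<^sub>v (Suc M)" "B *\<^sub>v c = 0\<^sub>v (Suc M)"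
    using det_0_iff_vec_prod_zero[OF B] by blast
  define P where "P = Abs_poly (\<lambda>i. if i < Suc M then c $ i else 0)"
  have coeffP: "coeff P i = (if i < Suc M then c $ i else 0)" for i
    unfolding P_def by (subst Abs_poly_inverse) (auto simp: MOST_nat intro!: exI[of _ "Suc M"])
  have P0: "P \<noteq> 0"
  proof
    assume "P = 0"
    then have "c = 0\<^sub>v (Suc M)" using c(1) coeffP by (intro eq_vecI) (auto, metis coeff_0)
    then show False using c(2) by simp
  qed
  obtain A where A: "P = smult (lead_coeff P) (\<Prod>x\<in>#A. [:- x, 1:])" "size A = degree P"
    using alg_closed_imp_factorization[OF P0] by blast
  obtain as where as: "mset as = A" using ex_mset by blast
  have P: "P = smult (lead_coeff P) (\<Prod>x\<leftarrow>as. [:- x, 1:])"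
    using A(1) unfolding as[symmetric] by (simp flip: prod_mset_prod_list)
  have len: "length as < Suc M"
  proof -
    have "degree P \<le> M" by (rule degree_le) (auto simp: coeffP)
    then show ?thesis using A(2) as by auto
  qed
  have zero: "(\<Sum>i<Suc M. coeff P i * (h ^\<^sub>m i) $$ (p, q)) = 0" if pq: "p < m" "q < m" for p q
  proof -
    have "p * m + q < Suc p * m" using pq by simp
    also have "Suc p * m \<le> M" unfolding M_def using pq by (intro mult_right_mono) auto
    finally have lt: "p * m + q < M" .
    have "0 = (B *\<^sub>v c) $ (p * m + q)" using c(3) lt by simp
    also have "\<dots> = (\<Sum>i<Suc M. (h ^\<^sub>m i) $$ (p, q) * c $ i)"
      using B c(1) lt pq unfolding B_def by (simp add: scalar_prod_def lessThan_atLeast0)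
    finally show ?thesis by (simp add: coeffP mult.commute)
  qed
  have "foldl (apply_factor h) v as = 0\<^sub>v m" if v: "v \<in> carrier_vec m" for v
  proof (rule eq_vecI)
    show "dim_vec (foldl (apply_factor h) v as) = dim_vec (0\<^sub>v m)"
    proof -
      have "foldl (apply_factor h) v as \<in> carrier_vec m"
        using v by (induction as arbitrary: v) (use h in auto)
      then show ?thesis by simp
    qed
    fix j assume "j < dim_vec (0\<^sub>v m)"
    then have j: "j < m" by simp
    have "lead_coeff P * foldl (apply_factor h) v as $ j =
        (\<Sum>i<Suc M. coeff P i * ((h ^\<^sub>m i) *\<^sub>v v) $ j)"
      unfolding apply_factors_sum[OF h v len j, symmetric] sum_distrib_left
      by (subst P) (simp add: mult.assoc)
    also have "\<dots> = (\<Sum>i<Suc M. \<Sum>q<m. coeff P i * (h ^\<^sub>m i) $$ (j, q) * v $ q)"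
    proof (rule sum.cong)
      fix i
      have "h ^\<^sub>m i \<in> carrier_mat m m" using h by simp
      then show "coeff P i * ((h ^\<^sub>m i) *\<^sub>v v) $ j = (\<Sum>q<m. coeff P i * (h ^\<^sub>m i) $$ (j, q) * v $ q)"
        by (simp only: mult_mat_vec_index[OF _ v j] sum_distrib_left mult.assoc)
    qed simp
    also have "\<dots> = (\<Sum>q<m. (\<Sum>i<Suc M. coeff P i * (h ^\<^sub>m i) $$ (j, q)) * v $ q)"
      unfolding sum_distrib_right by (rule sum.swap)
    also have "\<dots> = 0" using zero[OF j] by simp
    finally show "foldl (apply_factor h) v as $ j = 0\<^sub>v m $ j" using P0 j by simp
  qed
  then show ?thesis by blast
qed

text \<open>Apply the factors of an annihilating product to \<open>w\<close> one by one. The result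
  ends in \<open>W0\<close>, and the last vector still outside \<open>W0\<close> is the
  eigenvector.\<close>

lemma exists_eigenvector_mod:
  fixes h :: "'k::alg_closed_field mat"
  assumes h: "h \<in> carrier_mat m m" and W: "vec_subspace m W" "\<And>v. v \<in> W \<Longrightarrow> h *\<^sub>v v \<in> W"
    and W0: "vec_subspace m W0" and w: "w \<in> W" "w \<notin> W0"
  obtains u a where "u \<in> W" "u \<notin> W0" "apply_factor h u a \<in> W0"
proof -
  obtain as where as: "\<And>v. v \<in> carrier_vec m \<Longrightarrow> foldl (apply_factor h) v as = 0\<^sub>v m"
    using annihilating_factors[OF h] by blast
  have *: "\<exists>u a. u \<in> W \<and> u \<notin> W0 \<and> apply_factor h u a \<in> W0"
    if "foldl (apply_factor h) v as \<in> W0" "v \<in> W" "v \<notin> W0" for v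
    using that
  proof (induction as arbitrary: v)
    case (Cons a as)
    have "apply_factor h v a \<in> W"
      using vec_subspace_diff[OF W(1) W(2)[OF Cons.prems(2)] vec_subspaceD(4)[OF W(1) Cons.prems(2)]] .
    show ?case
    proof (cases "apply_factor h v a \<in> W0")
      case True
      then show ?thesis using Cons.prems(2,3) by blast
    next
      case False
      then show ?thesis
        using Cons.IH[OF _ \<open>apply_factor h v a \<in> W\<close>] Cons.prems(1) unfolding foldl_Cons by blast
    qed
  qed simp
  have "foldl (apply_factor h) w as \<in> W0" using as[OF vec_subspaceD(1)[OF W(1) w(1)]] vec_subspaceD(2)[OF W0] by simp
  from *[OF this w] show ?thesis by (elim exE conjE) (rule that)
qed

text \<open>Every eigenvalue is a root of the annihilating product: for \<open>c \<noteq> a\<close>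
  the factor \<open>h - a\<close> multiplies an eigenvector for \<open>c\<close> by
  \<open>c - a\<close> modulo \<open>W0\<close> and so keeps it outside \<open>W0\<close>, whereas
  the whole product gives zero.\<close>

lemma finite_eigenvalues_mod:
  fixes h :: "'k::alg_closed_field mat"
  assumes h: "h \<in> carrier_mat m m" and W0: "vec_subspace m W0" "\<And>v. v \<in> W0 \<Longrightarrow> h *\<^sub>v v \<in> W0"
  shows "finite {c. \<exists>v\<in>carrier_vec m - W0. apply_factor h v c \<in> W0}"
proof -
  obtain as where as: "\<And>v. v \<in> carrier_vec m \<Longrightarrow> foldl (apply_factor h) v as = 0\<^sub>v m"
    using annihilating_factors[OF h] by blast
  have *: "foldl (apply_factor h) v as \<notin> W0"
    if "apply_factor h v c \<in> W0" "v \<in> carrier_vec m" "v \<notin> W0" "c \<notin> set as" for v c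
    using that
  proof (induction as arbitrary: v)
    case (Cons a as)
    define x where "x = apply_factor h v c"
    define v1 where "v1 = apply_factor h v a"
    have carr: "x \<in> carrier_vec m" "v1 \<in> carrier_vec m" "h *\<^sub>v v \<in> carrier_vec m"
      "h *\<^sub>v (h *\<^sub>v v) \<in> carrier_vec m"
      using h Cons.prems(2) by (auto simp: x_def v1_def)
    have "v1 \<notin> W0"
    proof
      assume "v1 \<in> W0"
      then have "inverse (c - a) \<cdot>\<^sub>v (v1 - x) \<in> W0"
        using Cons.prems(1) vec_subspaceD(4)[OF W0(1)] vec_subspace_diff[OF W0(1)] by (simp add: x_def)
      moreover have "v1 - x = (c - a) \<cdot>\<^sub>v v"
        using Cons.prems(2) carr by (intro eq_vecI) (simp_all add: v1_def x_def left_diff_distrib)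
      then have "inverse (c - a) \<cdot>\<^sub>v (v1 - x) = v"
        using Cons.prems(2,4) by (simp add: smult_smult_assoc)
      ultimately show False using Cons.prems(3) by simp
    qed
    moreover have "apply_factor h v1 c \<in> W0"
    proof -
      have "apply_factor h v1 c = apply_factor h x a"
      proof -
        have "h *\<^sub>v v1 = h *\<^sub>v (h *\<^sub>v v) - a \<cdot>\<^sub>v (h *\<^sub>v v)" "h *\<^sub>v x = h *\<^sub>v (h *\<^sub>v v) - c \<cdot>\<^sub>v (h *\<^sub>v v)"
          unfolding v1_def x_def using h Cons.prems(2) carr
          by (simp_all add: mult_minus_distrib_mat_vec mult_mat_vec)
        moreover have "q - a \<cdot>\<^sub>v p - c \<cdot>\<^sub>v (p - a \<cdot>\<^sub>v v) = q - c \<cdot>\<^sub>v p - a \<cdot>\<^sub>v (p - c \<cdot>\<^sub>v v)"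
          if "p \<in> carrier_vec m" "q \<in> carrier_vec m" for p q
          using that Cons.prems(2) by (intro eq_vecI) (simp_all add: algebra_simps)
        ultimately show ?thesis using carr unfolding v1_def x_def by metis
      qed
      then show ?thesis
        using vec_subspace_diff[OF W0(1) W0(2) vec_subspaceD(4)[OF W0(1)]] Cons.prems(1)
        by (simp add: x_def)
    qed
    ultimately show ?case using Cons.IH[of v1] carr Cons.prems(4) by (simp add: v1_def)
  qed simp
  have "c \<in> set as" if "apply_factor h v c \<in> W0" "v \<in> carrier_vec m" "v \<notin> W0" for v c
    using *[OF that] as[OF that(2)] vec_subspaceD(2)[OF W0(1)] by auto
  then have "{c. \<exists>v\<in>carrier_vec m - W0. apply_factor h v c \<in> W0} \<subseteq> set as" by blast
  then show ?thesis using finite_subset by blast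
qed

section \<open>The symplectic form\<close>

lemma sum_double: "(\<Sum>i<2 * (n::nat). f i) = (\<Sum>i<n. f i) + (\<Sum>i<n. f (n + i) :: 'a::comm_monoid_add)"
proof -
  have "(\<Sum>i<n + n. f i) = (\<Sum>i<n. f i) + (\<Sum>i\<in>{n..<n + n}. f i)"
    by (subst sum.union_disjoint[symmetric]) (auto intro!: sum.cong)
  also have "(\<Sum>i\<in>{n..<n + n}. f i) = (\<Sum>i<n. f (n + i))"
    by (rule sum.reindex_bij_witness[of _ "\<lambda>i. n + i" "\<lambda>i. i - n"]) auto
  finally show ?thesis by (simp add: mult_2)
qed

lemma symp_form_index:
  "i < 2 * n \<Longrightarrow> j < 2 * n \<Longrightarrow>
    symp_form n $$ (i, j) = (if j = i + n then 1 else if i = j + n then - 1 else 0)"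
  unfolding symp_form_def by auto

definition sform :: "nat \<Rightarrow> 'k::comm_ring_1 vec \<Rightarrow> 'k vec \<Rightarrow> 'k" where
  "sform n u v = (\<Sum>i<n. u $ i * v $ (n + i) - u $ (n + i) * v $ i)"

lemma symp_form_mult_vec_index:
  assumes v: "v \<in> carrier_vec (2 * n)" and i: "i < n"
  shows "(symp_form n *\<^sub>v v) $ i = v $ (n + i)" "(symp_form n *\<^sub>v v) $ (n + i) = - (v $ i)"
proof -
  have "(symp_form n *\<^sub>v v) $ p = (\<Sum>q<2 * n. symp_form n $$ (p, q) * v $ q)" if "p < 2 * n" for p
    by (rule mult_mat_vec_index[OF symp_form_carrier v that])
  note * = this[unfolded sum_double]
  have 1: "symp_form n $$ (i, j) * v $ j = 0" "symp_form n $$ (n + i, n + j) * v $ (n + j) = 0"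
    "symp_form n $$ (i, n + j) * v $ (n + j) = (if j = i then v $ (n + i) else 0)"
    "symp_form n $$ (n + i, j) * v $ j = (if j = i then - (v $ i) else 0)" if "j < n" for j
    using i that by (auto simp: symp_form_index)
  show "(symp_form n *\<^sub>v v) $ i = v $ (n + i)" "(symp_form n *\<^sub>v v) $ (n + i) = - (v $ i)"
    using i by (simp_all add: * 1 cong: sum.cong_simp)
qed

lemma sform_eq_scalar_prod:
  assumes u: "u \<in> carrier_vec (2 * n)" and v: "v \<in> carrier_vec (2 * n)"
  shows "sform n u v = u \<bullet> (symp_form n *\<^sub>v v)"
proof -
  have "dim_vec (symp_form n *\<^sub>v v) = 2 * n" using carrier_matD[OF symp_form_carrier[of n]] by simp
  then have "u \<bullet> (symp_form n *\<^sub>v v) = (\<Sum>i<2 * n. u $ i * (symp_form n *\<^sub>v v) $ i)"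
    unfolding scalar_prod_def by (simp only: lessThan_atLeast0)
  also have "\<dots> = sform n u v"
    unfolding sum_double sform_def
    by (simp add: symp_form_mult_vec_index[OF v] sum_subtractf sum_negf cong: sum.cong_simp)
  finally show ?thesis ..
qed

context
  fixes n :: nat and u v w :: "'k::comm_ring_1 vec"
  assumes u: "u \<in> carrier_vec (2 * n)" and v: "v \<in> carrier_vec (2 * n)" and w: "w \<in> carrier_vec (2 * n)"
begin

lemma sform_add_left: "sform n (u + v) w = sform n u w + sform n v w"
  using u v w unfolding sform_def sum.distrib[symmetric] by (intro sum.cong) (auto simp: algebra_simps)

lemma sform_add_right: "sform n w (u + v) = sform n w u + sform n w v"
  using u v w unfolding sform_def sum.distrib[symmetric] by (intro sum.cong) (auto simp: algebra_simps)

lemma sform_diff_left: "sform n (u - v) w = sform n u w - sform n v w"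
  using u v w unfolding sform_def sum_subtractf[symmetric] by (intro sum.cong) (auto simp: algebra_simps)

lemma sform_diff_right: "sform n w (u - v) = sform n w u - sform n w v"
  using u v w unfolding sform_def sum_subtractf[symmetric] by (intro sum.cong) (auto simp: algebra_simps)

end

lemma sform_smult_left: "u \<in> carrier_vec (2 * n) \<Longrightarrow> sform n (c \<cdot>\<^sub>v u) w = c * sform n u w"
  unfolding sform_def sum_distrib_left by (intro sum.cong) (auto simp: algebra_simps)

lemma sform_smult_right: "u \<in> carrier_vec (2 * n) \<Longrightarrow> sform n w (c \<cdot>\<^sub>v u) = c * sform n w u"
  unfolding sform_def sum_distrib_left by (intro sum.cong) (auto simp: algebra_simps)

lemma sform_self [simp]: "sform n u u = 0"
  unfolding sform_def by (intro sum.neutral) auto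

lemma sform_swap: "sform n v u = - sform n u v"
  unfolding sform_def sum_negf[symmetric] by (intro sum.cong) auto

lemma sform_zero [simp]: "sform n (0\<^sub>v (2 * n)) v = 0" "sform n v (0\<^sub>v (2 * n)) = 0"
  unfolding sform_def by (intro sum.neutral; simp)+

lemma sform_unit_vec:
  assumes i: "i < n"
  shows "sform n u (unit_vec (2 * n) i) = - (u $ (n + i))" "sform n u (unit_vec (2 * n) (n + i)) = u $ i"
    "sform n (unit_vec (2 * n) i) u = u $ (n + i)" "sform n (unit_vec (2 * n) (n + i)) u = - (u $ i)"
proof -
  have *: "sform n u (unit_vec (2 * n) i) = - (u $ (n + i))" "sform n u (unit_vec (2 * n) (n + i)) = u $ i" for u
  proof -
    have "sform n u (unit_vec (2 * n) i) = (\<Sum>j<n. if j = i then - (u $ (n + i)) else 0)"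
      unfolding sform_def using i by (intro sum.cong) auto
    then show "sform n u (unit_vec (2 * n) i) = - (u $ (n + i))" using i by simp
    have "sform n u (unit_vec (2 * n) (n + i)) = (\<Sum>j<n. if j = i then u $ i else 0)"
      unfolding sform_def using i by (intro sum.cong) auto
    then show "sform n u (unit_vec (2 * n) (n + i)) = u $ i" using i by simp
  qed
  show "sform n u (unit_vec (2 * n) i) = - (u $ (n + i))" "sform n u (unit_vec (2 * n) (n + i)) = u $ i"
    "sform n (unit_vec (2 * n) i) u = u $ (n + i)" "sform n (unit_vec (2 * n) (n + i)) u = - (u $ i)"
    using *[of u] sform_swap[of n "unit_vec (2 * n) i" u] sform_swap[of n "unit_vec (2 * n) (n + i)" u]
    by simp_all
qed

lemma sform_nondegenerate:
  assumes u: "u \<in> carrier_vec (2 * n)" and z: "\<And>i. i < 2 * n \<Longrightarrow> sform n u (unit_vec (2 * n) i) = 0"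
  shows "u = 0\<^sub>v (2 * n)"
proof (rule eq_vecI)
  fix i assume "i < dim_vec (0\<^sub>v (2 * n) :: 'a vec)"
  then have i: "i < 2 * n" by simp
  show "u $ i = 0\<^sub>v (2 * n) $ i"
  proof (cases "i < n")
    case True
    then show ?thesis using z[of "n + i"] i by (simp add: sform_unit_vec)
  next
    case False
    then show ?thesis using z[of "i - n"] sform_unit_vec(1)[of "i - n" n u] i by simp
  qed
qed (use u in simp)

lemma sform_mult_mat_vec:
  assumes g: "g \<in> carrier_mat (2 * n) (2 * n)" and u: "u \<in> carrier_vec (2 * n)" and v: "v \<in> carrier_vec (2 * n)"
  shows "sform n (g *\<^sub>v u) (g *\<^sub>v v) = u \<bullet> ((transpose_mat g * symp_form n * g) *\<^sub>v v)"
proof -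
  let ?m = "2 * n"
  have J: "symp_form n \<in> carrier_mat ?m ?m" by simp
  have gv: "g *\<^sub>v v \<in> carrier_vec ?m" using g v by auto
  have Jgv: "symp_form n *\<^sub>v (g *\<^sub>v v) \<in> carrier_vec ?m" using mult_mat_vec_carrier[OF J gv] .
  have "sform n (g *\<^sub>v u) (g *\<^sub>v v) = (g *\<^sub>v u) \<bullet> (symp_form n *\<^sub>v (g *\<^sub>v v))"
    using g u gv by (intro sform_eq_scalar_prod) auto
  also have "\<dots> = u \<bullet> (transpose_mat g *\<^sub>v (symp_form n *\<^sub>v (g *\<^sub>v v)))"
    using transpose_vec_mult_scalar[of "transpose_mat g" ?m ?m _ u] g u Jgv
    by (metis transpose_carrier_mat transpose_transpose comm_scalar_prod mult_mat_vec_carrier)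
  also have "\<dots> = u \<bullet> ((transpose_mat g * symp_form n * g) *\<^sub>v v)"
    using g J gv v by (simp add: assoc_mult_mat_vec[of _ ?m ?m _ ?m] mult_carrier_mat[of _ ?m ?m _ ?m])
  finally show ?thesis .
qed

section \<open>The symplectic group as isometry group\<close>

text \<open>Testing both bilinear forms on unit vectors recovers the matrix entries, so invariance
  on vectors is the same as the matrix equation.\<close>

lemma Sp_iff:
  "g \<in> carrier (Sp n) \<longleftrightarrow> g \<in> carrier_mat (2 * n) (2 * n) \<and>
    (\<forall>u\<in>carrier_vec (2 * n). \<forall>v\<in>carrier_vec (2 * n). sform n (g *\<^sub>v u) (g *\<^sub>v v) = sform n u v)"
  (is "?l \<longleftrightarrow> ?r")
proof
  assume l: ?l
  then have g: "g \<in> carrier_mat (2 * n) (2 * n)" "transpose_mat g * symp_form n * g = symp_form n"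
    by (auto simp: Sp_def)
  show ?r
    by (intro conjI ballI g(1)) (simp only: sform_mult_mat_vec[OF g(1)] sform_eq_scalar_prod g(2))
next
  assume r: ?r
  let ?m = "2 * n" and ?X = "transpose_mat g * symp_form n * g"
  have X: "?X \<in> carrier_mat ?m ?m" using r by (simp add: mult_carrier_mat[of _ ?m ?m _ ?m])
  have "?X $$ (i, j) = symp_form n $$ (i, j)" if "i < ?m" "j < ?m" for i j
  proof -
    have *: "unit_vec ?m i \<bullet> (A *\<^sub>v unit_vec ?m j) = A $$ (i, j)" if "A \<in> carrier_mat ?m ?m" for A :: "'a mat"
    proof -
      have "unit_vec ?m i \<bullet> (A *\<^sub>v unit_vec ?m j) = (A *\<^sub>v unit_vec ?m j) $ i"
        using that \<open>i < ?m\<close> by (intro scalar_prod_left_unit) auto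
      also have "\<dots> = (\<Sum>q<?m. A $$ (i, q) * unit_vec ?m j $ q)"
        using that \<open>i < ?m\<close> by (intro mult_mat_vec_index) auto
      also have "\<dots> = (\<Sum>q<?m. if q = j then A $$ (i, j) else 0)"
        using \<open>j < ?m\<close> by (intro sum.cong) auto
      finally show ?thesis using \<open>j < ?m\<close> by simp
    qed
    show ?thesis
      using r sform_mult_mat_vec[of g n "unit_vec ?m i" "unit_vec ?m j"]
        sform_eq_scalar_prod[of "unit_vec ?m i :: 'a vec" n "unit_vec ?m j"] *[OF X] *[OF symp_form_carrier]
      by simp
  qed
  then have "?X = symp_form n"
    using carrier_matD[OF X] carrier_matD[of "symp_form n :: 'a mat" ?m ?m] by (intro eq_matI) auto
  then show ?l using r by (simp add: Sp_def)
qed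

lemma Sp_sform:
  "g \<in> carrier (Sp n) \<Longrightarrow> u \<in> carrier_vec (2 * n) \<Longrightarrow> v \<in> carrier_vec (2 * n) \<Longrightarrow>
    sform n (g *\<^sub>v u) (g *\<^sub>v v) = sform n u v"
  by (simp add: Sp_iff)

lemma Sp_carrier: "g \<in> carrier (Sp n) \<Longrightarrow> g \<in> carrier_mat (2 * n) (2 * n)"
  by (simp add: Sp_def)

lemma Sp_mult [simp]: "x \<otimes>\<^bsub>Sp n\<^esub> y = x * y" and Sp_one [simp]: "\<one>\<^bsub>Sp n\<^esub> = 1\<^sub>m (2 * n)"
  by (simp_all add: Sp_def)

lemma Sp_mult_vec: "g \<in> carrier (Sp n) \<Longrightarrow> v \<in> carrier_vec (2 * n) \<Longrightarrow> g *\<^sub>v v \<in> carrier_vec (2 * n)"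
  using Sp_carrier by (rule mult_mat_vec_carrier)

lemma Sp_closed: "g \<in> carrier (Sp n) \<Longrightarrow> h \<in> carrier (Sp n :: 'k::field mat monoid) \<Longrightarrow> g * h \<in> carrier (Sp n)"
  using monoid.m_closed[OF group.is_monoid[OF group_Sp[of n]]] by simp

lemma Sp_one_closed: "1\<^sub>m (2 * n) \<in> carrier (Sp n :: 'k::field mat monoid)"
  using monoid.one_closed[OF group.is_monoid[OF group_Sp[of n]]] by simp

lemma Sp_inv_closed: "g \<in> carrier (Sp n) \<Longrightarrow> inv\<^bsub>Sp n\<^esub> g \<in> carrier (Sp n :: 'k::field mat monoid)"
  using group.inv_closed[OF group_Sp[of n]] .

lemma Sp_inv_mult:
  fixes g :: "'k::field mat"
  assumes "g \<in> carrier (Sp n)"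
  shows "inv\<^bsub>Sp n\<^esub> g * g = 1\<^sub>m (2 * n)" "g * inv\<^bsub>Sp n\<^esub> g = 1\<^sub>m (2 * n)"
  using group.l_inv[OF group_Sp assms] group.r_inv[OF group_Sp assms] by simp_all

lemma Sp_inv_mult_vec:
  fixes g :: "'k::field mat"
  assumes g: "g \<in> carrier (Sp n)" and v: "v \<in> carrier_vec (2 * n)"
  shows "inv\<^bsub>Sp n\<^esub> g *\<^sub>v (g *\<^sub>v v) = v" "g *\<^sub>v (inv\<^bsub>Sp n\<^esub> g *\<^sub>v v) = v"
  using assoc_mult_mat_vec[OF Sp_carrier[OF g] Sp_carrier[OF Sp_inv_closed[OF g]] v]
    assoc_mult_mat_vec[OF Sp_carrier[OF Sp_inv_closed[OF g]] Sp_carrier[OF g] v] Sp_inv_mult[OF g] v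
  by simp_all

lemma Sp_sform_inv:
  fixes g :: "'k::field mat"
  assumes g: "g \<in> carrier (Sp n)" and u: "u \<in> carrier_vec (2 * n)" and v: "v \<in> carrier_vec (2 * n)"
  shows "sform n (g *\<^sub>v u) v = sform n u (inv\<^bsub>Sp n\<^esub> g *\<^sub>v v)"
  using Sp_sform[OF g u Sp_mult_vec[OF Sp_inv_closed[OF g] v]] Sp_inv_mult_vec[OF g v] by simp

text \<open>The entries of the inverse are linear in those of \<open>g\<close>; hence inversion and
  conjugation are polynomial maps on the group.\<close>

lemma Sp_inv_eq:
  fixes g :: "'k::field mat"
  assumes "g \<in> carrier (Sp n)"
  shows "inv\<^bsub>Sp n\<^esub> g = - (symp_form n * transpose_mat g * symp_form n)"
proof -
  let ?m = "2 * n" and ?J = "symp_form n :: 'k mat" and ?i = "inv\<^bsub>Sp n\<^esub> g"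
  have J: "?J \<in> carrier_mat ?m ?m" by simp
  have g: "g \<in> carrier_mat ?m ?m" and gJ: "transpose_mat g * ?J * g = ?J" using assms by (auto simp: Sp_def)
  have i: "?i \<in> carrier_mat ?m ?m" using Sp_carrier[OF Sp_inv_closed[OF assms]] .
  have gt: "transpose_mat g \<in> carrier_mat ?m ?m" using g by simp
  have "?J * transpose_mat g * ?J = ?J * transpose_mat g * ?J * (g * ?i)"
    by (simp only: Sp_inv_mult(2)[OF assms] right_mult_one_mat[OF mult_carrier_mat[OF mult_carrier_mat[OF J gt] J]])
  also have "\<dots> = ?J * (transpose_mat g * ?J * g) * ?i"
    using J gt g i by (simp add: assoc_mult_mat[of _ ?m ?m _ ?m _ ?m] mult_carrier_mat[of _ ?m ?m _ ?m])
  also have "\<dots> = - 1\<^sub>m ?m * ?i" by (simp add: gJ symp_form_square)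
  also have "\<dots> = - ?i" using i by (simp add: uminus_mult_left_mat)
  finally show ?thesis using i by (simp add: uminus_uminus_mat)
qed

section \<open>Connected solvable subgroups\<close>

definition poly_map :: "nat \<Rightarrow> 'k::comm_ring_1 mat set \<Rightarrow> ('k mat \<Rightarrow> 'k mat) \<Rightarrow> bool" where
  "poly_map m X \<phi> \<longleftrightarrow> (\<forall>A\<in>X. \<phi> A \<in> carrier_mat m m) \<and>
     (\<forall>i<m. \<forall>j<m. \<exists>p\<in>mat_polyfun m. \<forall>A\<in>X. \<phi> A $$ (i, j) = p A)"

lemma poly_map_const: "C \<in> carrier_mat m m \<Longrightarrow> poly_map m X (\<lambda>A. C)"
  unfolding poly_map_def by (auto intro!: bexI[OF _ mat_polyfun.const])

lemma poly_map_id: "X \<subseteq> carrier_mat m m \<Longrightarrow> poly_map m X (\<lambda>A. A)"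
  unfolding poly_map_def by (auto intro!: bexI[OF _ mat_polyfun.entry])

lemma poly_map_mult:
  assumes \<phi>: "poly_map m X \<phi>" and \<psi>: "poly_map m X \<psi>"
  shows "poly_map m X (\<lambda>A. \<phi> A * \<psi> A)"
  unfolding poly_map_def
proof (intro conjI ballI allI impI)
  show "\<phi> A * \<psi> A \<in> carrier_mat m m" if "A \<in> X" for A
    using assms that unfolding poly_map_def by (metis mult_carrier_mat)
  fix i j assume ij: "i < m" "j < m"
  have "\<forall>k\<in>{..<m}. \<exists>p. p \<in> mat_polyfun m \<and> (\<forall>A\<in>X. \<phi> A $$ (i, k) = p A)"
    using \<phi> ij unfolding poly_map_def by blast
  from bchoice[OF this] obtain p where p: "\<And>k. k < m \<Longrightarrow> p k \<in> mat_polyfun m"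
    "\<And>k A. k < m \<Longrightarrow> A \<in> X \<Longrightarrow> \<phi> A $$ (i, k) = p k A" by blast
  have "\<forall>k\<in>{..<m}. \<exists>p. p \<in> mat_polyfun m \<and> (\<forall>A\<in>X. \<psi> A $$ (k, j) = p A)"
    using \<psi> ij unfolding poly_map_def by blast
  from bchoice[OF this] obtain q where q: "\<And>k. k < m \<Longrightarrow> q k \<in> mat_polyfun m"
    "\<And>k A. k < m \<Longrightarrow> A \<in> X \<Longrightarrow> \<psi> A $$ (k, j) = q k A" by blast
  show "\<exists>r\<in>mat_polyfun m. \<forall>A\<in>X. (\<phi> A * \<psi> A) $$ (i, j) = r A"
  proof (intro bexI ballI)
    show "(\<lambda>A. \<Sum>k\<in>{..<m}. p k A * q k A) \<in> mat_polyfun m"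
      by (intro mat_polyfun_sum mat_polyfun.mult p(1) q(1)) auto
    fix A assume A: "A \<in> X"
    have carr: "\<phi> A \<in> carrier_mat m m" "\<psi> A \<in> carrier_mat m m"
      using assms A unfolding poly_map_def by auto
    show "(\<phi> A * \<psi> A) $$ (i, j) = (\<Sum>k\<in>{..<m}. p k A * q k A)"
      using carr ij A by (simp add: scalar_prod_def lessThan_atLeast0 p(2)[symmetric] q(2)[symmetric] cong: sum.cong_simp)
  qed
qed

lemma poly_map_Sp_inv:
  assumes X: "X \<subseteq> carrier (Sp n :: 'k::field mat monoid)"
  shows "poly_map (2 * n) X (\<lambda>A. inv\<^bsub>Sp n\<^esub> A)"
proof -
  let ?m = "2 * n" and ?J = "symp_form n :: 'k mat"
  have "poly_map ?m X (\<lambda>A. transpose_mat A)"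
    unfolding poly_map_def
  proof (intro conjI ballI allI impI)
    fix i j assume "i < ?m" "j < ?m"
    then show "\<exists>p\<in>mat_polyfun ?m. \<forall>A\<in>X. transpose_mat A $$ (i, j) = p A"
      using X Sp_carrier by (intro bexI[OF _ mat_polyfun.entry[of j _ i]]) fastforce+
  qed (use X Sp_carrier in fastforce)
  then have "poly_map ?m X (\<lambda>A. - ?J * transpose_mat A * ?J)"
    by (intro poly_map_mult poly_map_const) auto
  moreover have "inv\<^bsub>Sp n\<^esub> A = - ?J * transpose_mat A * ?J" if "A \<in> X" for A
  proof -
    have "A \<in> carrier (Sp n)" using that X by blast
    then have "transpose_mat A \<in> carrier_mat ?m ?m" using Sp_carrier[of A n] by simp
    then show ?thesis using Sp_inv_eq[OF \<open>A \<in> carrier (Sp n)\<close>]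
      by (simp add: uminus_mult_left_mat mult_carrier_mat[of _ ?m ?m _ ?m] carrier_matD[of "?J" ?m ?m])
  qed
  ultimately show ?thesis unfolding poly_map_def by simp
qed

lemma continuous_map_poly_map:
  fixes \<phi> :: "'k::idom mat \<Rightarrow> 'k mat"
  assumes "X \<subseteq> carrier_mat m m" "poly_map m X \<phi>" "\<And>A. A \<in> X \<Longrightarrow> \<phi> A \<in> Y"
  shows "continuous_map (subtopology (zariski m) X) (subtopology (zariski m) Y) \<phi>"
proof -
  have "continuous_map (subtopology (zariski m) X) (zariski m) \<phi>"
    using assms(1,2) by (intro continuous_map_zariski) (auto simp: poly_map_def)
  then show ?thesis using assms(1,3) by (auto simp: continuous_map_in_subtopology)
qed

lemma connectedin_poly_map_image:
  fixes \<phi> :: "'k::idom mat \<Rightarrow> 'k mat"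
  assumes "X \<subseteq> carrier_mat m m" "poly_map m X \<phi>" "connectedin (zariski m) X"
  shows "connectedin (zariski m) (\<phi> ` X)"
proof -
  have "connectedin (subtopology (zariski m) X) X" using assms(3) by (simp add: connectedin_subtopology)
  moreover have "continuous_map (subtopology (zariski m) X) (zariski m) \<phi>"
    using assms(1,2) by (intro continuous_map_zariski) (auto simp: poly_map_def)
  ultimately show ?thesis by (rule connectedin_continuous_map_image[rotated])
qed

text \<open>For fixed \<open>b\<close> the commutators of \<open>b\<close> with elements of
  \<open>H\<close> are a polynomial image of \<open>H\<close> that contains 1. Right translation by
  \<open>y\<close> carries a connected set through 1 and \<open>x\<close> to one through
  \<open>y\<close> and \<open>x * y\<close>, so products of commutators stay in the component of
  1.\<close>

lemma connectedin_derived_Sp: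
  fixes H :: "'k::field mat set"
  assumes H: "subgroup H (Sp n)" and conn: "connectedin (zariski (2 * n)) H"
  shows "connectedin (zariski (2 * n)) (derived (Sp n) H)"
proof -
  let ?G = "Sp n :: 'k mat monoid" and ?m = "2 * n" and ?D = "derived (Sp n) H"
  interpret G: group ?G by (rule group_Sp)
  let ?C = "connected_component_of (subtopology (zariski ?m) ?D)"
  have HG: "H \<subseteq> carrier ?G" using H by (rule subgroup.subset)
  have Hm: "H \<subseteq> carrier_mat ?m ?m" using HG Sp_carrier by blast
  have D: "subgroup ?D ?G" using G.derived_is_subgroup[OF HG] .
  have DG: "?D \<subseteq> carrier ?G" using D by (rule subgroup.subset)
  have Dm: "?D \<subseteq> carrier_mat ?m ?m" using DG Sp_carrier by blast
  have one: "1\<^sub>m ?m \<in> ?D" using subgroup.one_closed[OF D] by simp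
  have comm: "?C (1\<^sub>m ?m) (a \<otimes>\<^bsub>?G\<^esub> b \<otimes>\<^bsub>?G\<^esub> inv\<^bsub>?G\<^esub> a \<otimes>\<^bsub>?G\<^esub> inv\<^bsub>?G\<^esub> b)" if ab: "a \<in> H" "b \<in> H" for a b
  proof -
    let ?f = "\<lambda>A. A * b * inv\<^bsub>?G\<^esub> A * inv\<^bsub>?G\<^esub> b"
    have b: "b \<in> carrier ?G" using ab HG by blast
    have "connectedin (zariski ?m) (?f ` H)"
      by (intro connectedin_poly_map_image[OF Hm _ conn] poly_map_mult poly_map_Sp_inv[OF HG]
          poly_map_const poly_map_id[OF Hm] Sp_carrier b Sp_inv_closed)
    moreover have "?f ` H \<subseteq> ?D"
      unfolding derived_def using ab(2) by (auto intro!: generate.incl)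
    ultimately have "connectedin (subtopology (zariski ?m) ?D) (?f ` H)"
      by (simp add: connectedin_subtopology)
    moreover have "1\<^sub>m ?m \<in> ?f ` H"
    proof (rule image_eqI)
      show "1\<^sub>m ?m \<in> H" using subgroup.one_closed[OF H] by simp
      show "1\<^sub>m ?m = ?f (1\<^sub>m ?m)"
        using b Sp_carrier[OF b] Sp_carrier[OF Sp_inv_closed[OF b]] Sp_inv_mult[OF b] G.inv_one by simp
    qed
    ultimately show ?thesis unfolding connected_component_of_def using ab(1) by auto
  qed
  have "?C (1\<^sub>m ?m) x" if "x \<in> ?D" for x
    using that[unfolded derived_def]
  proof (induction rule: generate.induct)
    case one
    show ?case using \<open>1\<^sub>m ?m \<in> ?D\<close> Dm by (auto simp: connected_component_of_refl)
  next
    case (incl h)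
    then show ?case using comm by auto
  next
    case (inv h)
    then obtain a b where ab: "a \<in> H" "b \<in> H" "h = a \<otimes>\<^bsub>?G\<^esub> b \<otimes>\<^bsub>?G\<^esub> inv\<^bsub>?G\<^esub> a \<otimes>\<^bsub>?G\<^esub> inv\<^bsub>?G\<^esub> b" by blast
    have "a \<in> carrier ?G" "b \<in> carrier ?G" using ab HG by auto
    then have "inv\<^bsub>?G\<^esub> h = b \<otimes>\<^bsub>?G\<^esub> a \<otimes>\<^bsub>?G\<^esub> inv\<^bsub>?G\<^esub> b \<otimes>\<^bsub>?G\<^esub> inv\<^bsub>?G\<^esub> a"
      unfolding ab(3) by (simp add: G.inv_mult_group G.m_assoc del: Sp_mult)
    then show ?case using comm[OF ab(2,1)] by simp
  next
    case (eng x y)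
    have xy: "x \<in> ?D" "y \<in> ?D" using eng.hyps by (simp_all add: derived_def)
    have y: "y \<in> carrier ?G" using xy DG by blast
    obtain T where T: "connectedin (subtopology (zariski ?m) ?D) T" "1\<^sub>m ?m \<in> T" "x \<in> T"
      using eng.IH(1) unfolding connected_component_of_def by blast
    have "continuous_map (subtopology (zariski ?m) ?D) (subtopology (zariski ?m) ?D) (\<lambda>A. A * y)"
      by (intro continuous_map_poly_map[OF Dm] poly_map_mult poly_map_id[OF Dm] poly_map_const Sp_carrier y)
         (use subgroup.m_closed[OF D _ xy(2)] in simp)
    then have "connectedin (subtopology (zariski ?m) ?D) ((\<lambda>A. A * y) ` T)"
      using T(1) by (rule connectedin_continuous_map_image)
    moreover have "1\<^sub>m ?m * y = y" using Sp_carrier[OF y] by simp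
    ultimately have "?C y (x * y)" unfolding connected_component_of_def using T(2,3) by (metis imageI)
    then show ?case using eng.IH(2) connected_component_of_trans by fastforce
  qed
  moreover have "?D \<subseteq> topspace (zariski ?m)" using Dm by simp
  ultimately show ?thesis by (rule connectedin_if_connected_component_of)
qed

section \<open>Eigenvalues along connected sets, and Lie--Kolchin\<close>

definition sform_perp :: "nat \<Rightarrow> 'k::field vec set \<Rightarrow> 'k vec set" where
  "sform_perp n W = {v \<in> carrier_vec (2 * n). \<forall>z\<in>W. sform n v z = 0}"

lemma vec_subspace_perp:
  assumes "W \<subseteq> carrier_vec (2 * n)" shows "vec_subspace (2 * n) (sform_perp n W)"
  using assms unfolding vec_subspace_def sform_perp_def
  by (auto simp: sform_add_left sform_smult_left subset_iff)

text \<open>The condition is the vanishing, for each \<open>z\<close> in \<open>W\<close>, of a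
  function that is linear in the entries of \<open>g\<close>.\<close>

lemma closedin_apply_factor_perp:
  fixes h :: "'k::field mat"
  assumes h: "h \<in> carrier_mat (2 * n) (2 * n)" and v: "v \<in> carrier_vec (2 * n)"
    and W: "W \<subseteq> carrier_vec (2 * n)"
  shows "closedin (zariski (2 * n))
    {g \<in> carrier_mat (2 * n) (2 * n). apply_factor h (g *\<^sub>v v) c \<in> sform_perp n W}"
proof -
  let ?m = "2 * n"
  define f where "f z g = (\<Sum>i<?m. ((\<Sum>j<?m. h $$ (i, j) * (\<Sum>k<?m. g $$ (j, k) * v $ k)) +
    (- c) * (\<Sum>k<?m. g $$ (i, k) * v $ k)) * (symp_form n *\<^sub>v z) $ i)" for z and g :: "'k mat"
  have "f z \<in> mat_polyfun ?m" for z
    unfolding f_def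
    by (intro mat_polyfun_sum mat_polyfun.mult mat_polyfun.add mat_polyfun.const mat_polyfun.entry) auto
  moreover have "f z g = sform n (apply_factor h (g *\<^sub>v v) c) z"
    if g: "g \<in> carrier_mat ?m ?m" and z: "z \<in> W" for z g
  proof -
    have gv: "g *\<^sub>v v \<in> carrier_vec ?m" using g v by auto
    have hgv: "h *\<^sub>v (g *\<^sub>v v) \<in> carrier_vec ?m" using h gv by (metis mult_mat_vec_carrier)
    have carr: "apply_factor h (g *\<^sub>v v) c \<in> carrier_vec ?m" using gv hgv by auto
    have "dim_vec (symp_form n *\<^sub>v z) = ?m" using carrier_matD[OF symp_form_carrier[of n]] by simp
    then have "sform n (apply_factor h (g *\<^sub>v v) c) z =
        (\<Sum>i<?m. apply_factor h (g *\<^sub>v v) c $ i * (symp_form n *\<^sub>v z) $ i)"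
      using z W carr by (subst sform_eq_scalar_prod) (auto simp: scalar_prod_def lessThan_atLeast0)
    also have "\<dots> = f z g"
      unfolding f_def
    proof (intro sum.cong refl arg_cong2[of _ _ _ _ "(*)"])
      fix i assume "i \<in> {..<?m}"
      then have i: "i < ?m" by simp
      have "apply_factor h (g *\<^sub>v v) c $ i = (h *\<^sub>v (g *\<^sub>v v)) $ i - c * (g *\<^sub>v v) $ i"
        using i gv hgv g h by simp
      also have "(h *\<^sub>v (g *\<^sub>v v)) $ i = (\<Sum>j<?m. h $$ (i, j) * (\<Sum>k<?m. g $$ (j, k) * v $ k))"
        unfolding mult_mat_vec_index[OF h gv i]
        by (rule sum.cong) (use mult_mat_vec_index[OF g v] in auto)
      finally show "apply_factor h (g *\<^sub>v v) c $ i = (\<Sum>j<?m. h $$ (i, j) * (\<Sum>k<?m. g $$ (j, k) * v $ k)) +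
          (- c) * (\<Sum>k<?m. g $$ (i, k) * v $ k)"
        using mult_mat_vec_index[OF g v i] by simp
    qed
    finally show ?thesis ..
  qed
  then have "{g \<in> carrier_mat ?m ?m. apply_factor h (g *\<^sub>v v) c \<in> sform_perp n W} =
      {g \<in> carrier_mat ?m ?m. \<forall>p\<in>f ` W. p g = 0}"
    using h v unfolding sform_perp_def by (auto intro!: minus_carrier_vec)
  ultimately show ?thesis unfolding closedin_zariski by (intro exI[of _ "f ` W"]) auto
qed

text \<open>The eigenvalue of \<open>h\<close> at \<open>g *\<^sub>v v\<close> ranges over a finite
  set, and each value is attained on a closed set of \<open>g\<close>. These sets are disjoint,
  because a vector with two eigenvalues would lie in the orthogonal space. Connectedness leaves the
  value at \<open>g = 1\<close>.\<close>

lemma connected_eigenvalue_const: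
  fixes h :: "'k::alg_closed_field mat"
  assumes K: "connectedin (zariski (2 * n)) K" "1\<^sub>m (2 * n) \<in> K"
    and h: "h \<in> carrier_mat (2 * n) (2 * n)" "\<And>w. w \<in> sform_perp n W \<Longrightarrow> h *\<^sub>v w \<in> sform_perp n W"
    and W: "W \<subseteq> carrier_vec (2 * n)" and v: "v \<in> carrier_vec (2 * n)"
    and notin: "\<And>g. g \<in> K \<Longrightarrow> g *\<^sub>v v \<notin> sform_perp n W"
    and ex: "\<And>g. g \<in> K \<Longrightarrow> \<exists>c. apply_factor h (g *\<^sub>v v) c \<in> sform_perp n W"
    and a: "apply_factor h v a \<in> sform_perp n W" and g: "g \<in> K"
  shows "apply_factor h (g *\<^sub>v v) a \<in> sform_perp n W"
proof -
  let ?m = "2 * n" and ?P = "sform_perp n W"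
  have P: "vec_subspace ?m ?P" using W by (rule vec_subspace_perp)
  have Km: "K \<subseteq> carrier_mat ?m ?m" using connectedin_subset_topspace[OF K(1)] by simp
  define E where "E = {c. \<exists>v\<in>carrier_vec ?m - ?P. apply_factor h v c \<in> ?P}"
  define Z where "Z c = {g \<in> carrier_mat ?m ?m. apply_factor h (g *\<^sub>v v) c \<in> ?P}" for c
  have gv: "g *\<^sub>v v \<in> carrier_vec ?m - ?P" if "g \<in> K" for g
    using that Km v notin by auto
  have v1: "1\<^sub>m ?m *\<^sub>v v = v" using v by simp
  have "K \<subseteq> Z a"
  proof (rule connectedin_finite_closed_cover[OF K(1), where E = E and Z = Z])
    show "finite E" unfolding E_def using finite_eigenvalues_mod[OF h(1) P] h(2) by blast
    show "a \<in> E" unfolding E_def using gv[OF K(2)] a v1 by auto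
    show "closedin (zariski ?m) (Z c)" for c
      unfolding Z_def using closedin_apply_factor_perp[OF h(1) v W] .
    show "K \<subseteq> (\<Union>c\<in>E. Z c)"
    proof
      fix g assume g: "g \<in> K"
      obtain c where c: "apply_factor h (g *\<^sub>v v) c \<in> ?P" using ex[OF g] by (elim exE)
      have "c \<in> E" unfolding E_def by (intro CollectI bexI[of _ "g *\<^sub>v v"] c gv g)
      moreover have "g \<in> Z c" unfolding Z_def using c g Km by (intro CollectI conjI) auto
      ultimately show "g \<in> (\<Union>c\<in>E. Z c)" by blast
    qed
    show "Z c \<inter> Z d \<inter> K = {}" if "c \<noteq> d" for c d
    proof -
      have False if g: "g \<in> K" "apply_factor h (g *\<^sub>v v) c \<in> ?P" "apply_factor h (g *\<^sub>v v) d \<in> ?P" for g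
      proof -
        let ?x = "g *\<^sub>v v"
        have carr: "?x \<in> carrier_vec ?m" "h *\<^sub>v ?x \<in> carrier_vec ?m" using gv[OF g(1)] h by auto
        have "inverse (d - c) \<cdot>\<^sub>v (apply_factor h ?x c - apply_factor h ?x d) \<in> ?P"
          using vec_subspaceD(4)[OF P] vec_subspace_diff[OF P] g by blast
        moreover have "apply_factor h ?x c - apply_factor h ?x d = (d - c) \<cdot>\<^sub>v ?x"
          using carr by (intro eq_vecI) (simp_all add: left_diff_distrib)
        ultimately have "?x \<in> ?P" using \<open>c \<noteq> d\<close> by (simp add: smult_smult_assoc)
        then show False using notin g by blast
      qed
      then show ?thesis unfolding Z_def by blast
    qed
    show "Z a \<inter> K \<noteq> {}" using K(2) a v1 Km unfolding Z_def by auto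
  qed
  then show ?thesis using g unfolding Z_def by blast
qed

text \<open>
  The Lie--Kolchin theorem, in the quotient of a coisotropic invariant subspace by its radical.
  By downward induction, the terms of the derived series act by scalars on a minimal invariant
  subspace: an eigenvalue of a fixed element along a connected orbit is constant, since it takes
  only finitely many values.
\<close>

lemma Lie_Kolchin_Sp:
  fixes H :: "'k::alg_closed_field mat set"
  assumes H: "subgroup H (Sp n)" and conn: "connectedin (zariski (2 * n)) H"
    and solv: "solvable (Sp n\<lparr>carrier := H\<rparr>)"
    and W1: "vec_subspace (2 * n) W1" "\<And>h v. h \<in> H \<Longrightarrow> v \<in> W1 \<Longrightarrow> h *\<^sub>v v \<in> W1"
    and perp: "sform_perp n W1 \<subseteq> W1" "sform_perp n W1 \<noteq> W1"
  shows "\<exists>w\<in>W1 - sform_perp n W1. \<forall>h\<in>H. \<exists>c. apply_factor h w c \<in> sform_perp n W1"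
proof -
  let ?G = "Sp n :: 'k mat monoid" and ?m = "2 * n"
  let ?K = "?G\<lparr>carrier := H\<rparr>"
  define W0 where "W0 = sform_perp n W1"
  interpret G: group ?G by (rule group_Sp)
  interpret K: group ?K using G.subgroup_imp_group[OF H] .
  have HG: "H \<subseteq> carrier ?G" using H by (rule subgroup.subset)
  have Hm: "h \<in> carrier_mat ?m ?m" if "h \<in> H" for h using that HG Sp_carrier by blast
  have W1m: "W1 \<subseteq> carrier_vec ?m" using vec_subspaceD(1)[OF W1(1)] by blast
  have W0: "vec_subspace ?m W0" unfolding W0_def using vec_subspace_perp[OF W1m] .
  have Hinv: "inv\<^bsub>?G\<^esub> h \<in> H" if "h \<in> H" for h using subgroup.m_inv_closed[OF H that] .
  have Hmult: "g * h \<in> H" if "g \<in> H" "h \<in> H" for g h using subgroup.m_closed[OF H that] by simp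
  have W0H: "h *\<^sub>v v \<in> W0" if h: "h \<in> H" and v: "v \<in> W0" for h v
    unfolding W0_def sform_perp_def
  proof (intro CollectI conjI ballI)
    have hG: "h \<in> carrier ?G" using h HG by blast
    have vc: "v \<in> carrier_vec ?m" using vec_subspaceD(1)[OF W0 v] .
    show "h *\<^sub>v v \<in> carrier_vec ?m" using Hm[OF h] vc by auto
    fix z assume z: "z \<in> W1"
    have "sform n (h *\<^sub>v v) z = sform n v (inv\<^bsub>?G\<^esub> h *\<^sub>v z)"
      using Sp_sform_inv[OF hG vc] z W1m by blast
    then show "sform n (h *\<^sub>v v) z = 0"
      using v W1(2)[OF Hinv[OF h] z] unfolding W0_def sform_perp_def by simp
  qed
  have W0H': "v \<in> W0" if h: "h \<in> H" and v: "v \<in> carrier_vec ?m" "h *\<^sub>v v \<in> W0" for h v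
    using W0H[OF Hinv[OF h] v(2)] Sp_inv_mult_vec(1)[of h n v] h v(1) HG by auto
  define D where "D k = (derived ?G ^^ k) H" for k
  have DSuc: "D (Suc k) = derived ?G (D k)" and D0: "D 0 = H" for k by (simp_all add: D_def)
  have Dsub: "subgroup (D k) ?G" for k unfolding D_def using G.exp_of_derived_is_subgroup[OF H] .
  have DH: "D k \<subseteq> H" for k
    by (induction k) (auto simp: DSuc D0 dest: subsetD[OF G.derived_incl[OF _ H]])
  have DK: "D k \<lhd> ?K" for k
  proof (induction k)
    case 0
    show ?case using K.normal_self by (simp add: D0)
  next
    case (Suc k)
    have "derived ?K (D k) \<lhd> ?K" using K.derived_is_normal[OF Suc] .
    then show ?case using G.derived_consistent[OF DH H] by (simp add: DSuc)
  qed
  have Dconn: "connectedin (zariski ?m) (D k)" for k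
    by (induction k) (use conn Dsub connectedin_derived_Sp in \<open>auto simp: DSuc D0\<close>)
  obtain N where N: "D N = {1\<^sub>m ?m}"
  proof -
    obtain N where "(derived ?K ^^ N) H = {1\<^sub>m ?m}"
      using solv K.solvable_iff_trivial_derived_seq by auto
    moreover have "(derived ?K ^^ k) H = D k" for k
      by (induction k) (use G.derived_consistent[OF DH H] in \<open>auto simp: DSuc D0\<close>)
    ultimately show ?thesis using that by simp
  qed
  have one: "1\<^sub>m ?m \<in> D k" for k using subgroup.one_closed[OF Dsub] by simp
  have Dinv: "inv\<^bsub>?G\<^esub> h \<in> D k" if "h \<in> D k" for h k using subgroup.m_inv_closed[OF Dsub that] .
  have Dmult: "g * h \<in> D k" if "g \<in> D k" "h \<in> D k" for g h k using subgroup.m_closed[OF Dsub that] by simp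
  have Dcomm: "h * g * inv\<^bsub>?G\<^esub> h * inv\<^bsub>?G\<^esub> g \<in> D (Suc k)" if "h \<in> D k" "g \<in> D k" for h g k
    unfolding DSuc derived_def using that by (intro generate.incl) auto
  have Dconj: "inv\<^bsub>?G\<^esub> g * h * g \<in> D k" if g: "g \<in> H" and h: "h \<in> D k" for g h k
    using normal.inv_op_closed1[OF DK, of g h k] g h G.m_inv_consistent[OF H g] by simp
  define stab where "stab X W \<longleftrightarrow> (\<forall>g\<in>X. \<forall>v\<in>W. g *\<^sub>v v \<in> W)" for X :: "'k mat set" and W
  \<comment> \<open>Minimality above \<open>W0\<close> stands for irreducibility of \<open>W\<close>
    modulo \<open>W0\<close>; the aim is that all of \<open>H\<close> acts on this subspace by
    scalars modulo \<open>W0\<close>.\<close>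
  obtain W where W: "vec_subspace ?m W" "W0 \<subseteq> W" "W0 \<noteq> W" "W \<subseteq> W1" "stab H W"
    and min: "\<And>W'. vec_subspace ?m W' \<Longrightarrow> W0 \<subseteq> W' \<Longrightarrow> W0 \<noteq> W' \<Longrightarrow> stab H W' \<Longrightarrow> W' \<subseteq> W \<Longrightarrow> W' = W"
  proof -
    let ?P = "\<lambda>W. vec_subspace ?m W \<and> W0 \<subseteq> W \<and> W0 \<noteq> W \<and> W \<subseteq> W1 \<and> stab H W"
    have "?P W1" using W1 perp unfolding W0_def stab_def by blast
    then obtain W where "?P W" "\<And>W'. ?P W' \<Longrightarrow> W' \<subseteq> W \<Longrightarrow> W' = W"
      using vec_subspace_minimal[of ?P ?m W1] by blast
    then show ?thesis by (intro that[of W]) blast+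
  qed
  note Wc = vec_subspaceD(1)[OF W(1)]
  have const: "apply_factor h (g *\<^sub>v v) a \<in> W0"
    if "X = D k" "h \<in> H" "v \<in> W - W0" "\<And>g. g \<in> X \<Longrightarrow> \<exists>c. apply_factor h (g *\<^sub>v v) c \<in> W0"
      "apply_factor h v a \<in> W0" "g \<in> X" for X k h v a g
    unfolding W0_def
  proof (rule connected_eigenvalue_const)
    show "connectedin (zariski ?m) X" "1\<^sub>m ?m \<in> X" using that(1) Dconn one by auto
    show "h \<in> carrier_mat ?m ?m" "v \<in> carrier_vec ?m" using Hm[OF that(2)] Wc that(3) by auto
    show "g' *\<^sub>v v \<notin> sform_perp n W1" if "g' \<in> X" for g'
      using W0H'[of g' v] \<open>v \<in> W - W0\<close> Wc DH that \<open>X = D k\<close> unfolding W0_def by blast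
  qed (use that W0H W1m in \<open>auto simp: W0_def\<close>)
  have scalars: "\<forall>h\<in>D k. \<exists>c. \<forall>w\<in>W. apply_factor h w c \<in> W0" if "k \<le> N" for k
    using that
  proof (induction k rule: inc_induct)
    case base
    have "apply_factor (1\<^sub>m ?m) w 1 = 0\<^sub>v ?m" if "w \<in> W" for w
      using Wc[OF that] by simp
    then have "\<forall>w\<in>W. apply_factor (1\<^sub>m ?m) w 1 \<in> W0" using vec_subspaceD(2)[OF W0] by metis
    then show ?case unfolding N by blast
  next
    case (step k)
    \<comment> \<open>A second minimal subspace, now for \<open>D k\<close> alone. An eigenspace in
      \<open>W'\<close> of a single element of \<open>D k\<close> will turn out to be stable under
      \<open>D k\<close>, hence to be all of \<open>W'\<close>.\<close>
    obtain W' where W': "vec_subspace ?m W'" "W0 \<subseteq> W'" "W0 \<noteq> W'" "W' \<subseteq> W" "stab (D k) W'"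
      and min': "\<And>E. vec_subspace ?m E \<Longrightarrow> W0 \<subseteq> E \<Longrightarrow> W0 \<noteq> E \<Longrightarrow> stab (D k) E \<Longrightarrow> E \<subseteq> W' \<Longrightarrow> E = W'"
    proof -
      let ?P = "\<lambda>E. vec_subspace ?m E \<and> W0 \<subseteq> E \<and> W0 \<noteq> E \<and> E \<subseteq> W \<and> stab (D k) E"
      have "?P W" using W DH unfolding stab_def by blast
      then obtain W' where "?P W'" "\<And>E. ?P E \<Longrightarrow> E \<subseteq> W' \<Longrightarrow> E = W'"
        using vec_subspace_minimal[of ?P ?m W] by blast
      then show ?thesis by (intro that[of W']) blast+
    qed
    have eig: "\<exists>a. \<forall>v\<in>W'. apply_factor h v a \<in> W0" if h: "h \<in> D k" for h
    proof -
      have hH: "h \<in> H" using DH h by blast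
      have hG: "h \<in> carrier ?G" using hH HG by blast
      obtain w where w: "w \<in> W'" "w \<notin> W0" using W'(2,3) by blast
      obtain u a where u: "u \<in> W'" "u \<notin> W0" "apply_factor h u a \<in> W0"
        using exists_eigenvector_mod[OF Hm[OF hH] W'(1) _ W0 w] W'(5) h unfolding stab_def by blast
      define E where "E = {v \<in> W'. apply_factor h v a \<in> W0}"
      have "vec_subspace ?m E"
        using vec_subspace_eigenvectors[of "{h}" ?m W' W0 "\<lambda>_. a"] Hm[OF hH] W'(1) W0 unfolding E_def by simp
      moreover have "W0 \<subseteq> E"
        unfolding E_def using W'(2) vec_subspace_diff[OF W0 W0H[OF hH] vec_subspaceD(4)[OF W0]] by blast
      moreover have "W0 \<noteq> E" using u unfolding E_def by blast
      moreover have "stab (D k) E"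
        unfolding stab_def
      proof (intro ballI)
        fix g v assume g: "g \<in> D k" and v: "v \<in> E"
        have gv: "g' *\<^sub>v v \<in> W'" if "g' \<in> D k" for g'
          using W'(5) that v unfolding stab_def E_def by blast
        show "g *\<^sub>v v \<in> E"
        proof (cases "v \<in> W0")
          case True
          then show ?thesis using W0H[of g v] DH g \<open>W0 \<subseteq> E\<close> by blast
        next
          case False
          have "apply_factor h (g *\<^sub>v v) a \<in> W0"
          proof (rule const)
            show "v \<in> W - W0" using False v W'(4) unfolding E_def by blast
            show "apply_factor h v a \<in> W0" using v unfolding E_def by blast
            fix g assume g: "g \<in> D k"
            have gH: "g \<in> H" and gG: "g \<in> carrier ?G" using g DH HG by blast+
            have vc: "v \<in> carrier_vec ?m" using v vec_subspaceD(1)[OF W'(1)] unfolding E_def by blast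
            \<comment> \<open>By induction the commutator acts on \<open>W\<close> by a scalar
              \<open>x\<close> modulo \<open>W0\<close>. Since \<open>h * g = c0 * (g * h)\<close>,
              the vector \<open>g *\<^sub>v v\<close> is again an eigenvector of \<open>h\<close>,
              with eigenvalue \<open>x * a\<close>; the fact \<open>const\<close> then identifies it
              with \<open>a\<close>.\<close>
            define c0 where "c0 = h * g * inv\<^bsub>?G\<^esub> h * inv\<^bsub>?G\<^esub> g"
            have c0: "c0 \<in> D (Suc k)" unfolding c0_def using Dcomm[OF h g] .
            then have c0m: "c0 \<in> carrier_mat ?m ?m" using DH Hm by blast
            obtain x where x: "\<And>w. w \<in> W \<Longrightarrow> apply_factor c0 w x \<in> W0" using step.IH c0 by blast
            let ?w = "g *\<^sub>v (h *\<^sub>v v)"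
            have wW: "?w \<in> W" using W(5) gH hH v W'(4) unfolding stab_def E_def by blast
            have wc: "?w \<in> carrier_vec ?m" using wW Wc by blast
            have hv: "h *\<^sub>v v \<in> carrier_vec ?m" "g *\<^sub>v v \<in> carrier_vec ?m"
              using vc Hm[OF hH] Hm[OF gH] by auto
            have "c0 * (g * h) = h * g"
            proof -
              have "inv\<^bsub>?G\<^esub> g \<otimes>\<^bsub>?G\<^esub> (g \<otimes>\<^bsub>?G\<^esub> h) = h"
                using hG gG by (simp add: G.m_assoc[symmetric] del: Sp_mult Sp_one)
              then have "h \<otimes>\<^bsub>?G\<^esub> g \<otimes>\<^bsub>?G\<^esub> inv\<^bsub>?G\<^esub> h \<otimes>\<^bsub>?G\<^esub> inv\<^bsub>?G\<^esub> g \<otimes>\<^bsub>?G\<^esub> (g \<otimes>\<^bsub>?G\<^esub> h) = h \<otimes>\<^bsub>?G\<^esub> g"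
                using hG gG by (simp add: G.m_assoc del: Sp_mult Sp_one)
              then show ?thesis unfolding c0_def by simp
            qed
            then have hg: "h *\<^sub>v (g *\<^sub>v v) = c0 *\<^sub>v ?w"
              using assoc_mult_mat_vec[OF Hm[OF hH] Hm[OF gH] vc]
                assoc_mult_mat_vec[OF c0m mult_carrier_mat[OF Hm[OF gH] Hm[OF hH]] vc]
                assoc_mult_mat_vec[OF Hm[OF gH] Hm[OF hH] vc] by simp
            have "g *\<^sub>v apply_factor h v a \<in> W0" using W0H[OF gH] v unfolding E_def by blast
            moreover have "g *\<^sub>v apply_factor h v a = ?w - a \<cdot>\<^sub>v (g *\<^sub>v v)"
              using mult_minus_distrib_mat_vec[OF Hm[OF gH] hv(1)] mult_mat_vec[OF Hm[OF gH] vc] vc by simp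
            ultimately have "apply_factor c0 ?w x + x \<cdot>\<^sub>v (?w - a \<cdot>\<^sub>v (g *\<^sub>v v)) \<in> W0"
              using vec_subspaceD(3,4)[OF W0] x[OF wW] by metis
            moreover have "apply_factor c0 ?w x + x \<cdot>\<^sub>v (?w - a \<cdot>\<^sub>v (g *\<^sub>v v)) =
                apply_factor h (g *\<^sub>v v) (x * a)"
            proof -
              have "(p - x \<cdot>\<^sub>v q) + x \<cdot>\<^sub>v (q - a \<cdot>\<^sub>v r) = p - (x * a) \<cdot>\<^sub>v r"
                if "p \<in> carrier_vec ?m" "q \<in> carrier_vec ?m" "r \<in> carrier_vec ?m" for p q r :: "'k vec"
                using that by (intro eq_vecI) (simp_all add: algebra_simps)
              then show ?thesis unfolding hg using wc hv(2) mult_mat_vec_carrier[OF c0m wc] by blast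
            qed
            ultimately show "\<exists>c. apply_factor h (g *\<^sub>v v) c \<in> W0" by metis
          qed (use hH g in auto)
          then show ?thesis using gv[OF g] unfolding E_def by blast
        qed
      qed
      moreover have "E \<subseteq> W'" unfolding E_def by blast
      ultimately have "E = W'" by (rule min')
      then show ?thesis unfolding E_def by blast
    qed
    obtain w where w: "w \<in> W'" "w \<notin> W0" using W'(2,3) by blast
    have "\<forall>h\<in>D k. \<exists>c. apply_factor h w c \<in> W0" using eig w(1) by blast
    from bchoice[OF this] obtain x where x: "\<And>h. h \<in> D k \<Longrightarrow> apply_factor h w (x h) \<in> W0" by blast
    \<comment> \<open>The joint eigenspace in \<open>W\<close> for the weight \<open>x\<close>. As
      \<open>D k\<close> is normal, elements of \<open>H\<close> can only permute such eigenspaces,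
      and connectedness of \<open>H\<close> prevents any movement.\<close>
    define E where "E = {v \<in> W. \<forall>h\<in>D k. apply_factor h v (x h) \<in> W0}"
    have hm: "h \<in> carrier_mat ?m ?m" if "h \<in> D k" for h using that DH Hm by blast
    have "vec_subspace ?m E"
      unfolding E_def using hm by (intro vec_subspace_eigenvectors W(1) W0) blast
    moreover have "W0 \<subseteq> E"
    proof
      fix v assume v: "v \<in> W0"
      have "apply_factor h v (x h) \<in> W0" if "h \<in> D k" for h
        using vec_subspace_diff[OF W0 W0H vec_subspaceD(4)[OF W0 v]] that DH v by blast
      then show "v \<in> E" unfolding E_def using v W(2) by blast
    qed
    moreover have "W0 \<noteq> E" using w x W'(4) unfolding E_def by blast
    moreover have "stab H E"
      unfolding stab_def
    proof (intro ballI)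
      fix g v assume g: "g \<in> H" and v: "v \<in> E"
      have vc: "v \<in> carrier_vec ?m" using v Wc unfolding E_def by blast
      show "g *\<^sub>v v \<in> E"
      proof (cases "v \<in> W0")
        case True
        then show ?thesis using W0H[OF g] \<open>W0 \<subseteq> E\<close> by blast
      next
        case False
        have "apply_factor h (g *\<^sub>v v) (x h) \<in> W0" if h: "h \<in> D k" for h
        proof (rule const[where X = H and k = 0])
          show "v \<in> W - W0" using False v unfolding E_def by blast
          show "apply_factor h v (x h) \<in> W0" using v h unfolding E_def by blast
          show "h \<in> H" using h DH by blast
          fix g assume g: "g \<in> H"
          have gG: "g \<in> carrier ?G" using g HG by blast
          define h' where "h' = inv\<^bsub>?G\<^esub> g * h * g"
          have h': "h' \<in> D k" unfolding h'_def using Dconj[OF g h] .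
          have "h \<in> carrier ?G" using h DH HG by blast
          then have "g \<otimes>\<^bsub>?G\<^esub> (inv\<^bsub>?G\<^esub> g \<otimes>\<^bsub>?G\<^esub> h \<otimes>\<^bsub>?G\<^esub> g) = h \<otimes>\<^bsub>?G\<^esub> g"
            using gG by (simp add: G.m_assoc[symmetric] del: Sp_mult Sp_one)
          then have "g * h' = h * g" unfolding h'_def by simp
          then have "h *\<^sub>v (g *\<^sub>v v) = g *\<^sub>v (h' *\<^sub>v v)"
            using assoc_mult_mat_vec[OF hm[OF h] Hm[OF g] vc] assoc_mult_mat_vec[OF Hm[OF g] hm[OF h'] vc] by simp
          then have "apply_factor h (g *\<^sub>v v) (x h') = g *\<^sub>v apply_factor h' v (x h')"
            using mult_minus_distrib_mat_vec[OF Hm[OF g] mult_mat_vec_carrier[OF hm[OF h'] vc]]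
              mult_mat_vec[OF Hm[OF g] vc] vc by simp
          moreover have "g *\<^sub>v apply_factor h' v (x h') \<in> W0"
            using W0H[OF g] v h' unfolding E_def by blast
          ultimately show "\<exists>c. apply_factor h (g *\<^sub>v v) c \<in> W0" by metis
        qed (use g D0 in auto)
        then show ?thesis using v W(5) g unfolding E_def stab_def by blast
      qed
    qed
    moreover have "E \<subseteq> W" unfolding E_def by blast
    ultimately have "E = W" by (rule min)
    then show ?case unfolding E_def by blast
  qed
  obtain w where "w \<in> W" "w \<notin> W0" using W(2,3) by blast
  moreover have "\<forall>h\<in>H. \<exists>c. \<forall>w\<in>W. apply_factor h w c \<in> W0" using scalars[of 0] by (simp add: D0)
  ultimately show ?thesis using W(4) unfolding W0_def by blast
qed

section \<open>Transvections\<close>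

abbreviation ev :: "nat \<Rightarrow> nat \<Rightarrow> 'k::comm_ring_1 vec" where "ev n i \<equiv> unit_vec (2 * n) i"

text \<open>The map of rank at most one sending \<open>z\<close> to
  \<open>sform n b z \<cdot>\<^sub>v a\<close>, the common building block of transvections, Siegel
  transformations and \<open>pair_elt\<close>.\<close>

definition skew_mat :: "nat \<Rightarrow> 'k::comm_ring_1 vec \<Rightarrow> 'k vec \<Rightarrow> 'k mat" where
  "skew_mat n a b = mat (2 * n) (2 * n) (\<lambda>(i, j). a $ i * sform n b (ev n j))"

lemma skew_mat_carrier [simp]: "skew_mat n a b \<in> carrier_mat (2 * n) (2 * n)"
  by (simp add: skew_mat_def)

lemma skew_mat_mult_vec:
  assumes a: "a \<in> carrier_vec (2 * n)" and z: "z \<in> carrier_vec (2 * n)"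
  shows "skew_mat n a b *\<^sub>v z = sform n b z \<cdot>\<^sub>v a"
proof (rule eq_vecI)
  fix i assume "i < dim_vec (sform n b z \<cdot>\<^sub>v a)"
  then have i: "i < 2 * n" using a by simp
  have "(\<Sum>j<2 * n. sform n b (ev n j) * z $ j) = sform n b z"
    unfolding sum_double sform_def[of n b z] sum.distrib[symmetric]
    by (rule sum.cong) (auto simp: sform_unit_vec)
  then have "(\<Sum>j<2 * n. a $ i * (sform n b (ev n j) * z $ j)) = a $ i * sform n b z"
    by (simp flip: sum_distrib_left)
  then show "(skew_mat n a b *\<^sub>v z) $ i = (sform n b z \<cdot>\<^sub>v a) $ i"
    using a i mult_mat_vec_index[OF skew_mat_carrier z i]
    by (simp add: skew_mat_def mult.assoc mult.commute[of "sform n b z"])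
qed (use a in \<open>simp add: skew_mat_def\<close>)

definition transvection :: "nat \<Rightarrow> 'k::comm_ring_1 vec \<Rightarrow> 'k \<Rightarrow> 'k mat" where
  "transvection n u c = 1\<^sub>m (2 * n) + c \<cdot>\<^sub>m skew_mat n u u"

lemma transvection_mult_vec:
  assumes u: "u \<in> carrier_vec (2 * n)" and z: "z \<in> carrier_vec (2 * n)"
  shows "transvection n u c *\<^sub>v z = z + (c * sform n u z) \<cdot>\<^sub>v u"
proof -
  have "transvection n u c *\<^sub>v z = 1\<^sub>m (2 * n) *\<^sub>v z + (c \<cdot>\<^sub>m skew_mat n u u) *\<^sub>v z"
    unfolding transvection_def by (rule add_mult_distrib_mat_vec) (use z in auto)
  also have "(c \<cdot>\<^sub>m skew_mat n u u) *\<^sub>v z = c \<cdot>\<^sub>v (skew_mat n u u *\<^sub>v z)"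
    using z by (intro eq_vecI) (auto simp: skew_mat_def)
  finally show ?thesis using z by (simp add: skew_mat_mult_vec[OF u z] smult_smult_assoc)
qed

lemma transvection_carrier [simp]: "transvection n u c \<in> carrier_mat (2 * n) (2 * n)"
  by (simp add: transvection_def)

lemma transvection_Sp:
  fixes u :: "'k::field vec"
  assumes u: "u \<in> carrier_vec (2 * n)" shows "transvection n u c \<in> carrier (Sp n)"
  unfolding Sp_iff
proof (intro conjI ballI)
  fix x y :: "'k vec" assume x: "x \<in> carrier_vec (2 * n)" and y: "y \<in> carrier_vec (2 * n)"
  show "sform n (transvection n u c *\<^sub>v x) (transvection n u c *\<^sub>v y) = sform n x y"
    using u x y sform_swap[of n u x]
    by (simp add: transvection_mult_vec sform_add_left sform_add_right sform_smult_left sform_smult_right algebra_simps)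
qed simp

section \<open>Transitivity and generation by transvections\<close>

text \<open>For \<open>r \<le> n\<close> the orthogonal complement of the first \<open>r\<close>
  hyperbolic pairs. Transvections along its vectors fix these pairs, which permits induction on
  \<open>r\<close>.\<close>

definition tail_space :: "nat \<Rightarrow> nat \<Rightarrow> 'k::field vec set" where
  "tail_space n r = {v \<in> carrier_vec (2 * n). \<forall>i<r. v $ i = 0 \<and> v $ (n + i) = 0}"

lemma tail_space_carrier: "v \<in> tail_space n r \<Longrightarrow> v \<in> carrier_vec (2 * n)"
  by (simp add: tail_space_def)

lemma tail_space_0 [simp]: "tail_space n 0 = carrier_vec (2 * n)"
  by (simp add: tail_space_def)

lemma tail_space_mono: "r \<le> r' \<Longrightarrow> tail_space n r' \<subseteq> tail_space n r"
  by (auto simp: tail_space_def)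

lemma vec_subspace_tail_space: "r \<le> n \<Longrightarrow> vec_subspace (2 * n) (tail_space n r)"
  unfolding vec_subspace_def tail_space_def by auto

lemma unit_vec_tail_space:
  "r \<le> i \<Longrightarrow> i < n \<Longrightarrow> ev n i \<in> tail_space n r" "r \<le> i \<Longrightarrow> i < n \<Longrightarrow> ev n (n + i) \<in> tail_space n r"
  unfolding tail_space_def by auto

lemma tail_space_iff_sform:
  assumes "r \<le> n" "v \<in> carrier_vec (2 * n)"
  shows "v \<in> tail_space n r \<longleftrightarrow> (\<forall>i<r. sform n v (ev n i) = 0 \<and> sform n v (ev n (n + i)) = 0)"
  using assms unfolding tail_space_def by (auto simp: sform_unit_vec)

lemma tail_spaceD:
  assumes "v \<in> tail_space n r" "i < r" "r \<le> n"
  shows "sform n v (ev n i) = 0" "sform n v (ev n (n + i)) = 0"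
  using assms tail_space_iff_sform[of r n v] tail_space_carrier[OF assms(1)] by auto

lemma add_zero_smult_vec: "v \<in> carrier_vec m \<Longrightarrow> u \<in> carrier_vec m \<Longrightarrow> v + 0 \<cdot>\<^sub>v u = (v :: 'k::field vec)"
  by (intro eq_vecI) auto

inductive_set transvection_group :: "nat \<Rightarrow> nat \<Rightarrow> 'k::field mat set" for n r where
  one: "1\<^sub>m (2 * n) \<in> transvection_group n r"
| step: "g \<in> transvection_group n r \<Longrightarrow> u \<in> tail_space n r \<Longrightarrow> transvection n u c * g \<in> transvection_group n r"

lemma transvection_group_Sp: "g \<in> transvection_group n r \<Longrightarrow> g \<in> carrier (Sp n)"
  by (induction rule: transvection_group.induct)
     (auto intro: Sp_one_closed Sp_closed transvection_Sp tail_space_carrier)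

lemma transvection_group_mult:
  "g \<in> transvection_group n r \<Longrightarrow> h \<in> transvection_group n r \<Longrightarrow> g * h \<in> transvection_group n r"
proof (induction rule: transvection_group.induct)
  case one
  then show ?case using Sp_carrier[OF transvection_group_Sp] by fastforce
next
  case (step g u c)
  have "transvection n u c * g * h = transvection n u c * (g * h)"
    using Sp_carrier[OF transvection_group_Sp] step
    by (intro assoc_mult_mat[of _ "2 * n" "2 * n" _ "2 * n" _ "2 * n"]) auto
  then show ?case using step transvection_group.step by metis
qed

lemma transvection_in_group: "u \<in> tail_space n r \<Longrightarrow> transvection n u c \<in> transvection_group n r"
  using transvection_group.step[OF transvection_group.one, of u n r c]
    right_mult_one_mat[OF transvection_carrier, of n u c] by simp

lemma transvection_group_mono:
  assumes "r \<le> r'" shows "transvection_group n r' \<subseteq> transvection_group n r"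
proof
  fix g :: "'a mat" assume "g \<in> transvection_group n r'"
  then show "g \<in> transvection_group n r"
    by induction (use tail_space_mono[OF assms, of n] in \<open>auto intro: transvection_group.intros\<close>)
qed

lemma transvection_group_fixes:
  assumes "g \<in> transvection_group n r" "v \<in> carrier_vec (2 * n)" "\<And>u. u \<in> tail_space n r \<Longrightarrow> sform n u v = 0"
  shows "g *\<^sub>v v = v"
  using assms(1)
proof induction
  case (step g u c)
  have "(transvection n u c * g) *\<^sub>v v = transvection n u c *\<^sub>v v"
    using assoc_mult_mat_vec[OF transvection_carrier Sp_carrier[OF transvection_group_Sp[OF step.hyps(1)]] assms(2)]
      step.IH by simp
  then show ?case
    using transvection_mult_vec[OF tail_space_carrier[OF step.hyps(2)] assms(2), of c] assms(3)[OF step.hyps(2)]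
      add_zero_smult_vec[OF assms(2) tail_space_carrier[OF step.hyps(2)]]
    by simp
qed (use assms(2) in simp)

lemma transvection_group_fixes_unit_vec:
  assumes "g \<in> transvection_group n r" "i < r" "r \<le> n"
  shows "g *\<^sub>v ev n i = ev n i" "g *\<^sub>v ev n (n + i) = ev n (n + i)"
  using assms by (auto intro!: transvection_group_fixes tail_spaceD)

text \<open>A transvection along \<open>a - b\<close> displaces \<open>a\<close> by a multiple of
  \<open>a - b\<close>; as \<open>sform n (a - b) a = sform n a b\<close> is non-zero, the multiple
  can be made -1.\<close>

lemma transvection_moves:
  assumes a: "a \<in> tail_space n r" and b: "b \<in> tail_space n r" and r: "r \<le> n" and ab: "sform n a b \<noteq> 0"
  obtains c where "transvection n (a - b) c \<in> transvection_group n r" "transvection n (a - b) c *\<^sub>v a = b"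
proof
  let ?c = "- inverse (sform n a b)"
  have ac: "a \<in> carrier_vec (2 * n)" and bc: "b \<in> carrier_vec (2 * n)" using a b by (auto intro: tail_space_carrier)
  show "transvection n (a - b) ?c \<in> transvection_group n r"
    by (intro transvection_in_group vec_subspace_diff[OF vec_subspace_tail_space[OF r]] a b)
  have "?c * sform n (a - b) a = - 1"
    using ab sform_swap[of n b a] ac bc by (simp add: sform_diff_left)
  then have "transvection n (a - b) ?c *\<^sub>v a = a + (- 1) \<cdot>\<^sub>v (a - b)"
    using ac bc by (subst transvection_mult_vec) auto
  also have "\<dots> = b" using ac bc by (intro eq_vecI) auto
  finally show "transvection n (a - b) ?c *\<^sub>v a = b" .
qed

lemma sform_nonzero_tail_space:
  assumes a: "a \<in> tail_space n r" "a \<noteq> 0\<^sub>v (2 * n)" and r: "r \<le> n"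
  obtains z where "z \<in> tail_space n r" "sform n a z \<noteq> 0"
proof -
  obtain j where j: "j < 2 * n" "sform n a (ev n j) \<noteq> 0"
    using sform_nondegenerate[of a n] a tail_space_carrier by blast
  have "ev n j \<in> tail_space n r"
  proof (cases "j < n")
    case True
    then have "\<not> j < r" using j tail_spaceD[OF a(1) _ r] by auto
    then show ?thesis using True by (intro unit_vec_tail_space) auto
  next
    case False
    then obtain i where i: "j = n + i" "i < n" using j(1) by (metis add_less_cancel_left le_Suc_ex mult_2 not_less)
    then have "\<not> i < r" using j tail_spaceD[OF a(1) _ r] by auto
    then show ?thesis using i unit_vec_tail_space(2)[of r i n] by simp
  qed
  then show ?thesis using that j by blast
qed

text \<open>Orthogonal \<open>a\<close> and \<open>b\<close> are joined through some
  \<open>z\<close> orthogonal to neither; one of \<open>z1\<close>, \<open>z2\<close>,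
  \<open>z1 + z2\<close> has this property.\<close>

lemma transvection_group_transitive:
  assumes a: "a \<in> tail_space n r" "a \<noteq> 0\<^sub>v (2 * n)" and b: "b \<in> tail_space n r" "b \<noteq> 0\<^sub>v (2 * n)" and r: "r \<le> n"
  obtains g where "g \<in> transvection_group n r" "g *\<^sub>v a = b"
proof (cases "sform n a b = 0")
  case False
  then show ?thesis using transvection_moves[OF a(1) b(1) r] that by blast
next
  case True
  obtain z1 where z1: "z1 \<in> tail_space n r" "sform n a z1 \<noteq> 0" using sform_nonzero_tail_space[OF a r] .
  obtain z2 where z2: "z2 \<in> tail_space n r" "sform n b z2 \<noteq> 0" using sform_nonzero_tail_space[OF b r] .
  have "z1 + z2 \<in> tail_space n r" using vec_subspaceD(3)[OF vec_subspace_tail_space[OF r]] z1 z2 by blast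
  moreover have "sform n x (z1 + z2) = sform n x z1 + sform n x z2" if "x \<in> tail_space n r" for x
    using that z1 z2 by (simp add: sform_add_right tail_space_carrier)
  ultimately obtain z where z: "z \<in> tail_space n r" "sform n a z \<noteq> 0" "sform n b z \<noteq> 0"
    using z1 z2 a(1) b(1) by (metis add.left_neutral add.right_neutral)
  obtain c where c: "transvection n (a - z) c \<in> transvection_group n r" "transvection n (a - z) c *\<^sub>v a = z"
    using transvection_moves[OF a(1) z(1) r z(2)] .
  have "sform n z b \<noteq> 0" using z(3) sform_swap[of n z b] by simp
  then obtain d where d: "transvection n (z - b) d \<in> transvection_group n r" "transvection n (z - b) d *\<^sub>v z = b"
    using transvection_moves[OF z(1) b(1) r] by blast
  show ?thesis
  proof (rule that)
    show "transvection n (z - b) d * transvection n (a - z) c \<in> transvection_group n r"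
      using transvection_group_mult[OF d(1) c(1)] .
    show "(transvection n (z - b) d * transvection n (a - z) c) *\<^sub>v a = b"
      using assoc_mult_mat_vec[OF transvection_carrier transvection_carrier tail_space_carrier[OF a(1)]] c d by simp
  qed
qed

text \<open>As \<open>e\<close> pairs equally with \<open>x\<close> and \<open>b\<close>, the
  transvection along \<open>x - b\<close> fixes \<open>e\<close>. If \<open>a\<close> and
  \<open>b\<close> are orthogonal, the transvection along \<open>e\<close> first replaces
  \<open>a\<close> by \<open>a + e\<close>, which pairs with \<open>b\<close> to 1.\<close>

lemma transvection_group_transitive_stabilizer:
  assumes e: "e \<in> tail_space n r" and a: "a \<in> tail_space n r" "sform n e a = 1"
    and b: "b \<in> tail_space n r" "sform n e b = 1" and r: "r \<le> n"
  obtains g where "g \<in> transvection_group n r" "g *\<^sub>v e = e" "g *\<^sub>v a = b"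
proof -
  note carr = tail_space_carrier[OF e] tail_space_carrier[OF a(1)] tail_space_carrier[OF b(1)]
  have main: "\<exists>g. g \<in> transvection_group n r \<and> g *\<^sub>v e = e \<and> g *\<^sub>v x = b"
    if x: "x \<in> tail_space n r" "sform n e x = 1" "sform n x b \<noteq> 0" for x
  proof -
    obtain c where c: "transvection n (x - b) c \<in> transvection_group n r" "transvection n (x - b) c *\<^sub>v x = b"
      using transvection_moves[OF x(1) b(1) r x(3)] .
    have "sform n e (x - b) = 0"
      using x b carr tail_space_carrier[OF x(1)] by (simp add: sform_diff_right)
    then have "sform n (x - b) e = 0" using sform_swap[of n "x - b" e] by simp
    then have "transvection n (x - b) c *\<^sub>v e = e"
      using carr tail_space_carrier[OF x(1)] by (subst transvection_mult_vec) (auto intro: add_zero_smult_vec)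
    then show ?thesis using c by blast
  qed
  show ?thesis
  proof (cases "sform n a b = 0")
    case False
    then show ?thesis using main[OF a] that by blast
  next
    case True
    have ae: "a + e \<in> tail_space n r" using vec_subspaceD(3)[OF vec_subspace_tail_space[OF r]] a e by blast
    have "sform n e (a + e) = 1" "sform n (a + e) b \<noteq> 0"
      using carr a b True by (simp_all add: sform_add_left sform_add_right)
    then obtain g where g: "g \<in> transvection_group n r" "g *\<^sub>v e = e" "g *\<^sub>v (a + e) = b"
      using main[OF ae] by blast
    have t: "transvection n e 1 \<in> transvection_group n r" using transvection_in_group[OF e] .
    have "transvection n e 1 *\<^sub>v e = e" "transvection n e 1 *\<^sub>v a = a + e"
      using carr a by (simp_all add: transvection_mult_vec add_zero_smult_vec)
    then have "(g * transvection n e 1) *\<^sub>v e = e" "(g * transvection n e 1) *\<^sub>v a = b"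
      using assoc_mult_mat_vec[OF Sp_carrier[OF transvection_group_Sp[OF g(1)]] transvection_carrier] carr g
      by simp_all
    then show ?thesis using that[OF transvection_group_mult[OF g(1) t]] by blast
  qed
qed

lemma transvection_group_hyperbolic_pair:
  assumes u: "u \<in> tail_space n r" and v: "v \<in> tail_space n r" and uv: "sform n u v = 1" and r: "r < n"
  obtains g where "g \<in> transvection_group n r" "g *\<^sub>v u = ev n r" "g *\<^sub>v v = ev n (n + r)"
proof -
  have e: "ev n r \<in> tail_space n r" "ev n (n + r) \<in> tail_space n r" using r by (auto intro: unit_vec_tail_space)
  have ee: "sform n (ev n r) (ev n (n + r)) = 1" using r by (simp add: sform_unit_vec)
  have "u \<noteq> 0\<^sub>v (2 * n)" using uv by auto
  moreover have "ev n r \<noteq> 0\<^sub>v (2 * n)" using r by simp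
  ultimately obtain g where g: "g \<in> transvection_group n r" "g *\<^sub>v u = ev n r"
    using transvection_group_transitive[OF u _ e(1)] r by (metis less_imp_le)
  note gS = transvection_group_Sp[OF g(1)]
  have vc: "v \<in> carrier_vec (2 * n)" and uc: "u \<in> carrier_vec (2 * n)" using u v by (auto intro: tail_space_carrier)
  have gv: "g *\<^sub>v v \<in> tail_space n r"
    unfolding tail_space_iff_sform[OF less_imp_le[OF r] Sp_mult_vec[OF gS vc]]
  proof (intro allI impI)
    fix i assume i: "i < r"
    have "sform n (g *\<^sub>v v) (g *\<^sub>v ev n j) = sform n v (ev n j)" for j using Sp_sform[OF gS vc] by simp
    then show "sform n (g *\<^sub>v v) (ev n i) = 0 \<and> sform n (g *\<^sub>v v) (ev n (n + i)) = 0"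
      using transvection_group_fixes_unit_vec[OF g(1) i less_imp_le[OF r]] tail_spaceD[OF v i less_imp_le[OF r]]
      by metis
  qed
  have "sform n (ev n r) (g *\<^sub>v v) = 1" using Sp_sform[OF gS uc vc] g(2) uv by simp
  then obtain h where h: "h \<in> transvection_group n r" "h *\<^sub>v ev n r = ev n r" "h *\<^sub>v (g *\<^sub>v v) = ev n (n + r)"
    using transvection_group_transitive_stabilizer[OF e(1) gv _ e(2) ee] r by (metis less_imp_le)
  have "(h * g) *\<^sub>v u = ev n r" "(h * g) *\<^sub>v v = ev n (n + r)"
    using assoc_mult_mat_vec[OF Sp_carrier[OF transvection_group_Sp[OF h(1)]] Sp_carrier[OF gS]] uc vc g h by simp_all
  then show ?thesis using that[OF transvection_group_mult[OF h(1) g(1)]] by blast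
qed

lemma mat_eq_oneI:
  fixes A :: "'k::comm_ring_1 mat"
  assumes A: "A \<in> carrier_mat m m" and "\<And>j. j < m \<Longrightarrow> A *\<^sub>v unit_vec m j = unit_vec m j"
  shows "A = 1\<^sub>m m"
proof (rule eq_matI)
  fix i j assume "i < dim_row (1\<^sub>m m :: 'k mat)" "j < dim_col (1\<^sub>m m :: 'k mat)"
  then have ij: "i < m" "j < m" by auto
  have "(A *\<^sub>v unit_vec m j) $ i = (\<Sum>q<m. A $$ (i, q) * unit_vec m j $ q)"
    using A ij by (intro mult_mat_vec_index) auto
  also have "\<dots> = (\<Sum>q<m. if q = j then A $$ (i, j) else 0)" using ij by (intro sum.cong) auto
  finally show "A $$ (i, j) = 1\<^sub>m m $$ (i, j)" using assms(2)[OF ij(2)] ij by auto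
qed (use A in auto)

text \<open>One hyperbolic pair is restored at a time. Once the first \<open>r\<close> pairs are
  fixed, the remaining element preserves their complement, and the correction is made by
  transvections along that complement, which leave the restored pairs alone.\<close>

lemma Sp_generated_by_transvections:
  fixes g :: "'k::field mat"
  assumes g: "g \<in> carrier (Sp n)"
  obtains h where "h \<in> transvection_group n 0" "h * g = 1\<^sub>m (2 * n)"
proof -
  have gm: "g \<in> carrier_mat (2 * n) (2 * n)" using Sp_carrier[OF g] .
  have "\<exists>h\<in>transvection_group n 0. \<forall>i<r. (h * g) *\<^sub>v ev n i = ev n i \<and> (h * g) *\<^sub>v ev n (n + i) = ev n (n + i)"
    if "r \<le> n" for r
    using that
  proof (induction r)
    case 0
    show ?case using transvection_group.one by blast
  next
    case (Suc r)
    then obtain h where h: "h \<in> transvection_group n 0"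
      and fx: "\<And>i. i < r \<Longrightarrow> (h * g) *\<^sub>v ev n i = ev n i" "\<And>i. i < r \<Longrightarrow> (h * g) *\<^sub>v ev n (n + i) = ev n (n + i)"
      by auto
    define x where "x = h * g"
    have x: "x \<in> carrier (Sp n)" unfolding x_def using Sp_closed[OF transvection_group_Sp[OF h] g] .
    have r: "r < n" using Suc.prems by simp
    have tail: "x *\<^sub>v v \<in> tail_space n r" if v: "v \<in> tail_space n r" for v
      unfolding tail_space_iff_sform[OF less_imp_le[OF r] Sp_mult_vec[OF x tail_space_carrier[OF v]]]
    proof (intro allI impI)
      fix i assume i: "i < r"
      have "sform n (x *\<^sub>v v) (x *\<^sub>v ev n j) = sform n v (ev n j)" for j
        using Sp_sform[OF x tail_space_carrier[OF v]] by simp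
      then show "sform n (x *\<^sub>v v) (ev n i) = 0 \<and> sform n (x *\<^sub>v v) (ev n (n + i)) = 0"
        using fx[OF i] tail_spaceD[OF v i less_imp_le[OF r]] unfolding x_def by metis
    qed
    have "sform n (x *\<^sub>v ev n r) (x *\<^sub>v ev n (n + r)) = 1"
      using Sp_sform[OF x, of "ev n r" "ev n (n + r)"] r by (simp add: sform_unit_vec)
    then obtain k where k: "k \<in> transvection_group n r" "k *\<^sub>v (x *\<^sub>v ev n r) = ev n r"
        "k *\<^sub>v (x *\<^sub>v ev n (n + r)) = ev n (n + r)"
      using transvection_group_hyperbolic_pair[OF tail tail _ r] unit_vec_tail_space[of r r n] r by (metis le_refl)
    have kh: "k * h \<in> transvection_group n 0"
      using transvection_group_mult transvection_group_mono[of 0 r n] k(1) h by blast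
    have "(k * h) * g = k * x"
      unfolding x_def using Sp_carrier transvection_group_Sp k(1) h gm
      by (intro assoc_mult_mat[of _ "2 * n" "2 * n" _ "2 * n" _ "2 * n"]) blast+
    then have kx: "((k * h) * g) *\<^sub>v v = k *\<^sub>v (x *\<^sub>v v)" if "v \<in> carrier_vec (2 * n)" for v
      using assoc_mult_mat_vec[OF Sp_carrier[OF transvection_group_Sp[OF k(1)]] Sp_carrier[OF x] that] by simp
    have "((k * h) * g) *\<^sub>v ev n i = ev n i \<and> ((k * h) * g) *\<^sub>v ev n (n + i) = ev n (n + i)" if "i < Suc r" for i
    proof (cases "i = r")
      case True
      then show ?thesis using k(2,3) kx by simp
    next
      case False
      then have i: "i < r" using that by simp
      then show ?thesis using kx fx[OF i] transvection_group_fixes_unit_vec[OF k(1) i less_imp_le[OF r]]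
        unfolding x_def by simp
    qed
    then show ?case using kh by blast
  qed
  then obtain h where h: "h \<in> transvection_group n 0"
    and fx: "\<And>i. i < n \<Longrightarrow> (h * g) *\<^sub>v ev n i = ev n i" "\<And>i. i < n \<Longrightarrow> (h * g) *\<^sub>v ev n (n + i) = ev n (n + i)" by blast
  have "(h * g) *\<^sub>v ev n j = ev n j" if "j < 2 * n" for j
    using fx(1)[of j] fx(2)[of "j - n"] that by (cases "j < n") auto
  then have "h * g = 1\<^sub>m (2 * n)"
    using gm Sp_carrier[OF transvection_group_Sp[OF h]] by (intro mat_eq_oneI) auto
  then show ?thesis using that h by blast
qed

section \<open>Polynomial curves in the symplectic group\<close>

lemma rational_curve_mult:
  assumes \<gamma>: "rational_curve m S \<gamma>" "\<And>t. t \<notin> S \<Longrightarrow> \<gamma> t \<in> carrier_mat m m"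
    and \<delta>: "rational_curve m S \<delta>" "\<And>t. t \<notin> S \<Longrightarrow> \<delta> t \<in> carrier_mat m m"
    and S: "S = {}"
  shows "rational_curve m S (\<lambda>t. \<gamma> t * \<delta> t)"
  unfolding rational_curve_def
proof (intro conjI allI impI)
  show "finite S" using \<gamma> by (simp add: rational_curve_def)
  fix i j assume ij: "i < m" "j < m"
  have "(\<lambda>t. \<Sum>k<m. \<gamma> t $$ (i, k) * \<delta> t $$ (k, j)) \<in> rational_fun S"
    using \<gamma>(1) \<delta>(1) ij unfolding rational_curve_def by (intro rational_fun_sum rational_fun_mult) auto
  moreover have "(\<gamma> t * \<delta> t) $$ (i, j) = (\<Sum>k<m. \<gamma> t $$ (i, k) * \<delta> t $$ (k, j))" for t
    using \<gamma>(2)[of t] \<delta>(2)[of t] ij S by (simp add: scalar_prod_def lessThan_atLeast0)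
  ultimately show "(\<lambda>t. (\<gamma> t * \<delta> t) $$ (i, j)) \<in> rational_fun S" by simp
qed

lemma rational_curve_poly_map:
  assumes \<gamma>: "rational_curve m {} \<gamma>" "\<And>t. \<gamma> t \<in> X" and \<phi>: "poly_map m X \<phi>"
  shows "rational_curve m {} (\<lambda>t. \<phi> (\<gamma> t))"
  unfolding rational_curve_def
proof (intro conjI allI impI)
  fix i j assume "i < m" "j < m"
  then obtain p where "p \<in> mat_polyfun m" "\<And>A. A \<in> X \<Longrightarrow> \<phi> A $$ (i, j) = p A"
    using \<phi> unfolding poly_map_def by blast
  then show "(\<lambda>t. \<phi> (\<gamma> t) $$ (i, j)) \<in> rational_fun {}"
    using rational_curve_polyfun[OF \<gamma>(1)] \<gamma>(2) by simp
qed simp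

text \<open>Scaling every parameter of a product of transvections by \<open>t\<close> joins the
  identity to that product. Generation is available as \<open>h * g = 1\<close>, so the curve for
  \<open>h\<close> is inverted at the end.\<close>

lemma Sp_rational_curve:
  fixes g :: "'k::field mat"
  assumes g: "g \<in> carrier (Sp n)"
  obtains \<gamma> where "rational_curve (2 * n) {} \<gamma>" "\<And>t. \<gamma> t \<in> carrier (Sp n)" "\<gamma> 0 = 1\<^sub>m (2 * n)" "\<gamma> 1 = g"
proof -
  let ?m = "2 * n"
  have *: "\<exists>\<gamma>. rational_curve ?m {} \<gamma> \<and> (\<forall>t. \<gamma> t \<in> carrier (Sp n)) \<and> \<gamma> 0 = 1\<^sub>m ?m \<and> \<gamma> 1 = h"
    if "h \<in> transvection_group n 0" for h :: "'k mat"
    using that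
  proof induction
    case one
    show ?case
      by (rule exI[of _ "\<lambda>t. 1\<^sub>m ?m"]) (auto simp: rational_curve_def Sp_one_closed intro: rational_fun_const)
  next
    case (step h u c)
    then obtain \<gamma> where \<gamma>: "rational_curve ?m {} \<gamma>" "\<And>t. \<gamma> t \<in> carrier (Sp n)" "\<gamma> 0 = 1\<^sub>m ?m" "\<gamma> 1 = h" by blast
    have uc: "u \<in> carrier_vec ?m" using step.hyps by simp
    have "rational_curve ?m {} (\<lambda>t. transvection n u (t * c))"
      unfolding rational_curve_def transvection_def
    proof (intro conjI allI impI)
      fix i j assume ij: "i < ?m" "j < ?m"
      have "(\<lambda>t. 1\<^sub>m ?m $$ (i, j) + t * (c * skew_mat n u u $$ (i, j))) \<in> rational_fun {}"
        by (intro rational_fun_add rational_fun_mult rational_fun_const rational_fun_id)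
      then show "(\<lambda>t. (1\<^sub>m ?m + (t * c) \<cdot>\<^sub>m skew_mat n u u) $$ (i, j)) \<in> rational_fun {}"
        using ij carrier_matD[OF skew_mat_carrier[of n u u]] by (simp add: mult.assoc)
    qed simp
    then have "rational_curve ?m {} (\<lambda>t. transvection n u (t * c) * \<gamma> t)"
      using \<gamma> Sp_carrier by (intro rational_curve_mult) auto
    moreover have "transvection n u (t * c) * \<gamma> t \<in> carrier (Sp n)" for t
      using Sp_closed[OF transvection_Sp[OF uc] \<gamma>(2)] .
    moreover have "transvection n u (0 * c) = 1\<^sub>m ?m"
      unfolding transvection_def by (intro eq_matI) (auto simp: carrier_matD[OF skew_mat_carrier[of n u u]])
    ultimately show ?case using \<gamma>(3,4)
      by (intro exI[of _ "\<lambda>t. transvection n u (t * c) * \<gamma> t"]) auto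
  qed
  obtain h where h: "h \<in> transvection_group n 0" "h * g = 1\<^sub>m ?m" using Sp_generated_by_transvections[OF g] .
  interpret G: group "Sp n :: 'k mat monoid" by (rule group_Sp)
  have hG: "h \<in> carrier (Sp n)" using transvection_group_Sp[OF h(1)] .
  have "inv\<^bsub>Sp n\<^esub> h = g" using G.inv_equality[of g h] G.inv_char G.l_cancel_one h(2) hG g
    by (metis G.inv_inv G.inv_equality Sp_mult Sp_one)
  moreover obtain \<gamma> where \<gamma>: "rational_curve ?m {} \<gamma>" "\<And>t. \<gamma> t \<in> carrier (Sp n)" "\<gamma> 0 = 1\<^sub>m ?m" "\<gamma> 1 = h"
    using *[OF h(1)] by blast
  moreover have "rational_curve ?m {} (\<lambda>t. inv\<^bsub>Sp n\<^esub> \<gamma> t)"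
    using rational_curve_poly_map[OF \<gamma>(1,2) poly_map_Sp_inv] by blast
  ultimately show ?thesis
    using that[of "\<lambda>t. inv\<^bsub>Sp n\<^esub> \<gamma> t"] Sp_inv_closed G.inv_one by simp
qed

section \<open>Diagonalization in the symplectic group\<close>

lemma sform_eq_sum:
  assumes "z \<in> carrier_vec (2 * n)"
  shows "sform n b z = (\<Sum>j<2 * n. sform n b (ev n j) * z $ j)"
  unfolding sum_double sform_def[of n b z] sum.distrib[symmetric]
  by (rule sum.cong) (auto simp: sform_unit_vec)

lemma mat_mult_unit_vec_index:
  fixes A :: "'k::comm_ring_1 mat"
  assumes "A \<in> carrier_mat m m" "i < m" "j < m"
  shows "(A *\<^sub>v unit_vec m j) $ i = A $$ (i, j)"
proof -
  have "(A *\<^sub>v unit_vec m j) $ i = (\<Sum>q<m. A $$ (i, q) * unit_vec m j $ q)"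
    using assms by (intro mult_mat_vec_index) auto
  also have "\<dots> = (\<Sum>q<m. if q = j then A $$ (i, j) else 0)" using assms by (intro sum.cong) auto
  finally show ?thesis using assms by simp
qed

lemma mat_eq_unit_vecI:
  fixes A :: "'k::comm_ring_1 mat"
  assumes A: "A \<in> carrier_mat m m" and B: "B \<in> carrier_mat m m"
    and "\<And>j. j < m \<Longrightarrow> A *\<^sub>v unit_vec m j = B *\<^sub>v unit_vec m j"
  shows "A = B"
proof (rule eq_matI)
  fix i j assume "i < dim_row B" "j < dim_col B"
  then have ij: "i < m" "j < m" using B by auto
  show "A $$ (i, j) = B $$ (i, j)"
    using mat_mult_unit_vec_index[OF A ij] mat_mult_unit_vec_index[OF B ij] assms(3)[OF ij(2)] by simp
qed (use A B in auto)

text \<open>By nondegeneracy this says that the eigenvectors span the space. It is put as a pairing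
  condition because the construction of symplectic eigenbases asks for an eigenvector that is not
  orthogonal to a given vector.\<close>

definition eigenvectors_span :: "nat \<Rightarrow> 'k::field mat \<Rightarrow> bool" where
  "eigenvectors_span n x \<longleftrightarrow> (\<forall>u\<in>carrier_vec (2 * n). u \<noteq> 0\<^sub>v (2 * n) \<longrightarrow>
     (\<exists>v\<in>carrier_vec (2 * n). \<exists>a. x *\<^sub>v v = a \<cdot>\<^sub>v v \<and> sform n u v \<noteq> 0))"

lemma semisimple_eigenvectors_span:
  fixes x :: "'k::alg_closed_field mat"
  assumes x: "x \<in> carrier_mat (2 * n) (2 * n)" and ss: "semisimple_mat x"
  shows "eigenvectors_span n x"
  unfolding eigenvectors_span_def
proof (intro ballI impI)
  let ?m = "2 * n"
  fix u :: "'k vec" assume u: "u \<in> carrier_vec ?m" "u \<noteq> 0\<^sub>v ?m"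
  obtain D P Q where D: "diagonal_mat D" and w: "similar_mat_wit x D P Q"
    using ss unfolding semisimple_mat_def similar_mat_def by blast
  have carr: "D \<in> carrier_mat ?m ?m" "P \<in> carrier_mat ?m ?m" "Q \<in> carrier_mat ?m ?m"
    and PQ: "P * Q = 1\<^sub>m ?m" "Q * P = 1\<^sub>m ?m" and xe: "x = P * D * Q"
    using similar_mat_witD2[OF x w] by auto
  have eig: "x *\<^sub>v (P *\<^sub>v ev n j) = D $$ (j, j) \<cdot>\<^sub>v (P *\<^sub>v ev n j)" if j: "j < ?m" for j
  proof -
    have De: "D *\<^sub>v ev n j = D $$ (j, j) \<cdot>\<^sub>v ev n j"
    proof (rule eq_vecI)
      fix i assume "i < dim_vec (D $$ (j, j) \<cdot>\<^sub>v ev n j :: 'k vec)"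
      then have i: "i < ?m" by simp
      show "(D *\<^sub>v ev n j) $ i = (D $$ (j, j) \<cdot>\<^sub>v ev n j) $ i"
        using mat_mult_unit_vec_index[OF carr(1) i j] D carr(1) i j unfolding diagonal_mat_def by auto
    qed (use carr in simp)
    have "x *\<^sub>v (P *\<^sub>v ev n j) = (P * D) *\<^sub>v (Q *\<^sub>v (P *\<^sub>v ev n j))"
      unfolding xe using carr by (intro assoc_mult_mat_vec) auto
    also have "Q *\<^sub>v (P *\<^sub>v ev n j) = ev n j"
      using assoc_mult_mat_vec[OF carr(3,2), of "ev n j"] PQ(2) by simp
    also have "(P * D) *\<^sub>v ev n j = P *\<^sub>v (D *\<^sub>v ev n j)"
      using carr by (intro assoc_mult_mat_vec) auto
    also have "\<dots> = D $$ (j, j) \<cdot>\<^sub>v (P *\<^sub>v ev n j)"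
      unfolding De using carr by (intro mult_mat_vec) auto
    finally show ?thesis .
  qed
  have "\<exists>j<?m. sform n u (P *\<^sub>v ev n j) \<noteq> 0"
  proof (rule ccontr)
    assume "\<not> ?thesis"
    then have z: "\<And>j. j < ?m \<Longrightarrow> sform n u (P *\<^sub>v ev n j) = 0" by blast
    have "sform n u (P *\<^sub>v z) = 0" if zc: "z \<in> carrier_vec ?m" for z
    proof -
      have Pc: "P *\<^sub>v y \<in> carrier_vec ?m" for y using carr(2) by (simp add: carrier_vecI)
      have "sform n u (P *\<^sub>v z) = (\<Sum>i<?m. \<Sum>j<?m. sform n u (ev n i) * P $$ (i, j) * z $ j)"
        unfolding sform_eq_sum[OF Pc]
        using mult_mat_vec_index[OF carr(2) zc] by (simp add: sum_distrib_left mult.assoc)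
      also have "\<dots> = (\<Sum>j<?m. sform n u (P *\<^sub>v ev n j) * z $ j)"
        unfolding sform_eq_sum[OF Pc]
        using mat_mult_unit_vec_index[OF carr(2)]
        by (subst sum.swap) (simp add: sum_distrib_right)
      also have "\<dots> = 0" using z by simp
      finally show ?thesis .
    qed
    note P0 = this
    have "sform n u (ev n i) = 0" for i
    proof -
      have "P *\<^sub>v (Q *\<^sub>v ev n i) = ev n i"
        using assoc_mult_mat_vec[OF carr(2,3), of "ev n i"] PQ(1) by simp
      then show ?thesis using P0[of "Q *\<^sub>v ev n i"] carr(3) by (simp add: carrier_vecI)
    qed
    then show False using sform_nondegenerate[OF u(1)] u(2) by blast
  qed
  then show "\<exists>v\<in>carrier_vec ?m. \<exists>a. x *\<^sub>v v = a \<cdot>\<^sub>v v \<and> sform n u v \<noteq> 0"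
    using eig carr(2) by (metis mult_mat_vec_carrier unit_vec_carrier)
qed

lemma Sp_conj_mult_vec:
  fixes g :: "'k::field mat"
  assumes g: "g \<in> carrier (Sp n)" and x: "x \<in> carrier_mat (2 * n) (2 * n)" and v: "v \<in> carrier_vec (2 * n)"
  shows "(g * x * inv\<^bsub>Sp n\<^esub> g) *\<^sub>v (g *\<^sub>v v) = g *\<^sub>v (x *\<^sub>v v)"
proof -
  have c: "g \<in> carrier_mat (2 * n) (2 * n)" "inv\<^bsub>Sp n\<^esub> g \<in> carrier_mat (2 * n) (2 * n)"
    using Sp_carrier g Sp_inv_closed by blast+
  have "(g * x * inv\<^bsub>Sp n\<^esub> g) *\<^sub>v (g *\<^sub>v v) = (g * x) *\<^sub>v (inv\<^bsub>Sp n\<^esub> g *\<^sub>v (g *\<^sub>v v))"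
    using c x v by (intro assoc_mult_mat_vec) auto
  also have "\<dots> = g *\<^sub>v (x *\<^sub>v v)" unfolding Sp_inv_mult_vec(1)[OF g v] using c x v by (intro assoc_mult_mat_vec) auto
  finally show ?thesis .
qed

lemma Sp_conj_closed:
  fixes g :: "'k::field mat"
  shows "g \<in> carrier (Sp n) \<Longrightarrow> x \<in> carrier (Sp n) \<Longrightarrow> g * x * inv\<^bsub>Sp n\<^esub> g \<in> carrier (Sp n)"
  by (intro Sp_closed Sp_inv_closed)

lemma eigenvectors_span_conj:
  fixes g :: "'k::field mat"
  assumes g: "g \<in> carrier (Sp n)" and x: "x \<in> carrier_mat (2 * n) (2 * n)" and span: "eigenvectors_span n x"
  shows "eigenvectors_span n (g * x * inv\<^bsub>Sp n\<^esub> g)"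
  unfolding eigenvectors_span_def
proof (intro ballI impI)
  fix u :: "'k vec" assume u: "u \<in> carrier_vec (2 * n)" "u \<noteq> 0\<^sub>v (2 * n)"
  note ig = Sp_inv_closed[OF g]
  let ?u = "inv\<^bsub>Sp n\<^esub> g *\<^sub>v u"
  have uc: "?u \<in> carrier_vec (2 * n)" using Sp_mult_vec[OF ig u(1)] .
  have "?u \<noteq> 0\<^sub>v (2 * n)"
  proof
    assume "?u = 0\<^sub>v (2 * n)"
    then have "u = g *\<^sub>v 0\<^sub>v (2 * n)" using Sp_inv_mult_vec(2)[OF g u(1)] by simp
    moreover have "g *\<^sub>v 0\<^sub>v (2 * n) = 0\<^sub>v (2 * n)" using Sp_carrier[OF g] by (intro eq_vecI) auto
    ultimately show False using u(2) by simp
  qed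
  then obtain v a where v: "v \<in> carrier_vec (2 * n)" "x *\<^sub>v v = a \<cdot>\<^sub>v v" "sform n ?u v \<noteq> 0"
    using span uc unfolding eigenvectors_span_def by blast
  have "(g * x * inv\<^bsub>Sp n\<^esub> g) *\<^sub>v (g *\<^sub>v v) = a \<cdot>\<^sub>v (g *\<^sub>v v)"
    using Sp_conj_mult_vec[OF g x v(1)] v(2) mult_mat_vec[OF Sp_carrier[OF g] v(1)] by simp
  moreover have "sform n u (g *\<^sub>v v) = sform n ?u v"
    using Sp_sform[OF g uc v(1)] Sp_inv_mult_vec(2)[OF g u(1)] by simp
  ultimately show "\<exists>w\<in>carrier_vec (2 * n). \<exists>a. (g * x * inv\<^bsub>Sp n\<^esub> g) *\<^sub>v w = a \<cdot>\<^sub>v w \<and> sform n u w \<noteq> 0"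
    using v(3) Sp_mult_vec[OF g v(1)] by auto
qed

section \<open>Symplectic eigenbases\<close>

definition diag_upto :: "nat \<Rightarrow> 'k::field mat \<Rightarrow> (nat \<Rightarrow> 'k) \<Rightarrow> nat \<Rightarrow> bool" where
  "diag_upto n x t r \<longleftrightarrow> (\<forall>i<r. t i \<noteq> 0 \<and> x *\<^sub>v ev n i = t i \<cdot>\<^sub>v ev n i \<and>
     x *\<^sub>v ev n (n + i) = inverse (t i) \<cdot>\<^sub>v ev n (n + i))"

lemma Sp_eigenvalues_orthogonal:
  fixes x :: "'k::field mat"
  assumes x: "x \<in> carrier (Sp n)" and u: "u \<in> carrier_vec (2 * n)" "x *\<^sub>v u = a \<cdot>\<^sub>v u"
    and v: "v \<in> carrier_vec (2 * n)" "x *\<^sub>v v = b \<cdot>\<^sub>v v" and uv: "sform n u v \<noteq> 0"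
  shows "a * b = 1"
proof -
  have "b * (a * sform n u v) = sform n u v"
    using Sp_sform[OF x u(1) v(1)] unfolding u(2) v(2) sform_smult_left[OF u(1)] sform_smult_right[OF v(1)] .
  then have "(a * b - 1) * sform n u v = 0" by (simp add: algebra_simps)
  then show ?thesis using uv by simp
qed

text \<open>The component of an eigenvector in the complement of the diagonalized pairs. A non-zero
  coordinate at a basis vector forces its eigenvalue to be \<open>a\<close>, by pairing with the
  dual basis vector; so removing that coordinate leaves an eigenvector for \<open>a\<close>.\<close>

lemma eigenvector_tail_component:
  fixes x :: "'k::field mat"
  assumes x: "x \<in> carrier (Sp n)" and d: "diag_upto n x t r" and r: "r \<le> n"
    and v: "v \<in> carrier_vec (2 * n)" "x *\<^sub>v v = a \<cdot>\<^sub>v v"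
  obtains w where "w \<in> tail_space n r" "x *\<^sub>v w = a \<cdot>\<^sub>v w"
    "\<And>u. u \<in> tail_space n r \<Longrightarrow> sform n u w = sform n u v"
proof -
  have "\<exists>w\<in>tail_space n k. x *\<^sub>v w = a \<cdot>\<^sub>v w \<and> (\<forall>u\<in>tail_space n k. sform n u w = sform n u v)"
    if "k \<le> r" for k
    using that
  proof (induction k)
    case 0
    show ?case using v by auto
  next
    case (Suc k)
    then obtain w where w: "w \<in> tail_space n k" "x *\<^sub>v w = a \<cdot>\<^sub>v w"
      "\<And>u. u \<in> tail_space n k \<Longrightarrow> sform n u w = sform n u v" by auto
    have k: "k < r" "k < n" using Suc.prems r by auto
    have wc: "w \<in> carrier_vec (2 * n)" using tail_space_carrier[OF w(1)] .
    have xm: "x \<in> carrier_mat (2 * n) (2 * n)" using Sp_carrier[OF x] .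
    have t: "t k \<noteq> 0" "x *\<^sub>v ev n k = t k \<cdot>\<^sub>v ev n k" "x *\<^sub>v ev n (n + k) = inverse (t k) \<cdot>\<^sub>v ev n (n + k)"
      using d k unfolding diag_upto_def by auto
    define p q where "p = w $ k" and "q = w $ (n + k)"
    have p: "p * t k = p * a"
    proof (cases "p = 0")
      case False
      then have "sform n w (ev n (n + k)) \<noteq> 0" unfolding p_def using k by (simp add: sform_unit_vec)
      then have "a * inverse (t k) = 1" using Sp_eigenvalues_orthogonal[OF x wc w(2) _ t(3)] by simp
      then show ?thesis using t(1) by (simp add: field_simps)
    qed simp
    have q: "q * inverse (t k) = q * a"
    proof (cases "q = 0")
      case False
      then have "sform n w (ev n k) \<noteq> 0" unfolding q_def using k by (simp add: sform_unit_vec)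
      then have "a * t k = 1" using Sp_eigenvalues_orthogonal[OF x wc w(2) _ t(2)] by simp
      then show ?thesis using t(1) by (simp add: field_simps)
    qed simp
    define w' where "w' = w - (p \<cdot>\<^sub>v ev n k + q \<cdot>\<^sub>v ev n (n + k))"
    have "w' \<in> tail_space n (Suc k)"
      using w(1) k unfolding tail_space_def w'_def p_def q_def by (auto simp: less_Suc_eq)
    moreover have "x *\<^sub>v w' = a \<cdot>\<^sub>v w'"
    proof -
      have "x *\<^sub>v w' = x *\<^sub>v w - (p \<cdot>\<^sub>v (x *\<^sub>v ev n k) + q \<cdot>\<^sub>v (x *\<^sub>v ev n (n + k)))"
        unfolding w'_def using xm wc
        by (simp add: mult_minus_distrib_mat_vec mult_add_distrib_mat_vec mult_mat_vec)
      also have "\<dots> = a \<cdot>\<^sub>v w - ((p * t k) \<cdot>\<^sub>v ev n k + (q * inverse (t k)) \<cdot>\<^sub>v ev n (n + k))"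
        unfolding t(2,3) w(2) by (simp add: smult_smult_assoc)
      also have "\<dots> = a \<cdot>\<^sub>v w'"
        unfolding p q w'_def using wc by (intro eq_vecI) (auto simp: algebra_simps)
      finally show ?thesis .
    qed
    moreover have "sform n u w' = sform n u v" if u: "u \<in> tail_space n (Suc k)" for u
    proof -
      have uc: "u \<in> carrier_vec (2 * n)" using tail_space_carrier[OF u] .
      have "sform n u (ev n k) = 0" "sform n u (ev n (n + k)) = 0" using tail_spaceD[OF u] k by auto
      then have "sform n u w' = sform n u w"
        unfolding w'_def using uc wc by (simp add: sform_diff_right sform_add_right sform_smult_right)
      then show ?thesis using w(3) u tail_space_mono[of k "Suc k" n] by auto
    qed
    ultimately show ?case by blast
  qed
  then show ?thesis using that by blast
qed

lemma diag_upto_extend: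
  fixes x :: "'k::field mat"
  assumes x: "x \<in> carrier (Sp n)" and span: "eigenvectors_span n x" and d: "diag_upto n x t r" and r: "r < n"
    and u: "u \<in> tail_space n r" "x *\<^sub>v u = a \<cdot>\<^sub>v u" and v: "v \<in> tail_space n r" "x *\<^sub>v v = inverse a \<cdot>\<^sub>v v"
    and uv: "sform n u v = 1"
  obtains g where "g \<in> carrier (Sp n)" "diag_upto n (g * x * inv\<^bsub>Sp n\<^esub> g) (t(r := a)) (Suc r)"
proof -
  have uc: "u \<in> carrier_vec (2 * n)" and vc: "v \<in> carrier_vec (2 * n)" using u v by (auto intro: tail_space_carrier)
  have "a * inverse a = 1" using Sp_eigenvalues_orthogonal[OF x uc u(2) vc v(2)] uv by simp
  then have a: "a \<noteq> 0" by auto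
  obtain g where g: "g \<in> transvection_group n r" "g *\<^sub>v u = ev n r" "g *\<^sub>v v = ev n (n + r)"
    using transvection_group_hyperbolic_pair[OF u(1) v(1) uv r] .
  have gS: "g \<in> carrier (Sp n)" using transvection_group_Sp[OF g(1)] .
  have xm: "x \<in> carrier_mat (2 * n) (2 * n)" using Sp_carrier[OF x] .
  have eig: "(g * x * inv\<^bsub>Sp n\<^esub> g) *\<^sub>v (g *\<^sub>v w) = b \<cdot>\<^sub>v (g *\<^sub>v w)"
    if "w \<in> carrier_vec (2 * n)" "x *\<^sub>v w = b \<cdot>\<^sub>v w" for w b
    using Sp_conj_mult_vec[OF gS xm that(1)] that mult_mat_vec[OF Sp_carrier[OF gS] that(1)] by simp
  have "diag_upto n (g * x * inv\<^bsub>Sp n\<^esub> g) (t(r := a)) (Suc r)"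
    unfolding diag_upto_def
  proof (intro allI impI)
    fix i assume i: "i < Suc r"
    show "(t(r := a)) i \<noteq> 0 \<and> (g * x * inv\<^bsub>Sp n\<^esub> g) *\<^sub>v ev n i = (t(r := a)) i \<cdot>\<^sub>v ev n i \<and>
        (g * x * inv\<^bsub>Sp n\<^esub> g) *\<^sub>v ev n (n + i) = inverse ((t(r := a)) i) \<cdot>\<^sub>v ev n (n + i)"
    proof (cases "i = r")
      case True
      then show ?thesis using a eig[OF uc u(2)] eig[OF vc v(2)] g by simp
    next
      case False
      then have i: "i < r" using i by simp
      note f = transvection_group_fixes_unit_vec[OF g(1) i less_imp_le[OF r]]
      have "t i \<noteq> 0" "x *\<^sub>v ev n i = t i \<cdot>\<^sub>v ev n i" "x *\<^sub>v ev n (n + i) = inverse (t i) \<cdot>\<^sub>v ev n (n + i)"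
        using d i unfolding diag_upto_def by auto
      then show ?thesis using False eig[of "ev n i" "t i"] eig[of "ev n (n + i)" "inverse (t i)"] f by simp
    qed
  qed
  then show ?thesis using that gS by blast
qed

text \<open>An eigenvector that is not orthogonal to \<open>u\<close> has eigenvalue
  \<open>inverse a\<close>. Passing to its component in the tail space does not change its pairing
  with \<open>u\<close>, and scaling makes that pairing 1.\<close>

lemma eigenvector_pair:
  fixes x :: "'k::field mat"
  assumes x: "x \<in> carrier (Sp n)" and span: "eigenvectors_span n x" and d: "diag_upto n x t r" and r: "r \<le> n"
    and u: "u \<in> tail_space n r" "u \<noteq> 0\<^sub>v (2 * n)" "x *\<^sub>v u = a \<cdot>\<^sub>v u"
  obtains v where "v \<in> tail_space n r" "x *\<^sub>v v = inverse a \<cdot>\<^sub>v v" "sform n u v = 1"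
proof -
  have uc: "u \<in> carrier_vec (2 * n)" using u by (auto intro: tail_space_carrier)
  obtain v b where v: "v \<in> carrier_vec (2 * n)" "x *\<^sub>v v = b \<cdot>\<^sub>v v" "sform n u v \<noteq> 0"
    using span uc u(2) unfolding eigenvectors_span_def by blast
  obtain w where w: "w \<in> tail_space n r" "x *\<^sub>v w = b \<cdot>\<^sub>v w" "sform n u w = sform n u v"
    using eigenvector_tail_component[OF x d r v(1,2)] u(1) by metis
  have "a * b = 1" using Sp_eigenvalues_orthogonal[OF x uc u(3) v(1,2,3)] .
  then have b: "b = inverse a" by (metis inverse_unique)
  let ?c = "inverse (sform n u v)"
  have wc: "w \<in> carrier_vec (2 * n)" using w by (auto intro: tail_space_carrier)
  show ?thesis
  proof (rule that)
    show "?c \<cdot>\<^sub>v w \<in> tail_space n r" using vec_subspaceD(4)[OF vec_subspace_tail_space[OF r] w(1)] .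
    show "x *\<^sub>v (?c \<cdot>\<^sub>v w) = inverse a \<cdot>\<^sub>v (?c \<cdot>\<^sub>v w)"
      using mult_mat_vec[OF Sp_carrier[OF x] wc] w(2) b by (simp add: smult_smult_assoc mult.commute)
    show "sform n u (?c \<cdot>\<^sub>v w) = 1" using v(3) w(3) wc by (simp add: sform_smult_right)
  qed
qed

text \<open>
  Since \<open>a\<close> and \<open>inverse a\<close> may be interchanged within a hyperbolic pair, the diagonal entries can
  be chosen in any set \<open>Q\<close> that meets every pair \<open>{a, inverse a}\<close>.
\<close>

lemma Sp_diagonalize:
  fixes x :: "'k::field mat"
  assumes x: "x \<in> carrier (Sp n)" and span: "eigenvectors_span n x" and d: "diag_upto n x t r" and r: "r \<le> n"
    and Q: "\<And>a. Q a \<or> Q (inverse a)"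
  shows "\<exists>g\<in>carrier (Sp n). \<exists>s. (\<forall>i<r. s i = t i) \<and> (\<forall>i. r \<le> i \<and> i < n \<longrightarrow> Q (s i)) \<and>
    diag_upto n (g * x * inv\<^bsub>Sp n\<^esub> g) s n"
  using r x span d
proof (induction r arbitrary: x t rule: inc_induct)
  case base
  interpret G: group "Sp n :: 'k mat monoid" by (rule group_Sp)
  have "1\<^sub>m (2 * n) * x * inv\<^bsub>Sp n\<^esub> (1\<^sub>m (2 * n)) = x" using Sp_carrier[OF base(1)] G.inv_one by simp
  then show ?case using base Sp_one_closed[of n] by (intro bexI[of _ "1\<^sub>m (2 * n)"] exI[of _ t]) auto
next
  case (step r)
  have r: "r < n" using step.hyps by simp
  have e: "ev n r \<in> tail_space n r" using r by (intro unit_vec_tail_space) auto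
  obtain v0 a where v0: "v0 \<in> carrier_vec (2 * n)" "x *\<^sub>v v0 = a \<cdot>\<^sub>v v0" "sform n (ev n r) v0 \<noteq> 0"
    using step.prems(2) r unfolding eigenvectors_span_def by (metis unit_vec_carrier unit_vec_nonzero mult_2 trans_less_add1)
  obtain u where u: "u \<in> tail_space n r" "x *\<^sub>v u = a \<cdot>\<^sub>v u" "sform n (ev n r) u \<noteq> 0"
    using eigenvector_tail_component[OF step.prems(1,3) less_imp_le[OF r] v0(1,2)] e v0(3) by metis
  have uc: "u \<in> carrier_vec (2 * n)" using u by (auto intro: tail_space_carrier)
  have "u \<noteq> 0\<^sub>v (2 * n)" using u(3) by auto
  then obtain v where v: "v \<in> tail_space n r" "x *\<^sub>v v = inverse a \<cdot>\<^sub>v v" "sform n u v = 1"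
    using eigenvector_pair[OF step.prems(1,2,3) less_imp_le[OF r] u(1) _ u(2)] by blast
  have vc: "v \<in> carrier_vec (2 * n)" using v by (auto intro: tail_space_carrier)
  have "\<exists>g b. g \<in> carrier (Sp n) \<and> Q b \<and> diag_upto n (g * x * inv\<^bsub>Sp n\<^esub> g) (t(r := b)) (Suc r)"
  proof (cases "Q a")
    case True
    then show ?thesis using diag_upto_extend[OF step.prems(1-3) r u(1,2) v] by metis
  next
    case False
    then have "Q (inverse a)" using Q by blast
    \<comment> \<open>The members of the pair are exchanged; the sign makes \<open>(v, -u)\<close>
      hyperbolic again.\<close>
    moreover have "(- 1) \<cdot>\<^sub>v u \<in> tail_space n r"
      using vec_subspaceD(4)[OF vec_subspace_tail_space[OF less_imp_le[OF r]] u(1)] .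
    moreover have "x *\<^sub>v ((- 1) \<cdot>\<^sub>v u) = inverse (inverse a) \<cdot>\<^sub>v ((- 1) \<cdot>\<^sub>v u)"
      using mult_mat_vec[OF Sp_carrier[OF step.prems(1)] uc] u(2) by (simp add: smult_smult_assoc)
    moreover have "sform n v ((- 1) \<cdot>\<^sub>v u) = 1" using sform_swap[of n v u] v(3) uc by (simp add: sform_smult_right)
    ultimately show ?thesis using diag_upto_extend[OF step.prems(1-3) r v(1,2), of "(- 1) \<cdot>\<^sub>v u"] by metis
  qed
  then obtain g b where g: "g \<in> carrier (Sp n)" "Q b" "diag_upto n (g * x * inv\<^bsub>Sp n\<^esub> g) (t(r := b)) (Suc r)" by blast
  obtain h s where h: "h \<in> carrier (Sp n)" "\<forall>i<Suc r. s i = (t(r := b)) i" "\<forall>i. Suc r \<le> i \<and> i < n \<longrightarrow> Q (s i)"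
    "diag_upto n (h * (g * x * inv\<^bsub>Sp n\<^esub> g) * inv\<^bsub>Sp n\<^esub> h) s n"
    using step.IH[OF Sp_conj_closed[OF g(1) step.prems(1)] eigenvectors_span_conj[OF g(1) Sp_carrier[OF step.prems(1)] step.prems(2)] g(3)]
    by blast
  interpret G: group "Sp n :: 'k mat monoid" by (rule group_Sp)
  have "h \<otimes>\<^bsub>Sp n\<^esub> (g \<otimes>\<^bsub>Sp n\<^esub> x \<otimes>\<^bsub>Sp n\<^esub> inv\<^bsub>Sp n\<^esub> g) \<otimes>\<^bsub>Sp n\<^esub> inv\<^bsub>Sp n\<^esub> h =
      (h \<otimes>\<^bsub>Sp n\<^esub> g) \<otimes>\<^bsub>Sp n\<^esub> x \<otimes>\<^bsub>Sp n\<^esub> inv\<^bsub>Sp n\<^esub> (h \<otimes>\<^bsub>Sp n\<^esub> g)"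
    using g(1) h(1) step.prems(1) by (simp add: G.inv_mult_group G.m_assoc del: Sp_mult Sp_one)
  then have "diag_upto n ((h * g) * x * inv\<^bsub>Sp n\<^esub> (h * g)) s n" using h(4) by simp
  moreover have "(\<forall>i<r. s i = t i) \<and> (\<forall>i. r \<le> i \<and> i < n \<longrightarrow> Q (s i))"
  proof (intro conjI allI impI)
    fix i
    show "s i = t i" if "i < r" using h(2) that by simp
    show "Q (s i)" if "r \<le> i \<and> i < n"
      using h(2,3) g(2) that by (cases "i = r") (auto simp: Suc_le_eq)
  qed
  ultimately show ?case using Sp_closed[OF h(1) g(1)] by blast
qed

section \<open>Diagonal elements\<close>

definition dmat :: "nat \<Rightarrow> (nat \<Rightarrow> 'k::field) \<Rightarrow> 'k mat" where
  "dmat n t = mat (2 * n) (2 * n) (\<lambda>(i, j). if i = j then if i < n then t i else inverse (t (i - n)) else 0)"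

lemma dmat_carrier [simp]: "dmat n t \<in> carrier_mat (2 * n) (2 * n)"
  by (simp add: dmat_def)

lemma dmat_mult_unit_vec:
  assumes "i < n"
  shows "dmat n t *\<^sub>v ev n i = t i \<cdot>\<^sub>v ev n i" "dmat n t *\<^sub>v ev n (n + i) = inverse (t i) \<cdot>\<^sub>v ev n (n + i)"
proof -
  have *: "dmat n t *\<^sub>v ev n j = dmat n t $$ (j, j) \<cdot>\<^sub>v ev n j" if j: "j < 2 * n" for j
  proof (rule eq_vecI)
    fix i assume "i < dim_vec (dmat n t $$ (j, j) \<cdot>\<^sub>v ev n j :: 'a vec)"
    then have i: "i < 2 * n" by simp
    then show "(dmat n t *\<^sub>v ev n j) $ i = (dmat n t $$ (j, j) \<cdot>\<^sub>v ev n j) $ i"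
      using mat_mult_unit_vec_index[OF dmat_carrier i j, of t] j by (auto simp: dmat_def)
  qed (simp add: dmat_def)
  show "dmat n t *\<^sub>v ev n i = t i \<cdot>\<^sub>v ev n i" "dmat n t *\<^sub>v ev n (n + i) = inverse (t i) \<cdot>\<^sub>v ev n (n + i)"
    using *[of i] *[of "n + i"] assms by (simp_all add: dmat_def)
qed

lemma diag_upto_imp_dmat:
  assumes x: "x \<in> carrier_mat (2 * n) (2 * n)" and d: "diag_upto n x t n"
  shows "x = dmat n t"
proof (rule mat_eq_unit_vecI[OF x dmat_carrier])
  fix j assume j: "j < 2 * n"
  show "x *\<^sub>v ev n j = dmat n t *\<^sub>v ev n j"
    using d j dmat_mult_unit_vec[of j n t] dmat_mult_unit_vec[of "j - n" n t] unfolding diag_upto_def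
    by (cases "j < n") (auto simp: not_less dest: spec[of _ "j - n"])
qed

lemma dmat_Sp:
  assumes t: "\<And>i. i < n \<Longrightarrow> t i \<noteq> (0 :: 'k::field)" shows "dmat n t \<in> carrier (Sp n)"
  unfolding Sp_iff
proof (intro conjI ballI)
  have *: "(dmat n t *\<^sub>v v) $ i = (if i < n then t i else inverse (t (i - n))) * v $ i"
    if "i < 2 * n" "v \<in> carrier_vec (2 * n)" for i and v :: "'k vec"
  proof -
    have "(dmat n t *\<^sub>v v) $ i = (\<Sum>q<2 * n. dmat n t $$ (i, q) * v $ q)"
      using that by (intro mult_mat_vec_index) auto
    also have "\<dots> = (\<Sum>q<2 * n. if q = i then (if i < n then t i else inverse (t (i - n))) * v $ i else 0)"
      using that by (intro sum.cong) (auto simp: dmat_def)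
    finally show ?thesis using that by simp
  qed
  fix u v :: "'k vec" assume uv: "u \<in> carrier_vec (2 * n)" "v \<in> carrier_vec (2 * n)"
  show "sform n (dmat n t *\<^sub>v u) (dmat n t *\<^sub>v v) = sform n u v"
    unfolding sform_def using t uv by (intro sum.cong) (auto simp: * field_simps)
qed simp

lemma a_elt_eq_dmat: "a_elt n l = dmat n (\<lambda>_. l)"
  unfolding a_elt_def dmat_def by (rule eq_matI) (auto simp: Let_def)

lemma c_elt_eq_dmat:
  assumes "0 < n" shows "c_elt n l = dmat n (\<lambda>i. if i = 0 then l else 1)"
proof -
  obtain k where n: "n = Suc k" using assms by (cases n) auto
  have *: "c_elt n l $$ (i, j) = dmat n (\<lambda>i. if i = 0 then l else 1) $$ (i, j)"
    if ij: "i < 2 * n" "j < 2 * n" for i j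
  proof (cases i)
    case 0
    then show ?thesis using ij n by (cases j) (simp_all add: c_elt_def dmat_def Let_def)
  next
    case (Suc i')
    consider "i' < k" | "i' = k" | "k < i'" by linarith
    then show ?thesis
    proof cases
      case 1
      then show ?thesis using ij n Suc by (cases j) (auto simp: c_elt_def dmat_def Let_def)
    next
      case 2
      then show ?thesis using ij n Suc by (cases j) (auto simp: c_elt_def dmat_def Let_def)
    next
      case 3
      then show ?thesis using ij n Suc by (cases j) (auto simp: c_elt_def dmat_def Let_def)
    qed
  qed
  show ?thesis
    by (rule eq_matI) (use * n in \<open>simp_all add: dmat_def\<close>, simp_all add: c_elt_def Let_def)
qed

section \<open>Dense orbits\<close>

lemma conj_class_Sp:
  "x \<in> carrier (Sp n) \<Longrightarrow> conj_class (Sp n) x = {g * x * inv\<^bsub>Sp n\<^esub> g | g. g \<in> carrier (Sp n)}"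
  by (simp add: conj_class_def orbit_def conj_act_def)

lemma orbit_conj_act_Sp:
  "x \<in> carrier (Sp n) \<Longrightarrow>
    orbit (Sp n\<lparr>carrier := B\<rparr>) (conj_act (Sp n)) x = {b * x * inv\<^bsub>Sp n\<^esub> b | b. b \<in> B}"
  by (simp add: orbit_def conj_act_def)

lemma Sp_conj_conj:
  fixes g :: "'k::field mat"
  assumes "g \<in> carrier (Sp n)" "h \<in> carrier (Sp n)" "x \<in> carrier (Sp n)"
  shows "h * (g * x * inv\<^bsub>Sp n\<^esub> g) * inv\<^bsub>Sp n\<^esub> h = (h * g) * x * inv\<^bsub>Sp n\<^esub> (h * g)"
proof -
  interpret G: group "Sp n :: 'k mat monoid" by (rule group_Sp)
  have "h \<otimes>\<^bsub>Sp n\<^esub> (g \<otimes>\<^bsub>Sp n\<^esub> x \<otimes>\<^bsub>Sp n\<^esub> inv\<^bsub>Sp n\<^esub> g) \<otimes>\<^bsub>Sp n\<^esub> inv\<^bsub>Sp n\<^esub> h =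
      (h \<otimes>\<^bsub>Sp n\<^esub> g) \<otimes>\<^bsub>Sp n\<^esub> x \<otimes>\<^bsub>Sp n\<^esub> inv\<^bsub>Sp n\<^esub> (h \<otimes>\<^bsub>Sp n\<^esub> g)"
    using assms by (simp add: G.inv_mult_group G.m_assoc del: Sp_mult Sp_one)
  then show ?thesis by simp
qed

lemma Sp_conj_one:
  fixes x :: "'k::field mat"
  assumes "x \<in> carrier (Sp n)" shows "1\<^sub>m (2 * n) * x * inv\<^bsub>Sp n\<^esub> (1\<^sub>m (2 * n)) = x"
proof -
  interpret G: group "Sp n :: 'k mat monoid" by (rule group_Sp)
  show ?thesis using Sp_carrier[OF assms] G.inv_one by simp
qed

lemma Sp_conj_inv:
  fixes x :: "'k::field mat"
  assumes g: "g \<in> carrier (Sp n)" and x: "x \<in> carrier (Sp n)"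
  shows "inv\<^bsub>Sp n\<^esub> g * (g * x * inv\<^bsub>Sp n\<^esub> g) * inv\<^bsub>Sp n\<^esub> (inv\<^bsub>Sp n\<^esub> g) = x"
  using Sp_conj_conj[OF g Sp_inv_closed[OF g] x] Sp_inv_mult(1)[OF g] Sp_conj_one[OF x] by simp

lemma conj_class_Sp_self:
  fixes x :: "'k::field mat"
  assumes "x \<in> carrier (Sp n)" shows "x \<in> conj_class (Sp n) x"
proof -
  have "x = 1\<^sub>m (2 * n) * x * inv\<^bsub>Sp n\<^esub> (1\<^sub>m (2 * n))" using Sp_conj_one[OF assms] by simp
  then show ?thesis unfolding conj_class_Sp[OF assms] using Sp_one_closed by blast
qed

lemma conj_class_Sp_conj:
  fixes x :: "'k::field mat"
  assumes x: "x \<in> carrier (Sp n)" and g: "g \<in> carrier (Sp n)" and y: "y \<in> conj_class (Sp n) x"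
  shows "g * y * inv\<^bsub>Sp n\<^esub> g \<in> conj_class (Sp n) x"
proof -
  obtain h where h: "h \<in> carrier (Sp n)" "y = h * x * inv\<^bsub>Sp n\<^esub> h" using y unfolding conj_class_Sp[OF x] by blast
  have "g * y * inv\<^bsub>Sp n\<^esub> g = (g * h) * x * inv\<^bsub>Sp n\<^esub> (g * h)" unfolding h(2) using Sp_conj_conj[OF h(1) g x] .
  then show ?thesis unfolding conj_class_Sp[OF x] using Sp_closed[OF g h(1)] by blast
qed

lemma conj_class_Sp_carrier:
  fixes x :: "'k::field mat"
  assumes x: "x \<in> carrier (Sp n)" shows "conj_class (Sp n) x \<subseteq> carrier (Sp n)"
  unfolding conj_class_Sp[OF x] using Sp_conj_closed x by blast

lemma conj_class_Sp_eq:
  fixes x :: "'k::field mat"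
  assumes x: "x \<in> carrier (Sp n)" and y: "y \<in> conj_class (Sp n) x"
  shows "conj_class (Sp n) y = conj_class (Sp n) x"
proof
  have yG: "y \<in> carrier (Sp n)" using conj_class_Sp_carrier[OF x] y by blast
  obtain h where h: "h \<in> carrier (Sp n)" "y = h * x * inv\<^bsub>Sp n\<^esub> h" using y unfolding conj_class_Sp[OF x] by blast
  then have "x \<in> conj_class (Sp n) y"
    unfolding conj_class_Sp[OF yG] using Sp_conj_inv[OF h(1) x] Sp_inv_closed[OF h(1)]
    by (intro CollectI exI[of _ "inv\<^bsub>Sp n\<^esub> h"]) simp
  then show "conj_class (Sp n) x \<subseteq> conj_class (Sp n) y"
    using conj_class_Sp_conj[OF yG] unfolding conj_class_Sp[OF x] by blast
  show "conj_class (Sp n) y \<subseteq> conj_class (Sp n) x"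
    using conj_class_Sp_conj[OF x _ y] unfolding conj_class_Sp[OF yG] by blast
qed

section \<open>Polynomial functions and dense orbits\<close>

lemma polyfun_zero_on_closure:
  assumes cl: "subtopology (zariski m) C closure_of S = C" and f: "f \<in> mat_polyfun m"
    and zero: "\<And>y. y \<in> S \<Longrightarrow> f y = 0" and y: "y \<in> C"
  shows "f y = 0"
proof (rule ccontr)
  assume ne: "f y \<noteq> 0"
  have "y \<in> subtopology (zariski m) C closure_of S" unfolding cl using y .
  then have yt: "y \<in> topspace (subtopology (zariski m) C)"
    and *: "\<And>T. y \<in> T \<Longrightarrow> openin (subtopology (zariski m) C) T \<Longrightarrow> \<exists>z. z \<in> S \<and> z \<in> T"
    unfolding in_closure_of by blast+
  have "openin (zariski m) {A \<in> carrier_mat m m. \<exists>g\<in>{f}. g A \<noteq> 0}"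
    unfolding openin_zariski using f by blast
  then have op: "openin (subtopology (zariski m) C) ({A \<in> carrier_mat m m. \<exists>g\<in>{f}. g A \<noteq> 0} \<inter> C)"
    unfolding openin_subtopology by blast
  have "y \<in> {A \<in> carrier_mat m m. \<exists>g\<in>{f}. g A \<noteq> 0} \<inter> C" using yt ne by auto
  from *[OF this op] show False using zero by auto
qed

text \<open>
  A non-constant ratio of two semi-invariants of the same weight would be a non-constant
  invariant rational function, which cannot exist if there is a dense orbit.
\<close>

lemma semi_invariants_proportional:
  assumes cl: "subtopology (zariski m) C closure_of S = C" and x: "x \<in> C"
    and f: "f \<in> mat_polyfun m" "g \<in> mat_polyfun m"
    and semi: "\<And>y. y \<in> S \<Longrightarrow> \<exists>c. f y = c * f x \<and> g y = c * g x"
    and y: "y \<in> C" and z: "z \<in> C"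
  shows "f y * g z = g y * f z"
proof (cases "f x = 0 \<and> g x = 0")
  case True
  have zero: "f w = 0 \<and> g w = 0" if "w \<in> S" for w using semi[OF that] True by auto
  have "f y = 0" by (rule polyfun_zero_on_closure[OF cl f(1) _ y]) (use zero in blast)
  moreover have "g y = 0" by (rule polyfun_zero_on_closure[OF cl f(2) _ y]) (use zero in blast)
  ultimately show ?thesis by simp
next
  case False
  have "(\<lambda>y. f x * g y - g x * f y) \<in> mat_polyfun m"
    by (intro mat_polyfun_diff mat_polyfun.mult mat_polyfun.const f)
  moreover have "f x * g y - g x * f y = 0" if "y \<in> S" for y using semi[OF that] by auto
  ultimately have *: "f x * g y - g x * f y = 0" if "y \<in> C" for y
    by (rule polyfun_zero_on_closure[OF cl]) (use that in auto)
  from *[OF y] *[OF z] have e: "f x * g y = g x * f y" "f x * g z = g x * f z" by auto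
  show ?thesis
  proof (cases "f x = 0")
    case True
    then have "f y = 0" "f z = 0" using e False by auto
    then show ?thesis by simp
  next
    case fx: False
    have "f x * (f y * g z) = f x * (g y * f z)"
      using e by (metis mult.assoc mult.commute)
    then show ?thesis using fx by simp
  qed
qed

text \<open>Given an open set around \<open>y\<close>, take a curve in the class from
  \<open>x\<close> to \<open>y\<close>. \<open>F\<close> is non-zero at its start and the function
  \<open>f\<close> describing the open set is non-zero at its end, so both are non-zero at some
  common parameter; that point lies in the open set and, by \<open>good\<close>, in the
  orbit.\<close>

lemma dense_orbit_conj_class:
  fixes x :: "'k::alg_closed_field mat"
  assumes x: "x \<in> carrier (Sp n)" and F: "F \<in> mat_polyfun (2 * n)" "F x \<noteq> 0"
    and B: "B \<subseteq> carrier (Sp n)"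
    and good: "\<And>y. y \<in> conj_class (Sp n) x \<Longrightarrow> F y \<noteq> 0 \<Longrightarrow> \<exists>b\<in>B. y = b * x * inv\<^bsub>Sp n\<^esub> b"
  shows "subtopology (zariski (2 * n)) (conj_class (Sp n) x) closure_of
    orbit (Sp n\<lparr>carrier := B\<rparr>) (conj_act (Sp n)) x = conj_class (Sp n) x" (is "?T closure_of ?O = ?C")
proof
  let ?m = "2 * n"
  have Cm: "?C \<subseteq> carrier_mat ?m ?m" using conj_class_Sp_carrier[OF x] Sp_carrier by blast
  then have top: "topspace ?T = ?C" by auto
  show "?T closure_of ?O \<subseteq> ?C" using closure_of_subset_topspace[of ?T ?O] top by simp
  show "?C \<subseteq> ?T closure_of ?O"
  proof
    fix y assume y: "y \<in> ?C"
    have "\<exists>z. z \<in> ?O \<and> z \<in> T" if T: "y \<in> T" "openin ?T T" for T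
    proof -
      obtain U where U: "openin (zariski ?m) U" "T = U \<inter> ?C" using T(2) unfolding openin_subtopology by blast
      then obtain S where S: "S \<subseteq> mat_polyfun ?m" "U = {A \<in> carrier_mat ?m ?m. \<exists>f\<in>S. f A \<noteq> 0}"
        unfolding openin_zariski by blast
      then obtain f where f: "f \<in> S" "f y \<noteq> 0" using T(1) U(2) by blast
      obtain g where g: "g \<in> carrier (Sp n)" "y = g * x * inv\<^bsub>Sp n\<^esub> g" using y unfolding conj_class_Sp[OF x] by blast
      obtain \<gamma> where \<gamma>: "rational_curve ?m {} \<gamma>" "\<And>t. \<gamma> t \<in> carrier (Sp n)" "\<gamma> 0 = 1\<^sub>m ?m" "\<gamma> 1 = g"
        using Sp_rational_curve[OF g(1)] by metis
      define \<delta> where "\<delta> t = \<gamma> t * x * inv\<^bsub>Sp n\<^esub> \<gamma> t" for t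
      have "poly_map ?m (carrier (Sp n)) (\<lambda>A. A * x * inv\<^bsub>Sp n\<^esub> A)"
        using Sp_carrier by (intro poly_map_mult poly_map_id poly_map_const poly_map_Sp_inv Sp_carrier[OF x]) auto
      then have "rational_curve ?m {} \<delta>" unfolding \<delta>_def by (rule rational_curve_poly_map[OF \<gamma>(1,2)])
      moreover have "\<delta> 0 = x" "\<delta> 1 = y" unfolding \<delta>_def \<gamma>(3,4) g(2) using Sp_conj_one[OF x] by simp_all
      ultimately obtain t where t: "F (\<delta> t) \<noteq> 0" "f (\<delta> t) \<noteq> 0"
        using rational_curve_common_nonzero[of ?m "{}" \<delta> F f 0 1] F f S(1) by auto
      have dC: "\<delta> t \<in> ?C" unfolding \<delta>_def conj_class_Sp[OF x] using \<gamma>(2) by blast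
      then have "\<delta> t \<in> ?O" using good[OF dC t(1)] unfolding orbit_conj_act_Sp[OF x] by blast
      moreover have "\<delta> t \<in> T" unfolding U(2) S(2) using dC Cm t(2) f(1) by blast
      ultimately show ?thesis by blast
    qed
    then show "y \<in> ?T closure_of ?O" unfolding in_closure_of using y top by blast
  qed
qed

section \<open>The standard Borel subgroup\<close>

text \<open>
  The position of a basis vector in the ordering \<open>e\<^sub>0, \<dots>, e\<^sub>n\<^sub>-\<^sub>1, f\<^sub>n\<^sub>-\<^sub>1, \<dots>, f\<^sub>0\<close>, where
  \<open>f\<^sub>i\<close> is the basis vector with index \<open>n + i\<close>: in this ordering the Borel subgroup is upper triangular.
\<close>

definition ht :: "nat \<Rightarrow> nat \<Rightarrow> nat" where
  "ht n p = (if p < n then p else 3 * n - 1 - p)"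

definition dual_index :: "nat \<Rightarrow> nat \<Rightarrow> nat" where
  "dual_index n p = (if p < n then n + p else p - n)"

lemma dual_index_less: "p < 2 * n \<Longrightarrow> dual_index n p < 2 * n"
  by (auto simp: dual_index_def)

lemma dual_index_inj: "p < 2 * n \<Longrightarrow> q < 2 * n \<Longrightarrow> dual_index n p = dual_index n q \<longleftrightarrow> p = q"
  by (auto simp: dual_index_def)

lemma ht_less: "p < 2 * n \<Longrightarrow> ht n p < 2 * n"
  by (auto simp: ht_def)

lemma ht_inj: "p < 2 * n \<Longrightarrow> q < 2 * n \<Longrightarrow> ht n p = ht n q \<longleftrightarrow> p = q"
  by (auto simp: ht_def)

lemma ht_dual_index: "p < 2 * n \<Longrightarrow> ht n (dual_index n p) = 2 * n - 1 - ht n p"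
  by (auto simp: ht_def dual_index_def)

text \<open>Inversion is the adjoint for the form: it transposes the matrix and passes to dual
  indices, up to signs. Since \<open>dual_index\<close> reverses heights, conditions on height
  differences are inherited by inverses.\<close>

lemma Sp_inv_index:
  fixes g :: "'k::field mat"
  assumes g: "g \<in> carrier (Sp n)" and p: "p < 2 * n" and q: "q < 2 * n"
  shows "(inv\<^bsub>Sp n\<^esub> g) $$ (p, q) =
    (if p < n then 1 else - 1) * (if q < n then 1 else - 1) * g $$ (dual_index n q, dual_index n p)"
proof -
  have L: "sform n u (ev n (dual_index n p)) = (if p < n then 1 else - 1) * u $ p" for u :: "'k vec"
    using p sform_unit_vec(1)[of "p - n" n u] sform_unit_vec(2)[of p n u] by (simp add: dual_index_def)
  have R: "sform n (ev n q) w = (if q < n then 1 else - 1) * w $ dual_index n q" for w :: "'k vec"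
  proof (cases "q < n")
    case False
    then have "q - n < n" "n + (q - n) = q" using q by simp_all
    then show ?thesis using False sform_unit_vec(4)[of "q - n" n w] by (simp add: dual_index_def)
  qed (simp add: dual_index_def sform_unit_vec)
  note ig = Sp_inv_closed[OF g]
  have "sform n (inv\<^bsub>Sp n\<^esub> g *\<^sub>v ev n q) (ev n (dual_index n p)) = sform n (ev n q) (g *\<^sub>v ev n (dual_index n p))"
    using Sp_sform[OF g Sp_mult_vec[OF ig, of "ev n q"], of "ev n (dual_index n p)"]
      Sp_inv_mult_vec(2)[OF g, of "ev n q"] by simp
  then have "(if p < n then 1 else - 1) * (inv\<^bsub>Sp n\<^esub> g) $$ (p, q) =
      (if q < n then 1 else - 1) * g $$ (dual_index n q, dual_index n p)"
    unfolding L R using mat_mult_unit_vec_index[OF Sp_carrier[OF ig] p q]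
      mat_mult_unit_vec_index[OF Sp_carrier[OF g] dual_index_less[OF q] dual_index_less[OF p]] by simp
  then show ?thesis by (cases "p < n"; cases "q < n") (simp_all add: minus_equation_iff[of "(inv\<^bsub>Sp n\<^esub> g) $$ (p, q)"])
qed

text \<open>The case \<open>r = 0\<close> is the Borel subgroup itself, \<open>r = 1\<close> its unipotent radical.\<close>

definition borel_filt :: "nat \<Rightarrow> nat \<Rightarrow> 'k::field mat set" where
  "borel_filt n r = {b \<in> carrier (Sp n). \<forall>p<2 * n. \<forall>q<2 * n. ht n q < ht n p + r \<longrightarrow> b $$ (p, q) = (if p = q then 1 else 0)}"

definition std_borel :: "nat \<Rightarrow> 'k::field mat set" where
  "std_borel n = borel_filt n 0"

lemma borel_filtD:
  assumes "b \<in> borel_filt n r"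
  shows "b \<in> carrier (Sp n)" "\<And>p q. p < 2 * n \<Longrightarrow> q < 2 * n \<Longrightarrow> ht n q < ht n p + r \<Longrightarrow> b $$ (p, q) = (if p = q then 1 else 0)"
  using assms by (auto simp: borel_filt_def)

lemma std_borel_iff:
  "b \<in> std_borel n \<longleftrightarrow> b \<in> carrier (Sp n) \<and> (\<forall>p<2 * n. \<forall>q<2 * n. ht n q < ht n p \<longrightarrow> b $$ (p, q) = 0)"
  unfolding std_borel_def borel_filt_def by (auto, metis less_irrefl)

section \<open>Solvability and closedness of the triangular group\<close>

lemma mat_mult_index_sum:
  assumes "A \<in> carrier_mat m m" "B \<in> carrier_mat m m" "p < m" "q < m"
  shows "(A * B) $$ (p, q) = (\<Sum>k<m. A $$ (p, k) * B $$ (k, q))"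
  using assms by (simp add: scalar_prod_def lessThan_atLeast0)

text \<open>\<open>A * B = A + B - 1 + (A - 1) * (B - 1)\<close> entrywise; in the last product
  height differences add up.\<close>

lemma mat_mult_index_unipotent:
  fixes A :: "'k::comm_ring_1 mat"
  assumes A: "A \<in> carrier_mat m m" and B: "B \<in> carrier_mat m m" and pq: "p < m" "q < m"
  shows "(A * B) $$ (p, q) = A $$ (p, q) + B $$ (p, q) - (if p = q then 1 else 0) +
    (\<Sum>k<m. (A $$ (p, k) - (if p = k then 1 else 0)) * (B $$ (k, q) - (if k = q then 1 else 0)))"
proof -
  have "(\<Sum>k<m. (A $$ (p, k) - (if p = k then 1 else 0)) * (B $$ (k, q) - (if k = q then 1 else 0))) =
    (\<Sum>k<m. A $$ (p, k) * B $$ (k, q)) - (\<Sum>k<m. if k = q then A $$ (p, k) else 0) -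
    (\<Sum>k<m. if k = p then B $$ (k, q) else 0) + (\<Sum>k<m. if k = p then if p = q then 1 else 0 else 0)"
    unfolding sum_subtractf[symmetric] sum.distrib[symmetric] by (rule sum.cong) (auto simp: algebra_simps)
  then show ?thesis using mat_mult_index_sum[OF A B pq] pq by simp
qed

lemma subgroup_borel_filt: "subgroup (borel_filt n r) (Sp n :: 'k::field mat monoid)"
proof
  show "borel_filt n r \<subseteq> carrier (Sp n :: 'k mat monoid)" by (auto simp: borel_filt_def)
  show "\<one>\<^bsub>Sp n\<^esub> \<in> (borel_filt n r :: 'k mat set)" by (auto simp: borel_filt_def Sp_one_closed)
next
  fix x y :: "'k mat" assume x: "x \<in> borel_filt n r" and y: "y \<in> borel_filt n r"
  note xD = borel_filtD[OF x] and yD = borel_filtD[OF y]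
  have "(x * y) $$ (p, q) = (if p = q then 1 else 0)" if pq: "p < 2 * n" "q < 2 * n" "ht n q < ht n p + r" for p q
  proof -
    have "(x $$ (p, k) - (if p = k then 1 else 0)) * (y $$ (k, q) - (if k = q then 1 else 0)) = 0" if k: "k < 2 * n" for k
      using xD(2)[OF pq(1) k] yD(2)[OF k pq(2)] pq(3) by fastforce
    then show ?thesis
      unfolding mat_mult_index_unipotent[OF Sp_carrier[OF xD(1)] Sp_carrier[OF yD(1)] pq(1,2)]
      using xD(2)[OF pq] yD(2)[OF pq] by (subst sum.neutral) auto
  qed
  then show "x \<otimes>\<^bsub>Sp n\<^esub> y \<in> borel_filt n r" using Sp_closed[OF xD(1) yD(1)] by (auto simp: borel_filt_def)
next
  fix x :: "'k mat" assume x: "x \<in> borel_filt n r"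
  note xD = borel_filtD[OF x]
  have "(inv\<^bsub>Sp n\<^esub> x) $$ (p, q) = (if p = q then 1 else 0)" if pq: "p < 2 * n" "q < 2 * n" "ht n q < ht n p + r" for p q
  proof -
    have "ht n (dual_index n p) < ht n (dual_index n q) + r"
      using pq ht_less[OF pq(1)] ht_less[OF pq(2)] by (simp add: ht_dual_index)
    then show ?thesis
      using xD(2)[OF dual_index_less[OF pq(2)] dual_index_less[OF pq(1)]] pq
      unfolding Sp_inv_index[OF xD(1) pq(1,2)] by (auto simp: dual_index_inj)
  qed
  then show "inv\<^bsub>Sp n\<^esub> x \<in> borel_filt n r" using Sp_inv_closed[OF xD(1)] by (auto simp: borel_filt_def)
qed

text \<open>The commutator is \<open>g * h\<close> times the inverse \<open>y\<close> of
  \<open>h * g\<close>. It suffices that \<open>g * h\<close> and \<open>h * g\<close> agree at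
  height differences up to \<open>r\<close>, because the triangular factor \<open>y\<close> only
  moves entries to larger height differences.\<close>

lemma borel_filt_commutator:
  fixes g h :: "'k::field mat"
  assumes g: "g \<in> borel_filt n r" and h: "h \<in> borel_filt n r"
  shows "g * h * inv\<^bsub>Sp n\<^esub> g * inv\<^bsub>Sp n\<^esub> h \<in> borel_filt n (Suc r)"
proof -
  interpret G: group "Sp n :: 'k mat monoid" by (rule group_Sp)
  let ?m = "2 * n"
  note gD = borel_filtD[OF g] and hD = borel_filtD[OF h]
  have carr: "g \<in> carrier_mat ?m ?m" "h \<in> carrier_mat ?m ?m" using gD hD Sp_carrier by blast+
  define y where "y = inv\<^bsub>Sp n\<^esub> (h * g)"
  have hg: "h * g \<in> borel_filt n r" using subgroup.m_closed[OF subgroup_borel_filt h g] by simp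
  have y: "y \<in> borel_filt n r" unfolding y_def using subgroup.m_inv_closed[OF subgroup_borel_filt hg] .
  note yD = borel_filtD[OF y]
  have ym: "y \<in> carrier_mat ?m ?m" using Sp_carrier[OF yD(1)] .
  have hgm: "h * g \<in> carrier_mat ?m ?m" "g * h \<in> carrier_mat ?m ?m" using carr by auto
  have \<Delta>: "(g * h) $$ (p, q) = (h * g) $$ (p, q)" if pq: "p < ?m" "q < ?m" "ht n q < ht n p + Suc r" for p q
  proof -
    have "(g $$ (p, k) - (if p = k then 1 else 0)) * (h $$ (k, q) - (if k = q then 1 else 0)) =
       (h $$ (p, k) - (if p = k then 1 else 0)) * (g $$ (k, q) - (if k = q then 1 else 0))" if k: "k < ?m" for k
    proof (cases "ht n k < ht n p + r \<or> ht n q < ht n k + r")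
      case True
      then show ?thesis using gD(2)[OF pq(1) k] gD(2)[OF k pq(2)] hD(2)[OF pq(1) k] hD(2)[OF k pq(2)] by auto
    next
      case False
      \<comment> \<open>The remaining case forces \<open>r = 0\<close> and equal heights, that is
        the product of two diagonal entries, which commute.\<close>
      then have "ht n p = ht n k" "ht n q = ht n k" using pq(3) by linarith+
      then have "p = k" "q = k" using ht_inj pq(1,2) k by blast+
      then show ?thesis by simp
    qed
    then have "(\<Sum>k<?m. (g $$ (p, k) - (if p = k then 1 else 0)) * (h $$ (k, q) - (if k = q then 1 else 0))) =
        (\<Sum>k<?m. (h $$ (p, k) - (if p = k then 1 else 0)) * (g $$ (k, q) - (if k = q then 1 else 0)))"
      by (intro sum.cong) auto
    then show ?thesis
      unfolding mat_mult_index_unipotent[OF carr pq(1,2)] mat_mult_index_unipotent[OF carr(2,1) pq(1,2)] by simp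
  qed
  have "g \<otimes>\<^bsub>Sp n\<^esub> h \<otimes>\<^bsub>Sp n\<^esub> inv\<^bsub>Sp n\<^esub> g \<otimes>\<^bsub>Sp n\<^esub> inv\<^bsub>Sp n\<^esub> h = g \<otimes>\<^bsub>Sp n\<^esub> h \<otimes>\<^bsub>Sp n\<^esub> inv\<^bsub>Sp n\<^esub> (h \<otimes>\<^bsub>Sp n\<^esub> g)"
    using gD(1) hD(1) by (simp add: G.inv_mult_group G.m_assoc del: Sp_mult)
  then have eq: "g * h * inv\<^bsub>Sp n\<^esub> g * inv\<^bsub>Sp n\<^esub> h = g * h * y" by (simp add: y_def)
  have one: "h * g * y = 1\<^sub>m ?m" unfolding y_def using Sp_inv_mult(2)[OF borel_filtD(1)[OF hg]] .
  have "(g * h * y) $$ (p, q) = (if p = q then 1 else 0)" if pq: "p < ?m" "q < ?m" "ht n q < ht n p + Suc r" for p q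
  proof -
    have "(g * h) $$ (p, k) * y $$ (k, q) = (h * g) $$ (p, k) * y $$ (k, q)" if k: "k < ?m" for k
    proof (cases "ht n k < ht n p + Suc r")
      case True
      then show ?thesis using \<Delta>[OF pq(1) k] by simp
    next
      case False
      then have "ht n q < ht n k" using pq(3) by simp
      moreover from this have "k \<noteq> q" by auto
      ultimately show ?thesis using yD(2)[OF k pq(2)] by simp
    qed
    then have "(g * h * y) $$ (p, q) = (h * g * y) $$ (p, q)"
      unfolding mat_mult_index_sum[OF hgm(1) ym pq(1,2)] mat_mult_index_sum[OF hgm(2) ym pq(1,2)] by (intro sum.cong) auto
    then show ?thesis using one pq by simp
  qed
  moreover have "g * h * y \<in> carrier (Sp n)" using Sp_closed[OF Sp_closed[OF gD(1) hD(1)] yD(1)] .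
  ultimately show ?thesis unfolding eq by (auto simp: borel_filt_def)
qed

text \<open>Each derived subgroup climbs one step of the filtration, and height differences are
  below \<open>2 * n\<close>, so step \<open>2 * n\<close> is trivial.\<close>

lemma solvable_std_borel: "solvable (Sp n\<lparr>carrier := std_borel n :: 'k::field mat set\<rparr>)"
proof -
  let ?G = "Sp n :: 'k mat monoid" and ?B = "std_borel n :: 'k mat set"
  interpret G: group ?G by (rule group_Sp)
  have B: "subgroup ?B ?G" unfolding std_borel_def by (rule subgroup_borel_filt)
  interpret K: group "?G\<lparr>carrier := ?B\<rparr>" using G.subgroup_imp_group[OF B] .
  have *: "(derived ?G ^^ k) ?B \<subseteq> borel_filt n k" for k
  proof (induction k)
    case 0
    show ?case by (simp add: std_borel_def)
  next
    case (Suc k)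
    have "derived ?G (borel_filt n k) \<subseteq> borel_filt n (Suc k)"
      unfolding derived_def
      by (rule G.generate_subgroup_incl[OF _ subgroup_borel_filt]) (use borel_filt_commutator in auto)
    then show ?case using G.mono_derived[OF Suc] by simp
  qed
  have "borel_filt n (2 * n) \<subseteq> {1\<^sub>m (2 * n) :: 'k mat}"
  proof
    fix b :: "'k mat" assume b: "b \<in> borel_filt n (2 * n)"
    have "b = 1\<^sub>m (2 * n)"
      using borel_filtD(2)[OF b] Sp_carrier[OF borel_filtD(1)[OF b]] ht_less
      by (intro eq_matI) (auto simp: trans_less_add2)
    then show "b \<in> {1\<^sub>m (2 * n)}" by simp
  qed
  then have "(derived ?G ^^ (2 * n)) ?B \<subseteq> {\<one>\<^bsub>?G\<^esub>}" using * by fastforce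
  moreover have "\<one>\<^bsub>?G\<^esub> \<in> (derived ?G ^^ (2 * n)) ?B"
    using subgroup.one_closed[OF G.exp_of_derived_is_subgroup[OF B]] .
  ultimately have eq: "(derived ?G ^^ (2 * n)) ?B = {\<one>\<^bsub>?G\<^esub>}" by blast
  have sub: "(derived ?G ^^ k) ?B \<subseteq> ?B" for k
    by (induction k) (auto dest: subsetD[OF G.derived_incl[OF _ B]])
  have "(derived (?G\<lparr>carrier := ?B\<rparr>) ^^ k) ?B = (derived ?G ^^ k) ?B" for k
    by (induction k) (use G.derived_consistent[OF sub B] in auto)
  then show ?thesis using K.solvable_iff_trivial_derived_seq eq by auto
qed

lemma closedin_std_borel:
  "closedin (subtopology (zariski (2 * n)) (carrier (Sp n))) (std_borel n :: 'k::field mat set)"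
proof -
  let ?S = "{\<lambda>A :: 'k mat. A $$ (p, q) | p q. p < 2 * n \<and> q < 2 * n \<and> ht n q < ht n p}"
  have "closedin (zariski (2 * n)) {A \<in> carrier_mat (2 * n) (2 * n). \<forall>f\<in>?S. f A = 0}"
    unfolding closedin_zariski by (rule exI[of _ ?S]) (auto intro: mat_polyfun.entry)
  moreover have "std_borel n = {A \<in> carrier_mat (2 * n) (2 * n). \<forall>f\<in>?S. f A = 0} \<inter> carrier (Sp n :: 'k mat monoid)"
  proof (intro equalityI subsetI)
    fix A :: "'k mat" assume "A \<in> std_borel n"
    then show "A \<in> {A \<in> carrier_mat (2 * n) (2 * n). \<forall>f\<in>?S. f A = 0} \<inter> carrier (Sp n)"
      using Sp_carrier[of A n] by (auto simp: std_borel_iff)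
  next
    fix A :: "'k mat" assume A: "A \<in> {A \<in> carrier_mat (2 * n) (2 * n). \<forall>f\<in>?S. f A = 0} \<inter> carrier (Sp n)"
    have "A $$ (p, q) = 0" if "p < 2 * n" "q < 2 * n" "ht n q < ht n p" for p q
    proof -
      have mem: "(\<lambda>A. A $$ (p, q)) \<in> ?S" using that by blast
      from A have "\<forall>f\<in>?S. f A = 0" by (elim IntE CollectE conjE)
      from bspec[OF this mem] show ?thesis .
    qed
    then show "A \<in> std_borel n" using A by (auto simp: std_borel_iff)
  qed
  ultimately show ?thesis unfolding closedin_subtopology by blast
qed

section \<open>Connectedness of the triangular group\<close>

lemma std_borel_carrier: "b \<in> std_borel n \<Longrightarrow> b \<in> carrier_mat (2 * n) (2 * n)"
  using Sp_carrier by (auto simp: std_borel_iff)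

lemma dmat_std_borel:
  assumes "\<And>i. i < n \<Longrightarrow> t i \<noteq> (0 :: 'k::field)" shows "dmat n t \<in> std_borel n"
  using dmat_Sp[of n t] assms unfolding std_borel_iff by (auto simp: dmat_def)

lemma ht_dual_cases:
  assumes "i < 2 * n" "j < 2 * n"
  shows "symp_form n $$ (i, j) \<noteq> 0 \<Longrightarrow> ht n i + ht n j = 2 * n - 1"
  using assms by (auto simp: symp_form_index ht_def split: if_splits)

lemma std_borel_entry_ht:
  "b \<in> std_borel n \<Longrightarrow> p < 2 * n \<Longrightarrow> q < 2 * n \<Longrightarrow> b $$ (p, q) \<noteq> 0 \<Longrightarrow> ht n p \<le> ht n q"
  unfolding std_borel_iff by (meson not_less)

lemma transpose_symp_form_index:
  fixes g :: "'k::comm_ring_1 mat"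
  assumes g: "g \<in> carrier_mat (2 * n) (2 * n)" and ij: "i < 2 * n" "j < 2 * n"
  shows "(transpose_mat g * symp_form n * g) $$ (i, j) =
    (\<Sum>k<2 * n. \<Sum>l<2 * n. g $$ (k, i) * symp_form n $$ (k, l) * g $$ (l, j))"
proof -
  let ?m = "2 * n"
  have gt: "transpose_mat g \<in> carrier_mat ?m ?m" and J: "(symp_form n :: 'k mat) \<in> carrier_mat ?m ?m" using g by auto
  have "(transpose_mat g * symp_form n * g) $$ (i, j) = (\<Sum>l<?m. (transpose_mat g * symp_form n) $$ (i, l) * g $$ (l, j))"
    by (rule mat_mult_index_sum[OF mult_carrier_mat[OF gt J] g ij])
  also have "\<dots> = (\<Sum>l<?m. \<Sum>k<?m. g $$ (k, i) * symp_form n $$ (k, l) * g $$ (l, j))"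
    using mat_mult_index_sum[OF gt J ij(1)] g ij by (simp add: sum_distrib_right)
  also have "\<dots> = (\<Sum>k<?m. \<Sum>l<?m. g $$ (k, i) * symp_form n $$ (k, l) * g $$ (l, j))" by (rule sum.swap)
  finally show ?thesis .
qed

text \<open>
  Conjugation by \<open>diag(t\<^sup>h)\<close>, where \<open>h\<close> is the height, contracts the Borel subgroup
  to its torus as \<open>t \<rightarrow> 0\<close>; the entries of the conjugate are polynomials in \<open>t\<close>.
\<close>

lemma connectedin_std_borel:
  "connectedin (zariski (2 * n)) (std_borel n :: 'k::alg_closed_field mat set)"
proof (rule connectedin_if_connected_component_of)
  let ?m = "2 * n" and ?B = "std_borel n :: 'k mat set"
  have Bm: "?B \<subseteq> carrier_mat ?m ?m" using std_borel_carrier by blast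
  then show "?B \<subseteq> topspace (zariski ?m)" by simp
  fix b :: "'k mat" assume b: "b \<in> ?B"
  have bS: "b \<in> carrier (Sp n)" and bm: "b \<in> carrier_mat ?m ?m" using b Bm by (auto simp: std_borel_iff)
  have bJ: "transpose_mat b * symp_form n * b = symp_form n" using bS by (simp add: Sp_def)
  \<comment> \<open>Truncated subtraction is harmless: where \<open>ht n q < ht n p\<close> the
    entry of \<open>b\<close> is zero. The curve is polynomial, so that \<open>t = 0\<close> is
    allowed.\<close>
  define \<gamma> where "\<gamma> t = mat ?m ?m (\<lambda>(p, q). b $$ (p, q) * t ^ (ht n q - ht n p))" for t
  have \<gamma>m: "\<gamma> t \<in> carrier_mat ?m ?m" for t by (simp add: \<gamma>_def)
  have \<gamma>B: "\<gamma> t \<in> ?B" for t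
  proof -
    have "(transpose_mat (\<gamma> t) * symp_form n * \<gamma> t) $$ (i, j) = symp_form n $$ (i, j)" if ij: "i < ?m" "j < ?m" for i j
    proof -
      have "(transpose_mat (\<gamma> t) * symp_form n * \<gamma> t) $$ (i, j) =
          (\<Sum>k<?m. \<Sum>l<?m. t ^ (ht n i + ht n j - (2 * n - 1)) * (b $$ (k, i) * symp_form n $$ (k, l) * b $$ (l, j)))"
        unfolding transpose_symp_form_index[OF \<gamma>m ij]
      proof (intro sum.cong refl)
        fix k l assume "k \<in> {..<?m}" "l \<in> {..<?m}"
        then have kl: "k < ?m" "l < ?m" by auto
        show "\<gamma> t $$ (k, i) * symp_form n $$ (k, l) * \<gamma> t $$ (l, j) =
          t ^ (ht n i + ht n j - (2 * n - 1)) * (b $$ (k, i) * symp_form n $$ (k, l) * b $$ (l, j))"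
        proof (cases "b $$ (k, i) = 0 \<or> (symp_form n $$ (k, l) :: 'k) = 0 \<or> b $$ (l, j) = 0")
          case True
          then show ?thesis using kl ij by (auto simp: \<gamma>_def)
        next
          case False
          \<comment> \<open>Indices paired by the form have heights adding up to
            \<open>2 * n - 1\<close>, so the exponent depends on \<open>i\<close> and
            \<open>j\<close> only and factors out of the double sum.\<close>
          then have "ht n k \<le> ht n i" "ht n l \<le> ht n j" "ht n k + ht n l = 2 * n - 1"
            using std_borel_entry_ht[OF b] kl ij ht_dual_cases by blast+
          then have "ht n i + ht n j - (2 * n - 1) = (ht n i - ht n k) + (ht n j - ht n l)" by linarith
          then show ?thesis using kl ij by (simp add: \<gamma>_def power_add mult_ac)
        qed
      qed
      also have "\<dots> = t ^ (ht n i + ht n j - (2 * n - 1)) * symp_form n $$ (i, j)"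
        unfolding sum_distrib_left[symmetric] transpose_symp_form_index[OF bm ij, symmetric] bJ ..
      also have "\<dots> = symp_form n $$ (i, j)"
        using ht_dual_cases[OF ij, where ?'a = 'k] by (cases "(symp_form n $$ (i, j) :: 'k) = 0") auto
      finally show ?thesis .
    qed
    then have "transpose_mat (\<gamma> t) * symp_form n * \<gamma> t = symp_form n"
      using carrier_matD[OF \<gamma>m[of t]] carrier_matD[of "symp_form n :: 'k mat" ?m ?m] by (intro eq_matI) auto
    then have "\<gamma> t \<in> carrier (Sp n)" using \<gamma>m by (simp add: Sp_def)
    then show ?thesis using b by (auto simp: std_borel_iff \<gamma>_def)
  qed
  have "rational_curve ?m {} \<gamma>"
    unfolding rational_curve_def
  proof (intro conjI allI impI)
    fix p q assume "p < ?m" "q < ?m"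
    then show "(\<lambda>t. \<gamma> t $$ (p, q)) \<in> rational_fun {}"
      by (simp add: \<gamma>_def) (intro rational_fun_mult rational_fun_const rational_fun_power rational_fun_id)
  qed simp
  from connected_component_of_rational_curve[OF this Bm \<gamma>B, of 0 1]
  have "connected_component_of (subtopology (zariski ?m) ?B) (\<gamma> 0) (\<gamma> 1)" by simp
  moreover have "\<gamma> 1 = b" using bm by (intro eq_matI) (auto simp: \<gamma>_def)
  moreover define d where "d i = b $$ (i, i)" for i
  \<comment> \<open>Both factors of \<open>inv b * b\<close> are triangular, so only the diagonal
    term contributes to a diagonal entry. Hence the endpoint \<open>\<gamma> 0\<close> has
    reciprocal entries and lies in the torus.\<close>
  have dd: "b $$ (i, i) * b $$ (n + i, n + i) = 1" if i: "i < n" for i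
  proof -
    have "(1 :: 'k) = (inv\<^bsub>Sp n\<^esub> b * b) $$ (i, i)" using Sp_inv_mult(1)[OF bS] i by simp
    also have "\<dots> = (\<Sum>k<?m. (inv\<^bsub>Sp n\<^esub> b) $$ (i, k) * b $$ (k, i))"
      using i by (intro mat_mult_index_sum[OF Sp_carrier[OF Sp_inv_closed[OF bS]] bm]) auto
    also have "\<dots> = (\<Sum>k<?m. if k = i then (inv\<^bsub>Sp n\<^esub> b) $$ (i, i) * b $$ (i, i) else 0)"
    proof (intro sum.cong refl)
      fix k assume "k \<in> {..<?m}"
      then have k: "k < ?m" by simp
      have ib: "inv\<^bsub>Sp n\<^esub> b \<in> ?B"
        using subgroup.m_inv_closed[OF subgroup_borel_filt[of n 0], of b] b unfolding std_borel_def by simp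
      have "ht n i = ht n k" if "(inv\<^bsub>Sp n\<^esub> b) $$ (i, k) * b $$ (k, i) \<noteq> 0"
        using std_borel_entry_ht[OF ib _ k, of i] std_borel_entry_ht[OF b k, of i] that i by (auto intro: le_antisym)
      then show "(inv\<^bsub>Sp n\<^esub> b) $$ (i, k) * b $$ (k, i) = (if k = i then (inv\<^bsub>Sp n\<^esub> b) $$ (i, i) * b $$ (i, i) else 0)"
        using ht_inj[of i n k] i k by auto
    qed
    also have "\<dots> = (inv\<^bsub>Sp n\<^esub> b) $$ (i, i) * b $$ (i, i)" using i by simp
    also have "(inv\<^bsub>Sp n\<^esub> b) $$ (i, i) = b $$ (n + i, n + i)"
      using Sp_inv_index[OF bS, of i i] i by (simp add: dual_index_def)
    finally show ?thesis by (simp add: mult.commute)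
  qed
  have d0: "d i \<noteq> 0" if "i < n" for i using dd[OF that] unfolding d_def by auto
  have "\<gamma> 0 = dmat n d"
  proof (rule eq_matI)
    fix p q assume "p < dim_row (dmat n d)" "q < dim_col (dmat n d)"
    then have pq: "p < ?m" "q < ?m" by (simp_all add: dmat_def)
    show "\<gamma> 0 $$ (p, q) = dmat n d $$ (p, q)"
    proof (cases "p = q")
      case True
      show ?thesis
      proof (cases "p < n")
        case True
        then show ?thesis using pq \<open>p = q\<close> by (simp add: \<gamma>_def dmat_def d_def)
      next
        case False
        then have "p - n < n" "n + (p - n) = p" using pq by simp_all
        then have "b $$ (p, p) = inverse (d (p - n))"
          using dd[of "p - n"] pq inverse_unique[of "b $$ (p - n, p - n)"] by (simp add: d_def)
        then show ?thesis using False pq \<open>p = q\<close> by (simp add: \<gamma>_def dmat_def)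
      qed
    next
      case False
      have "b $$ (p, q) = 0 \<or> ht n q - ht n p \<noteq> 0"
        using std_borel_entry_ht[OF b pq] ht_inj[OF pq] False by fastforce
      then show ?thesis using False pq by (auto simp: \<gamma>_def dmat_def power_0_left)
    qed
  qed (simp_all add: \<gamma>_def dmat_def)
  moreover have "connected_component_of (subtopology (zariski ?m) ?B) (1\<^sub>m ?m) (dmat n d)"
  proof -
    \<comment> \<open>The line from 1 to \<open>d i\<close> has to avoid 0; the finitely many bad
      parameters are removed. They include neither 0 nor 1.\<close>
    define S where "S = (\<Union>i<n. {t. 1 + t * (d i - 1) = 0})"
    have fin: "finite S"
      unfolding S_def
    proof (intro finite_UN_I)
      fix i assume "i \<in> {..<n}"
      show "finite {t. 1 + t * (d i - 1) = 0}"
        using poly_roots_finite[of "[:1, d i - 1:]"] by simp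
    qed simp
    have nz: "1 + t * (d i - 1) \<noteq> 0" if "t \<notin> S" "i < n" for t i using that unfolding S_def by blast
    define \<delta> where "\<delta> t = dmat n (\<lambda>i. 1 + t * (d i - 1))" for t
    have "rational_curve ?m S \<delta>"
      unfolding rational_curve_def
    proof (intro conjI allI impI fin)
      fix p q assume pq: "p < ?m" "q < ?m"
      have f: "(\<lambda>t. 1 + t * (d i - 1)) \<in> rational_fun S" for i
        by (intro rational_fun_add rational_fun_mult rational_fun_const rational_fun_id)
      have "(\<lambda>t. inverse (1 + t * (d (p - n) - 1))) \<in> rational_fun S" if "\<not> p < n"
        using pq that by (intro rational_fun_inverse f nz) auto
      then show "(\<lambda>t. \<delta> t $$ (p, q)) \<in> rational_fun S"
        using pq f rational_fun_const by (cases "p = q"; cases "p < n") (auto simp: \<delta>_def dmat_def)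
    qed
    moreover have "\<delta> t \<in> ?B" if "t \<notin> S" for t unfolding \<delta>_def using nz[OF that] by (intro dmat_std_borel)
    moreover have "0 \<notin> S" "1 \<notin> S" using d0 unfolding S_def by auto
    ultimately have "connected_component_of (subtopology (zariski ?m) ?B) (\<delta> 0) (\<delta> 1)"
      by (intro connected_component_of_rational_curve[where S = S] Bm)
    moreover have "\<delta> 0 = 1\<^sub>m ?m" "\<delta> 1 = dmat n d" by (auto simp: \<delta>_def dmat_def intro!: eq_matI)
    ultimately show ?thesis by simp
  qed
  ultimately show "connected_component_of (subtopology (zariski ?m) ?B) (1\<^sub>m ?m) b"
    using connected_component_of_trans by metis
qed

section \<open>Root elements and maximality of the standard Borel subgroup\<close>

lemma transvection_std_borel:
  assumes j: "j < n" shows "transvection n (ev n j) (c :: 'k::field) \<in> std_borel n"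
  unfolding std_borel_iff
proof (intro conjI allI impI)
  fix p q assume pq: "p < 2 * n" "q < 2 * n" "ht n q < ht n p"
  then have "p \<noteq> q" by auto
  moreover have "ev n j $ p * sform n (ev n j) (ev n q) = (0 :: 'k)"
    using pq j by (auto simp: sform_unit_vec ht_def split: if_splits)
  ultimately show "transvection n (ev n j) c $$ (p, q) = 0"
    using pq by (simp add: transvection_def skew_mat_def)
qed (rule transvection_Sp, simp)

text \<open>A Siegel transformation. With \<open>u = ev n j\<close> and \<open>v\<close> in the tail
  space beyond \<open>j\<close> it provides the elements of the Borel subgroup that mix different
  hyperbolic pairs, which transvections along \<open>ev n j\<close> do not.\<close>

definition siegel :: "nat \<Rightarrow> 'k::comm_ring_1 vec \<Rightarrow> 'k vec \<Rightarrow> 'k mat" where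
  "siegel n u v = 1\<^sub>m (2 * n) + (skew_mat n v u + skew_mat n u v)"

lemma siegel_mult_vec:
  assumes u: "u \<in> carrier_vec (2 * n)" and v: "v \<in> carrier_vec (2 * n)" and z: "z \<in> carrier_vec (2 * n)"
  shows "siegel n u v *\<^sub>v z = z + (sform n u z \<cdot>\<^sub>v v + sform n v z \<cdot>\<^sub>v u)"
  using u v z unfolding siegel_def
  by (simp add: add_mult_distrib_mat_vec[of _ "2 * n" "2 * n"] skew_mat_mult_vec)

lemma siegel_Sp:
  fixes u :: "'k::field vec"
  assumes u: "u \<in> carrier_vec (2 * n)" and v: "v \<in> carrier_vec (2 * n)" and uv: "sform n u v = 0"
  shows "siegel n u v \<in> carrier (Sp n)"
  unfolding Sp_iff
proof (intro conjI ballI)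
  fix x y :: "'k vec" assume x: "x \<in> carrier_vec (2 * n)" and y: "y \<in> carrier_vec (2 * n)"
  have "sform n v u = 0" using uv sform_swap[of n v u] by simp
  then show "sform n (siegel n u v *\<^sub>v x) (siegel n u v *\<^sub>v y) = sform n x y"
    using u v x y uv sform_swap[of n u x] sform_swap[of n v x]
    by (simp add: siegel_mult_vec sform_add_left sform_add_right sform_smult_left sform_smult_right algebra_simps)
qed (simp add: siegel_def)

lemma siegel_std_borel:
  assumes j: "j < n" and w: "w \<in> tail_space n (Suc j)"
  shows "siegel n (ev n j) w \<in> std_borel (n :: nat)"
  unfolding std_borel_iff
proof (intro conjI allI impI)
  have wc: "w \<in> carrier_vec (2 * n)" using tail_space_carrier[OF w] .
  have w0: "w $ i = 0" "w $ (n + i) = 0" if "i \<le> j" for i using w that unfolding tail_space_def by auto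
  show "siegel n (ev n j) w \<in> carrier (Sp n)"
    using j w0[of j] wc by (intro siegel_Sp) (auto simp: sform_unit_vec)
  fix p q assume pq: "p < 2 * n" "q < 2 * n" "ht n q < ht n p"
  have "p \<noteq> q" using pq by auto
  moreover have "w $ p * sform n (ev n j) (ev n q) = 0"
  proof (cases "q = n + j")
    case True
    then have "\<not> p < n" "p - n \<le> j" using pq j by (auto simp: ht_def split: if_splits)
    then show ?thesis using w0(2)[of "p - n"] by simp
  qed (use pq j in \<open>simp add: sform_unit_vec\<close>)
  moreover have "(ev n j :: 'a vec) $ p * sform n w (ev n q) = 0"
  proof (cases "p = j")
    case True
    then have "q < j" using pq j by (auto simp: ht_def split: if_splits)
    then show ?thesis using w0(2)[of q] j by (simp add: sform_unit_vec)
  qed (use pq j in simp)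
  ultimately show "siegel n (ev n j) w $$ (p, q) = 0"
    using pq by (auto simp: siegel_def skew_mat_def)
qed

definition flag_space :: "nat \<Rightarrow> nat \<Rightarrow> 'k::field vec set" where
  "flag_space n r = {v \<in> carrier_vec (2 * n). \<forall>p<2 * n. r \<le> p \<longrightarrow> v $ p = 0}"

text \<open>For \<open>r \<le> n\<close> the orthogonal complement of \<open>flag_space n r\<close>,
  written in coordinates.\<close>

definition flag_perp :: "nat \<Rightarrow> nat \<Rightarrow> 'k::field vec set" where
  "flag_perp n r = {v \<in> carrier_vec (2 * n). \<forall>j<r. v $ (n + j) = 0}"

lemma vec_subspace_flag_space: "vec_subspace (2 * n) (flag_space n r)"
  unfolding vec_subspace_def flag_space_def by auto

lemma vec_subspace_flag_perp: "r \<le> n \<Longrightarrow> vec_subspace (2 * n) (flag_perp n r)"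
  unfolding vec_subspace_def flag_perp_def by auto

lemma unit_vec_flag_space: "j < r \<Longrightarrow> r \<le> n \<Longrightarrow> ev n j \<in> flag_space n r"
  unfolding flag_space_def by auto

lemma sform_perp_flag_perp:
  assumes r: "r \<le> n" shows "sform_perp n (flag_perp n r) = (flag_space n r :: 'k::field vec set)"
proof (intro equalityI subsetI)
  fix v :: "'k vec" assume v: "v \<in> sform_perp n (flag_perp n r)"
  then have vc: "v \<in> carrier_vec (2 * n)" and z: "\<And>z. z \<in> flag_perp n r \<Longrightarrow> sform n v z = 0"
    by (auto simp: sform_perp_def)
  have "v $ p = 0" if p: "p < 2 * n" "r \<le> p" for p
  proof (cases "p < n")
    case True
    then have "ev n (n + p) \<in> (flag_perp n r :: 'k vec set)" using p r unfolding flag_perp_def by auto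
    then show ?thesis using z[of "ev n (n + p)"] True by (simp add: sform_unit_vec)
  next
    case False
    then have q: "p - n < n" "n + (p - n) = p" using p by simp_all
    have "ev n (p - n) \<in> (flag_perp n r :: 'k vec set)" using q r unfolding flag_perp_def by auto
    then show ?thesis using z[of "ev n (p - n)"] sform_unit_vec(1)[OF q(1), of v] q(2) by simp
  qed
  then show "v \<in> flag_space n r" using vc unfolding flag_space_def by blast
next
  fix v :: "'k vec" assume v: "v \<in> flag_space n r"
  have "sform n v z = 0" if z: "z \<in> flag_perp n r" for z
    unfolding sform_def
  proof (intro sum.neutral ballI)
    fix i assume "i \<in> {..<n}"
    then have i: "i < n" by simp
    show "v $ i * z $ (n + i) - v $ (n + i) * z $ i = 0"
      using v z i r unfolding flag_space_def flag_perp_def by (cases "i < r") auto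
  qed
  then show "v \<in> sform_perp n (flag_perp n r)" using v unfolding flag_space_def sform_perp_def by blast
qed

text \<open>A transvection adds \<open>w $ (n + j)\<close> times \<open>ev n j\<close>, and a Siegel
  element built from \<open>ev n (n + j)\<close> adds \<open>- (w $ j)\<close> times
  \<open>ev n r\<close>. Comparing two coordinates shows that such a coordinate is zero, both for
  \<open>c = 1\<close> and for \<open>c \<noteq> 1\<close>.\<close>

lemma std_borel_eigenvector:
  fixes w :: "'k::field vec"
  assumes r: "r < n" and w: "w \<in> flag_perp n r"
    and eig: "\<And>b. b \<in> std_borel n \<Longrightarrow> \<exists>c. apply_factor b w c \<in> flag_space n r"
  shows "w \<in> flag_space n (Suc r)"
proof -
  have wc: "w \<in> carrier_vec (2 * n)" using w by (simp add: flag_perp_def)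
  have f: "w $ (n + j) = 0" if j: "j < n" for j
  proof (cases "j < r")
    case True
    then show ?thesis using w by (simp add: flag_perp_def)
  next
    case False
    obtain c where c: "apply_factor (transvection n (ev n j) 1) w c \<in> flag_space n r"
      using eig[OF transvection_std_borel[OF j]] by blast
    have e: "transvection n (ev n j) 1 *\<^sub>v w = w + w $ (n + j) \<cdot>\<^sub>v ev n j"
      using wc j by (simp add: transvection_mult_vec sform_unit_vec)
    have "apply_factor (transvection n (ev n j) 1) w c $ (n + j) = 0"
      "apply_factor (transvection n (ev n j) 1) w c $ j = 0"
      using c j False r unfolding flag_space_def by auto
    then have "(1 - c) * w $ (n + j) = 0" "(1 - c) * w $ j + w $ (n + j) = 0"
      unfolding e using wc j by (auto simp: algebra_simps)
    then show ?thesis by auto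
  qed
  have g: "w $ j = 0" if j: "r < j" "j < n" for j
  proof -
    have t: "ev n (n + j) \<in> (tail_space n (Suc r) :: 'k vec set)" using j by (intro unit_vec_tail_space) auto
    obtain c where c: "apply_factor (siegel n (ev n r) (ev n (n + j))) w c \<in> flag_space n r"
      using eig[OF siegel_std_borel[OF r t]] by blast
    have e: "siegel n (ev n r) (ev n (n + j)) *\<^sub>v w = w + (w $ (n + r) \<cdot>\<^sub>v ev n (n + j) + (- (w $ j)) \<cdot>\<^sub>v ev n r)"
      using wc j r by (simp add: siegel_mult_vec sform_unit_vec)
    have "apply_factor (siegel n (ev n r) (ev n (n + j))) w c $ j = 0"
      "apply_factor (siegel n (ev n r) (ev n (n + j))) w c $ r = 0"
      using c j r unfolding flag_space_def by auto
    then have "(1 - c) * w $ j = 0" "(1 - c) * w $ r - w $ j = 0"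
      unfolding e using wc j r by (auto simp: algebra_simps)
    then show ?thesis by auto
  qed
  show ?thesis
    unfolding flag_space_def
  proof (intro CollectI conjI allI impI wc)
    fix p assume p: "p < 2 * n" "Suc r \<le> p"
    show "w $ p = 0" using f[of "p - n"] g[of p] p by (cases "p < n") auto
  qed
qed

text \<open>Lie--Kolchin gives an eigenvector of \<open>H\<close> in \<open>flag_perp n r\<close>
  modulo \<open>flag_space n r\<close>. It is also one for the standard Borel subgroup, and these
  lie in the next step of the flag; so \<open>H\<close> stabilizes the standard flag step by
  step.\<close>

lemma std_borel_maximal:
  fixes H :: "'k::alg_closed_field mat set"
  assumes H: "closed_connected_solvable (2 * n) (Sp n) H" and BH: "std_borel n \<subseteq> H"
  shows "H = std_borel n"
proof -
  have sub: "subgroup H (Sp n)" and conn: "connectedin (zariski (2 * n)) H" and solv: "solvable (Sp n\<lparr>carrier := H\<rparr>)"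
    using H unfolding closed_connected_solvable_def by auto
  have HG: "h \<in> carrier (Sp n)" if "h \<in> H" for h using subgroup.subset[OF sub] that by blast
  have Hinv: "inv\<^bsub>Sp n\<^esub> h \<in> H" if "h \<in> H" for h using subgroup.m_inv_closed[OF sub that] .
  have stable: "\<forall>h\<in>H. \<forall>v\<in>flag_space n r. h *\<^sub>v v \<in> flag_space n r" if "r \<le> n" for r
    using that
  proof (induction r)
    case 0
    have "flag_space n 0 = {0\<^sub>v (2 * n) :: 'k vec}" unfolding flag_space_def by (auto intro!: eq_vecI)
    moreover have "h *\<^sub>v 0\<^sub>v (2 * n) = 0\<^sub>v (2 * n)" if "h \<in> H" for h
      using Sp_carrier[OF HG[OF that]] by (intro eq_vecI) auto
    ultimately show ?case by simp
  next
    case (Suc r)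
    then have r: "r < n" and IH: "\<And>h v. h \<in> H \<Longrightarrow> v \<in> flag_space n r \<Longrightarrow> h *\<^sub>v v \<in> flag_space n r" by auto
    let ?W1 = "flag_perp n r :: 'k vec set" and ?W0 = "flag_space n r :: 'k vec set"
    have perp: "sform_perp n ?W1 = ?W0" using sform_perp_flag_perp[of r n] r by simp
    have W1H: "h *\<^sub>v z \<in> ?W1" if h: "h \<in> H" and z: "z \<in> ?W1" for h z
      unfolding flag_perp_def
    proof (intro CollectI conjI allI impI)
      have zc: "z \<in> carrier_vec (2 * n)" using z by (simp add: flag_perp_def)
      show "h *\<^sub>v z \<in> carrier_vec (2 * n)" using Sp_mult_vec[OF HG[OF h] zc] .
      fix j assume j: "j < r"
      have "inv\<^bsub>Sp n\<^esub> h *\<^sub>v ev n j \<in> ?W0" using IH[OF Hinv[OF h] unit_vec_flag_space[OF j]] r by simp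
      then have "sform n (inv\<^bsub>Sp n\<^esub> h *\<^sub>v ev n j) z = 0"
        using z unfolding perp[symmetric] sform_perp_def by blast
      then have "sform n z (inv\<^bsub>Sp n\<^esub> h *\<^sub>v ev n j) = 0" using sform_swap[of n z] by simp
      then have "sform n (h *\<^sub>v z) (ev n j) = 0" using Sp_sform_inv[OF HG[OF h] zc, of "ev n j"] by simp
      then show "(h *\<^sub>v z) $ (n + j) = 0" using j r by (simp add: sform_unit_vec)
    qed
    have "ev n r \<in> ?W1" "ev n r \<notin> ?W0" using r unfolding flag_perp_def flag_space_def by auto
    moreover have "?W0 \<subseteq> ?W1" using r unfolding flag_perp_def flag_space_def by auto
    ultimately obtain w where w: "w \<in> ?W1" "w \<notin> ?W0" "\<And>h. h \<in> H \<Longrightarrow> \<exists>c. apply_factor h w c \<in> ?W0"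
      using Lie_Kolchin_Sp[OF sub conn solv vec_subspace_flag_perp[OF less_imp_le[OF r]] W1H] unfolding perp by blast
    have wF: "w \<in> flag_space n (Suc r)" using std_borel_eigenvector[OF r w(1)] w(3) BH by blast
    have wc: "w \<in> carrier_vec (2 * n)" using wF by (simp add: flag_space_def)
    have wr: "w $ r \<noteq> 0"
    proof
      assume "w $ r = 0"
      then have "w \<in> ?W0" using wF unfolding flag_space_def by (auto simp: Suc_le_eq le_less)
      then show False using w(2) by blast
    qed
    note FS = vec_subspace_flag_space[of n "Suc r"]
    have mono: "?W0 \<subseteq> flag_space n (Suc r)" unfolding flag_space_def by auto
    show ?case
    proof (intro ballI)
      fix h and v :: "'k vec" assume h: "h \<in> H" and v: "v \<in> flag_space n (Suc r)"
      note hm = Sp_carrier[OF HG[OF h]]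
      have vc: "v \<in> carrier_vec (2 * n)" using v by (simp add: flag_space_def)
      define a where "a = v $ r / w $ r"
      have vw: "v - a \<cdot>\<^sub>v w \<in> ?W0"
        using v wF vc wc wr r unfolding flag_space_def a_def by (auto simp: Suc_le_eq le_less)
      obtain c where c: "apply_factor h w c \<in> ?W0" using w(3)[OF h] by blast
      have "h *\<^sub>v w - c \<cdot>\<^sub>v w + c \<cdot>\<^sub>v w \<in> flag_space n (Suc r)"
        using vec_subspaceD(3)[OF FS] vec_subspaceD(4)[OF FS wF] c mono by blast
      moreover have hwc: "h *\<^sub>v w \<in> carrier_vec (2 * n)" "h *\<^sub>v (v - a \<cdot>\<^sub>v w) \<in> carrier_vec (2 * n)"
        using hm vc wc by (auto intro!: mult_mat_vec_carrier)
      moreover have "x - c \<cdot>\<^sub>v w + c \<cdot>\<^sub>v w = x" if "x \<in> carrier_vec (2 * n)" for x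
        using that wc by (intro eq_vecI) auto
      ultimately have hw: "h *\<^sub>v w \<in> flag_space n (Suc r)" by simp
      have "v = (v - a \<cdot>\<^sub>v w) + a \<cdot>\<^sub>v w" using vc wc by (intro eq_vecI) auto
      then have "h *\<^sub>v v = h *\<^sub>v (v - a \<cdot>\<^sub>v w) + a \<cdot>\<^sub>v (h *\<^sub>v w)"
        using mult_add_distrib_mat_vec[OF hm, of "v - a \<cdot>\<^sub>v w" "a \<cdot>\<^sub>v w"] mult_mat_vec[OF hm wc] vc wc by simp
      then show "h *\<^sub>v v \<in> flag_space n (Suc r)"
        using IH[OF h vw] mono vec_subspaceD(3)[OF FS] vec_subspaceD(4)[OF FS hw] by auto
    qed
  qed
  have col: "h $$ (p, q) = 0" if h: "h \<in> H" and q: "q < n" and p: "p < 2 * n" "q < p" for h p q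
  proof -
    have "h *\<^sub>v ev n q \<in> flag_space n (Suc q)"
      using stable[of "Suc q"] h unit_vec_flag_space[of q "Suc q" n] q by auto
    then show ?thesis
      using mat_mult_unit_vec_index[OF Sp_carrier[OF HG[OF h]] p(1), of q] p q unfolding flag_space_def by auto
  qed
  have "h \<in> std_borel n" if h: "h \<in> H" for h
    unfolding std_borel_iff
  proof (intro conjI allI impI HG[OF h])
    fix p q assume pq: "p < 2 * n" "q < 2 * n" "ht n q < ht n p"
    show "h $$ (p, q) = 0"
    proof (cases "q < n")
      case True
      then show ?thesis using col[OF h True pq(1)] pq by (auto simp: ht_def split: if_splits)
    next
      case False
      \<comment> \<open>The flag only controls the first \<open>n\<close> columns. An entry of the
        lower right block of \<open>h\<close> is an entry of the upper left block of its inverse, to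
        which the column argument applies.\<close>
      then have p: "\<not> p < n" "p < q" using pq by (auto simp: ht_def split: if_splits)
      have "(inv\<^bsub>Sp n\<^esub> h) $$ (q - n, p - n) = 0"
        using col[OF Hinv[OF h], of "p - n" "q - n"] pq p False by auto
      moreover have "(inv\<^bsub>Sp n\<^esub> h) $$ (q - n, p - n) = h $$ (p, q)"
        using Sp_inv_index[OF HG[OF h], of "q - n" "p - n"] pq p False by (auto simp: dual_index_def)
      ultimately show ?thesis by simp
    qed
  qed
  then show ?thesis using BH by blast
qed

lemma borel_subgroup_std_borel: "borel_subgroup (2 * n) (Sp n) (std_borel n :: 'k::alg_closed_field mat set)"
  unfolding borel_subgroup_def
proof (intro conjI allI impI)
  show "closed_connected_solvable (2 * n) (Sp n) (std_borel n :: 'k mat set)"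
    unfolding closed_connected_solvable_def
    using subgroup_borel_filt[of n 0] closedin_std_borel connectedin_std_borel solvable_std_borel
    by (auto simp: std_borel_def)
qed (use std_borel_maximal in blast)

section \<open>Semisimple classes that are not spherical\<close>

text \<open>Lie--Kolchin is used twice: on the whole space, whose radical is zero, and on the
  complement of the first eigenvector \<open>v1\<close>, whose radical is spanned by
  \<open>v1\<close>. Transitivity of transvections moves the resulting flag to the standard
  one.\<close>

lemma borel_fixes_isotropic_flag:
  fixes B :: "'k::alg_closed_field mat set"
  assumes B: "closed_connected_solvable (2 * n) (Sp n) B" and n: "n \<ge> 2"
  obtains g where "g \<in> carrier (Sp n)"
    "\<And>b. b \<in> B \<Longrightarrow> \<exists>c d f. (g * b * inv\<^bsub>Sp n\<^esub> g) *\<^sub>v ev n 0 = c \<cdot>\<^sub>v ev n 0 \<and>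
      (g * b * inv\<^bsub>Sp n\<^esub> g) *\<^sub>v ev n 1 = d \<cdot>\<^sub>v ev n 1 + f \<cdot>\<^sub>v ev n 0"
proof -
  let ?m = "2 * n"
  have sub: "subgroup B (Sp n)" and conn: "connectedin (zariski ?m) B" and solv: "solvable (Sp n\<lparr>carrier := B\<rparr>)"
    using B unfolding closed_connected_solvable_def by auto
  have BG: "b \<in> carrier (Sp n)" if "b \<in> B" for b using subgroup.subset[OF sub] that by blast
  have V: "vec_subspace ?m (carrier_vec ?m :: 'k vec set)" unfolding vec_subspace_def by auto
  have perp0: "sform_perp n (carrier_vec ?m) = {0\<^sub>v ?m :: 'k vec}"
    unfolding sform_perp_def by (auto intro!: sform_nondegenerate)
  have "(ev n 0 :: 'k vec) \<noteq> 0\<^sub>v ?m" using n by simp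
  then have "sform_perp n (carrier_vec ?m) \<noteq> (carrier_vec ?m :: 'k vec set)"
    unfolding perp0 by (metis singletonD unit_vec_carrier)
  then have "\<exists>w\<in>carrier_vec ?m - sform_perp n (carrier_vec ?m).
      \<forall>h\<in>B. \<exists>c. apply_factor h w c \<in> sform_perp n (carrier_vec ?m)"
    by (intro Lie_Kolchin_Sp[OF sub conn solv V]) (auto simp: perp0 intro: Sp_mult_vec BG)
  then obtain v1 where v1: "v1 \<in> carrier_vec ?m" "v1 \<noteq> 0\<^sub>v ?m"
    and eig0: "\<And>b. b \<in> B \<Longrightarrow> \<exists>c. apply_factor b v1 c = 0\<^sub>v ?m"
    unfolding perp0 by blast
  have eig1: "\<exists>c. b *\<^sub>v v1 = c \<cdot>\<^sub>v v1" if b: "b \<in> B" for b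
  proof -
    obtain c where c: "apply_factor b v1 c = 0\<^sub>v ?m" using eig0[OF b] by blast
    have bv: "b *\<^sub>v v1 \<in> carrier_vec ?m" using Sp_mult_vec[OF BG[OF b] v1(1)] .
    have "x = (x - c \<cdot>\<^sub>v v1) + c \<cdot>\<^sub>v v1" if "x \<in> carrier_vec ?m" for x
      using that v1(1) by (intro eq_vecI) auto
    from this[OF bv] show ?thesis unfolding c using v1(1) by auto
  qed
  have n0: "0 < n" using n by simp
  have e0: "(ev n 0 :: 'k vec) \<in> tail_space n 0" "(ev n 0 :: 'k vec) \<noteq> 0\<^sub>v ?m" using n by auto
  obtain g1 where g1: "g1 \<in> transvection_group n 0" "g1 *\<^sub>v v1 = ev n 0"
    using transvection_group_transitive[of v1 n 0 "ev n 0"] v1 e0 by auto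
  note g1S = transvection_group_Sp[OF g1(1)]
  \<comment> \<open>This is the orthogonal complement of \<open>v1\<close>. Describing it through
    \<open>g1\<close> makes its radical the preimage of \<open>flag_space n 1\<close>.\<close>
  define W1 where "W1 = {z \<in> carrier_vec ?m. g1 *\<^sub>v z \<in> flag_perp n 1}"
  have W1_iff: "z \<in> W1 \<longleftrightarrow> sform n z v1 = 0" if z: "z \<in> carrier_vec ?m" for z
  proof -
    have "sform n z v1 = - ((g1 *\<^sub>v z) $ n)"
      using Sp_sform[OF g1S z v1(1)] g1(2) sform_unit_vec(1)[OF n0, of "g1 *\<^sub>v z"] by simp
    then show ?thesis using z Sp_mult_vec[OF g1S z] unfolding W1_def flag_perp_def by auto
  qed
  have "W1 = {z \<in> carrier_vec ?m. sform n z v1 = 0}" using W1_iff by (auto simp: W1_def)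
  then have W1: "vec_subspace ?m W1"
    using v1(1) unfolding vec_subspace_def by (auto simp: sform_add_left sform_smult_left)
  have perpW: "sform_perp n W1 = {v \<in> carrier_vec ?m. g1 *\<^sub>v v \<in> flag_space n 1}"
  proof -
    have "v \<in> sform_perp n W1 \<longleftrightarrow> g1 *\<^sub>v v \<in> sform_perp n (flag_perp n 1)" if v: "v \<in> carrier_vec ?m" for v
    proof
      assume l: "v \<in> sform_perp n W1"
      have "sform n (g1 *\<^sub>v v) z = 0" if z: "z \<in> flag_perp n 1" for z
      proof -
        have zc: "z \<in> carrier_vec ?m" using z by (simp add: flag_perp_def)
        have "inv\<^bsub>Sp n\<^esub> g1 *\<^sub>v z \<in> W1"
          unfolding W1_def using z Sp_inv_mult_vec(2)[OF g1S zc] Sp_mult_vec[OF Sp_inv_closed[OF g1S] zc] by simp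
        then show ?thesis using l Sp_sform_inv[OF g1S v zc] unfolding sform_perp_def by simp
      qed
      then show "g1 *\<^sub>v v \<in> sform_perp n (flag_perp n 1)"
        using Sp_mult_vec[OF g1S v] unfolding sform_perp_def by blast
    next
      assume r: "g1 *\<^sub>v v \<in> sform_perp n (flag_perp n 1)"
      have "sform n v z = 0" if "z \<in> W1" for z
        using r that Sp_sform[OF g1S v, of z] unfolding sform_perp_def W1_def by auto
      then show "v \<in> sform_perp n W1" using v unfolding sform_perp_def by blast
    qed
    then show ?thesis using sform_perp_flag_perp[of 1 n] n unfolding sform_perp_def[of n W1] by auto
  qed
  have W1B: "b *\<^sub>v z \<in> W1" if b: "b \<in> B" and z: "z \<in> W1" for b z
  proof -
    have zc: "z \<in> carrier_vec ?m" using z by (simp add: W1_def)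
    obtain c where "inv\<^bsub>Sp n\<^esub> b *\<^sub>v v1 = c \<cdot>\<^sub>v v1" using eig1 subgroup.m_inv_closed[OF sub b] by blast
    then have "sform n (b *\<^sub>v z) v1 = 0"
      using Sp_sform_inv[OF BG[OF b] zc v1(1)] W1_iff[OF zc] z v1(1) by (simp add: sform_smult_right)
    then show ?thesis using W1_iff[OF Sp_mult_vec[OF BG[OF b] zc]] by simp
  qed
  have "inv\<^bsub>Sp n\<^esub> g1 *\<^sub>v ev n 1 \<in> W1" "inv\<^bsub>Sp n\<^esub> g1 *\<^sub>v ev n 1 \<notin> sform_perp n W1"
    unfolding perpW unfolding W1_def using Sp_inv_mult_vec(2)[OF g1S, of "ev n 1"] Sp_mult_vec[OF Sp_inv_closed[OF g1S], of "ev n 1"] n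
    by (auto simp: flag_perp_def flag_space_def intro!: exI[of _ 1])
  moreover have "sform_perp n W1 \<subseteq> W1"
    unfolding perpW unfolding W1_def using n by (auto simp: flag_perp_def flag_space_def)
  ultimately obtain w where w: "w \<in> W1" "w \<notin> sform_perp n W1"
    and eig2: "\<And>b. b \<in> B \<Longrightarrow> \<exists>d. apply_factor b w d \<in> sform_perp n W1"
    using Lie_Kolchin_Sp[OF sub conn solv W1 W1B] by blast
  have wc: "w \<in> carrier_vec ?m" using w(1) by (simp add: W1_def)
  define u where "u = g1 *\<^sub>v w"
  \<comment> \<open>Only the class of \<open>w\<close> modulo \<open>v1\<close> matters. Without its
    \<open>ev n 0\<close> coordinate the vector lies in \<open>tail_space n 1\<close>, where it can
    be moved to \<open>ev n 1\<close> while \<open>ev n 0\<close> stays fixed.\<close>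
  define u2 where "u2 = u - u $ 0 \<cdot>\<^sub>v ev n 0"
  have uc: "u \<in> carrier_vec ?m" unfolding u_def using Sp_mult_vec[OF g1S wc] .
  have un: "u $ n = 0" using w(1) unfolding W1_def flag_perp_def u_def by auto
  have u2: "u2 \<in> tail_space n 1" unfolding u2_def tail_space_def using uc un n by auto
  have "u2 \<noteq> 0\<^sub>v ?m"
  proof
    assume z: "u2 = 0\<^sub>v ?m"
    have "u $ p = 0" if p: "p < ?m" "1 \<le> p" for p
    proof -
      have "u2 $ p = u $ p" unfolding u2_def using p uc n by simp
      then show ?thesis using z p by simp
    qed
    then have "u \<in> flag_space n 1" using uc unfolding flag_space_def by blast
    then show False using w(2) wc unfolding perpW u_def by blast
  qed
  moreover have "(ev n 1 :: 'k vec) \<in> tail_space n 1" "(ev n 1 :: 'k vec) \<noteq> 0\<^sub>v ?m"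
    using n unit_vec_tail_space(1)[of 1 1 n] by auto
  ultimately obtain g2 where g2: "g2 \<in> transvection_group n 1" "g2 *\<^sub>v u2 = ev n 1"
    using transvection_group_transitive[OF u2] n by (metis (no_types, lifting) Suc_leD numeral_2_eq_2 One_nat_def)
  note g2S = transvection_group_Sp[OF g2(1)]
  have g2e: "g2 *\<^sub>v ev n 0 = ev n 0" using transvection_group_fixes_unit_vec(1)[OF g2(1), of 0] n by simp
  define g where "g = g2 * g1"
  have g: "g \<in> carrier (Sp n)" unfolding g_def using Sp_closed[OF g2S g1S] .
  have gv: "g *\<^sub>v v = g2 *\<^sub>v (g1 *\<^sub>v v)" if "v \<in> carrier_vec ?m" for v
    unfolding g_def using assoc_mult_mat_vec[OF Sp_carrier[OF g2S] Sp_carrier[OF g1S] that] .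
  have gv1: "g *\<^sub>v v1 = ev n 0" using gv[OF v1(1)] g1(2) g2e by simp
  have gw: "g *\<^sub>v w = ev n 1 + u $ 0 \<cdot>\<^sub>v ev n 0"
  proof -
    have "u = u2 + u $ 0 \<cdot>\<^sub>v ev n 0" unfolding u2_def using uc by (intro eq_vecI) auto
    then have "g2 *\<^sub>v u = g2 *\<^sub>v u2 + g2 *\<^sub>v (u $ 0 \<cdot>\<^sub>v ev n 0)"
      using mult_add_distrib_mat_vec[OF Sp_carrier[OF g2S] tail_space_carrier[OF u2], of "u $ 0 \<cdot>\<^sub>v ev n 0"] by simp
    then show ?thesis using gv[OF wc] g2(2) g2e mult_mat_vec[OF Sp_carrier[OF g2S], of "ev n 0" "u $ 0"]
      by (simp add: u_def)
  qed
  have gW0: "\<exists>y0. g *\<^sub>v y = y0 \<cdot>\<^sub>v ev n 0" if y: "y \<in> sform_perp n W1" for y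
  proof -
    have yc: "y \<in> carrier_vec ?m" and yF: "g1 *\<^sub>v y \<in> flag_space n 1" using y unfolding perpW by auto
    have "g1 *\<^sub>v y = (g1 *\<^sub>v y) $ 0 \<cdot>\<^sub>v ev n 0"
    proof (rule eq_vecI)
      fix p assume "p < dim_vec ((g1 *\<^sub>v y) $ 0 \<cdot>\<^sub>v ev n 0 :: 'k vec)"
      then have p: "p < ?m" by simp
      show "(g1 *\<^sub>v y) $ p = ((g1 *\<^sub>v y) $ 0 \<cdot>\<^sub>v ev n 0) $ p"
        using yF p n unfolding flag_space_def by (cases "p = 0") auto
    qed (use Sp_carrier[OF g1S] in simp)
    then have "g *\<^sub>v y = (g1 *\<^sub>v y) $ 0 \<cdot>\<^sub>v ev n 0"
      using gv[OF yc] mult_mat_vec[OF Sp_carrier[OF g2S], of "ev n 0" "(g1 *\<^sub>v y) $ 0"] g2e by simp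
    then show ?thesis by blast
  qed
  have "\<exists>c d f. (g * b * inv\<^bsub>Sp n\<^esub> g) *\<^sub>v ev n 0 = c \<cdot>\<^sub>v ev n 0 \<and>
      (g * b * inv\<^bsub>Sp n\<^esub> g) *\<^sub>v ev n 1 = d \<cdot>\<^sub>v ev n 1 + f \<cdot>\<^sub>v ev n 0" if b: "b \<in> B" for b
  proof -
    let ?b = "g * b * inv\<^bsub>Sp n\<^esub> g"
    have bm: "b \<in> carrier_mat ?m ?m" using Sp_carrier[OF BG[OF b]] .
    have bm': "?b \<in> carrier_mat ?m ?m" using Sp_carrier[OF Sp_conj_closed[OF g BG[OF b]]] .
    note conj = Sp_conj_mult_vec[OF g bm]
    obtain c where c: "b *\<^sub>v v1 = c \<cdot>\<^sub>v v1" using eig1[OF b] by blast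
    have b0: "?b *\<^sub>v ev n 0 = c \<cdot>\<^sub>v ev n 0"
      using conj[OF v1(1)] c mult_mat_vec[OF Sp_carrier[OF g] v1(1), of c] gv1 by simp
    obtain d where d: "apply_factor b w d \<in> sform_perp n W1" using eig2[OF b] by blast
    obtain y0 where y0: "g *\<^sub>v apply_factor b w d = y0 \<cdot>\<^sub>v ev n 0" using gW0[OF d] by blast
    have bw: "b *\<^sub>v w \<in> carrier_vec ?m" using Sp_mult_vec[OF BG[OF b] wc] .
    have gbw: "g *\<^sub>v (b *\<^sub>v w) - d \<cdot>\<^sub>v (g *\<^sub>v w) = y0 \<cdot>\<^sub>v ev n 0"
      using y0 mult_minus_distrib_mat_vec[OF Sp_carrier[OF g] bw, of "d \<cdot>\<^sub>v w"] mult_mat_vec[OF Sp_carrier[OF g] wc, of d] wc by simp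
    have "?b *\<^sub>v (ev n 1 + u $ 0 \<cdot>\<^sub>v ev n 0) = g *\<^sub>v (b *\<^sub>v w)" using conj[OF wc] gw by simp
    moreover have "?b *\<^sub>v (ev n 1 + u $ 0 \<cdot>\<^sub>v ev n 0) = ?b *\<^sub>v ev n 1 + (u $ 0 * c) \<cdot>\<^sub>v ev n 0"
      using mult_add_distrib_mat_vec[OF bm', of "ev n 1" "u $ 0 \<cdot>\<^sub>v ev n 0"] mult_mat_vec[OF bm', of "ev n 0" "u $ 0"] b0
      by (simp add: smult_smult_assoc)
    ultimately have E: "?b *\<^sub>v ev n 1 + (u $ 0 * c) \<cdot>\<^sub>v ev n 0 - d \<cdot>\<^sub>v (ev n 1 + u $ 0 \<cdot>\<^sub>v ev n 0) = y0 \<cdot>\<^sub>v ev n 0"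
      using gbw gw by simp
    have X: "?b *\<^sub>v ev n 1 \<in> carrier_vec ?m" using bm' by auto
    have solve: "x = d \<cdot>\<^sub>v ev n 1 + (d * u $ 0 + y0 - u $ 0 * c) \<cdot>\<^sub>v ev n 0"
      if xc: "x \<in> carrier_vec ?m"
        and e: "x + (u $ 0 * c) \<cdot>\<^sub>v ev n 0 - d \<cdot>\<^sub>v (ev n 1 + u $ 0 \<cdot>\<^sub>v ev n 0) = y0 \<cdot>\<^sub>v ev n 0" for x
    proof (rule eq_vecI)
      fix p assume "p < dim_vec (d \<cdot>\<^sub>v ev n 1 + (d * u $ 0 + y0 - u $ 0 * c) \<cdot>\<^sub>v ev n 0)"
      then have p: "p < ?m" by simp
      show "x $ p = (d \<cdot>\<^sub>v ev n 1 + (d * u $ 0 + y0 - u $ 0 * c) \<cdot>\<^sub>v ev n 0) $ p"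
        using arg_cong[OF e, of "\<lambda>x. x $ p"] p xc n by (auto simp: algebra_simps split: if_splits)
    qed (use xc in simp)
    show ?thesis using b0 solve[OF X E] by blast
  qed
  then show ?thesis using that[OF g] by blast
qed

section \<open>Semi-invariants on a class with a dense orbit\<close>

text \<open>The flag stable under \<open>B\<close> is standard only after conjugation by
  \<open>g\<close>. Pulling \<open>f1\<close> and \<open>f2\<close> back along this conjugation
  gives polynomial functions that are semi-invariant under \<open>B\<close> itself.\<close>

lemma dense_orbit_semi_invariants:
  fixes x :: "'k::alg_closed_field mat"
  assumes x0: "x0 \<in> carrier (Sp n)" and C: "C = conj_class (Sp n) x0" and x: "x \<in> C" and B: "B \<subseteq> carrier (Sp n)"
    and cl: "subtopology (zariski (2 * n)) C closure_of orbit (Sp n\<lparr>carrier := B\<rparr>) (conj_act (Sp n)) x = C"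
    and g: "g \<in> carrier (Sp n)" and f: "f1 \<in> mat_polyfun (2 * n)" "f2 \<in> mat_polyfun (2 * n)"
    and semi: "\<And>b y. b \<in> B \<Longrightarrow> y \<in> C \<Longrightarrow> \<exists>c. \<forall>f\<in>{f1, f2}.
      f ((g * b * inv\<^bsub>Sp n\<^esub> g) * y * inv\<^bsub>Sp n\<^esub> (g * b * inv\<^bsub>Sp n\<^esub> g)) = c * f y"
    and y: "y \<in> C" and z: "z \<in> C"
  shows "f1 y * f2 z = f2 y * f1 z"
proof -
  let ?m = "2 * n"
  interpret G: group "Sp n :: 'k mat monoid" by (rule group_Sp)
  have CG: "C \<subseteq> carrier (Sp n)" unfolding C using conj_class_Sp_carrier[OF x0] .
  have xG: "x \<in> carrier (Sp n)" using x CG by blast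
  have pm: "poly_map ?m C (\<lambda>A. g * A * inv\<^bsub>Sp n\<^esub> g)"
    using Sp_carrier CG by (intro poly_map_mult poly_map_const poly_map_id Sp_carrier g Sp_inv_closed) blast
  have "\<exists>p\<in>mat_polyfun ?m. \<forall>A\<in>C. f (g * A * inv\<^bsub>Sp n\<^esub> g) = p A" if "f \<in> mat_polyfun ?m" for f
    using mat_polyfun_comp[OF that, of ?m C "\<lambda>A. g * A * inv\<^bsub>Sp n\<^esub> g"] pm unfolding poly_map_def by blast
  then obtain p1 p2 where p: "p1 \<in> mat_polyfun ?m" "p2 \<in> mat_polyfun ?m"
      "\<And>A. A \<in> C \<Longrightarrow> f1 (g * A * inv\<^bsub>Sp n\<^esub> g) = p1 A" "\<And>A. A \<in> C \<Longrightarrow> f2 (g * A * inv\<^bsub>Sp n\<^esub> g) = p2 A"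
    using f by metis
  have inC: "h * A * inv\<^bsub>Sp n\<^esub> h \<in> C" if "h \<in> carrier (Sp n)" "A \<in> C" for h A
    using conj_class_Sp_conj[OF x0 that(1)] that(2) unfolding C by blast
  have semi': "\<exists>c. p1 w = c * p1 x \<and> p2 w = c * p2 x"
    if w: "w \<in> orbit (Sp n\<lparr>carrier := B\<rparr>) (conj_act (Sp n)) x" for w
  proof -
    obtain b where b: "b \<in> B" "w = b * x * inv\<^bsub>Sp n\<^esub> b" using w unfolding orbit_conj_act_Sp[OF xG] by blast
    have bG: "b \<in> carrier (Sp n)" using b B by blast
    have wC: "w \<in> C" unfolding b(2) using inC[OF bG x] .
    let ?b = "g * b * inv\<^bsub>Sp n\<^esub> g"
    have bG': "?b \<in> carrier (Sp n)" using Sp_conj_closed[OF g bG] .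
    have "?b * g = g * b"
    proof -
      have "g \<otimes>\<^bsub>Sp n\<^esub> b \<otimes>\<^bsub>Sp n\<^esub> inv\<^bsub>Sp n\<^esub> g \<otimes>\<^bsub>Sp n\<^esub> g = g \<otimes>\<^bsub>Sp n\<^esub> b"
        using g bG by (simp add: G.m_assoc del: Sp_mult Sp_one)
      then show ?thesis by simp
    qed
    then have "?b * (g * x * inv\<^bsub>Sp n\<^esub> g) * inv\<^bsub>Sp n\<^esub> ?b = g * w * inv\<^bsub>Sp n\<^esub> g"
      unfolding b(2) Sp_conj_conj[OF bG g xG] Sp_conj_conj[OF g bG' xG] by simp
    moreover obtain c where "\<forall>f\<in>{f1, f2}. f (?b * (g * x * inv\<^bsub>Sp n\<^esub> g) * inv\<^bsub>Sp n\<^esub> ?b) = c * f (g * x * inv\<^bsub>Sp n\<^esub> g)"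
      using semi[OF b(1) inC[OF g x]] by blast
    ultimately show ?thesis using p(3,4)[OF wC] p(3,4)[OF x] by auto
  qed
  have *: "\<exists>A\<in>C. g * A * inv\<^bsub>Sp n\<^esub> g = A'" if A': "A' \<in> C" for A'
  proof -
    have "A' \<in> carrier (Sp n)" using A' CG by blast
    then have "inv\<^bsub>Sp n\<^esub> (inv\<^bsub>Sp n\<^esub> g) * (inv\<^bsub>Sp n\<^esub> g * A' * inv\<^bsub>Sp n\<^esub> (inv\<^bsub>Sp n\<^esub> g)) * inv\<^bsub>Sp n\<^esub> (inv\<^bsub>Sp n\<^esub> (inv\<^bsub>Sp n\<^esub> g)) = A'"
      using Sp_conj_inv[OF Sp_inv_closed[OF g]] by blast
    then show ?thesis using inC[OF Sp_inv_closed[OF g] A'] g by (metis G.inv_inv)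
  qed
  obtain y' z' where yz: "y' \<in> C" "g * y' * inv\<^bsub>Sp n\<^esub> g = y" "z' \<in> C" "g * z' * inv\<^bsub>Sp n\<^esub> g = z"
    using *[OF y] *[OF z] by blast
  have "p1 y' * p2 z' = p2 y' * p1 z'"
    by (rule semi_invariants_proportional[OF cl x p(1,2) semi' yz(1,3)])
  then show ?thesis using p(3,4)[OF yz(1)] p(3,4)[OF yz(3)] yz by simp
qed

text \<open>The Gram matrix of the bilinear form \<open>(u, v) \<mapsto> \<omega>(y u, v)\<close> on \<open>e\<^sub>0, \<dots>, e\<^sub>n\<^sub>-\<^sub>1\<close>.\<close>

definition gram :: "nat \<Rightarrow> nat \<Rightarrow> nat \<Rightarrow> 'k::comm_ring_1 mat \<Rightarrow> 'k" where
  "gram n i j y = - (y $$ (n + j, i))"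

lemma gram_polyfun: "i < n \<Longrightarrow> j < n \<Longrightarrow> gram n i j \<in> mat_polyfun (2 * n)"
  unfolding gram_def using mat_polyfun.mult[OF mat_polyfun.const[of "-1"] mat_polyfun.entry[of "n + j" "2 * n" i]]
  by simp

lemma gram_eq_sform:
  assumes "y \<in> carrier_mat (2 * n) (2 * n)" "i < n" "j < n"
  shows "gram n i j y = sform n (y *\<^sub>v ev n i) (ev n j)"
  using assms mat_mult_unit_vec_index[OF assms(1), of "n + j" i] by (simp add: sform_unit_vec gram_def)

lemma gram_conj:
  fixes h :: "'k::field mat"
  assumes h: "h \<in> carrier (Sp n)" and x: "x \<in> carrier (Sp n)" and ij: "i < n" "j < n"
    and u: "u \<in> carrier_vec (2 * n)" "h *\<^sub>v u = ev n i" and v: "v \<in> carrier_vec (2 * n)" "h *\<^sub>v v = ev n j"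
  shows "gram n i j (h * x * inv\<^bsub>Sp n\<^esub> h) = sform n (x *\<^sub>v u) v"
proof -
  have "gram n i j (h * x * inv\<^bsub>Sp n\<^esub> h) = sform n ((h * x * inv\<^bsub>Sp n\<^esub> h) *\<^sub>v (h *\<^sub>v u)) (h *\<^sub>v v)"
    unfolding u(2) v(2) by (rule gram_eq_sform[OF Sp_carrier[OF Sp_conj_closed[OF h x]] ij])
  also have "\<dots> = sform n (x *\<^sub>v u) v"
    unfolding Sp_conj_mult_vec[OF h Sp_carrier[OF x] u(1)] using Sp_sform[OF h Sp_mult_vec[OF x u(1)] v(1)] .
  finally show ?thesis .
qed

text \<open>Minus the entry \<open>(n, 0)\<close> of \<open>y * y\<close>, that is
  \<open>sform\<close> of \<open>y *\<^sub>v (y *\<^sub>v e)\<close> and \<open>e\<close> for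
  \<open>e = ev n 0\<close>.\<close>

definition gram_sq :: "nat \<Rightarrow> 'k::comm_ring_1 mat \<Rightarrow> 'k" where
  "gram_sq n y = - (\<Sum>k<2 * n. y $$ (n, k) * y $$ (k, 0))"

lemma gram_sq_polyfun: "0 < n \<Longrightarrow> gram_sq n \<in> mat_polyfun (2 * n)"
proof -
  assume n: "0 < n"
  have "(\<lambda>y. (-1) * (\<Sum>k\<in>{..<2 * n}. y $$ (n, k) * y $$ (k, 0))) \<in> mat_polyfun (2 * n)"
    by (intro mat_polyfun.mult mat_polyfun.const mat_polyfun_sum mat_polyfun.entry) (use n in auto)
  then show ?thesis unfolding gram_sq_def by simp
qed

lemma gram_sq_conj:
  fixes h :: "'k::field mat"
  assumes h: "h \<in> carrier (Sp n)" and x: "x \<in> carrier (Sp n)" and n: "0 < n"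
    and u: "u \<in> carrier_vec (2 * n)" "h *\<^sub>v u = ev n 0"
  shows "gram_sq n (h * x * inv\<^bsub>Sp n\<^esub> h) = sform n (x *\<^sub>v (x *\<^sub>v u)) u"
proof -
  let ?y = "h * x * inv\<^bsub>Sp n\<^esub> h"
  have y: "?y \<in> carrier_mat (2 * n) (2 * n)" using Sp_carrier[OF Sp_conj_closed[OF h x]] .
  note xm = Sp_carrier[OF x]
  have "gram_sq n ?y = sform n (?y *\<^sub>v (?y *\<^sub>v ev n 0)) (ev n 0)"
    using n mult_mat_vec_index[OF y, of "?y *\<^sub>v ev n 0" n] mat_mult_unit_vec_index[OF y, of _ 0] y
    by (simp add: sform_unit_vec gram_sq_def mult_mat_vec_carrier[OF y])
  also have "?y *\<^sub>v (?y *\<^sub>v ev n 0) = h *\<^sub>v (x *\<^sub>v (x *\<^sub>v u))"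
    unfolding u(2)[symmetric] Sp_conj_mult_vec[OF h xm u(1)] Sp_conj_mult_vec[OF h xm Sp_mult_vec[OF x u(1)]] ..
  also have "sform n \<dots> (ev n 0) = sform n (x *\<^sub>v (x *\<^sub>v u)) u"
    unfolding u(2)[symmetric] using Sp_sform[OF h Sp_mult_vec[OF x Sp_mult_vec[OF x u(1)]] u(1)] .
  finally show ?thesis .
qed

text \<open>A case of Witt's theorem. The auxiliary \<open>z0\<close> completes \<open>w0\<close> to
  a hyperbolic pair orthogonal to \<open>w1\<close>; once this pair is moved to the first one,
  \<open>w1\<close> lies in \<open>tail_space n 1\<close>, where transvections are transitive on
  non-zero vectors.\<close>

lemma Sp_moves_isotropic_pair:
  fixes w0 w1 z0 :: "'k::field vec"
  assumes n: "n \<ge> 2" and w: "w0 \<in> carrier_vec (2 * n)" "w1 \<in> carrier_vec (2 * n)" "z0 \<in> carrier_vec (2 * n)"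
    and "sform n w0 z0 = 1" "sform n w1 z0 = 0" "sform n w1 w0 = 0" "w1 \<noteq> 0\<^sub>v (2 * n)"
  obtains h where "h \<in> carrier (Sp n)" "h *\<^sub>v w0 = ev n 0" "h *\<^sub>v w1 = ev n 1"
proof -
  have n0: "0 < n" using n by simp
  obtain h1 where h1: "h1 \<in> transvection_group n 0" "h1 *\<^sub>v w0 = ev n 0" "h1 *\<^sub>v z0 = ev n (n + 0)"
    using transvection_group_hyperbolic_pair[of w0 n 0 z0] assms n0 by auto
  note h1S = transvection_group_Sp[OF h1(1)]
  have c: "h1 *\<^sub>v w1 \<in> carrier_vec (2 * n)" using Sp_mult_vec[OF h1S w(2)] .
  have "sform n (h1 *\<^sub>v w1) (ev n 0) = 0" "sform n (h1 *\<^sub>v w1) (ev n (n + 0)) = 0"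
    using Sp_sform[OF h1S w(2,1)] Sp_sform[OF h1S w(2,3)] h1(2,3) assms by simp_all
  then have t: "h1 *\<^sub>v w1 \<in> tail_space n 1" using c n by (simp add: tail_space_iff_sform)
  have "h1 *\<^sub>v w1 \<noteq> 0\<^sub>v (2 * n)"
  proof
    assume "h1 *\<^sub>v w1 = 0\<^sub>v (2 * n)"
    then have "w1 = inv\<^bsub>Sp n\<^esub> h1 *\<^sub>v 0\<^sub>v (2 * n)" using Sp_inv_mult_vec(1)[OF h1S w(2)] by simp
    moreover have "inv\<^bsub>Sp n\<^esub> h1 *\<^sub>v 0\<^sub>v (2 * n) = 0\<^sub>v (2 * n)"
      using Sp_carrier[OF Sp_inv_closed[OF h1S]] by (intro eq_vecI) auto
    ultimately show False using assms by simp
  qed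
  moreover have "(ev n 1 :: 'k vec) \<in> tail_space n 1" "(ev n 1 :: 'k vec) \<noteq> 0\<^sub>v (2 * n)" "1 \<le> n"
    using n unit_vec_tail_space(1)[of 1 1 n] by auto
  ultimately obtain h2 where h2: "h2 \<in> transvection_group n 1" "h2 *\<^sub>v (h1 *\<^sub>v w1) = ev n 1"
    using transvection_group_transitive[OF t] by blast
  note h2S = transvection_group_Sp[OF h2(1)]
  have "h2 *\<^sub>v ev n 0 = ev n 0" using transvection_group_fixes_unit_vec(1)[OF h2(1), of 0] n by simp
  then show ?thesis
    using that[OF Sp_closed[OF h2S h1S]] assoc_mult_mat_vec[OF Sp_carrier[OF h2S] Sp_carrier[OF h1S]] w h1 h2 by simp
qed

lemma char_two_add_self: "CHAR('k::comm_ring_1) = 2 \<Longrightarrow> (x :: 'k) + x = 0"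
  by (metis mult_2 mult_zero_left of_nat_CHAR of_nat_numeral)

lemma char_two_uminus: "CHAR('k::comm_ring_1) = 2 \<Longrightarrow> - (x :: 'k) = x"
  using char_two_add_self[of x] by (simp add: eq_neg_iff_add_eq_0 minus_unique)

text \<open>In characteristic 2, \<open>a * a = 1\<close> means
  \<open>(a - 1) * (a - 1) = 0\<close>. The disjunct \<open>a = 0\<close> is due to the convention
  \<open>inverse 0 = 0\<close>.\<close>

lemma char_two_neq_inverse:
  fixes a :: "'k::field"
  assumes "CHAR('k) = 2" "a \<noteq> 1" shows "a \<noteq> inverse a \<or> a = 0"
proof (rule disjCI)
  assume "a \<noteq> 0"
  show "a \<noteq> inverse a"
  proof
    assume "a = inverse a"
    then have "a * a = 1" using \<open>a \<noteq> 0\<close> by (metis right_inverse)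
    then have "(a - 1) * (a - 1) = 0"
      using char_two_add_self[OF assms(1), of a] char_two_add_self[OF assms(1), of 1] by (simp add: algebra_simps)
    then show False using assms(2) by simp
  qed
qed

text \<open>Eliminates the Borel subgroup: after this, semi-invariance has to be checked only under
  elements preserving the flag spanned by \<open>ev n 0\<close> and \<open>ev n 1\<close>.
  Invertibility gives \<open>c \<noteq> 0\<close> and \<open>d \<noteq> 0\<close>.\<close>

lemma spherical_class_dmat:
  fixes t :: "nat \<Rightarrow> 'k::alg_closed_field"
  assumes n: "n \<ge> 2" and t: "\<And>i. i < n \<Longrightarrow> t i \<noteq> 0"
    and sph: "spherical_class (2 * n) (Sp n) (conj_class (Sp n) (dmat n t))"
  shows "\<And>f1 f2 y z. f1 \<in> mat_polyfun (2 * n) \<Longrightarrow> f2 \<in> mat_polyfun (2 * n) \<Longrightarrow>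
      y \<in> conj_class (Sp n) (dmat n t) \<Longrightarrow> z \<in> conj_class (Sp n) (dmat n t) \<Longrightarrow>
      (\<And>b y c d f. b \<in> carrier (Sp n) \<Longrightarrow> y \<in> carrier (Sp n) \<Longrightarrow> c \<noteq> 0 \<Longrightarrow> d \<noteq> 0 \<Longrightarrow>
        b *\<^sub>v ev n 0 = c \<cdot>\<^sub>v ev n 0 \<Longrightarrow> b *\<^sub>v ev n 1 = d \<cdot>\<^sub>v ev n 1 + f \<cdot>\<^sub>v ev n 0 \<Longrightarrow>
        \<exists>e. \<forall>f\<in>{f1, f2}. f (b * y * inv\<^bsub>Sp n\<^esub> b) = e * f y) \<Longrightarrow>
      f1 y * f2 z = f2 y * f1 z"
proof -
  fix f1 f2 :: "'k mat \<Rightarrow> 'k" and y z :: "'k mat"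
  assume f: "f1 \<in> mat_polyfun (2 * n)" "f2 \<in> mat_polyfun (2 * n)"
    and yz: "y \<in> conj_class (Sp n) (dmat n t)" "z \<in> conj_class (Sp n) (dmat n t)"
    and semi: "\<And>b y c d f. b \<in> carrier (Sp n) \<Longrightarrow> y \<in> carrier (Sp n) \<Longrightarrow> c \<noteq> 0 \<Longrightarrow> d \<noteq> 0 \<Longrightarrow>
        b *\<^sub>v ev n 0 = c \<cdot>\<^sub>v ev n 0 \<Longrightarrow> b *\<^sub>v ev n 1 = d \<cdot>\<^sub>v ev n 1 + f \<cdot>\<^sub>v ev n 0 \<Longrightarrow>
        \<exists>e. \<forall>f\<in>{f1, f2}. f (b * y * inv\<^bsub>Sp n\<^esub> b) = e * f y"
  have D: "dmat n t \<in> carrier (Sp n)" using dmat_Sp t by blast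
  obtain B x where B: "borel_subgroup (2 * n) (Sp n) B" and x: "x \<in> conj_class (Sp n) (dmat n t)"
    and cl: "subtopology (zariski (2 * n)) (conj_class (Sp n) (dmat n t)) closure_of
        orbit (Sp n\<lparr>carrier := B\<rparr>) (conj_act (Sp n)) x = conj_class (Sp n) (dmat n t)"
    using sph unfolding spherical_class_def by blast
  have ccs: "closed_connected_solvable (2 * n) (Sp n) B" using B unfolding borel_subgroup_def by blast
  then have BG: "B \<subseteq> carrier (Sp n)" unfolding closed_connected_solvable_def using subgroup.subset by blast
  obtain g where g: "g \<in> carrier (Sp n)"
    and flag: "\<And>b. b \<in> B \<Longrightarrow> \<exists>c d f. (g * b * inv\<^bsub>Sp n\<^esub> g) *\<^sub>v ev n 0 = c \<cdot>\<^sub>v ev n 0 \<and>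
      (g * b * inv\<^bsub>Sp n\<^esub> g) *\<^sub>v ev n 1 = d \<cdot>\<^sub>v ev n 1 + f \<cdot>\<^sub>v ev n 0"
    using borel_fixes_isotropic_flag[OF ccs n] by blast
  have n1: "0 < n" "1 < n" using n by auto
  show "f1 y * f2 z = f2 y * f1 z"
  proof (rule dense_orbit_semi_invariants[OF D refl x BG cl g f _ yz])
    fix b y assume b: "b \<in> B" and y: "y \<in> conj_class (Sp n) (dmat n t)"
    let ?b = "g * b * inv\<^bsub>Sp n\<^esub> g"
    have bS: "?b \<in> carrier (Sp n)" using Sp_conj_closed g b BG by blast
    have yS: "y \<in> carrier (Sp n)" using y conj_class_Sp_carrier[OF D] by blast
    obtain c d f where cdf: "?b *\<^sub>v ev n 0 = c \<cdot>\<^sub>v ev n 0" "?b *\<^sub>v ev n 1 = d \<cdot>\<^sub>v ev n 1 + f \<cdot>\<^sub>v ev n 0"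
      using flag[OF b] by blast
    have col: "?b $$ (p, 0) = 0" if "p < 2 * n" "p \<noteq> 0" for p
      using arg_cong[OF cdf(1), of "\<lambda>v. v $ p"] mat_mult_unit_vec_index[OF Sp_carrier[OF bS] that(1), of 0] that n by simp
    have zero: "v = 0\<^sub>v (2 * n)" if v: "v \<in> carrier_vec (2 * n)" "?b *\<^sub>v v = 0\<^sub>v (2 * n)" for v
    proof -
      have "v = inv\<^bsub>Sp n\<^esub> ?b *\<^sub>v 0\<^sub>v (2 * n)" using Sp_inv_mult_vec(1)[OF bS v(1)] v(2) by simp
      also have "\<dots> = 0\<^sub>v (2 * n)" using Sp_carrier[OF Sp_inv_closed[OF bS]] by (intro eq_vecI) auto
      finally show ?thesis .
    qed
    have c: "c \<noteq> 0"
    proof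
      assume "c = 0"
      then have "?b *\<^sub>v ev n 0 = 0\<^sub>v (2 * n)" using cdf(1) by (auto intro!: eq_vecI)
      then show False using zero[of "ev n 0"] n1 by simp
    qed
    have d: "d \<noteq> 0"
    proof
      assume d0: "d = 0"
      let ?v = "ev n 1 - (f / c) \<cdot>\<^sub>v ev n 0 :: 'k vec"
      have "?b *\<^sub>v ?v = ?b *\<^sub>v ev n 1 - (f / c) \<cdot>\<^sub>v (?b *\<^sub>v ev n 0)"
        using mult_minus_distrib_mat_vec[OF Sp_carrier[OF bS], of "ev n 1" "(f / c) \<cdot>\<^sub>v ev n 0"]
          mult_mat_vec[OF Sp_carrier[OF bS], of "ev n 0" "f / c"] by simp
      also have "\<dots> = 0\<^sub>v (2 * n)" unfolding cdf d0 using c by (intro eq_vecI) auto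
      finally have "?v = 0\<^sub>v (2 * n)" using zero[of ?v] by simp
      moreover have "?v $ 1 = 1" using n1 by simp
      ultimately show False using n1 by simp
    qed
    show "\<exists>c. \<forall>f\<in>{f1, f2}. f (?b * y * inv\<^bsub>Sp n\<^esub> ?b) = c * f y"
      using semi[OF bS yS c d cdf] .
  qed
qed

context
  fixes n :: nat and b y :: "'k::field mat" and c d f :: 'k
  assumes n: "n \<ge> 2" and b: "b \<in> carrier (Sp n)" and y: "y \<in> carrier (Sp n)" and cd: "c \<noteq> 0" "d \<noteq> 0"
    and flag: "b *\<^sub>v ev n 0 = c \<cdot>\<^sub>v ev n 0" "b *\<^sub>v ev n 1 = d \<cdot>\<^sub>v ev n 1 + f \<cdot>\<^sub>v ev n 0"
begin

text \<open>The Gram matrix changes by congruence with the upper triangular matrix with diagonal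
  \<open>c\<close>, \<open>d\<close> and corner \<open>f\<close>. So its determinant scales by the
  square of \<open>c * d\<close> and the difference of its off-diagonal entries by
  \<open>c * d\<close>; this is why that difference is squared to match the weights.\<close>

lemma gram_flag_transform:
  fixes y' defines "y' \<equiv> b * y * inv\<^bsub>Sp n\<^esub> b"
  shows "gram n 0 0 y = c * c * gram n 0 0 y'"
    "gram n 0 1 y = c * d * gram n 0 1 y' + c * f * gram n 0 0 y'"
    "gram n 1 0 y = c * d * gram n 1 0 y' + c * f * gram n 0 0 y'"
    "gram n 1 1 y = d * d * gram n 1 1 y' + d * f * (gram n 0 1 y' + gram n 1 0 y') + f * f * gram n 0 0 y'"
    "gram_sq n y = c * c * gram_sq n y'"
proof -
  let ?m = "2 * n"
  note yS' = Sp_conj_closed[OF b y, folded y'_def]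
  have n1: "0 < n" "1 < n" using n by auto
  have ym: "y' \<in> carrier_mat ?m ?m" using Sp_carrier[OF yS'] .
  have yv: "y' *\<^sub>v v \<in> carrier_vec ?m" if "v \<in> carrier_vec ?m" for v using Sp_mult_vec[OF yS' that] .
  have T: "sform n (y *\<^sub>v u) v = sform n (y' *\<^sub>v (b *\<^sub>v u)) (b *\<^sub>v v)"
    if "u \<in> carrier_vec ?m" "v \<in> carrier_vec ?m" for u v
    unfolding y'_def Sp_conj_mult_vec[OF b Sp_carrier[OF y] that(1)]
    using Sp_sform[OF b Sp_mult_vec[OF y that(1)] that(2)] by simp
  note g = gram_eq_sform[OF Sp_carrier[OF y]] gram_eq_sform[OF ym]
  note lin = mult_add_distrib_mat_vec[OF ym] mult_mat_vec[OF ym] sform_add_left sform_add_right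
    sform_smult_left sform_smult_right yv
  show "gram n 0 0 y = c * c * gram n 0 0 y'"
    unfolding g(1)[OF n1(1) n1(1)] g(2)[OF n1(1) n1(1)] using n1 by (simp add: T flag lin)
  show "gram n 0 1 y = c * d * gram n 0 1 y' + c * f * gram n 0 0 y'"
    unfolding g(1)[OF n1] g(2)[OF n1] g(2)[OF n1(1) n1(1)] T[OF unit_vec_carrier unit_vec_carrier] flag
    by (simp add: lin, (simp add: algebra_simps)?)
  show "gram n 1 0 y = c * d * gram n 1 0 y' + c * f * gram n 0 0 y'"
    unfolding g(1)[OF n1(2,1)] g(2)[OF n1(2,1)] g(2)[OF n1(1) n1(1)] T[OF unit_vec_carrier unit_vec_carrier] flag
    by (simp add: lin, (simp add: algebra_simps)?)
  show "gram n 1 1 y = d * d * gram n 1 1 y' + d * f * (gram n 0 1 y' + gram n 1 0 y') + f * f * gram n 0 0 y'"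
    unfolding g(1)[OF n1(2) n1(2)] g(2)[OF n1(2) n1(2)] g(2)[OF n1(1) n1(1)] g(2)[OF n1] g(2)[OF n1(2,1)]
      T[OF unit_vec_carrier unit_vec_carrier] flag
    by (simp add: lin, (simp add: algebra_simps)?)
  have sq: "gram_sq n x = sform n (x *\<^sub>v (x *\<^sub>v ev n 0)) (ev n 0)" if x: "x \<in> carrier (Sp n)" for x :: "'k mat"
    using gram_sq_conj[OF Sp_one_closed x n1(1), of "ev n 0"] Sp_conj_one[OF x] by simp
  have "y' *\<^sub>v (y' *\<^sub>v (b *\<^sub>v ev n 0)) = b *\<^sub>v (y *\<^sub>v (y *\<^sub>v ev n 0))"
    unfolding y'_def using Sp_conj_mult_vec[OF b Sp_carrier[OF y], of "ev n 0"]
      Sp_conj_mult_vec[OF b Sp_carrier[OF y] Sp_mult_vec[OF y], of "ev n 0"] by simp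
  then have "sform n (y *\<^sub>v (y *\<^sub>v ev n 0)) (ev n 0) = sform n (y' *\<^sub>v (y' *\<^sub>v (b *\<^sub>v ev n 0))) (b *\<^sub>v ev n 0)"
    using Sp_sform[OF b Sp_mult_vec[OF y Sp_mult_vec[OF y, of "ev n 0"]], of "ev n 0"] by simp
  then show "gram_sq n y = c * c * gram_sq n y'"
    unfolding sq[OF y] sq[OF yS'] flag by (simp add: lin)
qed

lemma gram_semi_invariant:
  "\<exists>e. \<forall>f\<in>{gram n 0 0, gram_sq n}. f (b * y * inv\<^bsub>Sp n\<^esub> b) = e * f y"
  using gram_flag_transform(1,5) cd by (intro exI[of _ "inverse (c * c)"]) (simp add: field_simps)

lemma gram_det_semi_invariant:
  "\<exists>e. \<forall>f\<in>{\<lambda>y. gram n 0 0 y * gram n 1 1 y - gram n 0 1 y * gram n 1 0 y,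
      \<lambda>y. (gram n 0 1 y - gram n 1 0 y) * (gram n 0 1 y - gram n 1 0 y)}. f (b * y * inv\<^bsub>Sp n\<^esub> b) = e * f y"
proof -
  let ?y = "b * y * inv\<^bsub>Sp n\<^esub> b" and ?e = "inverse (c * c * (d * d))"
  have inv: "x' = ?e * x" if "x = c * c * (d * d) * x'" for x x'
    using that cd by (simp add: field_simps)
  have "gram n 0 0 y * gram n 1 1 y - gram n 0 1 y * gram n 1 0 y =
      c * c * (d * d) * (gram n 0 0 ?y * gram n 1 1 ?y - gram n 0 1 ?y * gram n 1 0 ?y)"
    unfolding gram_flag_transform by (simp add: algebra_simps)
  note E1 = inv[OF this]
  have "(gram n 0 1 y - gram n 1 0 y) * (gram n 0 1 y - gram n 1 0 y) =
      c * c * (d * d) * ((gram n 0 1 ?y - gram n 1 0 ?y) * (gram n 0 1 ?y - gram n 1 0 ?y))"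
    unfolding gram_flag_transform by (simp add: algebra_simps)
  note E2 = inv[OF this]
  show ?thesis by (rule exI[of _ ?e]) (use E1 E2 in blast)
qed

end

section \<open>Constraints on the eigenvalues of a spherical class\<close>

lemma dmat_mult_pair:
  fixes t :: "nat \<Rightarrow> 'k::field"
  assumes "p < 2 * n" "q < 2 * n"
  shows "dmat n t *\<^sub>v (ev n p + ev n q) = dmat n t $$ (p, p) \<cdot>\<^sub>v ev n p + dmat n t $$ (q, q) \<cdot>\<^sub>v ev n q"
proof -
  have *: "dmat n t *\<^sub>v ev n j = dmat n t $$ (j, j) \<cdot>\<^sub>v ev n j" if j: "j < 2 * n" for j
    using dmat_mult_unit_vec[of j n t] dmat_mult_unit_vec[of "j - n" n t] j
    by (cases "j < n") (auto simp: dmat_def)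
  show ?thesis
    using mult_add_distrib_mat_vec[OF dmat_carrier, of "ev n p" n "ev n q" t] *[OF assms(1)] *[OF assms(2)] by simp
qed

text \<open>Moving \<open>ev n k + ev n (n + k)\<close> to \<open>ev n 0\<close> gives a point of
  the class where the two functions are \<open>t k - inverse (t k)\<close> and the corresponding
  difference of squares, with quotient \<open>t k + inverse (t k)\<close>. Proportionality equates
  these sums for \<open>i\<close> and \<open>j\<close>, and the sum determines \<open>t k\<close> up
  to inversion.\<close>

lemma not_spherical_two_eigenvalues:
  fixes t :: "nat \<Rightarrow> 'k::alg_closed_field"
  assumes n: "n \<ge> 2" and t: "\<And>i. i < n \<Longrightarrow> t i \<noteq> 0"
    and sph: "spherical_class (2 * n) (Sp n) (conj_class (Sp n) (dmat n t))"
    and ij: "i < n" "j < n" and ne: "t i \<noteq> inverse (t i)" "t j \<noteq> inverse (t j)"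
  shows "t i = t j \<or> t i = inverse (t j)"
proof -
  have n1: "0 < n" using n by simp
  have D: "dmat n t \<in> carrier (Sp n)" using dmat_Sp t by blast
  let ?C = "conj_class (Sp n) (dmat n t)"
  have pt: "\<exists>y\<in>?C. gram n 0 0 y = t k - inverse (t k) \<and> gram_sq n y = t k * t k - inverse (t k) * inverse (t k)"
    if k: "k < n" for k
  proof -
    let ?w = "ev n k + ev n (n + k) :: 'k vec"
    have "sform n ?w (ev n (n + k)) = 1" using k by (simp add: sform_add_left sform_unit_vec)
    then have "?w \<noteq> 0\<^sub>v (2 * n)" by (metis sform_zero(1) zero_neq_one)
    moreover have "(ev n 0 :: 'k vec) \<noteq> 0\<^sub>v (2 * n)" using n1 by simp
    ultimately obtain h where h: "h \<in> transvection_group n 0" "h *\<^sub>v ?w = ev n 0"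
      using transvection_group_transitive[of ?w n 0 "ev n 0"] by auto
    note hS = transvection_group_Sp[OF h(1)]
    have Dw: "dmat n t *\<^sub>v ?w = t k \<cdot>\<^sub>v ev n k + inverse (t k) \<cdot>\<^sub>v ev n (n + k)"
      using dmat_mult_pair[of k n "n + k" t] k by (simp add: dmat_def)
    have DDw: "dmat n t *\<^sub>v (dmat n t *\<^sub>v ?w) = (t k * t k) \<cdot>\<^sub>v ev n k + (inverse (t k) * inverse (t k)) \<cdot>\<^sub>v ev n (n + k)"
      unfolding Dw using mult_add_distrib_mat_vec[OF dmat_carrier, of "t k \<cdot>\<^sub>v ev n k" n "inverse (t k) \<cdot>\<^sub>v ev n (n + k)" t]
        mult_mat_vec[OF dmat_carrier, of "ev n k" n t "t k"] mult_mat_vec[OF dmat_carrier, of "ev n (n + k)" n t "inverse (t k)"]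
        dmat_mult_unit_vec[OF k, of t] by (simp add: smult_smult_assoc)
    have w: "?w \<in> carrier_vec (2 * n)" by simp
    have "sform n (dmat n t *\<^sub>v ?w) ?w = t k - inverse (t k)"
      unfolding Dw using k by (simp add: sform_add_left sform_add_right sform_smult_left sform_smult_right sform_unit_vec)
    moreover have "sform n (dmat n t *\<^sub>v (dmat n t *\<^sub>v ?w)) ?w = t k * t k - inverse (t k) * inverse (t k)"
      unfolding DDw using k by (simp add: sform_add_left sform_add_right sform_smult_left sform_smult_right sform_unit_vec)
    moreover have "h * dmat n t * inv\<^bsub>Sp n\<^esub> h \<in> ?C" unfolding conj_class_Sp[OF D] using hS by blast
    ultimately show ?thesis
      using gram_conj[OF hS D n1 n1 w h(2) w h(2)] gram_sq_conj[OF hS D n1 w h(2)] by metis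
  qed
  obtain y where y: "y \<in> ?C" "gram n 0 0 y = t i - inverse (t i)" "gram_sq n y = t i * t i - inverse (t i) * inverse (t i)"
    using pt[OF ij(1)] by blast
  obtain z where z: "z \<in> ?C" "gram n 0 0 z = t j - inverse (t j)" "gram_sq n z = t j * t j - inverse (t j) * inverse (t j)"
    using pt[OF ij(2)] by blast
  have "gram n 0 0 y * gram_sq n z = gram_sq n y * gram n 0 0 z"
    by (rule spherical_class_dmat[OF n t sph _ _ y(1) z(1)])
       (rule gram_polyfun gram_sq_polyfun n1 gram_semi_invariant[OF n] | assumption)+
  then have "(t i - inverse (t i)) * (t j - inverse (t j)) * ((t j + inverse (t j)) - (t i + inverse (t i))) = 0"
    unfolding y z by (simp add: algebra_simps)
  then have "t j + inverse (t j) = t i + inverse (t i)" using ne by simp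
  moreover have "t i * inverse (t i) = 1" "t j * inverse (t j) = 1" using t ij by auto
  moreover have "(a - b) * (a * b - 1) = 0" if "b + b' = a + a'" "a * a' = 1" "b * b' = 1" for a b a' b' :: 'k
  proof -
    have "a * b * ((a + a') - (b + b')) = a * b * a + (a * a') * b - a * b * b - a * (b * b')"
      by (simp add: algebra_simps)
    then have "a * b * a + b - a * b * b - a = 0" using that by simp
    then show ?thesis by (simp add: algebra_simps)
  qed
  ultimately have "(t i - t j) * (t i * t j - 1) = 0" by blast
  then have "t i = t j \<or> t j * t i = 1" by (auto simp: mult.commute)
  then show ?thesis using inverse_unique[of "t j" "t i"] by auto
qed

text \<open>Two points of the class are compared. At \<open>y\<close> the Gram matrix is diagonal
  with non-zero determinant, so its off-diagonal difference vanishes; at \<open>z\<close> that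
  difference is \<open>t i + inverse (t i) + 2\<close>, which in characteristic 2 is
  \<open>t i - inverse (t i)\<close> and non-zero.\<close>

lemma not_spherical_mixed:
  fixes t :: "nat \<Rightarrow> 'k::alg_closed_field"
  assumes char: "CHAR('k) = 2" and n: "n \<ge> 2" and t: "\<And>i. i < n \<Longrightarrow> t i \<noteq> 0"
    and sph: "spherical_class (2 * n) (Sp n) (conj_class (Sp n) (dmat n t))"
    and ij: "i < n" "j < n" "i \<noteq> j" "l < n" "l \<noteq> i"
    and ne: "t i \<noteq> inverse (t i)" "t j \<noteq> inverse (t j)" and one: "t l = 1"
  shows False
proof -
  have n1: "0 < n" "1 < n" using n by auto
  have D: "dmat n t \<in> carrier (Sp n)" using dmat_Sp t by blast
  let ?C = "conj_class (Sp n) (dmat n t)"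
  let ?f1 = "\<lambda>y. gram n 0 0 y * gram n 1 1 y - gram n 0 1 y * gram n 1 0 y"
  let ?f2 = "\<lambda>y. (gram n 0 1 y - gram n 1 0 y) * (gram n 0 1 y - gram n 1 0 y)"
  note sf = sform_add_left sform_add_right sform_smult_left sform_smult_right sform_unit_vec
  have pt: "\<exists>y\<in>?C. gram n 0 0 y = sform n (dmat n t *\<^sub>v w0) w0 \<and> gram n 0 1 y = sform n (dmat n t *\<^sub>v w0) w1 \<and>
      gram n 1 0 y = sform n (dmat n t *\<^sub>v w1) w0 \<and> gram n 1 1 y = sform n (dmat n t *\<^sub>v w1) w1"
    if w: "w0 \<in> carrier_vec (2 * n)" "w1 \<in> carrier_vec (2 * n)" "z0 \<in> carrier_vec (2 * n)"
      "sform n w0 z0 = 1" "sform n w1 z0 = 0" "sform n w1 w0 = 0" "w1 \<noteq> 0\<^sub>v (2 * n)" for w0 w1 z0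
  proof -
    obtain h where h: "h \<in> carrier (Sp n)" "h *\<^sub>v w0 = ev n 0" "h *\<^sub>v w1 = ev n 1"
      using Sp_moves_isotropic_pair[OF n w] .
    have "h * dmat n t * inv\<^bsub>Sp n\<^esub> h \<in> ?C" unfolding conj_class_Sp[OF D] using h(1) by blast
    then show ?thesis
      using gram_conj[OF h(1) D n1(1) n1(1) w(1) h(2) w(1) h(2)] gram_conj[OF h(1) D n1 w(1) h(2) w(2) h(3)]
        gram_conj[OF h(1) D n1(2,1) w(2) h(3) w(1) h(2)] gram_conj[OF h(1) D n1(2) n1(2) w(2) h(3) w(2) h(3)] by metis
  qed
  have nz: "w \<noteq> 0\<^sub>v (2 * n)" if "sform n w v \<noteq> 0" for w v :: "'k vec" using that by auto
  let ?p0 = "ev n i + ev n (n + i) :: 'k vec" and ?p1 = "ev n j + ev n (n + j) :: 'k vec"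
  have "sform n ?p1 (ev n (n + j)) \<noteq> 0" using ij by (simp add: sf)
  then have "?p1 \<noteq> 0\<^sub>v (2 * n)" by (rule nz)
  then obtain y where y: "y \<in> ?C" "gram n 0 0 y = sform n (dmat n t *\<^sub>v ?p0) ?p0"
      "gram n 0 1 y = sform n (dmat n t *\<^sub>v ?p0) ?p1" "gram n 1 0 y = sform n (dmat n t *\<^sub>v ?p1) ?p0"
      "gram n 1 1 y = sform n (dmat n t *\<^sub>v ?p1) ?p1"
    using pt[of ?p0 ?p1 "ev n (n + i)"] ij by (auto simp: sf)
  have Dp: "dmat n t *\<^sub>v (ev n k + ev n (n + k)) = t k \<cdot>\<^sub>v ev n k + inverse (t k) \<cdot>\<^sub>v ev n (n + k)" if "k < n" for k
    using dmat_mult_pair[of k n "n + k" t] that by (simp add: dmat_def)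
  have fy: "?f1 y = (t i - inverse (t i)) * (t j - inverse (t j))" "?f2 y = 0"
    unfolding y Dp[OF ij(1)] Dp[OF ij(2)] using ij by (simp_all add: sf)
  \<comment> \<open>These two vectors pair to \<open>1 + 1\<close> up to sign, so they span an
    isotropic plane only in characteristic 2. The partner \<open>ev n (n + i)\<close> of
    \<open>?q0\<close> is orthogonal to \<open>?q1\<close>.\<close>
  let ?q0 = "ev n i + ev n l :: 'k vec" and ?q1 = "ev n (n + i) + ev n (n + l) :: 'k vec"
  have "sform n ?q1 (ev n i) \<noteq> 0" using ij by (simp add: sf)
  then have "?q1 \<noteq> 0\<^sub>v (2 * n)" by (rule nz)
  moreover have "sform n ?q1 ?q0 = 0" using ij char_two_add_self[OF char, of 1] char_two_uminus[OF char] by (simp add: sf)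
  ultimately obtain z where z: "z \<in> ?C" "gram n 0 0 z = sform n (dmat n t *\<^sub>v ?q0) ?q0"
      "gram n 0 1 z = sform n (dmat n t *\<^sub>v ?q0) ?q1" "gram n 1 0 z = sform n (dmat n t *\<^sub>v ?q1) ?q0"
      "gram n 1 1 z = sform n (dmat n t *\<^sub>v ?q1) ?q1"
    using pt[of ?q0 ?q1 "ev n (n + i)"] ij by (auto simp: sf)
  have Dq: "dmat n t *\<^sub>v ?q0 = t i \<cdot>\<^sub>v ev n i + 1 \<cdot>\<^sub>v ev n l"
    "dmat n t *\<^sub>v ?q1 = inverse (t i) \<cdot>\<^sub>v ev n (n + i) + 1 \<cdot>\<^sub>v ev n (n + l)"
    using dmat_mult_pair[of i n l t] dmat_mult_pair[of "n + i" n "n + l" t] ij one by (simp_all add: dmat_def)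
  have "gram n 0 1 z - gram n 1 0 z = t i + inverse (t i) + (1 + 1)"
    unfolding z Dq using ij by (simp add: sf) (simp add: algebra_simps)?
  then have "gram n 0 1 z - gram n 1 0 z = t i - inverse (t i)"
    using char_two_add_self[OF char, of 1] char_two_uminus[OF char, of "inverse (t i)"] by (metis add.right_neutral diff_conv_add_uminus)
  then have fz: "?f2 z \<noteq> 0" using ne(1) by simp
  have "?f1 y * ?f2 z = ?f2 y * ?f1 z"
    by (rule spherical_class_dmat[OF n t sph _ _ y(1) z(1)])
       (rule mat_polyfun_diff mat_polyfun.mult gram_polyfun n1 gram_det_semi_invariant[OF n] | assumption)+
  then show False using fy fz ne by simp
qed

section \<open>Classification of the spherical semisimple classes\<close>

lemma dmat_cong: "(\<And>i. i < n \<Longrightarrow> s i = t i) \<Longrightarrow> dmat n s = dmat n t"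
  unfolding dmat_def by (rule eq_matI) auto

text \<open>If 1 were the only eigenvalue, invariance of the form would make
  \<open>x *\<^sub>v z - z\<close> orthogonal to every eigenvector, hence zero for each
  \<open>z\<close>.\<close>

lemma eigenvectors_span_nontrivial:
  fixes x :: "'k::field mat"
  assumes x: "x \<in> carrier (Sp n)" "x \<noteq> 1\<^sub>m (2 * n)" and span: "eigenvectors_span n x"
  obtains v a where "v \<in> carrier_vec (2 * n)" "v \<noteq> 0\<^sub>v (2 * n)" "x *\<^sub>v v = a \<cdot>\<^sub>v v" "a \<noteq> 1"
proof (rule ccontr)
  assume contra: "\<not> thesis"
  note obt = that
  note xm = Sp_carrier[OF x(1)]
  have one: "x *\<^sub>v v = v" if v: "v \<in> carrier_vec (2 * n)" "x *\<^sub>v v = a \<cdot>\<^sub>v v" for v a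
  proof (cases "v = 0\<^sub>v (2 * n)")
    case True
    then show ?thesis using v(2) by auto
  next
    case False
    then have "a = 1" using obt contra v by blast
    then show ?thesis using v by simp
  qed
  have "x *\<^sub>v z = z" if z: "z \<in> carrier_vec (2 * n)" for z
  proof -
    have xz: "x *\<^sub>v z \<in> carrier_vec (2 * n)" using Sp_mult_vec[OF x(1) z] .
    have "x *\<^sub>v z - z = 0\<^sub>v (2 * n)"
    proof (rule ccontr)
      assume "x *\<^sub>v z - z \<noteq> 0\<^sub>v (2 * n)"
      then obtain v a where v: "v \<in> carrier_vec (2 * n)" "x *\<^sub>v v = a \<cdot>\<^sub>v v" "sform n (x *\<^sub>v z - z) v \<noteq> 0"
        using span xz z unfolding eigenvectors_span_def by (meson minus_carrier_vec)
      have "sform n (x *\<^sub>v z - z) v = sform n (x *\<^sub>v z) (x *\<^sub>v v) - sform n z v"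
        using one[OF v(1,2)] sform_diff_left[OF xz z v(1)] by simp
      then show False using v(3) Sp_sform[OF x(1) z v(1)] by simp
    qed
    moreover have "x *\<^sub>v z = (x *\<^sub>v z - z) + z"
    proof -
      have "y = (y - z) + z" if "y \<in> carrier_vec (2 * n)" for y using that z by (intro eq_vecI) auto
      then show ?thesis using xz by blast
    qed
    ultimately show ?thesis using z by simp
  qed
  then have "x = 1\<^sub>m (2 * n)" by (intro mat_eq_oneI[OF xm]) auto
  then show False using x(2) by simp
qed

text \<open>The element is diagonalized with first entry \<open>a \<noteq> 1\<close> and with
  \<open>inverse a\<close> excluded. The first obstruction leaves the entries 1 and
  \<open>a\<close>; the second forbids a repeated \<open>a\<close> next to a 1, so either all
  entries are \<open>a\<close> or only the first is.\<close>

lemma spherical_semisimple_class: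
  fixes C :: "'k::alg_closed_field mat set"
  assumes char: "CHAR('k) = 2" and n: "n \<ge> 2" and C: "C \<in> conj_classes (Sp n)"
    and ne: "C \<noteq> {1\<^sub>m (2 * n)}" and ss: "semisimple_class C" and sph: "spherical_class (2 * n) (Sp n) C"
  shows "\<exists>l. l \<noteq> 0 \<and> l \<noteq> 1 \<and> (a_elt n l \<in> C \<or> c_elt n l \<in> C)"
proof -
  have n0: "0 < n" using n by simp
  obtain x where x: "x \<in> carrier (Sp n)" and Cx: "C = conj_class (Sp n) x"
    using C unfolding conj_classes_def orbits_def conj_class_def by blast
  have xC: "x \<in> C" unfolding Cx using conj_class_Sp_self[OF x] .
  have x1: "x \<noteq> 1\<^sub>m (2 * n)"
  proof
    assume "x = 1\<^sub>m (2 * n)"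
    then have "g * x * inv\<^bsub>Sp n\<^esub> g = 1\<^sub>m (2 * n)" if "g \<in> carrier (Sp n)" for g
      using right_mult_one_mat[OF Sp_carrier[OF that]] Sp_inv_mult(2)[OF that] by simp
    then have "C \<subseteq> {1\<^sub>m (2 * n)}" unfolding Cx conj_class_Sp[OF x] by auto
    then have "C = {1\<^sub>m (2 * n)}" using xC by blast
    then show False using ne by simp
  qed
  have span: "eigenvectors_span n x"
    using semisimple_eigenvectors_span[OF Sp_carrier[OF x]] ss xC unfolding semisimple_class_def by blast
  obtain v0 a where v0: "v0 \<in> carrier_vec (2 * n)" "v0 \<noteq> 0\<^sub>v (2 * n)" "x *\<^sub>v v0 = a \<cdot>\<^sub>v v0" "a \<noteq> 1"
    using eigenvectors_span_nontrivial[OF x x1 span] .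
  have d0: "diag_upto n x (\<lambda>_. 1) 0" by (simp add: diag_upto_def)
  have v0t: "v0 \<in> tail_space n 0" using v0 by simp
  obtain w where w: "w \<in> tail_space n 0" "x *\<^sub>v w = inverse a \<cdot>\<^sub>v w" "sform n v0 w = 1"
    using eigenvector_pair[OF x span d0 _ v0t v0(2,3)] by auto
  obtain g1 where g1: "g1 \<in> carrier (Sp n)" "diag_upto n (g1 * x * inv\<^bsub>Sp n\<^esub> g1) ((\<lambda>_. 1)(0 := a)) (Suc 0)"
    using diag_upto_extend[OF x span d0 n0 v0t v0(3) w] .
  define x1 where "x1 = g1 * x * inv\<^bsub>Sp n\<^esub> g1"
  have x1S: "x1 \<in> carrier (Sp n)" unfolding x1_def using Sp_conj_closed[OF g1(1) x] .
  have a0: "a \<noteq> 0" using g1(2) unfolding diag_upto_def by auto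
  have aa: "a \<noteq> inverse a" using char_two_neq_inverse[OF char v0(4)] a0 by blast
  \<comment> \<open>Every pair \<open>{b, inverse b}\<close> has a member other than
    \<open>inverse a\<close>, because \<open>a\<close> and \<open>inverse a\<close> differ.
    Excluding \<open>inverse a\<close> rules out entries that agree with \<open>a\<close> only up to
    inversion.\<close>
  have Q: "b \<noteq> inverse a \<or> inverse b \<noteq> inverse a" for b using aa by auto
  obtain g2 s where g2: "g2 \<in> carrier (Sp n)" "\<forall>i<Suc 0. s i = ((\<lambda>_. 1)(0 := a)) i"
    "\<forall>i. Suc 0 \<le> i \<and> i < n \<longrightarrow> s i \<noteq> inverse a" "diag_upto n (g2 * x1 * inv\<^bsub>Sp n\<^esub> g2) s n"
    using Sp_diagonalize[OF x1S eigenvectors_span_conj[OF g1(1) Sp_carrier[OF x] span, folded x1_def]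
        g1(2)[folded x1_def], of "\<lambda>b. b \<noteq> inverse a"] n Q by auto
  have s0: "s 0 = a" using g2(2) by simp
  have snz: "s i \<noteq> 0" if "i < n" for i using g2(4) that unfolding diag_upto_def by blast
  have D: "g2 * x1 * inv\<^bsub>Sp n\<^esub> g2 = dmat n s"
    using diag_upto_imp_dmat[OF Sp_carrier[OF Sp_conj_closed[OF g2(1) x1S]] g2(4)] .
  have DC: "dmat n s \<in> C"
    unfolding D[symmetric] x1_def Cx using conj_class_Sp_conj[OF x g2(1) conj_class_Sp_conj[OF x g1(1) conj_class_Sp_self[OF x]]] .
  have CD: "C = conj_class (Sp n) (dmat n s)" using conj_class_Sp_eq[OF x] DC unfolding Cx by simp
  note sph' = sph[unfolded CD]
  have two: "s i = 1 \<or> s i = a" if i: "i < n" for i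
  proof (cases "i = 0 \<or> s i = 1")
    case False
    then have "s i \<noteq> inverse (s i)" using char_two_neq_inverse[OF char] snz[OF i] by blast
    then show ?thesis
      using not_spherical_two_eigenvalues[OF n snz sph' i n0] s0 aa g2(3) False i by auto
  qed (use s0 in auto)
  show ?thesis
  proof (cases "\<forall>i<n. s i = a")
    case True
    then have "a_elt n a = dmat n s" unfolding a_elt_eq_dmat by (intro dmat_cong) simp
    then show ?thesis using DC a0 v0(4) by metis
  next
    case False
    then obtain l where l: "l < n" "s l \<noteq> a" by blast
    then have sl: "s l = 1" using two by blast
    have "s i = 1" if i: "i < n" "i \<noteq> 0" for i
    proof (rule ccontr)
      assume "s i \<noteq> 1"
      then have si: "s i = a" using two i by blast
      have "l \<noteq> 0" using l s0 by metis
      then show False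
        using not_spherical_mixed[OF char n snz sph' n0 i(1) i(2)[symmetric] l(1)] s0 si aa sl by auto
    qed
    then have "c_elt n a = dmat n s" unfolding c_elt_eq_dmat[OF n0] by (intro dmat_cong) (auto simp: s0)
    then show ?thesis using DC a0 v0(4) by metis
  qed
qed

section \<open>The classes of \<open>c\<^sub>\<lambda>\<close> are spherical\<close>

text \<open>
  The element acting by \<open>l\<close> on \<open>u\<close>, by \<open>inverse l\<close> on \<open>v\<close> and trivially on the
  orthogonal complement of the hyperbolic pair \<open>(u, v)\<close>.
\<close>

definition pair_elt :: "nat \<Rightarrow> 'k::field \<Rightarrow> 'k vec \<Rightarrow> 'k vec \<Rightarrow> 'k mat" where
  "pair_elt n l u v = 1\<^sub>m (2 * n) + (skew_mat n ((inverse l - 1) \<cdot>\<^sub>v v) u + skew_mat n ((1 - l) \<cdot>\<^sub>v u) v)"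

lemma pair_elt_carrier [simp]: "pair_elt n l u v \<in> carrier_mat (2 * n) (2 * n)"
  unfolding pair_elt_def by simp

lemma pair_elt_mult_vec:
  assumes u: "u \<in> carrier_vec (2 * n)" and v: "v \<in> carrier_vec (2 * n)" and z: "z \<in> carrier_vec (2 * n)"
  shows "pair_elt n l u v *\<^sub>v z =
    z + ((sform n u z * (inverse l - 1)) \<cdot>\<^sub>v v + (sform n v z * (1 - l)) \<cdot>\<^sub>v u)"
proof -
  have "pair_elt n l u v *\<^sub>v z = z + (skew_mat n ((inverse l - 1) \<cdot>\<^sub>v v) u *\<^sub>v z + skew_mat n ((1 - l) \<cdot>\<^sub>v u) v *\<^sub>v z)"
    unfolding pair_elt_def using z by (simp add: add_mult_distrib_mat_vec[of _ "2 * n" "2 * n"])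
  then show ?thesis using skew_mat_mult_vec[of "(inverse l - 1) \<cdot>\<^sub>v v" n z u] skew_mat_mult_vec[of "(1 - l) \<cdot>\<^sub>v u" n z v] u v z
    by (simp add: smult_smult_assoc)
qed

lemma pair_elt_conj:
  fixes g :: "'k::field mat"
  assumes g: "g \<in> carrier (Sp n)" and u: "u \<in> carrier_vec (2 * n)" and v: "v \<in> carrier_vec (2 * n)"
  shows "g * pair_elt n l u v * inv\<^bsub>Sp n\<^esub> g = pair_elt n l (g *\<^sub>v u) (g *\<^sub>v v)"
proof (rule mat_eq_unit_vecI)
  let ?m = "2 * n"
  have gm: "g \<in> carrier_mat ?m ?m" using Sp_carrier[OF g] .
  show "g * pair_elt n l u v * inv\<^bsub>Sp n\<^esub> g \<in> carrier_mat ?m ?m"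
    using gm Sp_carrier[OF Sp_inv_closed[OF g]] by (simp add: mult_carrier_mat[of _ ?m ?m _ ?m])
  fix j
  define z where "z = inv\<^bsub>Sp n\<^esub> g *\<^sub>v ev n j"
  have zc: "z \<in> carrier_vec ?m" unfolding z_def using Sp_mult_vec[OF Sp_inv_closed[OF g]] by simp
  have gz: "g *\<^sub>v z = ev n j" unfolding z_def using Sp_inv_mult_vec(2)[OF g] by simp
  have guv: "g *\<^sub>v u \<in> carrier_vec ?m" "g *\<^sub>v v \<in> carrier_vec ?m" using Sp_mult_vec[OF g] u v by auto
  have "(g * pair_elt n l u v * inv\<^bsub>Sp n\<^esub> g) *\<^sub>v (g *\<^sub>v z) = g *\<^sub>v (pair_elt n l u v *\<^sub>v z)"
    by (rule Sp_conj_mult_vec[OF g pair_elt_carrier zc])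
  also have "\<dots> = g *\<^sub>v z + ((sform n u z * (inverse l - 1)) \<cdot>\<^sub>v (g *\<^sub>v v) + (sform n v z * (1 - l)) \<cdot>\<^sub>v (g *\<^sub>v u))"
    unfolding pair_elt_mult_vec[OF u v zc]
    using u v zc by (simp add: mult_add_distrib_mat_vec[OF gm] mult_mat_vec[OF gm])
  also have "\<dots> = pair_elt n l (g *\<^sub>v u) (g *\<^sub>v v) *\<^sub>v (g *\<^sub>v z)"
    unfolding pair_elt_mult_vec[OF guv Sp_mult_vec[OF g zc]] Sp_sform[OF g u zc] Sp_sform[OF g v zc] ..
  finally show "(g * pair_elt n l u v * inv\<^bsub>Sp n\<^esub> g) *\<^sub>v ev n j = pair_elt n l (g *\<^sub>v u) (g *\<^sub>v v) *\<^sub>v ev n j"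
    unfolding gz .
qed simp

lemma pair_elt_scale:
  fixes l c :: "'k::field"
  assumes u: "u \<in> carrier_vec (2 * n)" and v: "v \<in> carrier_vec (2 * n)" and c: "c \<noteq> 0"
  shows "pair_elt n l (c \<cdot>\<^sub>v u) (inverse c \<cdot>\<^sub>v v) = pair_elt n l u v"
proof (rule mat_eq_unit_vecI)
  fix j
  have "sform n (c \<cdot>\<^sub>v u) (ev n j) * (inverse l - 1) * inverse c = sform n u (ev n j) * (inverse l - 1)"
    "sform n (inverse c \<cdot>\<^sub>v v) (ev n j) * (1 - l) * c = sform n v (ev n j) * (1 - l)"
    using u v c by (simp_all add: sform_smult_left)
  note E = this
  show "pair_elt n l (c \<cdot>\<^sub>v u) (inverse c \<cdot>\<^sub>v v) *\<^sub>v ev n j = pair_elt n l u v *\<^sub>v ev n j"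
    unfolding pair_elt_mult_vec[OF u v unit_vec_carrier]
      pair_elt_mult_vec[OF smult_carrier_vec[THEN iffD2, OF u] smult_carrier_vec[THEN iffD2, OF v] unit_vec_carrier]
      smult_smult_assoc E ..
qed simp_all

lemma c_elt_eq_pair_elt:
  assumes n: "0 < n" shows "c_elt n l = pair_elt n l (ev n 0) (ev n n)"
proof (rule mat_eq_unit_vecI)
  show "c_elt n l \<in> carrier_mat (2 * n) (2 * n)" unfolding c_elt_eq_dmat[OF n] by simp
  fix j assume j: "j < 2 * n"
  have s: "sform n (ev n 0) (ev n j) = (if j = n then 1 else 0 :: 'a)" "sform n (ev n n) (ev n j) = (if j = 0 then - 1 else 0 :: 'a)"
    using sform_unit_vec(3)[of 0 n "ev n j"] sform_unit_vec(4)[of 0 n "ev n j"] n j by auto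
  show "c_elt n l *\<^sub>v ev n j = pair_elt n l (ev n 0) (ev n n) *\<^sub>v ev n j"
  proof (rule eq_vecI)
    fix i assume "i < dim_vec (pair_elt n l (ev n 0) (ev n n) *\<^sub>v ev n j)"
    then have i: "i < 2 * n" using carrier_matD[OF pair_elt_carrier[of n l "ev n 0" "ev n n"]] by simp
    show "(c_elt n l *\<^sub>v ev n j) $ i = (pair_elt n l (ev n 0) (ev n n) *\<^sub>v ev n j) $ i"
      using i j n unfolding c_elt_eq_dmat[OF n] mat_mult_unit_vec_index[OF dmat_carrier i j] pair_elt_mult_vec[OF unit_vec_carrier unit_vec_carrier unit_vec_carrier]
      by (auto simp: s dmat_def)
  qed (use c_elt_eq_dmat[OF n, of l] carrier_matD[OF pair_elt_carrier[of n l "ev n 0" "ev n n"]] in \<open>simp add: dmat_def\<close>)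
qed simp

section \<open>Normal form of hyperbolic pairs under the Borel subgroup\<close>

text \<open>The Siegel element along \<open>w\<close> removes all coordinates of \<open>u\<close>
  outside the pair \<open>j\<close>, using that its coordinate at \<open>n + j\<close> is 1; a
  transvection along \<open>ev n j\<close> then removes the coordinate at \<open>j\<close>. Both fix
  the earlier pairs.\<close>

lemma std_borel_moves_to_lowest:
  fixes u :: "'k::field vec"
  assumes j: "j < n" and u: "u \<in> tail_space n j" "u $ (n + j) = 1"
  obtains b where "b \<in> std_borel n" "b *\<^sub>v u = ev n (n + j)" "\<And>i. i < j \<Longrightarrow> b *\<^sub>v ev n i = ev n i"
    "\<And>i. i < j \<Longrightarrow> b *\<^sub>v ev n (n + i) = ev n (n + i)"
proof -
  let ?m = "2 * n"
  have uc: "u \<in> carrier_vec ?m" using tail_space_carrier[OF u(1)] .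
  define w where "w = ev n (n + j) + u $ j \<cdot>\<^sub>v ev n j - u"
  have wc: "w \<in> carrier_vec ?m" unfolding w_def using uc by simp
  have w: "w \<in> tail_space n (Suc j)"
    using u j uc unfolding w_def tail_space_def by (auto simp: less_Suc_eq)
  define S where "S = siegel n (ev n j) w"
  have SB: "S \<in> std_borel n" unfolding S_def using siegel_std_borel[OF j w] .
  have w0: "w $ j = 0" "w $ (n + j) = 0" using w unfolding tail_space_def by auto
  define c where "c = sform n w u + u $ j"
  have Su: "S *\<^sub>v u = ev n (n + j) + c \<cdot>\<^sub>v ev n j"
  proof -
    have "S *\<^sub>v u = u + (1 \<cdot>\<^sub>v w + sform n w u \<cdot>\<^sub>v ev n j)"
      unfolding S_def using siegel_mult_vec[of "ev n j" n w u] wc uc j u(2) by (simp add: sform_unit_vec)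
    also have "\<dots> = ev n (n + j) + c \<cdot>\<^sub>v ev n j"
      unfolding w_def c_def using uc by (intro eq_vecI) (auto simp: algebra_simps)
    finally show ?thesis .
  qed
  define T where "T = transvection n (ev n j) (- c)"
  have TB: "T \<in> std_borel n" unfolding T_def using transvection_std_borel[OF j] .
  have "T *\<^sub>v (ev n (n + j) + c \<cdot>\<^sub>v ev n j) = ev n (n + j)"
  proof -
    have "sform n (ev n j) (ev n (n + j) + c \<cdot>\<^sub>v ev n j) = 1"
      using j by (simp add: sform_add_right sform_smult_right sform_unit_vec)
    then have "T *\<^sub>v (ev n (n + j) + c \<cdot>\<^sub>v ev n j) = ev n (n + j) + c \<cdot>\<^sub>v ev n j + (- c) \<cdot>\<^sub>v ev n j"
      unfolding T_def by (subst transvection_mult_vec) auto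
    also have "\<dots> = ev n (n + j)" by (intro eq_vecI) auto
    finally show ?thesis .
  qed
  moreover have "S *\<^sub>v z = z" "T *\<^sub>v z = z" if z: "z \<in> carrier_vec ?m" "sform n (ev n j) z = 0" "sform n w z = 0" for z
  proof -
    have "z + (0 \<cdot>\<^sub>v x + 0 \<cdot>\<^sub>v y) = z" "z + 0 \<cdot>\<^sub>v x = z" if "x \<in> carrier_vec ?m" "y \<in> carrier_vec ?m" for x y
      using that z(1) by (auto intro!: eq_vecI)
    then show "S *\<^sub>v z = z" "T *\<^sub>v z = z" unfolding S_def T_def
      using z wc by (simp_all add: siegel_mult_vec transvection_mult_vec)
  qed
  moreover have "T * S \<in> std_borel n"
    using subgroup.m_closed[OF subgroup_borel_filt[of n 0]] TB SB unfolding std_borel_def by simp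
  moreover have "(T * S) *\<^sub>v z = T *\<^sub>v (S *\<^sub>v z)" if "z \<in> carrier_vec ?m" for z
    using assoc_mult_mat_vec[OF std_borel_carrier[OF TB] std_borel_carrier[OF SB] that] .
  moreover have "sform n w (ev n i) = 0" "sform n w (ev n (n + i)) = 0" if "i < j" for i
    using tail_spaceD[OF w, of i] that j by auto
  ultimately show ?thesis using that[of "T * S"] Su uc j by (auto simp: sform_unit_vec)
qed

lemma spherical_classI:
  fixes x :: "'k::alg_closed_field mat"
  assumes x: "x \<in> carrier (Sp n)" and F: "F \<in> mat_polyfun (2 * n)" "F x \<noteq> 0"
    and good: "\<And>y. y \<in> conj_class (Sp n) x \<Longrightarrow> F y \<noteq> 0 \<Longrightarrow> \<exists>b\<in>std_borel n. y = b * x * inv\<^bsub>Sp n\<^esub> b"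
  shows "spherical_class (2 * n) (Sp n) (conj_class (Sp n) x)"
  unfolding spherical_class_def
proof (intro exI conjI bexI)
  show "borel_subgroup (2 * n) (Sp n) (std_borel n :: 'k mat set)" by (rule borel_subgroup_std_borel)
  have "std_borel n \<subseteq> carrier (Sp n :: 'k mat monoid)" by (auto simp: std_borel_iff)
  then show "subtopology (zariski (2 * n)) (conj_class (Sp n) x) closure_of
      orbit (Sp n\<lparr>carrier := std_borel n\<rparr>) (conj_act (Sp n)) x = conj_class (Sp n) x"
    using dense_orbit_conj_class[OF x F _ good] by blast
  show "x \<in> conj_class (Sp n) x" by (rule conj_class_Sp_self[OF x])
qed

lemma std_borel_inv: "b \<in> std_borel n \<Longrightarrow> inv\<^bsub>Sp n\<^esub> b \<in> std_borel (n :: nat)"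
  using subgroup.m_inv_closed[OF subgroup_borel_filt[of n 0], of b] unfolding std_borel_def .

lemma std_borel_mult: "a \<in> std_borel n \<Longrightarrow> b \<in> std_borel n \<Longrightarrow> a * b \<in> std_borel (n :: nat)"
  using subgroup.m_closed[OF subgroup_borel_filt[of n 0], of a b] unfolding std_borel_def by simp

lemma pair_elt_class:
  fixes u v :: "'k::field vec"
  assumes n: "0 < n" and c: "c_elt n l \<in> carrier (Sp n)"
    and u: "u \<in> carrier_vec (2 * n)" and v: "v \<in> carrier_vec (2 * n)" and uv: "sform n u v = 1"
  shows "pair_elt n l u v \<in> conj_class (Sp n) (c_elt n l)"
proof -
  obtain g where g: "g \<in> transvection_group n 0" "g *\<^sub>v u = ev n 0" "g *\<^sub>v v = ev n n"
    using transvection_group_hyperbolic_pair[of u n 0 v] u v uv n by auto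
  note gS = transvection_group_Sp[OF g(1)] and igS = Sp_inv_closed[OF transvection_group_Sp[OF g(1)]]
  have "inv\<^bsub>Sp n\<^esub> g *\<^sub>v ev n 0 = u" "inv\<^bsub>Sp n\<^esub> g *\<^sub>v ev n n = v"
    unfolding g(2,3)[symmetric] using Sp_inv_mult_vec(1)[OF gS] u v by auto
  then have "pair_elt n l u v = inv\<^bsub>Sp n\<^esub> g * c_elt n l * inv\<^bsub>Sp n\<^esub> (inv\<^bsub>Sp n\<^esub> g)"
    using pair_elt_conj[OF igS, of "ev n 0" "ev n n" l] by (simp add: c_elt_eq_pair_elt[OF n])
  then show ?thesis unfolding conj_class_Sp[OF c] using igS by blast
qed

text \<open>The identity contributes nothing because \<open>ev n 0\<close> and \<open>ev n 1\<close>
  span an isotropic plane; what is left is the rank-two part, expressed by the coordinates of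
  \<open>u\<close> and \<open>v\<close> at \<open>n\<close> and \<open>n + 1\<close>.\<close>

lemma gram_pair_elt:
  fixes u v :: "'k::field vec"
  assumes n: "n \<ge> 2" and u: "u \<in> carrier_vec (2 * n)" and v: "v \<in> carrier_vec (2 * n)"
  shows "gram n 0 0 (pair_elt n l u v) = u $ n * v $ n * (inverse l - l)"
    and "gram n 0 1 (pair_elt n l u v) - gram n 1 0 (pair_elt n l u v) =
      (u $ n * v $ (n + 1) - u $ (n + 1) * v $ n) * (inverse l + l - 2)"
proof -
  have n1: "0 < n" "1 < n" using n by auto
  have G: "gram n i j (pair_elt n l u v) = sform n (ev n i) (ev n j) +
      (u $ (n + i) * (inverse l - 1) * v $ (n + j) + v $ (n + i) * (1 - l) * u $ (n + j))" if "i < n" "j < n" for i j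
    unfolding gram_eq_sform[OF pair_elt_carrier that] pair_elt_mult_vec[OF u v unit_vec_carrier]
    using u v that by (simp add: sform_add_left sform_smult_left sform_unit_vec(1))
  have z: "sform n (ev n i) (ev n j) = (0 :: 'k)" if "i < n" "j < n" for i j
    using that by (simp add: sform_unit_vec)
  show "gram n 0 0 (pair_elt n l u v) = u $ n * v $ n * (inverse l - l)"
    unfolding G[OF n1(1) n1(1)] z[OF n1(1) n1(1)] by (simp add: algebra_simps)
  show "gram n 0 1 (pair_elt n l u v) - gram n 1 0 (pair_elt n l u v) =
      (u $ n * v $ (n + 1) - u $ (n + 1) * v $ n) * (inverse l + l - 2)"
    unfolding G[OF n1] G[OF n1(2,1)] z[OF n1] z[OF n1(2,1)] by (simp add: algebra_simps)
qed

lemma std_borel_mult_unit_vec: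
  fixes b :: "'k::field mat"
  assumes b: "b \<in> std_borel n" and n: "n \<ge> 2"
  shows "b *\<^sub>v ev n 0 = b $$ (0, 0) \<cdot>\<^sub>v ev n 0" "b *\<^sub>v ev n 1 = b $$ (1, 1) \<cdot>\<^sub>v ev n 1 + b $$ (0, 1) \<cdot>\<^sub>v ev n 0"
proof -
  note bm = std_borel_carrier[OF b]
  have z: "b $$ (p, q) = 0" if "p < 2 * n" "q < p" "q \<le> 1" for p q
  proof -
    have "ht n q < ht n p" using that n by (auto simp: ht_def)
    then show ?thesis using b that unfolding std_borel_iff by auto
  qed
  show "b *\<^sub>v ev n 0 = b $$ (0, 0) \<cdot>\<^sub>v ev n 0"
  proof (rule eq_vecI)
    fix p assume "p < dim_vec (b $$ (0, 0) \<cdot>\<^sub>v ev n 0)"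
    then have p: "p < 2 * n" by simp
    show "(b *\<^sub>v ev n 0) $ p = (b $$ (0, 0) \<cdot>\<^sub>v ev n 0) $ p"
      using z[OF p, of 0] mat_mult_unit_vec_index[OF bm p, of 0] p by (cases "p = 0") auto
  qed (use bm in simp)
  show "b *\<^sub>v ev n 1 = b $$ (1, 1) \<cdot>\<^sub>v ev n 1 + b $$ (0, 1) \<cdot>\<^sub>v ev n 0"
  proof (rule eq_vecI)
    fix p assume "p < dim_vec (b $$ (1, 1) \<cdot>\<^sub>v ev n 1 + b $$ (0, 1) \<cdot>\<^sub>v ev n 0)"
    then have p: "p < 2 * n" by simp
    consider "p = 0" | "p = 1" | "1 < p" by linarith
    then show "(b *\<^sub>v ev n 1) $ p = (b $$ (1, 1) \<cdot>\<^sub>v ev n 1 + b $$ (0, 1) \<cdot>\<^sub>v ev n 0) $ p"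
      using z[OF p, of 1] mat_mult_unit_vec_index[OF bm p, of 1] p n by cases auto
  qed (use bm in simp)
qed

text \<open>\<open>u\<close> is moved to \<open>ev n n\<close>, after which the pairing forces the
  coordinate -1 of \<open>v\<close> at 0. The rest of \<open>v\<close> is straightened without
  disturbing the first pair, and the torus together with rescaling of \<open>(u, v)\<close>
  normalizes the last two coefficients. The conditions \<open>gen\<close> keep all of these divisors
  non-zero.\<close>

lemma pair_elt_normal_form:
  fixes u v :: "'k::alg_closed_field vec"
  assumes n: "n \<ge> 2" and u: "u \<in> carrier_vec (2 * n)" and v: "v \<in> carrier_vec (2 * n)" and uv: "sform n u v = 1"
    and gen: "u $ n \<noteq> 0" "v $ n \<noteq> 0" "u $ n * v $ (n + 1) - u $ (n + 1) * v $ n \<noteq> 0"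
  obtains b where "b \<in> std_borel n"
    "b * pair_elt n l u v * inv\<^bsub>Sp n\<^esub> b = pair_elt n l (ev n n) ((- 1) \<cdot>\<^sub>v ev n 0 + (ev n n + ev n (n + 1)))"
proof -
  let ?m = "2 * n"
  have n1: "0 < n" "1 < n" using n by auto
  \<comment> \<open>Rescaling the pair does not change \<open>pair_elt\<close>; it gives
    \<open>u1\<close> the coordinate 1 at \<open>n\<close>, as needed for moving it to
    \<open>ev n n\<close>.\<close>
  define c where "c = inverse (u $ n)"
  define u1 where "u1 = c \<cdot>\<^sub>v u"
  define v1 where "v1 = inverse c \<cdot>\<^sub>v v"
  have c: "c \<noteq> 0" using gen by (simp add: c_def)
  have u1: "u1 \<in> carrier_vec ?m" "u1 $ n = 1" unfolding u1_def c_def using u gen n1 by auto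
  have v1: "v1 \<in> carrier_vec ?m" "v1 $ n \<noteq> 0" unfolding v1_def using v gen c n1 by auto
  have uv1: "sform n u1 v1 = 1" unfolding u1_def v1_def using u v c uv by (simp add: sform_smult_left sform_smult_right)
  have "u1 $ n * v1 $ (n + 1) - u1 $ (n + 1) * v1 $ n = (c * inverse c) * (u $ n * v $ (n + 1) - u $ (n + 1) * v $ n)"
    unfolding u1_def v1_def using u v n1 by (simp add: algebra_simps)
  then have minor1: "u1 $ n * v1 $ (n + 1) - u1 $ (n + 1) * v1 $ n \<noteq> 0" using gen c by simp
  have pe1: "pair_elt n l u v = pair_elt n l u1 v1" unfolding u1_def v1_def using pair_elt_scale[OF u v c] by simp
  obtain b1 where b1: "b1 \<in> std_borel n" "b1 *\<^sub>v u1 = ev n (n + 0)"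
    using std_borel_moves_to_lowest[of 0 n u1] u1 n1 by auto
  have b1S: "b1 \<in> carrier (Sp n)" using b1 by (simp add: std_borel_iff)
  define v2 where "v2 = b1 *\<^sub>v v1"
  have v2c: "v2 \<in> carrier_vec ?m" unfolding v2_def using Sp_mult_vec[OF b1S v1(1)] .
  note flag = std_borel_mult_unit_vec[OF b1(1) n]
  \<comment> \<open>The coordinates at \<open>n\<close> and \<open>n + 1\<close> are the pairings
    with \<open>ev n 0\<close> and \<open>ev n 1\<close>, on which \<open>b1\<close> is triangular.
    So the minor is multiplied by diagonal entries of \<open>b1\<close>, and its non-vanishing
    passes to \<open>v2 $ (n + 1)\<close>.\<close>
  have E0: "z $ n = b1 $$ (0, 0) * (b1 *\<^sub>v z) $ n" if z: "z \<in> carrier_vec ?m" for z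
    using Sp_sform[OF b1S unit_vec_carrier z, of 0] flag(1) sform_unit_vec(3)[OF n1(1), of z]
      sform_unit_vec(3)[OF n1(1), of "b1 *\<^sub>v z"] by (simp add: sform_smult_left)
  have E1: "z $ (n + 1) = b1 $$ (1, 1) * (b1 *\<^sub>v z) $ (n + 1) + b1 $$ (0, 1) * (b1 *\<^sub>v z) $ n" if z: "z \<in> carrier_vec ?m" for z
    using Sp_sform[OF b1S unit_vec_carrier z, of 1] sform_unit_vec(3)[OF n1(2), of z]
      sform_unit_vec(3)[OF n1(1), of "b1 *\<^sub>v z"] sform_unit_vec(3)[OF n1(2), of "b1 *\<^sub>v z"] Sp_mult_vec[OF b1S z]
    unfolding flag(2) by (simp add: sform_add_left sform_smult_left)
  have v2n: "v2 $ n \<noteq> 0" using E0[OF v1(1)] v1(2) unfolding v2_def by auto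
  have bu: "(b1 *\<^sub>v u1) $ n = 1" "(b1 *\<^sub>v u1) $ (n + 1) = 0" using b1(2) n1 by auto
  have "u1 $ n * v1 $ (n + 1) - u1 $ (n + 1) * v1 $ n = b1 $$ (0, 0) * b1 $$ (1, 1) * v2 $ (n + 1)"
    unfolding E0[OF u1(1)] E0[OF v1(1)] E1[OF u1(1)] E1[OF v1(1)] bu v2_def[symmetric] by (simp add: algebra_simps)
  then have v2n1: "v2 $ (n + 1) \<noteq> 0" using minor1 by auto
  have v20: "v2 $ 0 = - 1"
    using Sp_sform[OF b1S u1(1) v1(1)] uv1 sform_unit_vec(4)[OF n1(1), of v2] unfolding b1(2) v2_def[symmetric]
    by (simp add: minus_equation_iff[of _ 1])
  define g where "g = v2 $ n"
  define h where "h = v2 $ (n + 1)"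
  \<comment> \<open>The part of \<open>v2\<close> outside the first hyperbolic pair, scaled to have
    coordinate 1 at \<open>n + 1\<close>; it lies in \<open>tail_space n 1\<close> and can be
    straightened there.\<close>
  define w where "w = inverse h \<cdot>\<^sub>v (v2 - ((- 1) \<cdot>\<^sub>v ev n 0 + g \<cdot>\<^sub>v ev n n))"
  have w: "w \<in> tail_space n 1" "w $ (n + 1) = 1"
    unfolding w_def tail_space_def using v2c v20 v2n1 n1 by (auto simp: g_def h_def)
  have v2w: "v2 = ((- 1) \<cdot>\<^sub>v ev n 0 + g \<cdot>\<^sub>v ev n (n + 0)) + h \<cdot>\<^sub>v w"
    unfolding w_def using v2c v2n1 by (intro eq_vecI) (auto simp: h_def simp flip: mult.assoc)
  have "\<exists>b. b \<in> std_borel n \<and> b *\<^sub>v w = ev n (n + 1) \<and> b *\<^sub>v ev n 0 = ev n 0 \<and> b *\<^sub>v ev n (n + 0) = ev n (n + 0)"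
  proof (rule std_borel_moves_to_lowest[OF n1(2) w])
    fix b :: "'k mat"
    assume b: "b \<in> std_borel n" "b *\<^sub>v w = ev n (n + 1)" "\<And>i. i < 1 \<Longrightarrow> b *\<^sub>v ev n i = ev n i"
      "\<And>i. i < 1 \<Longrightarrow> b *\<^sub>v ev n (n + i) = ev n (n + i)"
    show ?thesis
      by (intro exI[of _ b] conjI b) simp_all
  qed
  then obtain b2 where b2: "b2 \<in> std_borel n" "b2 *\<^sub>v w = ev n (n + 1)" "b2 *\<^sub>v ev n 0 = ev n 0"
    "b2 *\<^sub>v ev n (n + 0) = ev n (n + 0)" by blast
  have b2S: "b2 \<in> carrier (Sp n)" and b2m: "b2 \<in> carrier_mat ?m ?m" using b2 std_borel_carrier by (auto simp: std_borel_iff)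
  have wc: "w \<in> carrier_vec ?m" using tail_space_carrier[OF w(1)] .
  have b2v: "b2 *\<^sub>v v2 = ((- 1) \<cdot>\<^sub>v ev n 0 + g \<cdot>\<^sub>v ev n n) + h \<cdot>\<^sub>v ev n (n + 1)"
    unfolding v2w using wc b2(2-4) by (simp add: mult_add_distrib_mat_vec[OF b2m] mult_mat_vec[OF b2m])
  \<comment> \<open>The torus turns the coefficients -1, \<open>g\<close>, \<open>h\<close> into
    \<open>-\<tau>\<close>, \<open>g / \<tau>\<close> and \<open>h / (h / \<tau>)\<close>. With
    \<open>\<tau> ^ 2 = g\<close> they have the common factor \<open>\<tau>\<close>, which cancels
    against the factor \<open>inverse \<tau>\<close> of the first vector by
    \<open>pair_elt_scale\<close>.\<close>
  obtain \<tau> where \<tau>: "\<tau> ^ 2 = g" using nth_root_exists[of 2 g] by auto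
  have \<tau>0: "\<tau> \<noteq> 0" using \<tau> v2n by (auto simp: g_def)
  have h0: "h \<noteq> 0" using v2n1 by (simp add: h_def)
  define t where "t i = (if i = 0 then \<tau> else if i = 1 then h / \<tau> else 1)" for i :: nat
  have tB: "dmat n t \<in> std_borel n" by (rule dmat_std_borel) (use \<tau>0 h0 in \<open>auto simp: t_def\<close>)
  have tS: "dmat n t \<in> carrier (Sp n)" using tB by (simp add: std_borel_iff)
  note te = dmat_mult_unit_vec[OF n1(1), of t] dmat_mult_unit_vec[OF n1(2), of t]
  have tf0: "dmat n t *\<^sub>v ev n n = inverse \<tau> \<cdot>\<^sub>v ev n n" using te(2) by (simp add: t_def)
  have tv: "dmat n t *\<^sub>v (((- 1) \<cdot>\<^sub>v ev n 0 + g \<cdot>\<^sub>v ev n n) + h \<cdot>\<^sub>v ev n (n + 1)) =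
      \<tau> \<cdot>\<^sub>v ((- 1) \<cdot>\<^sub>v ev n 0 + (ev n n + ev n (n + 1)))"
  proof -
    have "dmat n t *\<^sub>v (((- 1) \<cdot>\<^sub>v ev n 0 + g \<cdot>\<^sub>v ev n n) + h \<cdot>\<^sub>v ev n (n + 1)) =
        ((- 1) \<cdot>\<^sub>v (\<tau> \<cdot>\<^sub>v ev n 0) + g \<cdot>\<^sub>v (inverse \<tau> \<cdot>\<^sub>v ev n n)) + h \<cdot>\<^sub>v (inverse (h / \<tau>) \<cdot>\<^sub>v ev n (n + 1))"
      using te tf0 by (simp add: mult_add_distrib_mat_vec[OF dmat_carrier] mult_mat_vec[OF dmat_carrier] t_def)
    also have "\<dots> = \<tau> \<cdot>\<^sub>v ((- 1) \<cdot>\<^sub>v ev n 0 + (ev n n + ev n (n + 1)))"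
    proof -
      have "g * inverse \<tau> = \<tau>" "h * inverse (h / \<tau>) = \<tau>" using \<tau>[symmetric] \<tau>0 h0 by (auto simp: power2_eq_square)
      then show ?thesis unfolding smult_smult_assoc by (intro eq_vecI) (auto simp: algebra_simps)
    qed
    finally show ?thesis .
  qed
  define b where "b = dmat n t * (b2 * b1)"
  have bB: "b \<in> std_borel n" unfolding b_def by (intro std_borel_mult tB b2 b1)
  have bS: "b \<in> carrier (Sp n)" using bB by (simp add: std_borel_iff)
  have bz: "b *\<^sub>v z = dmat n t *\<^sub>v (b2 *\<^sub>v (b1 *\<^sub>v z))" if z: "z \<in> carrier_vec ?m" for z
    unfolding b_def
    using assoc_mult_mat_vec[OF dmat_carrier Sp_carrier[OF Sp_closed[OF b2S b1S]] z]
      assoc_mult_mat_vec[OF b2m Sp_carrier[OF b1S] z] by simp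
  have bu1: "b *\<^sub>v u1 = inverse \<tau> \<cdot>\<^sub>v ev n n" using bz[OF u1(1)] b1(2) b2(4) tf0 by simp
  have bv1: "b *\<^sub>v v1 = inverse (inverse \<tau>) \<cdot>\<^sub>v ((- 1) \<cdot>\<^sub>v ev n 0 + (ev n n + ev n (n + 1)))"
    using bz[OF v1(1)] b2v tv by (simp add: v2_def)
  have "b * pair_elt n l u v * inv\<^bsub>Sp n\<^esub> b = pair_elt n l (ev n n) ((- 1) \<cdot>\<^sub>v ev n 0 + (ev n n + ev n (n + 1)))"
    unfolding pe1 pair_elt_conj[OF bS u1(1) v1(1)] bu1 bv1 using \<tau>0 by (intro pair_elt_scale) auto
  then show ?thesis using that bB by blast
qed

lemma spherical_class_c_elt:
  fixes l :: "'k::alg_closed_field"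
  assumes char: "CHAR('k) = 2" and n: "n \<ge> 2" and l: "l \<noteq> 0" "l \<noteq> 1"
  shows "spherical_class (2 * n) (Sp n) (conj_class (Sp n) (c_elt n l))"
proof -
  let ?m = "2 * n"
  have n1: "0 < n" "1 < n" using n by auto
  have c: "c_elt n l \<in> carrier (Sp n)" unfolding c_elt_eq_dmat[OF n1(1)] by (rule dmat_Sp) (use l in auto)
  define v0 :: "'k vec" where "v0 = (- 1) \<cdot>\<^sub>v ev n 0 + (ev n n + ev n (n + 1))"
  \<comment> \<open>The base point is the normal form, since the function \<open>F\<close> chosen
    below vanishes at \<open>c_elt n l\<close> itself.\<close>
  define x0 where "x0 = pair_elt n l (ev n n) v0"
  have v0: "v0 \<in> carrier_vec ?m" "v0 $ 0 = - 1" "v0 $ n = 1" "v0 $ (n + 1) = 1" unfolding v0_def using n1 by auto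
  have "sform n (ev n n) v0 = 1" using sform_unit_vec(4)[OF n1(1), of v0] v0(2) by simp
  then have x0C: "x0 \<in> conj_class (Sp n) (c_elt n l)"
    unfolding x0_def by (intro pair_elt_class[OF n1(1) c] v0) auto
  then have x0S: "x0 \<in> carrier (Sp n)" using conj_class_Sp_carrier[OF c] by blast
  \<comment> \<open>By \<open>gram_pair_elt\<close> this is, up to the non-zero constants of
    \<open>k1\<close> and \<open>k2\<close>, the product of the three quantities that the normal
    form requires to be non-zero.\<close>
  define F where "F y = gram n 0 0 y * (gram n 0 1 y - gram n 1 0 y)" for y :: "'k mat"
  have k1: "inverse l - l \<noteq> 0" using char_two_neq_inverse[OF char l(2)] l by auto
  have k2: "inverse l + l - 2 \<noteq> 0"
  proof
    assume "inverse l + l - 2 = 0"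
    then have "(l - 1) * (l - 1) = 0" using l(1) by (simp add: field_simps)
    then show False using l(2) by simp
  qed
  have "spherical_class ?m (Sp n) (conj_class (Sp n) x0)"
  proof (rule spherical_classI[OF x0S, of F])
    show "F \<in> mat_polyfun ?m"
      unfolding F_def using n1 by (intro mat_polyfun.mult mat_polyfun_diff gram_polyfun)
    show "F x0 \<noteq> 0"
      unfolding F_def x0_def gram_pair_elt[OF n unit_vec_carrier v0(1)] using k1 k2 v0 n1 by simp
    fix y assume y: "y \<in> conj_class (Sp n) x0" "F y \<noteq> 0"
    obtain g where g: "g \<in> carrier (Sp n)" "y = g * x0 * inv\<^bsub>Sp n\<^esub> g" using y(1) unfolding conj_class_Sp[OF x0S] by blast
    let ?u = "g *\<^sub>v ev n n" and ?v = "g *\<^sub>v v0"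
    have uv: "?u \<in> carrier_vec ?m" "?v \<in> carrier_vec ?m" using Sp_mult_vec[OF g(1)] v0 by auto
    have "sform n ?u ?v = 1" using Sp_sform[OF g(1) _ v0(1), of "ev n n"] \<open>sform n (ev n n) v0 = 1\<close> by simp
    have ye: "y = pair_elt n l ?u ?v" unfolding g(2) x0_def by (rule pair_elt_conj[OF g(1) _ v0(1)]) simp
    have gen: "?u $ n \<noteq> 0" "?v $ n \<noteq> 0" "?u $ n * ?v $ (n + 1) - ?u $ (n + 1) * ?v $ n \<noteq> 0"
      using y(2) unfolding F_def ye gram_pair_elt[OF n uv] by (auto simp only: mult_eq_0_iff)
    obtain b where b: "b \<in> std_borel n" "b * y * inv\<^bsub>Sp n\<^esub> b = x0"
      using pair_elt_normal_form[OF n uv \<open>sform n ?u ?v = 1\<close> gen, of l] unfolding ye x0_def v0_def by blast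
    have bS: "b \<in> carrier (Sp n)" using b by (simp add: std_borel_iff)
    have yS: "y \<in> carrier (Sp n)" using y conj_class_Sp_carrier[OF x0S] by blast
    have "y = inv\<^bsub>Sp n\<^esub> b * x0 * inv\<^bsub>Sp n\<^esub> (inv\<^bsub>Sp n\<^esub> b)" using Sp_conj_inv[OF bS yS] unfolding b(2) by simp
    then show "\<exists>b\<in>std_borel n. y = b * x0 * inv\<^bsub>Sp n\<^esub> b" using std_borel_inv[OF b(1)] by blast
  qed
  then show ?thesis using conj_class_Sp_eq[OF c x0C] by simp
qed

section \<open>The classes of \<open>a\<^sub>\<lambda>\<close> are spherical\<close>

text \<open>The vectors \<open>a i\<close> form a triangular basis of the flag; the coordinate at
  \<open>r\<close> is removed by a multiple of \<open>a r\<close>.\<close>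

lemma sform_zero_on_flag_space:
  fixes a :: "nat \<Rightarrow> 'k::field vec"
  assumes z: "z \<in> carrier_vec (2 * n)" and r: "r \<le> n"
    and a: "\<And>i. i < r \<Longrightarrow> a i \<in> flag_space n (Suc i)" "\<And>i. i < r \<Longrightarrow> a i $ i \<noteq> 0" "\<And>i. i < r \<Longrightarrow> sform n (a i) z = 0"
    and v: "v \<in> flag_space n r"
  shows "sform n v z = 0"
  using r a v
proof (induction r arbitrary: v)
  case 0
  then have "v = 0\<^sub>v (2 * n)" unfolding flag_space_def by (auto intro!: eq_vecI)
  then show ?case by simp
next
  case (Suc r)
  have ac: "a r \<in> carrier_vec (2 * n)" and vc: "v \<in> carrier_vec (2 * n)" using Suc.prems by (auto simp: flag_space_def)
  define c where "c = v $ r / a r $ r"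
  have "(v - c \<cdot>\<^sub>v a r) $ p = 0" if p: "p < 2 * n" "r \<le> p" for p
  proof (cases "p = r")
    case True
    then show ?thesis using Suc.prems(3)[of r] p vc ac by (simp add: c_def)
  next
    case False
    then have "v $ p = 0" "a r $ p = 0" using Suc.prems(2)[of r] Suc.prems(5) p unfolding flag_space_def by auto
    then show ?thesis using p vc ac by simp
  qed
  then have "v - c \<cdot>\<^sub>v a r \<in> flag_space n r" using vc ac unfolding flag_space_def by simp
  moreover have "a i \<in> flag_space n (Suc i)" "a i $ i \<noteq> 0" "sform n (a i) z = 0" if "i < r" for i
    using Suc.prems(2-4)[of i] that by simp_all
  ultimately have "sform n (v - c \<cdot>\<^sub>v a r) z = 0" using Suc.IH[OF Suc_leD[OF Suc.prems(1)]] by blast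
  then show ?case using Suc.prems(4)[of r] ac vc z by (simp add: sform_diff_left sform_smult_left)
qed

lemma flag_space_isotropic:
  assumes "u \<in> flag_space n n" "v \<in> flag_space n n" shows "sform n u v = 0"
  using assms unfolding sform_def flag_space_def by (intro sum.neutral) auto

lemma flag_space_mono: "r \<le> r' \<Longrightarrow> flag_space n r \<subseteq> flag_space n r'"
  unfolding flag_space_def by auto

lemma Sp_basisI:
  fixes g :: "'k::field mat"
  assumes g: "g \<in> carrier_mat (2 * n) (2 * n)"
    and "\<And>p q. p < 2 * n \<Longrightarrow> q < 2 * n \<Longrightarrow> sform n (g *\<^sub>v ev n p) (g *\<^sub>v ev n q) = sform n (ev n p) (ev n q)"
  shows "g \<in> carrier (Sp n)"
proof -
  let ?m = "2 * n" and ?X = "transpose_mat g * symp_form n * g"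
  have J: "(symp_form n :: 'k mat) \<in> carrier_mat ?m ?m" by simp
  have X: "?X \<in> carrier_mat ?m ?m" using g J by (simp add: mult_carrier_mat[of _ ?m ?m _ ?m])
  have *: "unit_vec ?m i \<bullet> (A *\<^sub>v unit_vec ?m j) = A $$ (i, j)"
    if "A \<in> carrier_mat ?m ?m" "i < ?m" "j < ?m" for A :: "'k mat" and i j
    using scalar_prod_left_unit[OF mult_mat_vec_carrier[OF that(1) unit_vec_carrier] that(2), of j]
      mat_mult_unit_vec_index[OF that] by simp
  have "?X $$ (i, j) = symp_form n $$ (i, j)" if ij: "i < ?m" "j < ?m" for i j
    using *[OF X ij] *[OF J ij] sform_mult_mat_vec[OF g unit_vec_carrier unit_vec_carrier, of i j]
      sform_eq_scalar_prod[OF unit_vec_carrier unit_vec_carrier, where ?'a = 'k, of n i j] assms(2)[OF ij] by simp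
  then have "?X = symp_form n" using carrier_matD[OF X] carrier_matD[OF J] by (intro eq_matI) auto
  then show ?thesis using g by (simp add: Sp_def)
qed

text \<open>The first \<open>n\<close> columns suffice. In the column of
  \<open>ev n (n + j)\<close>, the entry at \<open>n + k\<close> is the pairing with
  \<open>ev n k\<close>; for \<open>k < j\<close> this vector lies in the span of the first
  \<open>j\<close> columns, which are orthogonal to that column.\<close>

lemma std_borel_columnsI:
  fixes c :: "'k::field mat"
  assumes c: "c \<in> carrier (Sp n)"
    and cols: "\<And>q. q < n \<Longrightarrow> c *\<^sub>v ev n q \<in> flag_space n (Suc q)" "\<And>q. q < n \<Longrightarrow> (c *\<^sub>v ev n q) $ q \<noteq> 0"
  shows "c \<in> std_borel n"
  unfolding std_borel_iff
proof (intro conjI allI impI c)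
  note cm = Sp_carrier[OF c]
  fix p q assume pq: "p < 2 * n" "q < 2 * n" "ht n q < ht n p"
  show "c $$ (p, q) = 0"
  proof (cases "q < n")
    case True
    then have "q < p" using pq by (auto simp: ht_def split: if_splits)
    then show ?thesis using cols(1)[OF True] mat_mult_unit_vec_index[OF cm pq(1,2)] pq unfolding flag_space_def by auto
  next
    case False
    define j where "j = q - n"
    define k where "k = p - n"
    have jk: "j < n" "q = n + j" "k < j" "p = n + k" using False pq unfolding j_def k_def by (auto simp: ht_def split: if_splits)
    have "sform n (ev n k) (c *\<^sub>v ev n q) = 0"
    proof (rule sform_zero_on_flag_space[where r = j and a = "\<lambda>i. c *\<^sub>v ev n i"])
      show "c *\<^sub>v ev n q \<in> carrier_vec (2 * n)" using Sp_mult_vec[OF c] by simp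
      show "ev n k \<in> flag_space n j" using jk unfolding flag_space_def by auto
      fix i assume "i < j"
      then show "sform n (c *\<^sub>v ev n i) (c *\<^sub>v ev n q) = 0"
        using Sp_sform[OF c, of "ev n i" "ev n q"] jk by (simp add: sform_unit_vec)
    qed (use jk cols in auto)
    then show ?thesis using jk mat_mult_unit_vec_index[OF cm pq(1,2)] by (simp add: sform_unit_vec)
  qed
qed

section \<open>Leading minors and Gram--Schmidt\<close>

text \<open>Up to sign a leading principal minor of the Gram matrix, because
  \<open>y $$ (n + i, j) = - gram n j i y\<close>.\<close>

definition lower_minor :: "nat \<Rightarrow> nat \<Rightarrow> 'k::comm_ring_1 mat \<Rightarrow> 'k" where
  "lower_minor n k y = det (mat k k (\<lambda>(i, j). y $$ (n + i, j)))"

text \<open>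
  Gram--Schmidt for the bilinear form \<open>(u, v) \<mapsto> \<omega>(y u, v)\<close> on the span of \<open>e\<^sub>0, \<dots>, e\<^sub>n\<^sub>-\<^sub>1\<close>,
  on which it is symmetric if \<open>y + inverse y\<close> is a scalar.
\<close>

lemma orthonormal_flag_basis:
  fixes y :: "'k::alg_closed_field mat"
  assumes y: "y \<in> carrier_mat (2 * n) (2 * n)"
    and sym: "\<And>u v. u \<in> flag_space n n \<Longrightarrow> v \<in> flag_space n n \<Longrightarrow> sform n (y *\<^sub>v u) v = sform n (y *\<^sub>v v) u"
    and minors: "\<And>k. 1 \<le> k \<Longrightarrow> k \<le> n \<Longrightarrow> lower_minor n k y \<noteq> 0" and r: "r \<le> n"
  shows "\<exists>a. (\<forall>i<r. a i \<in> flag_space n (Suc i) \<and> a i $ i \<noteq> 0) \<and>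
    (\<forall>i<r. \<forall>j<r. sform n (y *\<^sub>v a i) (a j) = (if i = j then - 1 else 0))"
  using r
proof (induction r)
  case 0
  show ?case by simp
next
  case (Suc r)
  let ?m = "2 * n"
  have r: "r < n" using Suc.prems by simp
  obtain a where a: "\<And>i. i < r \<Longrightarrow> a i \<in> flag_space n (Suc i)" "\<And>i. i < r \<Longrightarrow> a i $ i \<noteq> 0"
    "\<And>i j. i < r \<Longrightarrow> j < r \<Longrightarrow> sform n (y *\<^sub>v a i) (a j) = (if i = j then - 1 else 0)"
    using Suc.IH r by auto
  have fc: "v \<in> carrier_vec ?m" if "v \<in> flag_space n k" for v :: "'k vec" and k using that by (simp add: flag_space_def)
  have yc: "y *\<^sub>v v \<in> carrier_vec ?m" if "v \<in> carrier_vec ?m" for v using y that by auto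
  note FS = vec_subspace_flag_space[of n]
  have "\<exists>v. v \<in> flag_space n (Suc r) \<and> v $ r = 1 \<and> (\<forall>j<k. sform n (y *\<^sub>v v) (a j) = 0)" if "k \<le> r" for k
    using that
  proof (induction k)
    case 0
    have "(ev n r :: 'k vec) \<in> flag_space n (Suc r)" "(ev n r :: 'k vec) $ r = 1" using r by (auto simp: flag_space_def)
    then show ?case by blast
  next
    case (Suc k)
    then obtain v where v: "v \<in> flag_space n (Suc r)" "v $ r = 1" "\<And>j. j < k \<Longrightarrow> sform n (y *\<^sub>v v) (a j) = 0" by auto
    have k: "k < r" using Suc.prems by simp
    define x where "x = sform n (y *\<^sub>v v) (a k)"
    have ak: "a k \<in> flag_space n (Suc r)" "a k $ r = 0" "a k \<in> carrier_vec ?m"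
      using a(1)[OF k] k r flag_space_mono[of "Suc k" "Suc r" n] unfolding flag_space_def by auto
    have vc: "v \<in> carrier_vec ?m" using fc[OF v(1)] .
    have S: "sform n (y *\<^sub>v (v + x \<cdot>\<^sub>v a k)) (a j) = sform n (y *\<^sub>v v) (a j) + x * sform n (y *\<^sub>v a k) (a j)" if "j < r" for j
      using vc ak(3) fc[OF a(1)[OF that]] yc
      by (simp add: mult_add_distrib_mat_vec[OF y] mult_mat_vec[OF y] sform_add_left sform_smult_left)
    have "sform n (y *\<^sub>v (v + x \<cdot>\<^sub>v a k)) (a j) = 0" if j: "j < Suc k" for j
    proof -
      have "j < r" using j k by simp
      then show ?thesis unfolding S[OF \<open>j < r\<close>] a(3)[OF k \<open>j < r\<close>] using v(3)[of j] j by (cases "j = k") (auto simp: x_def)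
    qed
    moreover have "v + x \<cdot>\<^sub>v a k \<in> flag_space n (Suc r)"
      using vec_subspaceD(3)[OF FS v(1) vec_subspaceD(4)[OF FS ak(1)]] .
    moreover have "(v + x \<cdot>\<^sub>v a k) $ r = 1" using v(2) ak vc r by simp
    ultimately show ?case by blast
  qed
  then obtain v where v: "v \<in> flag_space n (Suc r)" "v $ r = 1" "\<And>j. j < r \<Longrightarrow> sform n (y *\<^sub>v v) (a j) = 0" by blast
  have vc: "v \<in> carrier_vec ?m" using fc[OF v(1)] .
  \<comment> \<open>Otherwise \<open>y *\<^sub>v v\<close> would be orthogonal to all of
    \<open>flag_space n (Suc r)\<close>, and the first \<open>Suc r\<close> coordinates of
    \<open>v\<close> would be a kernel vector of the leading minor of that size.\<close>
  have "sform n (y *\<^sub>v v) v \<noteq> 0"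
  proof
    assume vv: "sform n (y *\<^sub>v v) v = 0"
    define a' where "a' i = (if i < r then a i else v)" for i
    have zero: "sform n u (y *\<^sub>v v) = 0" if u: "u \<in> flag_space n (Suc r)" for u
    proof (rule sform_zero_on_flag_space[where a = a', OF yc[OF vc] _ _ _ _ u])
      fix i assume i: "i < Suc r"
      show "a' i \<in> flag_space n (Suc i)" "a' i $ i \<noteq> 0"
        using i a(1,2)[of i] v(1,2) by (cases "i < r"; auto simp: a'_def less_Suc_eq)+
      show "sform n (a' i) (y *\<^sub>v v) = 0"
        using i v(3)[of i] vv sform_swap[of n "a' i" "y *\<^sub>v v"] by (cases "i < r") (auto simp: a'_def)
    qed (use r in simp)
    define M where "M = mat (Suc r) (Suc r) (\<lambda>(i, j). y $$ (n + i, j))"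
    define w where "w = vec (Suc r) (\<lambda>j. v $ j)"
    have M: "M \<in> carrier_mat (Suc r) (Suc r)" by (simp add: M_def)
    have "M *\<^sub>v w = 0\<^sub>v (Suc r)"
    proof (rule eq_vecI)
      fix i assume "i < dim_vec (0\<^sub>v (Suc r) :: 'k vec)"
      then have i: "i < Suc r" by simp
      have "(M *\<^sub>v w) $ i = (\<Sum>q<Suc r. y $$ (n + i, q) * v $ q)"
        using i by (subst mult_mat_vec_index[OF M]) (auto simp: M_def w_def)
      also have "\<dots> = (\<Sum>q<?m. y $$ (n + i, q) * v $ q)"
        using r v(1) unfolding flag_space_def by (intro sum.mono_neutral_left) auto
      also have "\<dots> = (y *\<^sub>v v) $ (n + i)" using i r by (intro mult_mat_vec_index[OF y vc, symmetric]) simp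
      also have "\<dots> = sform n (ev n i) (y *\<^sub>v v)" using i r by (simp add: sform_unit_vec)
      also have "\<dots> = 0" using i r by (intro zero) (auto simp: flag_space_def)
      finally show "(M *\<^sub>v w) $ i = 0\<^sub>v (Suc r) $ i" using i by simp
    qed (simp add: M_def)
    moreover have "w \<in> carrier_vec (Suc r)" by (simp add: w_def)
    moreover have "w \<noteq> 0\<^sub>v (Suc r)"
    proof
      assume "w = 0\<^sub>v (Suc r)"
      then have "w $ r = 0" by simp
      then show False using v(2) by (simp add: w_def)
    qed
    ultimately have "det M = 0" using det_0_iff_vec_prod_zero[OF M] by blast
    then show False using minors[of "Suc r"] r unfolding lower_minor_def M_def by simp
  qed
  \<comment> \<open>The value -1 is chosen so that \<open>sform n a (y *\<^sub>v a) = 1\<close>: a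
    basis vector and its image under \<open>y\<close> then form a hyperbolic pair. The square root
    exists by algebraic closedness.\<close>
  moreover obtain x where x: "x ^ 2 = - inverse (sform n (y *\<^sub>v v) v)" using nth_root_exists[of 2] by auto
  ultimately have xx: "x * x * sform n (y *\<^sub>v v) v = - 1" and x0: "x \<noteq> 0" by (auto simp: power2_eq_square)
  define b where "b = a(r := x \<cdot>\<^sub>v v)"
  have "b i \<in> flag_space n (Suc i) \<and> b i $ i \<noteq> 0" if "i < Suc r" for i
    using that a(1,2)[of i] vec_subspaceD(4)[OF FS v(1), of x] v(2) x0 vc r by (cases "i = r") (auto simp: b_def)
  moreover have "sform n (y *\<^sub>v b i) (b j) = (if i = j then - 1 else 0)" if ij: "i < Suc r" "j < Suc r" for i j
  proof -
    have vE: "v \<in> flag_space n n" using v(1) flag_space_mono[of "Suc r" n n] r by auto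
    have aE: "a i \<in> flag_space n n" if "i < r" for i using a(1)[OF that] flag_space_mono[of "Suc i" n n] r that by auto
    have xv: "y *\<^sub>v (x \<cdot>\<^sub>v v) = x \<cdot>\<^sub>v (y *\<^sub>v v)" using mult_mat_vec[OF y vc] .
    consider "i = r" "j = r" | "i = r" "j < r" | "i < r" "j = r" | "i < r" "j < r" using ij by linarith
    then show ?thesis
    proof cases
      case 1
      then show ?thesis using xx vc yc[OF vc] by (simp add: b_def xv sform_smult_left sform_smult_right mult.assoc)
    next
      case 2
      then show ?thesis using v(3)[of j] yc[OF vc] by (simp add: b_def xv sform_smult_left)
    next
      case 3
      then have "sform n (y *\<^sub>v a i) v = 0" using sym[OF aE[OF 3(1)] vE] v(3)[of i] by simp
      then show ?thesis using 3 vc by (simp add: b_def sform_smult_right)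
    next
      case 4
      then show ?thesis using a(3) by (simp add: b_def)
    qed
  qed
  ultimately show ?case by blast
qed

section \<open>The companion form of the class of a scalar pair\<close>

text \<open>On each hyperbolic plane the companion matrix of the polynomial
  \<open>X\<^sup>2 - s X + 1\<close>. Its lower left block is the identity, so all lower minors are
  1, unlike those of the diagonal representative.\<close>

definition companion_elt :: "nat \<Rightarrow> 'k::comm_ring_1 \<Rightarrow> 'k mat" where
  "companion_elt n s = mat (2 * n) (2 * n)
     (\<lambda>(p, q). if p = q + n then 1 else if q = p + n then - 1 else if p = q \<and> n \<le> p then s else 0)"

lemma companion_elt_carrier [simp]: "companion_elt n s \<in> carrier_mat (2 * n) (2 * n)"
  by (simp add: companion_elt_def)

lemma companion_elt_mult_unit_vec:
  fixes s :: "'k::comm_ring_1"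
  assumes i: "i < n"
  shows "companion_elt n s *\<^sub>v ev n i = ev n (n + i)"
    "companion_elt n s *\<^sub>v ev n (n + i) = s \<cdot>\<^sub>v ev n (n + i) - ev n i"
proof -
  show "companion_elt n s *\<^sub>v ev n i = ev n (n + i)"
  proof (rule eq_vecI)
    fix p assume "p < dim_vec (ev n (n + i) :: 'k vec)"
    then have p: "p < 2 * n" by simp
    show "(companion_elt n s *\<^sub>v ev n i) $ p = ev n (n + i) $ p"
      using mat_mult_unit_vec_index[OF companion_elt_carrier p, of i s] p i by (auto simp: companion_elt_def)
  qed (simp add: companion_elt_def)
  show "companion_elt n s *\<^sub>v ev n (n + i) = s \<cdot>\<^sub>v ev n (n + i) - ev n i"
  proof (rule eq_vecI)
    fix p assume "p < dim_vec (s \<cdot>\<^sub>v ev n (n + i) - ev n i)"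
    then have p: "p < 2 * n" by simp
    show "(companion_elt n s *\<^sub>v ev n (n + i)) $ p = (s \<cdot>\<^sub>v ev n (n + i) - ev n i) $ p"
      using mat_mult_unit_vec_index[OF companion_elt_carrier p, of "n + i" s] p i by (auto simp: companion_elt_def)
  qed (simp add: companion_elt_def)
qed

lemma Sp_conj_eqI:
  fixes g :: "'k::field mat"
  assumes g: "g \<in> carrier (Sp n)" and x: "x \<in> carrier_mat (2 * n) (2 * n)" and y: "y \<in> carrier_mat (2 * n) (2 * n)"
    and eq: "\<And>j. j < 2 * n \<Longrightarrow> y *\<^sub>v (g *\<^sub>v ev n j) = g *\<^sub>v (x *\<^sub>v ev n j)"
  shows "y = g * x * inv\<^bsub>Sp n\<^esub> g"
proof -
  let ?m = "2 * n"
  have gm: "g \<in> carrier_mat ?m ?m" and im: "inv\<^bsub>Sp n\<^esub> g \<in> carrier_mat ?m ?m"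
    using Sp_carrier g Sp_inv_closed by blast+
  have "y * g = g * x"
    using eq gm x y assoc_mult_mat_vec[OF y gm, of "ev n _"] assoc_mult_mat_vec[OF gm x, of "ev n _"]
    by (intro mat_eq_unit_vecI[of _ ?m]) auto
  then have "g * x * inv\<^bsub>Sp n\<^esub> g = y * g * inv\<^bsub>Sp n\<^esub> g" by simp
  also have "\<dots> = y * (g * inv\<^bsub>Sp n\<^esub> g)" using y gm im by (rule assoc_mult_mat)
  also have "\<dots> = y" unfolding Sp_inv_mult(2)[OF g] using y by simp
  finally show ?thesis ..
qed

text \<open>On each plane \<open>p i\<close> and \<open>q i\<close> are eigenvectors for
  \<open>l\<close> and \<open>inverse l\<close>, and together they form a symplectic basis.\<close>

lemma companion_elt_class:
  fixes l :: "'k::field"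
  assumes l: "l \<noteq> 0" "l \<noteq> inverse l"
  shows "companion_elt n (l + inverse l) \<in> conj_class (Sp n) (a_elt n l)"
proof -
  let ?m = "2 * n" and ?X = "companion_elt n (l + inverse l)"
  \<comment> \<open>Without this factor the two eigenvectors would pair to
    \<open>l - inverse l\<close>, which is non-zero since the eigenvalues differ.\<close>
  define k where "k = inverse (l - inverse l)"
  have k: "k * (l - inverse l) = 1" unfolding k_def using l by simp
  define p where "p i = ev n i - l \<cdot>\<^sub>v ev n (n + i)" for i
  define q where "q i = k \<cdot>\<^sub>v (ev n i - inverse l \<cdot>\<^sub>v ev n (n + i))" for i
  have pc: "p i \<in> carrier_vec ?m" "q i \<in> carrier_vec ?m" for i unfolding p_def q_def by auto
  define g where "g = mat ?m ?m (\<lambda>(r, j). if j < n then p j $ r else q (j - n) $ r)"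
  have gm: "g \<in> carrier_mat ?m ?m" by (simp add: g_def)
  have ge: "g *\<^sub>v ev n j = (if j < n then p j else q (j - n))" if j: "j < ?m" for j
  proof (rule eq_vecI)
    fix r assume "r < dim_vec (if j < n then p j else q (j - n))"
    then have r: "r < ?m" using carrier_vecD[OF pc(1)] carrier_vecD[OF pc(2)] by (auto split: if_splits)
    show "(g *\<^sub>v ev n j) $ r = (if j < n then p j else q (j - n)) $ r"
      using mat_mult_unit_vec_index[OF gm r j] r j by (simp add: g_def)
  qed (use gm carrier_vecD[OF pc(1)] carrier_vecD[OF pc(2)] in auto)
  note sf = sform_diff_left sform_diff_right sform_smult_left sform_smult_right sform_unit_vec
  have pp: "sform n (p i) (p j) = 0" "sform n (q i) (q j) = 0" if "i < n" "j < n" for i j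
    using that by (auto simp: p_def q_def sf)
  have pq: "sform n (p i) (q j) = (if i = j then 1 else 0)" if "i < n" "j < n" for i j
  proof -
    have "sform n (p i) (q j) = (if i = j then k * (l - inverse l) else 0)"
      using that by (auto simp: p_def q_def sf)
    then show ?thesis using k by simp
  qed
  have gS: "g \<in> carrier (Sp n)"
  proof (rule Sp_basisI[OF gm])
    fix i j assume ij: "i < ?m" "j < ?m"
    have qp: "sform n (q i') (p j') = (if i' = j' then - 1 else 0)" if "i' < n" "j' < n" for i' j'
      using sform_swap[of n "q i'" "p j'"] pq[of j' i'] that by auto
    show "sform n (g *\<^sub>v ev n i) (g *\<^sub>v ev n j) = sform n (ev n i) (ev n j)"
    proof (cases "i < n")
      case True
      then show ?thesis using ij pp(1)[of i j] pq[of i "j - n"] sform_unit_vec(3)[of i n "ev n j"] by (auto simp: ge)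
    next
      case False
      then have i: "i - n < n" "n + (i - n) = i" using ij by simp_all
      show ?thesis
        using False ij i pp(2)[of "i - n" "j - n"] qp[of "i - n" j] sform_unit_vec(4)[OF i(1), of "ev n j"] by (auto simp: ge)
    qed
  qed
  have aS: "a_elt n l \<in> carrier (Sp n)" unfolding a_elt_eq_dmat by (rule dmat_Sp) (use l in auto)
  have Xv: "?X *\<^sub>v (ev n i - x \<cdot>\<^sub>v ev n (n + i)) = x \<cdot>\<^sub>v (ev n i - x' \<cdot>\<^sub>v ev n (n + i))"
    if i: "i < n" and x: "x * x' = x * (l + inverse l) - 1" for i x x'
  proof -
    have "?X *\<^sub>v (ev n i - x \<cdot>\<^sub>v ev n (n + i)) = ev n (n + i) - x \<cdot>\<^sub>v ((l + inverse l) \<cdot>\<^sub>v ev n (n + i) - ev n i)"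
      using companion_elt_mult_unit_vec[OF i, of "l + inverse l"]
      by (simp add: mult_minus_distrib_mat_vec[OF companion_elt_carrier] mult_mat_vec[OF companion_elt_carrier])
    also have "\<dots> = x \<cdot>\<^sub>v (ev n i - x' \<cdot>\<^sub>v ev n (n + i))"
    proof (rule eq_vecI)
      fix r assume "r < dim_vec (x \<cdot>\<^sub>v (ev n i - x' \<cdot>\<^sub>v ev n (n + i)))"
      then have r: "r < ?m" by simp
      have "x * (x' * d) = x * ((l + inverse l) * d) - d" for d
        using arg_cong[OF x, of "\<lambda>z. z * d"] by (simp add: algebra_simps)
      then have "c - x * ((l + inverse l) * c - d) = x * (d - x' * c)" for c d
        by (simp only: right_diff_distrib) simp
      moreover have "(f - x \<cdot>\<^sub>v ((l + inverse l) \<cdot>\<^sub>v f - e)) $ r = f $ r - x * ((l + inverse l) * f $ r - e $ r)"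
        "(x \<cdot>\<^sub>v (e - x' \<cdot>\<^sub>v f)) $ r = x * (e $ r - x' * f $ r)"
        if "e \<in> carrier_vec ?m" "f \<in> carrier_vec ?m" for e f
        using that r by simp_all
      ultimately show "(ev n (n + i) - x \<cdot>\<^sub>v ((l + inverse l) \<cdot>\<^sub>v ev n (n + i) - ev n i)) $ r =
          (x \<cdot>\<^sub>v (ev n i - x' \<cdot>\<^sub>v ev n (n + i))) $ r"
        by (metis unit_vec_carrier)
    qed simp
    finally show ?thesis .
  qed
  have "?X = g * a_elt n l * inv\<^bsub>Sp n\<^esub> g"
  proof (rule Sp_conj_eqI[OF gS Sp_carrier[OF aS] companion_elt_carrier])
    fix j assume j: "j < ?m"
    show "?X *\<^sub>v (g *\<^sub>v ev n j) = g *\<^sub>v (a_elt n l *\<^sub>v ev n j)"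
    proof (cases "j < n")
      case True
      have "?X *\<^sub>v p j = l \<cdot>\<^sub>v p j" unfolding p_def using l by (intro Xv[OF True]) (simp add: algebra_simps)
      moreover have "a_elt n l *\<^sub>v ev n j = l \<cdot>\<^sub>v ev n j" unfolding a_elt_eq_dmat using dmat_mult_unit_vec(1)[OF True] .
      ultimately show ?thesis using True ge[OF j] mult_mat_vec[OF gm, of "ev n j" l] by simp
    next
      case False
      then have i: "j - n < n" "n + (j - n) = j" using j by simp_all
      let ?q = "ev n (j - n) - inverse l \<cdot>\<^sub>v ev n j :: 'k vec"
      have "?X *\<^sub>v ?q = inverse l \<cdot>\<^sub>v ?q"
        using Xv[OF i(1), of "inverse l" "inverse l"] l unfolding i(2) by (simp add: algebra_simps)
      then have "?X *\<^sub>v q (j - n) = inverse l \<cdot>\<^sub>v q (j - n)"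
        unfolding q_def i(2) using mult_mat_vec[OF companion_elt_carrier, of ?q n "l + inverse l" k]
        by (simp add: smult_smult_assoc mult.commute)
      moreover have "a_elt n l *\<^sub>v ev n j = inverse l \<cdot>\<^sub>v ev n j"
        unfolding a_elt_eq_dmat using dmat_mult_unit_vec(2)[OF i(1), of "\<lambda>_. l"] i(2) by simp
      ultimately show ?thesis using False ge[OF j] mult_mat_vec[OF gm, of "ev n j" "inverse l"] by simp
    qed
  qed
  then show ?thesis unfolding conj_class_Sp[OF aS] using gS by blast
qed

text \<open>The relation \<open>y + inverse y = s\<close> on the whole class. It makes the Gram form
  symmetric on isotropic subspaces and the span of \<open>v\<close> and \<open>y *\<^sub>v v\<close>
  stable under \<open>y\<close>.\<close>

lemma companion_elt_quadratic:
  fixes s :: "'k::field"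
  assumes X: "companion_elt n s \<in> carrier (Sp n)" and g: "g \<in> carrier (Sp n)"
    and y: "y = g * companion_elt n s * inv\<^bsub>Sp n\<^esub> g" and v: "v \<in> carrier_vec (2 * n)"
  shows "y *\<^sub>v (y *\<^sub>v v) = s \<cdot>\<^sub>v (y *\<^sub>v v) - v"
proof -
  let ?m = "2 * n" and ?X = "companion_elt n s"
  have XX: "?X * ?X = s \<cdot>\<^sub>m ?X - 1\<^sub>m ?m"
  proof (rule mat_eq_unit_vecI[of _ ?m])
    show "s \<cdot>\<^sub>m ?X - 1\<^sub>m ?m \<in> carrier_mat ?m ?m" by (intro minus_carrier_mat) simp
    fix j assume j: "j < ?m"
    have sX: "(s \<cdot>\<^sub>m ?X - 1\<^sub>m ?m) *\<^sub>v ev n j = s \<cdot>\<^sub>v (?X *\<^sub>v ev n j) - ev n j"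
    proof (rule eq_vecI)
      fix r assume "r < dim_vec (s \<cdot>\<^sub>v (?X *\<^sub>v ev n j) - ev n j)"
      then have r: "r < ?m" by simp
      have "s \<cdot>\<^sub>m ?X - 1\<^sub>m ?m \<in> carrier_mat ?m ?m" by (intro minus_carrier_mat) simp
      from mat_mult_unit_vec_index[OF this r j] mat_mult_unit_vec_index[OF companion_elt_carrier r j, of s]
      show "((s \<cdot>\<^sub>m ?X - 1\<^sub>m ?m) *\<^sub>v ev n j) $ r = (s \<cdot>\<^sub>v (?X *\<^sub>v ev n j) - ev n j) $ r"
        using r j carrier_matD[OF companion_elt_carrier[of n s]] by auto
    qed simp
    have "(?X * ?X) *\<^sub>v ev n j = ?X *\<^sub>v (?X *\<^sub>v ev n j)"
      by (rule assoc_mult_mat_vec[of _ ?m ?m _ ?m]) auto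
    also have "\<dots> = s \<cdot>\<^sub>v (?X *\<^sub>v ev n j) - ev n j"
    proof (cases "j < n")
      case True
      then show ?thesis by (simp add: companion_elt_mult_unit_vec)
    next
      case False
      then have i: "j - n < n" "n + (j - n) = j" using j by simp_all
      note c = companion_elt_mult_unit_vec[OF i(1), of s, unfolded i(2)]
      show ?thesis unfolding c(2) using c
        by (simp add: mult_minus_distrib_mat_vec[OF companion_elt_carrier] mult_mat_vec[OF companion_elt_carrier])
    qed
    finally show "(?X * ?X) *\<^sub>v ev n j = (s \<cdot>\<^sub>m ?X - 1\<^sub>m ?m) *\<^sub>v ev n j" unfolding sX .
  qed (rule mult_carrier_mat[OF companion_elt_carrier companion_elt_carrier])
  define w where "w = inv\<^bsub>Sp n\<^esub> g *\<^sub>v v"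
  have wc: "w \<in> carrier_vec ?m" unfolding w_def using Sp_mult_vec[OF Sp_inv_closed[OF g] v] .
  have gw: "g *\<^sub>v w = v" unfolding w_def using Sp_inv_mult_vec(2)[OF g v] .
  note gm = Sp_carrier[OF g]
  have Xw: "?X *\<^sub>v w \<in> carrier_vec ?m" using Sp_mult_vec[OF X wc] .
  have yv: "y *\<^sub>v v = g *\<^sub>v (?X *\<^sub>v w)"
    unfolding y gw[symmetric] by (rule Sp_conj_mult_vec[OF g companion_elt_carrier wc])
  have "y *\<^sub>v (y *\<^sub>v v) = g *\<^sub>v (?X *\<^sub>v (?X *\<^sub>v w))"
    unfolding yv unfolding y by (rule Sp_conj_mult_vec[OF g companion_elt_carrier Xw])
  also have "?X *\<^sub>v (?X *\<^sub>v w) = (?X * ?X) *\<^sub>v w"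
    by (rule assoc_mult_mat_vec[symmetric, of _ ?m ?m _ ?m]) (use wc in auto)
  also have "\<dots> = s \<cdot>\<^sub>v (?X *\<^sub>v w) - w"
    unfolding XX
  proof (rule eq_vecI)
    fix r assume "r < dim_vec (s \<cdot>\<^sub>v (?X *\<^sub>v w) - w)"
    then have r: "r < ?m" using wc by simp
    have c: "s \<cdot>\<^sub>m ?X - 1\<^sub>m ?m \<in> carrier_mat ?m ?m" by (intro minus_carrier_mat) simp
    have "((s \<cdot>\<^sub>m ?X - 1\<^sub>m ?m) *\<^sub>v w) $ r = (\<Sum>q<?m. s * (?X $$ (r, q) * w $ q) - (if q = r then w $ r else 0))"
      unfolding mult_mat_vec_index[OF c wc r]
      using r carrier_matD[OF companion_elt_carrier[of n s]] by (intro sum.cong) (auto simp: algebra_simps)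
    also have "\<dots> = s * (?X *\<^sub>v w) $ r - w $ r"
      unfolding mult_mat_vec_index[OF companion_elt_carrier wc r] sum_subtractf sum_distrib_left using r by simp
    finally show "((s \<cdot>\<^sub>m ?X - 1\<^sub>m ?m) *\<^sub>v w) $ r = (s \<cdot>\<^sub>v (?X *\<^sub>v w) - w) $ r"
      using r wc carrier_matD[OF companion_elt_carrier[of n s]] by simp
  qed (use wc in simp)
  also have "g *\<^sub>v \<dots> = s \<cdot>\<^sub>v (y *\<^sub>v v) - v"
    unfolding yv using Xw wc gw by (simp add: mult_minus_distrib_mat_vec[OF gm] mult_mat_vec[OF gm])
  finally show ?thesis .
qed

text \<open>The vectors \<open>a i\<close> of an orthonormalized flag basis and their images under
  \<open>y\<close> form a symplectic basis in which \<open>y\<close> has the companion form. Since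
  the \<open>a i\<close> are adapted to the flag, the change of basis belongs to the Borel
  subgroup.\<close>

lemma spherical_class_a_elt:
  fixes l :: "'k::alg_closed_field"
  assumes l: "l \<noteq> 0" "l \<noteq> inverse l"
  shows "spherical_class (2 * n) (Sp n) (conj_class (Sp n) (a_elt n l))"
proof -
  let ?m = "2 * n"
  define s where "s = l + inverse l"
  let ?X = "companion_elt n s"
  have aS: "a_elt n l \<in> carrier (Sp n)" unfolding a_elt_eq_dmat by (rule dmat_Sp) (use l in auto)
  have XC: "?X \<in> conj_class (Sp n) (a_elt n l)" unfolding s_def by (rule companion_elt_class[OF l])
  then have XS: "?X \<in> carrier (Sp n)" using conj_class_Sp_carrier[OF aS] by blast
  define F where "F y = (\<Prod>k\<in>{1..n}. lower_minor n k y)" for y :: "'k mat"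
  have "spherical_class ?m (Sp n) (conj_class (Sp n) ?X)"
  proof (rule spherical_classI[OF XS, of F])
    have "lower_minor n k \<in> mat_polyfun ?m" if "k \<in> {1..n}" for k
      unfolding lower_minor_def using that by (intro mat_polyfun_det mat_polyfun.entry) auto
    then show "F \<in> mat_polyfun ?m" unfolding F_def by (intro mat_polyfun_prod) auto
    have "lower_minor n k ?X = 1" if "k \<in> {1..n}" for k
    proof -
      have "mat k k (\<lambda>(i, j). ?X $$ (n + i, j)) = 1\<^sub>m k"
        using that by (intro eq_matI) (auto simp: companion_elt_def)
      then show ?thesis unfolding lower_minor_def by simp
    qed
    then show "F ?X \<noteq> 0" unfolding F_def by simp
    fix y assume y: "y \<in> conj_class (Sp n) ?X" "F y \<noteq> 0"
    have yS: "y \<in> carrier (Sp n)" using y conj_class_Sp_carrier[OF XS] by blast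
    note ym = Sp_carrier[OF yS]
    obtain g where g: "g \<in> carrier (Sp n)" "y = g * ?X * inv\<^bsub>Sp n\<^esub> g" using y(1) unfolding conj_class_Sp[OF XS] by blast
    note quad = companion_elt_quadratic[OF XS g]
    have yc: "y *\<^sub>v v \<in> carrier_vec ?m" if "v \<in> carrier_vec ?m" for v using Sp_mult_vec[OF yS that] .
    have fc: "v \<in> carrier_vec ?m" if "v \<in> flag_space n k" for v :: "'k vec" and k using that by (simp add: flag_space_def)
    have sym: "sform n (y *\<^sub>v u) v = sform n (y *\<^sub>v v) u" if uv: "u \<in> flag_space n n" "v \<in> flag_space n n" for u v
    proof -
      note c = fc[OF uv(1)] fc[OF uv(2)]
      have "sform n u v = sform n (y *\<^sub>v u) (y *\<^sub>v v)" using Sp_sform[OF yS c] by simp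
      \<comment> \<open>Invariance under \<open>y\<close>, then the quadratic relation; the term
        with \<open>s\<close> is \<open>s * sform n u v\<close>, which vanishes as the flag is
        isotropic.\<close>
      have "sform n (y *\<^sub>v u) v = sform n (y *\<^sub>v (y *\<^sub>v u)) (y *\<^sub>v v)" using Sp_sform[OF yS yc[OF c(1)] c(2)] by simp
      also have "\<dots> = s * sform n (y *\<^sub>v u) (y *\<^sub>v v) - sform n u (y *\<^sub>v v)"
        unfolding quad[OF c(1)] using c yc by (simp add: sform_diff_left sform_smult_left)
      also have "\<dots> = sform n (y *\<^sub>v v) u"
        using Sp_sform[OF yS c] flag_space_isotropic[OF uv] sform_swap[of n u "y *\<^sub>v v"] by simp
      finally show ?thesis .
    qed
    have minors: "lower_minor n k y \<noteq> 0" if "1 \<le> k" "k \<le> n" for k using y(2) that unfolding F_def by auto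
    obtain a where a: "\<And>i. i < n \<Longrightarrow> a i \<in> flag_space n (Suc i)" "\<And>i. i < n \<Longrightarrow> a i $ i \<noteq> 0"
      "\<And>i j. i < n \<Longrightarrow> j < n \<Longrightarrow> sform n (y *\<^sub>v a i) (a j) = (if i = j then - 1 else 0)"
      using orthonormal_flag_basis[OF ym sym minors le_refl] by blast
    have ac: "a i \<in> carrier_vec ?m" "a i \<in> flag_space n n" if "i < n" for i
      using fc[OF a(1)[OF that]] a(1)[OF that] flag_space_mono[of "Suc i" n n] that by auto
    define c where "c = mat ?m ?m (\<lambda>(p, q). if q < n then a q $ p else (y *\<^sub>v a (q - n)) $ p)"
    have cm: "c \<in> carrier_mat ?m ?m" by (simp add: c_def)
    have ce: "c *\<^sub>v ev n q = (if q < n then a q else y *\<^sub>v a (q - n))" if q: "q < ?m" for q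
    proof (rule eq_vecI)
      have d: "dim_vec (if q < n then a q else y *\<^sub>v a (q - n)) = ?m"
        using ac(1)[of q] yc[OF ac(1)[of "q - n"]] q by (auto dest: carrier_vecD)
      show "dim_vec (c *\<^sub>v ev n q) = dim_vec (if q < n then a q else y *\<^sub>v a (q - n))" unfolding d using cm by simp
      fix r assume "r < dim_vec (if q < n then a q else y *\<^sub>v a (q - n))"
      then have r: "r < ?m" unfolding d .
      show "(c *\<^sub>v ev n q) $ r = (if q < n then a q else y *\<^sub>v a (q - n)) $ r"
        using mat_mult_unit_vec_index[OF cm r q] r q by (simp add: c_def)
    qed
    have cS: "c \<in> carrier (Sp n)"
    proof (rule Sp_basisI[OF cm])
      fix p q assume pq: "p < ?m" "q < ?m"
      have aa: "sform n (a i) (a j) = 0" "sform n (y *\<^sub>v a i) (y *\<^sub>v a j) = 0" if "i < n" "j < n" for i j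
        using flag_space_isotropic[OF ac(2)[OF that(1)] ac(2)[OF that(2)]]
          Sp_sform[OF yS ac(1)[OF that(1)] ac(1)[OF that(2)]] by simp_all
      have ay: "sform n (a i) (y *\<^sub>v a j) = (if i = j then 1 else 0)" if "i < n" "j < n" for i j
        using sform_swap[of n "a i" "y *\<^sub>v a j"] a(3)[OF that(2,1)] by auto
      show "sform n (c *\<^sub>v ev n p) (c *\<^sub>v ev n q) = sform n (ev n p) (ev n q)"
      proof (cases "p < n")
        case True
        then show ?thesis using pq aa(1)[of p q] ay[of p "q - n"] sform_unit_vec(3)[of p n "ev n q"] by (auto simp: ce)
      next
        case False
        then have i: "p - n < n" "n + (p - n) = p" using pq by simp_all
        show ?thesis
          using False pq i aa(2)[of "p - n" "q - n"] a(3)[of "p - n" q] sform_unit_vec(4)[OF i(1), of "ev n q"] by (auto simp: ce)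
      qed
    qed
    have "c \<in> std_borel n"
      by (rule std_borel_columnsI[OF cS]) (use a(1,2) ce in auto)
    moreover have "y = c * ?X * inv\<^bsub>Sp n\<^esub> c"
    proof (rule Sp_conj_eqI[OF cS companion_elt_carrier ym])
      fix j assume j: "j < ?m"
      show "y *\<^sub>v (c *\<^sub>v ev n j) = c *\<^sub>v (?X *\<^sub>v ev n j)"
      proof (cases "j < n")
        case True
        then show ?thesis using ce[OF j] ce[of "n + j"] by (simp add: companion_elt_mult_unit_vec)
      next
        case False
        then have i: "j - n < n" "n + (j - n) = j" using j by simp_all
        have "c *\<^sub>v (?X *\<^sub>v ev n j) = s \<cdot>\<^sub>v (c *\<^sub>v ev n j) - c *\<^sub>v ev n (j - n)"
          using companion_elt_mult_unit_vec(2)[OF i(1), of s] unfolding i(2)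
          by (simp add: mult_minus_distrib_mat_vec[OF cm] mult_mat_vec[OF cm])
        also have "\<dots> = s \<cdot>\<^sub>v (y *\<^sub>v a (j - n)) - a (j - n)" using False ce[OF j] ce[of "j - n"] i(1) by simp
        also have "\<dots> = y *\<^sub>v (c *\<^sub>v ev n j)" using quad[OF ac(1)[OF i(1)]] False ce[OF j] by simp
        finally show ?thesis ..
      qed
    qed
    ultimately show "\<exists>b\<in>std_borel n. y = b * ?X * inv\<^bsub>Sp n\<^esub> b" by blast
  qed
  then show ?thesis using conj_class_Sp_eq[OF aS XC] by simp
qed

section \<open>Semisimplicity of the representatives and conclusion\<close>

lemma semisimple_class_dmat:
  fixes t :: "nat \<Rightarrow> 'k::alg_closed_field"
  assumes t: "dmat n t \<in> carrier (Sp n)"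
  shows "semisimple_class (conj_class (Sp n) (dmat n t))"
  unfolding semisimple_class_def semisimple_mat_def
proof (intro ballI exI conjI)
  fix x assume "x \<in> conj_class (Sp n) (dmat n t)"
  then obtain g where g: "g \<in> carrier (Sp n)" "x = g * dmat n t * inv\<^bsub>Sp n\<^esub> g" unfolding conj_class_Sp[OF t] by blast
  show "diagonal_mat (dmat n t)" by (simp add: diagonal_mat_def dmat_def)
  have "similar_mat_wit x (dmat n t) g (inv\<^bsub>Sp n\<^esub> g)"
    using Sp_inv_mult[OF g(1)] Sp_carrier[OF g(1)] Sp_carrier[OF Sp_inv_closed[OF g(1)]] g(2)
      Sp_carrier[OF Sp_conj_closed[OF g(1) t]]
    by (intro similar_mat_witI[of _ _ "2 * n"]) auto
  then show "similar_mat x (dmat n t)" unfolding similar_mat_def by blast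
qed

theorem proposition3p18:
  fixes n :: nat
  assumes "CHAR('k::alg_closed_field) = 2" and "n \<ge> 2"
  shows "(\<forall>l::'k. l \<noteq> 0 \<and> l \<noteq> 1 \<longrightarrow>
            (\<forall>x \<in> {a_elt n l, c_elt n l}.
               x \<in> carrier (Sp n) \<and>
               conj_class (Sp n) x \<noteq> {\<one>\<^bsub>Sp n\<^esub>} \<and>
               semisimple_class (conj_class (Sp n) x) \<and>
               spherical_class (2 * n) (Sp n) (conj_class (Sp n) x)))
       \<and> (\<forall>C \<in> conj_classes (Sp n :: 'k mat monoid).
            C \<noteq> {\<one>\<^bsub>Sp n\<^esub>} \<and> semisimple_class C \<and> spherical_class (2 * n) (Sp n) C \<longrightarrow>
            (\<exists>l. l \<noteq> 0 \<and> l \<noteq> 1 \<and> (a_elt n l \<in> C \<or> c_elt n l \<in> C)))"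
proof (intro conjI allI impI ballI)
  have n0: "0 < n" using assms(2) by simp
  fix l :: 'k and x assume l: "l \<noteq> 0 \<and> l \<noteq> 1" and x: "x \<in> {a_elt n l, c_elt n l}"
  have ll: "l \<noteq> inverse l" using char_two_neq_inverse[OF assms(1)] l by blast
  obtain t where t: "x = dmat n t" "\<And>i. t i \<noteq> 0" "t 0 = l"
    using x l a_elt_eq_dmat[of n l] c_elt_eq_dmat[OF n0, of l]
      that[of "\<lambda>_. l"] that[of "\<lambda>i. if i = 0 then l else 1"] by auto
  show xS: "x \<in> carrier (Sp n)" unfolding t(1) using t(2) by (intro dmat_Sp)
  show "semisimple_class (conj_class (Sp n) x)"
    using semisimple_class_dmat xS unfolding t(1) by blast
  show "conj_class (Sp n) x \<noteq> {\<one>\<^bsub>Sp n\<^esub>}"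
  proof
    assume "conj_class (Sp n) x = {\<one>\<^bsub>Sp n\<^esub>}"
    then have "dmat n t = 1\<^sub>m (2 * n)" using conj_class_Sp_self[OF xS] t(1) by simp
    then have "dmat n t $$ (0, 0) = 1" using n0 by simp
    then show False using t(3) l n0 by (simp add: dmat_def)
  qed
  show "spherical_class (2 * n) (Sp n) (conj_class (Sp n) x)"
    using x spherical_class_a_elt[OF _ ll] spherical_class_c_elt[OF assms] l by blast
next
  fix C :: "'k mat set"
  assume "C \<in> conj_classes (Sp n)"
    and "C \<noteq> {\<one>\<^bsub>Sp n\<^esub>} \<and> semisimple_class C \<and> spherical_class (2 * n) (Sp n) C"
  then show "\<exists>l. l \<noteq> 0 \<and> l \<noteq> 1 \<and> (a_elt n l \<in> C \<or> c_elt n l \<in> C)"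
    using spherical_semisimple_class[OF assms] by simp
qed

end
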